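(* Let $L,\tau,a,\kappa_1>0$, $\kappa_2\in\mathbb{R}\setminus\{0\}$ with $|\kappa_2|<\kappa_1$, $0<\alpha<\beta<\gamma<L$, $c_0>0$, $b=\mathbf 1_{(0,\beta)}$, $c=c_0\mathbf 1_{(\alpha,\gamma)}$. Then $\mathcal A$ generates a $C_0$-semigroup of contractions $(e^{t\mathcal A})_{t\ge0}$ on $\mathcal H$, and for every $U_0\in\mathcal H$ the evolution problem $U_t=\mathcal AU$, $U(0)=U_0$ admits a unique weak solution $U(t)=e^{t\mathcal A}U_0\in C^0(\mathbb R^+,\mathcal H)$. Moreover, if $U_0\in D(\mathcal A)$, it admits a unique strong solution $U(t)=e^{t\mathcal A}U_0\in C^0(\mathbb R^+,D(\mathcal A))\cap C^1(\mathbb R^+,\mathcal H)$.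
   Context: Let $H^1_L(0,\beta)=\{\tilde\eta\in H^1(0,\beta):\tilde\eta(0)=0\}$, $\mathcal W=L^2((0,1);H^1_L(0,\beta))$, and $\mathcal H=(H^1_0(0,L)\times L^2(0,L))^2\times\mathcal W$ with inner product $(U,U^1)_{\mathcal H}=\int_0^L(au_x\overline{u^1_x}+v\overline{v^1}+y_x\overline{y^1_x}+z\overline{z^1})dx+\tau|\kappa_2|\int_0^\beta\int_0^1\eta_x\overline{\eta^1_x}\,d\rho\,dx$ for $U=(u,v,y,z,\eta)$. With $S_b(u,v,\eta)=au_x+b(\cdot)(\kappa_1v_x+\kappa_2\eta_x(\cdot,1))$, let $D(\mathcal A)=\{U\in\mathcal H: y\in H^2(0,L)\cap H^1_0(0,L),\ v,z\in H^1_0(0,L),\ (S_b(u,v,\eta))_x\in L^2(0,L),\ \eta_\rho\in\mathcal W,\ \eta(\cdot,0)=v\}$ and $\mathcal A(u,v,y,z,\eta)=(v,(S_b(u,v,\eta))_x-c z,z,y_{xx}+cv,-\tau^{-1}\eta_\rho)$. The problem $U_t=\mathcal AU$ with $U=(u,u_t,y,y_t,\eta)$, $\eta(x,\rho,t)=u_t(x,t-\rho\tau)$, is the first-order formulation of the coupled wave system $u_{tt}-[au_x+b(x)(\kappa_1u_{tx}+\kappa_2u_{tx}(x,t-\tau))]_x+c(x)y_t=0$, $y_{tt}-y_{xx}-c(x)u_t=0$ on $(0,L)$ with homogeneous Dirichlet conditions. *)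

theory Defs
  imports "HOL-Analysis.Analysis"
begin

section \<open>Function spaces on intervals (elements are representatives; equality is a.e.)\<close>

definition L2 :: "real \<Rightarrow> real \<Rightarrow> (real \<Rightarrow> complex) \<Rightarrow> bool" where
  "L2 a b f \<longleftrightarrow> set_borel_measurable lebesgue {a<..<b} f \<and>
     set_integrable lebesgue {a<..<b} (\<lambda>x. (cmod (f x))^2)"

definition test_fun :: "real \<Rightarrow> real \<Rightarrow> (real \<Rightarrow> real) \<Rightarrow> bool" where
  "test_fun a b phi \<longleftrightarrow> (\<forall>n x. ((deriv ^^ n) phi) differentiable (at x)) \<and>
     (\<exists>c d. a < c \<and> c \<le> d \<and> d < b \<and> (\<forall>x. x \<notin> {c..d} \<longrightarrow> phi x = 0))"

definition weak_deriv :: "real \<Rightarrow> real \<Rightarrow> (real \<Rightarrow> complex) \<Rightarrow> (real \<Rightarrow> complex) \<Rightarrow> bool" where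
  "weak_deriv a b f g \<longleftrightarrow> (\<forall>phi. test_fun a b phi \<longrightarrow>
     (LINT x:{a<..<b}|lebesgue. complex_of_real (deriv phi x) * f x) =
     - (LINT x:{a<..<b}|lebesgue. complex_of_real (phi x) * g x))"

definition H1 :: "real \<Rightarrow> real \<Rightarrow> (real \<Rightarrow> complex) \<Rightarrow> bool" where
  "H1 a b f \<longleftrightarrow> L2 a b f \<and> (\<exists>g. L2 a b g \<and> weak_deriv a b f g)"

text \<open>The (a.e. unique) weak derivative.\<close>
definition wd :: "real \<Rightarrow> real \<Rightarrow> (real \<Rightarrow> complex) \<Rightarrow> (real \<Rightarrow> complex)" where
  "wd a b f = (SOME g. L2 a b g \<and> weak_deriv a b f g)"

definition H2 :: "real \<Rightarrow> real \<Rightarrow> (real \<Rightarrow> complex) \<Rightarrow> bool" where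
  "H2 a b f \<longleftrightarrow> H1 a b f \<and> H1 a b (wd a b f)"

definition cont_rep :: "real \<Rightarrow> real \<Rightarrow> (real \<Rightarrow> complex) \<Rightarrow> (real \<Rightarrow> complex) \<Rightarrow> bool" where
  "cont_rep a b f f' \<longleftrightarrow> continuous_on {a..b} f' \<and>
     (AE x in lebesgue. x \<in> {a<..<b} \<longrightarrow> f x = f' x)"

definition H10 :: "real \<Rightarrow> real \<Rightarrow> (real \<Rightarrow> complex) \<Rightarrow> bool" where
  "H10 a b f \<longleftrightarrow> H1 a b f \<and> (\<exists>f'. cont_rep a b f f' \<and> f' a = 0 \<and> f' b = 0)"

definition H1L :: "real \<Rightarrow> (real \<Rightarrow> complex) \<Rightarrow> bool" where
  "H1L b f \<longleftrightarrow> H1 0 b f \<and> (\<exists>f'. cont_rep 0 b f f' \<and> f' 0 = 0)"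

definition h1norm2 :: "real \<Rightarrow> (real \<Rightarrow> complex) \<Rightarrow> real" where
  "h1norm2 b f = (LINT x:{0<..<b}|lebesgue. (cmod (f x))^2 + (cmod (wd 0 b f x))^2)"

section \<open>The space W = L^2((0,1); H^1_L(0,beta)); eta is written eta x rho\<close>

definition W_deriv :: "real \<Rightarrow> (real \<Rightarrow> real \<Rightarrow> complex) \<Rightarrow> (real \<Rightarrow> real \<Rightarrow> complex) \<Rightarrow> bool" where
  "W_deriv b eta etax \<longleftrightarrow>
     (\<lambda>(x,r). eta x r) \<in> borel_measurable lebesgue \<and>
     (\<lambda>(x,r). etax x r) \<in> borel_measurable lebesgue \<and>
     (AE r in lebesgue. r \<in> {0<..<1} \<longrightarrow>
        H1L b (\<lambda>x. eta x r) \<and> L2 0 b (\<lambda>x. etax x r) \<and>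
        weak_deriv 0 b (\<lambda>x. eta x r) (\<lambda>x. etax x r)) \<and>
     set_integrable lebesgue ({0<..<b} \<times> {0<..<1})
        (\<lambda>(x,r). (cmod (eta x r))^2 + (cmod (etax x r))^2)"

definition Wmem :: "real \<Rightarrow> (real \<Rightarrow> real \<Rightarrow> complex) \<Rightarrow> bool" where
  "Wmem b eta \<longleftrightarrow> (\<exists>etax. W_deriv b eta etax)"

definition Wx :: "real \<Rightarrow> (real \<Rightarrow> real \<Rightarrow> complex) \<Rightarrow> (real \<Rightarrow> real \<Rightarrow> complex)" where
  "Wx b eta = (SOME etax. W_deriv b eta etax)"

text \<open>eta_rho in W: weak derivative in rho of the H^1_L-valued function rho \<mapsto> eta(.,rho)
  (the H^1_L-valued Bochner integrals, viewed in L^2(0,beta), taken pointwise a.e. in x).\<close>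
definition rho_deriv :: "real \<Rightarrow> (real \<Rightarrow> real \<Rightarrow> complex) \<Rightarrow> (real \<Rightarrow> real \<Rightarrow> complex) \<Rightarrow> bool" where
  "rho_deriv b eta etar \<longleftrightarrow> Wmem b etar \<and>
     (\<forall>phi. test_fun 0 1 phi \<longrightarrow>
        (AE x in lebesgue. x \<in> {0<..<b} \<longrightarrow>
          (LINT r:{0<..<1}|lebesgue. complex_of_real (deriv phi r) * eta x r) =
          - (LINT r:{0<..<1}|lebesgue. complex_of_real (phi r) * etar x r)))"

definition eta_rho :: "real \<Rightarrow> (real \<Rightarrow> real \<Rightarrow> complex) \<Rightarrow> (real \<Rightarrow> real \<Rightarrow> complex)" where
  "eta_rho b eta = (SOME etar. rho_deriv b eta etar)"

text \<open>Continuous representative [0,1] \<rightarrow> H^1_L(0,beta) (exists when eta, eta_rho \<in> W);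
  used to define the traces eta(.,0) and eta(.,1).\<close>
definition trace_rep :: "real \<Rightarrow> (real \<Rightarrow> real \<Rightarrow> complex) \<Rightarrow> (real \<Rightarrow> real \<Rightarrow> complex) \<Rightarrow> bool" where
  "trace_rep b eta et \<longleftrightarrow> (\<forall>r\<in>{0..1}. H1L b (et r)) \<and>
     (\<forall>r0\<in>{0..1}. ((\<lambda>r. h1norm2 b (\<lambda>x. et r x - et r0 x)) \<longlongrightarrow> 0) (at r0 within {0..1})) \<and>
     (AE r in lebesgue. r \<in> {0<..<1} \<longrightarrow> h1norm2 b (\<lambda>x. et r x - eta x r) = 0)"

definition eta_tr :: "real \<Rightarrow> (real \<Rightarrow> real \<Rightarrow> complex) \<Rightarrow> real \<Rightarrow> (real \<Rightarrow> complex)" where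
  "eta_tr b eta = (SOME et. trace_rep b eta et)"

type_synonym st = "(real \<Rightarrow> complex) \<times> (real \<Rightarrow> complex) \<times> (real \<Rightarrow> complex) \<times>
                   (real \<Rightarrow> complex) \<times> (real \<Rightarrow> real \<Rightarrow> complex)"

definition st_lin :: "complex \<Rightarrow> st \<Rightarrow> complex \<Rightarrow> st \<Rightarrow> st" where
  "st_lin c U d V = (case U of (u,v,y,z,e) \<Rightarrow> case V of (u',v',y',z',e') \<Rightarrow>
     ((\<lambda>x. c * u x + d * u' x), (\<lambda>x. c * v x + d * v' x), (\<lambda>x. c * y x + d * y' x),
      (\<lambda>x. c * z x + d * z' x), (\<lambda>x r. c * e x r + d * e' x r)))"

definition Hsp :: "real \<Rightarrow> real \<Rightarrow> st set" where
  "Hsp L b = {(u,v,y,z,e). H10 0 L u \<and> L2 0 L v \<and> H10 0 L y \<and> L2 0 L z \<and> Wmem b e}"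

definition inner_H :: "real \<Rightarrow> real \<Rightarrow> real \<Rightarrow> real \<Rightarrow> real \<Rightarrow> st \<Rightarrow> st \<Rightarrow> complex" where
  "inner_H L a tau k2 b U U' = (case U of (u,v,y,z,e) \<Rightarrow> case U' of (u',v',y',z',e') \<Rightarrow>
     (LINT x:{0<..<L}|lebesgue.
        complex_of_real a * wd 0 L u x * cnj (wd 0 L u' x) + v x * cnj (v' x)
        + wd 0 L y x * cnj (wd 0 L y' x) + z x * cnj (z' x))
     + complex_of_real (tau * \<bar>k2\<bar>) *
       (LINT x:{0<..<b}|lebesgue. LINT r:{0<..<1}|lebesgue. Wx b e x r * cnj (Wx b e' x r)))"

definition norm_H :: "real \<Rightarrow> real \<Rightarrow> real \<Rightarrow> real \<Rightarrow> real \<Rightarrow> st \<Rightarrow> real" where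
  "norm_H L a tau k2 b U = sqrt (Re (inner_H L a tau k2 b U U))"

definition Sb :: "real \<Rightarrow> real \<Rightarrow> real \<Rightarrow> real \<Rightarrow> real \<Rightarrow> st \<Rightarrow> (real \<Rightarrow> complex)" where
  "Sb L a k1 k2 b U = (case U of (u,v,y,z,e) \<Rightarrow> (\<lambda>x.
     complex_of_real a * wd 0 L u x + complex_of_real (indicator {0<..<b} x) *
       (complex_of_real k1 * wd 0 L v x + complex_of_real k2 * wd 0 b (eta_tr b e 1) x)))"

definition DA :: "real \<Rightarrow> real \<Rightarrow> real \<Rightarrow> real \<Rightarrow> real \<Rightarrow> st set" where
  "DA L a k1 k2 b = {U \<in> Hsp L b. case U of (u,v,y,z,e) \<Rightarrow>
     H2 0 L y \<and> H10 0 L y \<and> H10 0 L v \<and> H10 0 L z \<and>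
     H1 0 L (Sb L a k1 k2 b U) \<and>
     (\<exists>er. rho_deriv b e er) \<and>
     (AE x in lebesgue. x \<in> {0<..<b} \<longrightarrow> eta_tr b e 0 x = v x)}"

definition Aop :: "real \<Rightarrow> real \<Rightarrow> real \<Rightarrow> real \<Rightarrow> real \<Rightarrow> real \<Rightarrow> real \<Rightarrow> real \<Rightarrow> real \<Rightarrow> st \<Rightarrow> st" where
  "Aop L a tau k1 k2 b al ga c0 U = (case U of (u,v,y,z,e) \<Rightarrow>
     let c = (\<lambda>x. complex_of_real (c0 * indicator {al<..<ga} x)) in
     (v, (\<lambda>x. wd 0 L (Sb L a k1 k2 b U) x - c x * z x), z,
      (\<lambda>x. wd 0 L (wd 0 L y) x + c x * v x),
      (\<lambda>x r. - eta_rho b e x r / complex_of_real tau)))"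

section \<open>Abstract semigroup notions (on a space given by representatives, a norm and
  linear combinations; vectors at norm-distance 0 are identified)\<close>

definition C0_contraction_semigroup ::
  "'s set \<Rightarrow> ('s \<Rightarrow> real) \<Rightarrow> (complex \<Rightarrow> 's \<Rightarrow> complex \<Rightarrow> 's \<Rightarrow> 's) \<Rightarrow> (real \<Rightarrow> 's \<Rightarrow> 's) \<Rightarrow> bool" where
  "C0_contraction_semigroup H nrm lin T \<longleftrightarrow>
     (\<forall>t\<ge>0. \<forall>U\<in>H. T t U \<in> H) \<and>
     (\<forall>t\<ge>0. \<forall>U\<in>H. \<forall>V\<in>H. \<forall>c d.
        nrm (lin 1 (T t (lin c U d V)) (-1) (lin c (T t U) d (T t V))) = 0) \<and>
     (\<forall>U\<in>H. nrm (lin 1 (T 0 U) (-1) U) = 0) \<and>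
     (\<forall>t\<ge>0. \<forall>s\<ge>0. \<forall>U\<in>H. nrm (lin 1 (T (t + s) U) (-1) (T t (T s U))) = 0) \<and>
     (\<forall>U\<in>H. ((\<lambda>t. nrm (lin 1 (T t U) (-1) U)) \<longlongrightarrow> 0) (at_right 0)) \<and>
     (\<forall>t\<ge>0. \<forall>U\<in>H. nrm (T t U) \<le> nrm U)"

definition is_generator ::
  "'s set \<Rightarrow> ('s \<Rightarrow> real) \<Rightarrow> (complex \<Rightarrow> 's \<Rightarrow> complex \<Rightarrow> 's \<Rightarrow> 's) \<Rightarrow> (real \<Rightarrow> 's \<Rightarrow> 's)
     \<Rightarrow> 's set \<Rightarrow> ('s \<Rightarrow> 's) \<Rightarrow> bool" where
  "is_generator H nrm lin T D A \<longleftrightarrow> D \<subseteq> H \<and>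
     (\<forall>U\<in>H. U \<in> D \<longleftrightarrow> (\<exists>W\<in>H. ((\<lambda>h. nrm (lin 1 (lin (of_real (1/h)) (T h U) (of_real (-1/h)) U) (-1) W))
                                   \<longlongrightarrow> 0) (at_right 0))) \<and>
     (\<forall>U\<in>D. A U \<in> H \<and> ((\<lambda>h. nrm (lin 1 (lin (of_real (1/h)) (T h U) (of_real (-1/h)) U) (-1) (A U)))
                                   \<longlongrightarrow> 0) (at_right 0))"

text \<open>Weak solution in the sense of J. Ball: continuous H-valued, and for every V in D(A^*)
  (with A^* V = V'), (U(t),V) = (U0,V) + int_0^t (U(s),A^* V) ds.\<close>
definition weak_solution ::
  "'s set \<Rightarrow> ('s \<Rightarrow> real) \<Rightarrow> (complex \<Rightarrow> 's \<Rightarrow> complex \<Rightarrow> 's \<Rightarrow> 's) \<Rightarrow> ('s \<Rightarrow> 's \<Rightarrow> complex)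
     \<Rightarrow> 's set \<Rightarrow> ('s \<Rightarrow> 's) \<Rightarrow> 's \<Rightarrow> (real \<Rightarrow> 's) \<Rightarrow> bool" where
  "weak_solution H nrm lin ip D A U0 U \<longleftrightarrow>
     (\<forall>t\<ge>0. U t \<in> H) \<and>
     (\<forall>t0\<ge>0. ((\<lambda>t. nrm (lin 1 (U t) (-1) (U t0))) \<longlongrightarrow> 0) (at t0 within {0..})) \<and>
     nrm (lin 1 (U 0) (-1) U0) = 0 \<and>
     (\<forall>V\<in>H. \<forall>V'\<in>H. (\<forall>W\<in>D. ip (A W) V = ip W V') \<longrightarrow>
        (\<forall>t\<ge>0. ip (U t) V = ip U0 V + integral {0..t} (\<lambda>s. ip (U s) V')))"

definition strong_solution ::
  "'s set \<Rightarrow> ('s \<Rightarrow> real) \<Rightarrow> (complex \<Rightarrow> 's \<Rightarrow> complex \<Rightarrow> 's \<Rightarrow> 's)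
     \<Rightarrow> 's set \<Rightarrow> ('s \<Rightarrow> 's) \<Rightarrow> 's \<Rightarrow> (real \<Rightarrow> 's) \<Rightarrow> bool" where
  "strong_solution H nrm lin D A U0 U \<longleftrightarrow>
     (\<forall>t\<ge>0. U t \<in> D) \<and>
     (\<forall>t0\<ge>0. ((\<lambda>t. nrm (lin 1 (U t) (-1) (U t0)) + nrm (lin 1 (A (U t)) (-1) (A (U t0))))
                \<longlongrightarrow> 0) (at t0 within {0..})) \<and>
     (\<exists>U'. (\<forall>t\<ge>0. U' t \<in> H) \<and>
        (\<forall>t0\<ge>0. ((\<lambda>t. nrm (lin 1 (U' t) (-1) (U' t0))) \<longlongrightarrow> 0) (at t0 within {0..})) \<and>
        (\<forall>t0\<ge>0. ((\<lambda>t. nrm (lin 1 (lin (of_real (1/(t - t0))) (U t) (of_real (-1/(t - t0))) (U t0))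
                               (-1) (U' t0))) \<longlongrightarrow> 0) (at t0 within {0..})) \<and>
        (\<forall>t\<ge>0. nrm (lin 1 (U' t) (-1) (A (U t))) = 0)) \<and>
     nrm (lin 1 (U 0) (-1) U0) = 0"

end

theory Submission
  imports Defs
begin

text \<open>Every component of a state is determined by square integrable functions: \<open>u\<close> and \<open>y\<close> by their
  mean-free derivatives, \<open>\<eta>\<close> by \<open>\<eta>\<^sub>x\<close>. This identifies the state space with a closed subspace of a product
  of \<open>L\<^sup>2\<close> spaces. Integrating \<open>\<A>U = V\<close> once in \<open>x\<close> and once in \<open>\<rho>\<close> removes all traces and weak derivatives
  from the domain: with \<open>v\<close> given by \<open>V\<close>, the transport equation yields \<open>\<eta>\<^sub>x(x,\<rho>) = v\<^sub>x(x) - \<tau>\<integral>\<^sub>0\<^sup>\<rho> W\<close>, where \<open>W\<close> is the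
  \<open>x\<close>-derivative of the last component of \<open>V\<close>, and \<open>u\<^sub>x\<close>, \<open>y\<^sub>x\<close> are primitives up to constants fixed by the
  mean-free conditions. Hence \<open>\<A>\<close> is onto with bounded inverse. The coupling terms cancel in
  \<open>Re(\<A>U,U)\<close>, and the transport identity turns the delay term into
  \<open>|\<kappa>\<^sub>2|(|v\<^sub>x|\<^sup>2 - |\<eta>\<^sub>x(\<cdot>,1)|\<^sup>2)/2\<close>, which is dominated by the damping as \<open>|\<kappa>\<^sub>2| < \<kappa>\<^sub>1\<close>; so \<open>\<A>\<close> is dissipative.
  Such an operator generates a contraction semigroup, obtained from the implicit Euler scheme; weak
  solutions are unique because the time integral of a weak solution with zero data is a strong one.\<close>

section \<open>Dissipative operators with bounded inverse\<close>

text \<open>\<open>Aop\<close> is assembled from derivatives and traces picked by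
  \<open>SOME\<close> and fixed only almost everywhere, so neither its linearity nor its
  compatibility with a.e. equality can be read off. \<open>Rel\<close> carries the same information
  as a.e. identities between integrals; the operator is studied through it. Parameter 0 is the
  convenient one: there the system decouples into quadratures, v and z coming straight from the
  data, then eta_x, then u_x and y_x, whereas a positive parameter would leave a coupled boundary
  value problem. Positive parameters are reached from 0 by perturbation. The weight tau |kappa_2| in
  the inner product is what gives the transport term the factor |kappa_2|/2; Young's inequality with
  equal weights for the mixed term kappa_2 eta_x(.,1) v_x then cancels the squares of eta_x(.,1)
  exactly. The abstract theory lives in a real Hilbert space. Complex scalars act as bounded
  operators commuting with the construction, and the imaginary part of the inner product is the real
  product with i V.\<close>

lemma subspace_closure:
  fixes M :: "'a::real_normed_vector set"
  assumes "subspace M" shows "subspace (closure M)"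
  unfolding subspace_def
proof (intro conjI ballI allI)
  show "0 \<in> closure M" using assms subspace_0 closure_subset by blast
next
  fix x y assume "x \<in> closure M" "y \<in> closure M"
  then obtain f g where "\<forall>n. f n \<in> M" "f \<longlonglongrightarrow> x" "\<forall>n. g n \<in> M" "g \<longlonglongrightarrow> y"
    unfolding closure_sequential by blast
  then show "x + y \<in> closure M" unfolding closure_sequential
    using assms by (intro exI[of _ "\<lambda>n. f n + g n"]) (auto intro!: tendsto_intros subspace_add)
next
  fix c x assume "x \<in> closure M"
  then obtain f where "\<forall>n. f n \<in> M" "f \<longlonglongrightarrow> x"
    unfolding closure_sequential by blast
  then show "c *\<^sub>R x \<in> closure M" unfolding closure_sequential
    using assms by (intro exI[of _ "\<lambda>n. c *\<^sub>R f n"]) (auto intro!: tendsto_intros subspace_scale)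
qed

text \<open>A minimizing sequence for the distance from \<open>f\<close> is Cauchy by the
  parallelogram law, and minimality along every line through \<open>p\<close> forces orthogonality.
  Completeness is asked of the subspace alone, so the result applies inside kernels and
  closures.\<close>

lemma closest_point_complete_subspace:
  fixes M :: "'a::real_inner set"
  assumes sub: "subspace M" and comp: "complete M"
  shows "\<exists>p\<in>M. \<forall>m\<in>M. inner (f - p) m = 0"
proof -
  define d where "d = infdist f M"
  have ne: "M \<noteq> {}" using sub subspace_0 by blast
  have d0: "0 \<le> d" unfolding d_def by (rule infdist_nonneg)
  have dle: "d \<le> norm (f - m)" if "m \<in> M" for m
    using infdist_le[OF that, of f] by (simp add: d_def dist_norm)
  have "\<exists>m\<in>M. norm (f - m) < d + 1 / Suc n" for n
  proof (rule ccontr)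
    assume *: "\<not> (\<exists>m\<in>M. norm (f - m) < d + 1 / Suc n)"
    have "d + 1 / Suc n \<le> infdist f M"
      unfolding infdist_notempty[OF ne]
      by (rule cINF_greatest[OF ne]) (use * in \<open>force simp: dist_norm not_less\<close>)
    then show False unfolding d_def[symmetric] by (simp add: field_simps)
  qed
  then obtain m where mM: "\<And>n. m n \<in> M" and mlt: "\<And>n. norm (f - m n) < d + 1 / Suc n"
    by metis
  have sq: "(norm (f - m n))\<^sup>2 \<le> d\<^sup>2 + (2*d+1) / Suc n" for n
  proof -
    have "(norm (f - m n))\<^sup>2 \<le> (d + 1 / Suc n)\<^sup>2"
      using mlt[of n] by (intro power_mono) auto
    also have "\<dots> = d\<^sup>2 + (2*d + 1/Suc n) * (1 / Suc n)"
      by (simp add: power2_eq_square algebra_simps)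
    also have "\<dots> \<le> d\<^sup>2 + (2*d+1) * (1/Suc n)"
      by (intro add_left_mono mult_right_mono) auto
    finally show ?thesis by simp
  qed
  have par: "(norm (m i - m j))\<^sup>2 \<le> 2*(2*d+1) * (1/Suc i + 1/Suc j)" for i j
  proof -
    \<comment> \<open>The midpoint lies in \<open>M\<close>, so its distance to \<open>f\<close> is
      at least \<open>d\<close>; this lower bound turns the parallelogram identity into smallness of
      \<open>m i - m j\<close>.\<close>
    have "(1/2) *\<^sub>R (m i + m j) \<in> M" using mM sub by (intro subspace_scale subspace_add)
    then have "d\<^sup>2 \<le> (norm (f - (1/2) *\<^sub>R (m i + m j)))\<^sup>2" using dle d0 by (intro power_mono) auto
    moreover have "(norm (m i - m j))\<^sup>2 + 4 * (norm (f - (1/2) *\<^sub>R (m i + m j)))\<^sup>2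
      = 2 * (norm (f - m i))\<^sup>2 + 2 * (norm (f - m j))\<^sup>2"
      unfolding power2_norm_eq_inner
      by (simp add: inner_simps inner_commute algebra_simps)
    moreover have "2*(2*d+1) * (1/Suc i + 1/Suc j) = 2*((2*d+1)/Suc i) + 2*((2*d+1)/Suc j)"
      by (simp add: field_simps)
    ultimately show ?thesis using sq[of i] sq[of j] by linarith
  qed
  have cau: "Cauchy m"
  proof (rule metric_CauchyI)
    fix e :: real assume e: "e > 0"
    obtain N where N: "4*(2*d+1) / e\<^sup>2 < real N" using reals_Archimedean2 by blast
    show "\<exists>N. \<forall>i\<ge>N. \<forall>j\<ge>N. dist (m i) (m j) < e"
    proof (intro exI allI impI)
      fix i j assume ij: "N \<le> i" "N \<le> j"
      have e2: "4*(2*d+1) < real (Suc k) * e\<^sup>2" if "N \<le> k" for k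
      proof -
        have "4*(2*d+1) < real N * e\<^sup>2" using N e by (simp add: field_simps)
        also have "\<dots> \<le> real (Suc k) * e\<^sup>2" using that by (intro mult_right_mono) auto
        finally show ?thesis .
      qed
      have "(norm (m i - m j))\<^sup>2 \<le> 2*(2*d+1) * (1/Suc i + 1/Suc j)" by (rule par)
      also have "\<dots> = 2*(2*d+1) / Suc i + 2*(2*d+1)/Suc j" by (simp add: algebra_simps add_divide_distrib)
      also have "\<dots> < e\<^sup>2/2 + e\<^sup>2/2"
        using e2[OF ij(1)] e2[OF ij(2)] by (intro add_strict_mono) (simp_all add: field_simps)
      finally show "dist (m i) (m j) < e"
        using e by (simp add: dist_norm power2_less_imp_less)
    qed
  qed
  then obtain p where pM: "p \<in> M" and lim: "m \<longlonglongrightarrow> p"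
    using comp mM unfolding complete_def by blast
  have "(\<lambda>n. norm (f - m n)) \<longlonglongrightarrow> norm (f - p)" by (intro tendsto_intros lim)
  moreover have "(\<lambda>n. d + 1 / real (Suc n)) \<longlonglongrightarrow> d + 0"
    by (intro tendsto_add tendsto_const LIMSEQ_Suc lim_1_over_n)
  ultimately have np: "norm (f - p) \<le> d"
    using mlt by (intro LIMSEQ_le[of _ _ "\<lambda>n. d + 1 / real (Suc n)"]) (auto intro: less_imp_le)
  have "inner (f - p) x = 0" if x: "x \<in> M" for x
  proof -
    have "d\<^sup>2 \<le> (norm (f - (p + t *\<^sub>R x)))\<^sup>2" for t
      using sub pM x d0 by (intro power_mono dle subspace_add subspace_scale) auto
    then have 1: "d\<^sup>2 \<le> (norm (f - p))\<^sup>2 - 2 * t * inner (f - p) x + t\<^sup>2 * (norm x)\<^sup>2" for t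
      unfolding power2_norm_eq_inner
      by (simp add: inner_simps inner_commute algebra_simps power2_eq_square)
    have "(norm (f - p))\<^sup>2 \<le> d\<^sup>2" using np by (intro power_mono) auto
    with 1 have 2: "2 * t * inner (f - p) x \<le> t\<^sup>2 * (norm x)\<^sup>2" for t by (smt (verit))
    show ?thesis
    proof (cases "x = 0")
      case False
      \<comment> \<open>The vertex of the quadratic in \<open>t\<close>; there the bound
        \<open>2\<close> collapses to \<open>t * inner (f - p) x \<le> 0\<close>, whose left side is
        a scaled square.\<close>
      define t where "t = inner (f - p) x / (norm x)\<^sup>2"
      have "t\<^sup>2 * (norm x)\<^sup>2 = t * inner (f-p) x" using False by (simp add: t_def power2_eq_square)
      then have "t * inner (f-p) x \<le> 0" using 2[of t] by simp
      then have "t * inner (f-p) x * (norm x)\<^sup>2 \<le> 0" by (simp add: mult_nonpos_nonneg)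
      moreover have "t * inner (f-p) x * (norm x)\<^sup>2 = (inner (f - p) x)\<^sup>2"
        using False by (simp add: t_def power2_eq_square)
      ultimately have "(inner (f - p) x)\<^sup>2 \<le> 0" by simp
      then show ?thesis by simp
    qed simp
  qed
  then show ?thesis using pM by blast
qed

text \<open>If \<open>l\<close> is not zero, take the component \<open>e\<close> of some
  \<open>x0\<close> with \<open>l x0 \<noteq> 0\<close> that is orthogonal to the kernel. Every
  \<open>x - (l x / l e) *\<^sub>R e\<close> lies in the kernel, so pairing with \<open>e\<close>
  recovers \<open>l x\<close> up to the factor \<open>inner e e / l e\<close>.\<close>

lemma riesz_on_subspace:
  fixes S :: "'a::real_inner set"
  assumes sub: "subspace S" and comp: "complete S"
    and lin: "\<And>x y. x\<in>S \<Longrightarrow> y\<in>S \<Longrightarrow> l (x+y) = l x + l y"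
      "\<And>c x. x\<in>S \<Longrightarrow> l (c *\<^sub>R x) = c * (l x :: real)"
    and bd: "\<And>x. x\<in>S \<Longrightarrow> \<bar>l x\<bar> \<le> C * norm x"
  shows "\<exists>v\<in>S. \<forall>x\<in>S. l x = inner x v"
proof -
  have ldiff: "l (x - y) = l x - l y" if "x\<in>S" "y\<in>S" for x y
    using lin(1)[of x "(-1) *\<^sub>R y"] lin(2)[of y "-1"] that sub subspace_scale[of S y "-1"] by simp
  define K where "K = {x\<in>S. l x = 0}"
  have Ksub: "subspace K"
    unfolding K_def subspace_def using lin lin(2)[of 0 0] sub
    by (auto simp: subspace_0 subspace_add subspace_scale)
  have Kcomp: "complete K"
  proof (unfold complete_def, intro allI impI, elim conjE)
    fix f :: "nat \<Rightarrow> 'a" assume f: "\<forall>n. f n \<in> K" "Cauchy f"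
    then obtain p where p: "p\<in>S" "f \<longlonglongrightarrow> p" using comp unfolding complete_def K_def by blast
    have "l p = l (p - f n)" for n using ldiff[of p "f n"] f p by (auto simp: K_def)
    then have "\<bar>l p\<bar> \<le> C * norm (p - f n)" for n
      using bd[of "p - f n"] f p sub by (auto simp: K_def subspace_diff)
    moreover have "(\<lambda>n. C * norm (p - f n)) \<longlonglongrightarrow> C * norm (p - p)" by (intro tendsto_intros p)
    ultimately have "\<bar>l p\<bar> \<le> C * norm (p - p)" by (intro LIMSEQ_le_const) auto
    then show "\<exists>l\<in>K. f \<longlonglongrightarrow> l" using p by (auto simp: K_def)
  qed
  show ?thesis
  proof (cases "\<forall>x\<in>S. l x = 0")
    case True then show ?thesis using sub subspace_0 by (intro bexI[of _ 0]) auto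
  next
    case False
    then obtain x0 where x0: "x0\<in>S" "l x0 \<noteq> 0" by blast
    obtain p where p: "p\<in>K" "\<forall>m\<in>K. inner (x0 - p) m = 0"
      using closest_point_complete_subspace[OF Ksub Kcomp] by blast
    define e where "e = x0 - p"
    have eS: "e\<in>S" using p x0 sub by (auto simp: e_def K_def subspace_diff)
    have le: "l e = l x0" using ldiff[of x0 p] p x0 by (auto simp: e_def K_def)
    have "e \<noteq> 0" using le x0 lin(2)[of 0 0] sub subspace_0 by force
    then have ne: "inner e e \<noteq> 0" by simp
    show ?thesis
    proof (intro bexI ballI)
      show "(l e / inner e e) *\<^sub>R e \<in> S" using eS sub by (simp add: subspace_scale)
      fix x assume x: "x\<in>S"
      have "x - (l x / l e) *\<^sub>R e \<in> K"
        using x eS le x0 sub ldiff[of x "(l x / l e) *\<^sub>R e"] lin(2)[OF eS]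
        by (simp add: K_def subspace_diff subspace_scale)
      then have "inner e (x - (l x / l e) *\<^sub>R e) = 0" using p e_def by blast
      then have "inner e x = l x / l e * inner e e" by (simp add: inner_simps)
      then show "l x = inner x ((l e / inner e e) *\<^sub>R e)"
        using ne le x0 by (simp add: inner_commute)
    qed
  qed
qed

text \<open>\<open>S\<close> is the state space inside a possibly larger Hilbert space. The range
  condition is posed at parameter 0, with a bound for the inverse there; solvability for
  \<open>I - lam A\<close> with positive \<open>lam\<close> and density of \<open>D\<close> are
  consequences.\<close>

locale dissipative =
  fixes S D :: "'a::{real_inner,banach} set" and A :: "'a \<Rightarrow> 'a" and C :: real
  assumes subS: "subspace S" and compS: "complete S"
    and subD: "subspace D" and DS: "D \<subseteq> S"
    and AS: "\<And>x. x \<in> D \<Longrightarrow> A x \<in> S"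
    and A_add: "\<And>x y. x \<in> D \<Longrightarrow> y \<in> D \<Longrightarrow> A (x + y) = A x + A y"
    and A_scale: "\<And>c x. x \<in> D \<Longrightarrow> A (c *\<^sub>R x) = c *\<^sub>R A x"
    and diss: "\<And>x. x \<in> D \<Longrightarrow> inner (A x) x \<le> 0"
    and A_surj: "\<And>f. f \<in> S \<Longrightarrow> \<exists>x\<in>D. A x = f"
    and A_bound: "\<And>x. x \<in> D \<Longrightarrow> norm x \<le> C * norm (A x)"
begin

lemma A_diff: "x \<in> D \<Longrightarrow> y \<in> D \<Longrightarrow> A (x - y) = A x - A y"
  using A_add[of x "(-1) *\<^sub>R y"] A_scale[of y "-1"] subD subspace_scale[of D y "-1"] by simp

lemma A_0: "A 0 = 0"
  using A_scale[of 0 0] subD subspace_0 by force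

section \<open>Solvability of the resolvent equation and density of the domain\<close>

definition rsurj :: "real \<Rightarrow> bool" where
  "rsurj mu \<longleftrightarrow> (\<forall>f\<in>S. \<exists>x\<in>D. mu *\<^sub>R x - A x = f)"

text \<open>With \<open>g\<close> inverting \<open>mu0 - A\<close>, the equation at
  \<open>mu\<close> becomes the fixed point problem
  \<open>x = g (f + (mu0 - mu) *\<^sub>R x)\<close>. Since \<open>M\<close> bounds the inverse, the
  contraction factor is \<open>\<bar>mu0 - mu\<bar> * M\<close>.\<close>

lemma rsurj_near:
  assumes s: "rsurj mu0" and b: "\<And>x. x \<in> D \<Longrightarrow> norm x \<le> M * norm (mu0 *\<^sub>R x - A x)"
    and M: "M \<ge> 0" and c: "\<bar>mu0 - mu\<bar> * M < 1"
  shows "rsurj mu"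
  unfolding rsurj_def
proof
  fix f assume f: "f \<in> S"
  define g where "g = (\<lambda>h. SOME x. x\<in>D \<and> mu0 *\<^sub>R x - A x = h)"
  have g: "g h \<in> D" "mu0 *\<^sub>R g h - A (g h) = h" if "h\<in>S" for h
    using someI_ex[of "\<lambda>x. x\<in>D \<and> mu0 *\<^sub>R x - A x = h"] s that unfolding rsurj_def g_def by blast+
  define k where "k = (\<lambda>x. g (f + (mu0 - mu) *\<^sub>R x))"
  have inS: "f + (mu0 - mu) *\<^sub>R x \<in> S" if "x\<in>S" for x
    using that f subS by (intro subspace_add subspace_scale)
  have "\<exists>!x\<in>S. k x = x"
  proof (rule Banach_fix[OF compS])
    show "S \<noteq> {}" using f by blast
    show "0 \<le> \<bar>mu0 - mu\<bar> * M" using M by simp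
    show "\<bar>mu0 - mu\<bar> * M < 1" by fact
    show "k ` S \<subseteq> S" using g inS DS by (auto simp: k_def)
    fix x y assume xy: "x\<in>S" "y\<in>S"
    let ?d = "k x - k y"
    have D: "k x \<in> D" "k y \<in> D" using g inS xy by (auto simp: k_def)
    have "mu0 *\<^sub>R ?d - A ?d = (mu0 *\<^sub>R k x - A (k x)) - (mu0 *\<^sub>R k y - A (k y))"
      unfolding A_diff[OF D] by (simp add: scaleR_diff_right)
    also have "\<dots> = (f + (mu0 - mu) *\<^sub>R x) - (f + (mu0 - mu) *\<^sub>R y)"
      unfolding k_def g(2)[OF inS[OF xy(1)]] g(2)[OF inS[OF xy(2)]] ..
    finally have "mu0 *\<^sub>R ?d - A ?d = (mu0 - mu) *\<^sub>R (x - y)" by (simp add: scaleR_diff_right)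
    then have "norm ?d \<le> M * norm ((mu0 - mu) *\<^sub>R (x - y))"
      using b[of ?d] D subD by (simp add: subspace_diff)
    then show "dist (k x) (k y) \<le> \<bar>mu0 - mu\<bar> * M * dist x y" by (simp add: dist_norm mult_ac)
  qed
  then obtain x where x: "x\<in>S" "k x = x" by blast
  then have "x\<in>D" "mu0 *\<^sub>R x - A x = f + (mu0 - mu) *\<^sub>R x" using g[OF inS[OF x(1)]] by (auto simp: k_def)
  then show "\<exists>x\<in>D. mu *\<^sub>R x - A x = f" by (intro bexI[of _ x]) (auto simp: algebra_simps)
qed

lemma diss_norm:
  assumes "x \<in> D" "mu \<ge> 0"
  shows "mu * norm x \<le> norm (mu *\<^sub>R x - A x)"
proof (cases "x = 0")
  case False
  have "mu * (norm x)\<^sup>2 \<le> inner (mu *\<^sub>R x - A x) x"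
    using diss[OF assms(1)] by (simp add: inner_simps power2_norm_eq_inner)
  also have "\<dots> \<le> norm (mu *\<^sub>R x - A x) * norm x" by (rule norm_cauchy_schwarz)
  finally show ?thesis using False by (simp add: power2_eq_square)
qed simp

text \<open>A continuation argument from parameter 0. The bound \<open>C\<close> reaches every
  parameter up to \<open>m0\<close>; from a positive \<open>mu\<close> the dissipative bound
  \<open>1/mu\<close> for the inverse reaches everything below \<open>2 * mu\<close>, so finitely
  many steps cover the half line.\<close>

lemma rsurj_pos: "mu > 0 \<Longrightarrow> rsurj mu"
proof -
  define m0 where "m0 = 1 / (2 * (\<bar>C\<bar> + 1))"
  have m0: "m0 > 0" by (simp add: m0_def)
  have "rsurj 0" unfolding rsurj_def
  proof
    fix f assume "f\<in>S"
    then obtain x where x: "x\<in>D" "A x = f" using A_surj by blast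
    have "(-1) *\<^sub>R x \<in> D" using subspace_scale[OF subD x(1)] .
    moreover have "0 *\<^sub>R ((-1) *\<^sub>R x) - A ((-1) *\<^sub>R x) = f" using A_scale[OF x(1), of "-1"] x(2) by simp
    ultimately show "\<exists>x\<in>D. 0 *\<^sub>R x - A x = f" by blast
  qed
  then have small: "rsurj mu" if "0 < mu" "mu \<le> m0" for mu
  proof (rule rsurj_near[where M="\<bar>C\<bar>"])
    fix x assume x: "x\<in>D"
    have "norm x \<le> C * norm (A x)" by (rule A_bound[OF x])
    also have "\<dots> \<le> \<bar>C\<bar> * norm (A x)" by (intro mult_right_mono) auto
    finally show "norm x \<le> \<bar>C\<bar> * norm (0 *\<^sub>R x - A x)" by simp
  next
    have "mu * \<bar>C\<bar> \<le> m0 * \<bar>C\<bar>" using that by (intro mult_right_mono) auto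
    also have "\<dots> < 1" by (simp add: m0_def field_simps)
    finally show "\<bar>0 - mu\<bar> * \<bar>C\<bar> < 1" using that by simp
  qed simp
  have step: "rsurj nu" if "rsurj mu" "0 < mu" "mu \<le> nu" "nu < 2 * mu" for mu nu
  proof (rule rsurj_near[OF that(1), where M="1/mu"])
    fix x assume "x\<in>D"
    then show "norm x \<le> 1/mu * norm (mu *\<^sub>R x - A x)" using diss_norm[of x mu] that by (simp add: field_simps)
  qed (use that in \<open>auto simp: field_simps\<close>)
  \<comment> \<open>The ratio \<open>3/2\<close> stays below the admissible factor 2 of
    \<open>step\<close>, and its powers are unbounded.\<close>
  have pow: "rsurj mu" if "0 < mu" "mu \<le> m0 * (3/2)^n" for n mu
    using that
  proof (induction n arbitrary: mu)
    case 0 then show ?case using small by simp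
  next
    case (Suc n)
    have "rsurj (2/3 * mu)" using Suc.prems by (intro Suc.IH) (auto simp: field_simps)
    then show ?case using Suc.prems by (elim step) auto
  qed
  assume mu: "mu > 0"
  obtain n where "mu / m0 < (3/2)^n" using real_arch_pow[of "3/2" "mu/m0"] by auto
  then show ?thesis using pow[of mu n] mu m0 by (simp add: field_simps)
qed

text \<open>The residual \<open>f - p\<close> of the projection onto the closure can be written as
  \<open>x - A x\<close> with \<open>x\<close> in \<open>D\<close>. Pairing with \<open>x\<close>,
  to which it is orthogonal, gives \<open>inner x x = inner (A x) x \<le> 0\<close>, so
  \<open>x\<close> and the residual vanish.\<close>

lemma dense: "S \<subseteq> closure D"
proof
  fix f assume f: "f \<in> S"
  have "closed S" using compS complete_imp_closed by blast
  then have cS: "closure D \<subseteq> S" using DS closure_minimal by blast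
  have "complete (closure D)" using complete_closed_subset[OF closed_closure cS compS] .
  moreover have "subspace (closure D)" by (rule subspace_closure[OF subD])
  ultimately obtain p where p: "p \<in> closure D" "\<forall>m\<in>closure D. inner (f - p) m = 0"
    using closest_point_complete_subspace by blast
  have "f - p \<in> S" using f p cS subS subspace_diff by blast
  then obtain x where x: "x\<in>D" "1 *\<^sub>R x - A x = f - p" using rsurj_pos[of 1] unfolding rsurj_def by force
  have "inner (f - p) x = 0" using p x closure_subset by blast
  then have "inner x x = inner (A x) x" using x(2) by (simp add: inner_diff_left flip: x(2))
  then have "inner x x \<le> 0" using diss[OF x(1)] by simp
  then have "x = 0" using inner_gt_zero_iff[of x] by linarith
  then show "f \<in> closure D" using x p A_0 by simp
qed

lemma approx:
  assumes "f \<in> S" "e > 0" obtains g where "g \<in> D" "norm (f - g) < e"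
proof -
  have "f \<in> closure D" using dense assms by blast
  then obtain g where "g \<in> D" "dist g f < e" using assms(2) unfolding closure_approachable by blast
  then show ?thesis using that[of g] by (simp add: dist_norm norm_minus_commute)
qed

text \<open>The resolvent of \<open>A\<close> in the form \<open>(I - lam A)^(-1)\<close>, that is,
  one step of size \<open>lam\<close> of the implicit Euler scheme. \<open>J_unique\<close> makes
  the choice harmless for positive \<open>lam\<close> and \<open>f\<close> in
  \<open>S\<close>.\<close>

definition J :: "real \<Rightarrow> 'a \<Rightarrow> 'a" where
  "J lam f = (SOME x. x \<in> D \<and> x - lam *\<^sub>R A x = f)"

lemma J_ex: assumes "lam > 0" "f \<in> S" shows "\<exists>x\<in>D. x - lam *\<^sub>R A x = f"
proof -
  obtain x where x: "x\<in>D" "(1/lam) *\<^sub>R x - A x = (1/lam) *\<^sub>R f"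
    using rsurj_pos[of "1/lam"] assms(1) subspace_scale[OF subS assms(2), of "1/lam"]
    unfolding rsurj_def by (meson zero_less_divide_1_iff)
  have "lam *\<^sub>R ((1/lam) *\<^sub>R x - A x) = f" using x assms by simp
  then have "x - lam *\<^sub>R A x = f" using assms by (simp add: algebra_simps)
  then show ?thesis using x by blast
qed

lemma J: assumes "lam > 0" "f \<in> S" shows "J lam f \<in> D" "J lam f - lam *\<^sub>R A (J lam f) = f"
  using someI_ex[of "\<lambda>x. x\<in>D \<and> x - lam *\<^sub>R A x = f"] J_ex[OF assms] unfolding J_def by blast+

lemma J_S: "lam > 0 \<Longrightarrow> f \<in> S \<Longrightarrow> J lam f \<in> S"
  using J DS by blast

lemma contr0: assumes "lam > 0" "x \<in> D" shows "norm x \<le> norm (x - lam *\<^sub>R A x)"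
proof -
  have "x - lam *\<^sub>R A x = lam *\<^sub>R ((1/lam) *\<^sub>R x - A x)" using assms by (simp add: algebra_simps)
  then have "norm (x - lam *\<^sub>R A x) = lam * norm ((1/lam) *\<^sub>R x - A x)" using assms by simp
  then show ?thesis using diss_norm[of x "1/lam"] assms by (simp add: field_simps)
qed

lemma J_unique: assumes "lam > 0" "x \<in> D" "x - lam *\<^sub>R A x = f" shows "J lam f = x"
proof -
  have f: "f \<in> S" using assms DS AS subS by (metis subspace_diff subspace_scale subsetD)
  note j = J[OF assms(1) f]
  have d: "J lam f - x \<in> D" using j assms subD subspace_diff by blast
  have "(J lam f - x) - lam *\<^sub>R A (J lam f - x) = (J lam f - lam *\<^sub>R A (J lam f)) - (x - lam *\<^sub>R A x)"
    by (simp add: A_diff[OF j(1) assms(2)] scaleR_diff_right)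
  also have "\<dots> = 0" using j(2) assms(3) by simp
  finally have "(J lam f - x) - lam *\<^sub>R A (J lam f - x) = 0" .
  then have "norm (J lam f - x) \<le> 0" using contr0[OF assms(1) d] by simp
  then show ?thesis by simp
qed

lemma J_contr: "lam > 0 \<Longrightarrow> f \<in> S \<Longrightarrow> norm (J lam f) \<le> norm f"
  using contr0[of lam "J lam f"] J by metis

lemma J_add: assumes "lam > 0" "f \<in> S" "g \<in> S" shows "J lam (f + g) = J lam f + J lam g"
proof (rule J_unique[OF assms(1)])
  show "J lam f + J lam g \<in> D" using J assms subD subspace_add by blast
  show "J lam f + J lam g - lam *\<^sub>R A (J lam f + J lam g) = f + g"
    unfolding A_add[OF J(1)[OF assms(1,2)] J(1)[OF assms(1,3)]] scaleR_add_right
    using J(2)[OF assms(1,2)] J(2)[OF assms(1,3)] by (metis add_diff_add)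
qed

lemma J_scale: assumes "lam > 0" "f \<in> S" shows "J lam (c *\<^sub>R f) = c *\<^sub>R J lam f"
proof (rule J_unique[OF assms(1)])
  show "c *\<^sub>R J lam f \<in> D" using J assms subD subspace_scale by blast
  show "c *\<^sub>R J lam f - lam *\<^sub>R A (c *\<^sub>R J lam f) = c *\<^sub>R f"
    using J[OF assms] A_scale[OF J(1)[OF assms]]
    by (metis (no_types, lifting) mult.commute scaleR_right_diff_distrib scaleR_scaleR)
qed

lemma J_diff: "lam > 0 \<Longrightarrow> f \<in> S \<Longrightarrow> g \<in> S \<Longrightarrow> J lam (f - g) = J lam f - J lam g"
  using J_add[of lam f "(-1) *\<^sub>R g"] J_scale[of lam g "-1"] subS subspace_scale[of S g "-1"] by simp

text \<open>For \<open>x\<close> in \<open>D\<close> the vector \<open>A (J lam x)\<close> is a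
  multiple of \<open>J lam x - x\<close> and hence lies in \<open>D\<close> again, so
  \<open>A\<close> may be applied to the whole resolvent equation.\<close>

lemma J_A: assumes "lam > 0" "x \<in> D" shows "A (J lam x) = J lam (A x)"
proof -
  have xS: "x \<in> S" using assms DS by blast
  define y where "y = J lam x"
  have y: "y \<in> D" "y - lam *\<^sub>R A y = x" using J[OF assms(1) xS] by (auto simp: y_def)
  have "A y = (1/lam) *\<^sub>R (y - x)" using y assms by (simp flip: y(2))
  then have Ay: "A y \<in> D" using y assms subD by (simp add: subspace_scale subspace_diff)
  have "A x = A (y - lam *\<^sub>R A y)" using y(2) by simp
  also have "\<dots> = A y - lam *\<^sub>R A (A y)"
    using A_diff[OF y(1) subspace_scale[OF subD Ay]] A_scale[OF Ay] by simp
  finally have "A x = A y - lam *\<^sub>R A (A y)" .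
  then have "J lam (A x) = A y" by (intro J_unique[OF assms(1) Ay]) simp
  then show ?thesis by (simp add: y_def)
qed

lemma J_commute: assumes "lam > 0" "mu > 0" "f \<in> S" shows "J lam (J mu f) = J mu (J lam f)"
proof -
  define y where "y = J mu f"
  have y: "y\<in>D" "y - mu *\<^sub>R A y = f" using J[OF assms(2,3)] by (auto simp: y_def)
  have yS: "y \<in> S" "A y \<in> S" using y DS AS by auto
  have "J lam f = J lam (y - mu *\<^sub>R A y)" using y(2) by simp
  also have "\<dots> = J lam y - mu *\<^sub>R A (J lam y)"
    using J_diff[OF assms(1) yS(1) subspace_scale[OF subS yS(2)]] J_scale[OF assms(1) yS(2)]
      J_A[OF assms(1) y(1)] by simp
  finally have "J mu (J lam f) = J lam y" by (intro J_unique[OF assms(2) J(1)[OF assms(1) yS(1)]]) simp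
  then show ?thesis by (simp add: y_def)
qed

end

section \<open>The semigroup as a limit of resolvent powers\<close>

lemma norm_triangle3: "norm (a + b + c) \<le> norm a + norm b + norm (c::'a::real_normed_vector)"
  by (meson add_mono norm_triangle_ineq order_refl order_trans)

lemma floor_grid:
  assumes "t \<ge> 0"
  shows "real (nat \<lfloor>t * real (Suc k)\<rfloor>) * (1 / real (Suc k)) \<le> t"
    "t - 1 / real (Suc k) \<le> real (nat \<lfloor>t * real (Suc k)\<rfloor>) * (1 / real (Suc k))"
proof -
  define N where "N = real (Suc k)"
  have N: "N > 0" by (simp add: N_def)
  have n: "real (nat \<lfloor>t * N\<rfloor>) = of_int \<lfloor>t * N\<rfloor>" using assms N by simp
  have fl: "of_int \<lfloor>t * N\<rfloor> \<le> t * N" "t * N - 1 \<le> of_int \<lfloor>t * N\<rfloor>" by linarith+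
  show "real (nat \<lfloor>t * real (Suc k)\<rfloor>) * (1 / real (Suc k)) \<le> t"
    unfolding N_def[symmetric] n using fl(1) N by (simp add: divide_le_eq)
  have "t - 1 / N = (t * N - 1) / N" using N by (simp add: diff_divide_distrib)
  also have "\<dots> \<le> of_int \<lfloor>t * N\<rfloor> / N" using fl(2) N by (intro divide_right_mono) auto
  finally show "t - 1 / real (Suc k) \<le> real (nat \<lfloor>t * real (Suc k)\<rfloor>) * (1 / real (Suc k))"
    unfolding N_def[symmetric] n by simp
qed

section \<open>Powers of the resolvent and comparison of step sizes\<close>

context dissipative begin

lemma pow_S: "lam > 0 \<Longrightarrow> x \<in> S \<Longrightarrow> (J lam ^^ n) x \<in> S"
  by (induction n) (auto intro: J_S)

lemma pow_D: "lam > 0 \<Longrightarrow> x \<in> D \<Longrightarrow> (J lam ^^ n) x \<in> D"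
proof (induction n)
  case (Suc n) then show ?case using J(1)[of lam "(J lam ^^ n) x"] DS by auto
qed simp

lemma pow_contr: "lam > 0 \<Longrightarrow> x \<in> S \<Longrightarrow> norm ((J lam ^^ n) x) \<le> norm x"
proof (induction n)
  case (Suc n) then show ?case using J_contr[OF Suc.prems(1) pow_S[OF Suc.prems, of n]] by auto
qed simp

lemma pow_diff: "lam > 0 \<Longrightarrow> x \<in> S \<Longrightarrow> y \<in> S \<Longrightarrow> (J lam ^^ n) (x - y) = (J lam ^^ n) x - (J lam ^^ n) y"
  by (induction n) (auto simp: J_diff pow_S)

lemma pow_add: "lam > 0 \<Longrightarrow> x \<in> S \<Longrightarrow> y \<in> S \<Longrightarrow> (J lam ^^ n) (x + y) = (J lam ^^ n) x + (J lam ^^ n) y"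
  by (induction n) (auto simp: J_add pow_S)

lemma pow_scale: "lam > 0 \<Longrightarrow> x \<in> S \<Longrightarrow> (J lam ^^ n) (c *\<^sub>R x) = c *\<^sub>R (J lam ^^ n) x"
  by (induction n) (auto simp: J_scale pow_S)

lemma pow_A: "lam > 0 \<Longrightarrow> x \<in> D \<Longrightarrow> A ((J lam ^^ n) x) = (J lam ^^ n) (A x)"
  by (induction n) (auto simp: J_A pow_D)

lemma pow_J: "lam > 0 \<Longrightarrow> mu > 0 \<Longrightarrow> x \<in> S \<Longrightarrow> J mu ((J lam ^^ n) x) = (J lam ^^ n) (J mu x)"
  by (induction n) (auto simp: J_commute[of mu lam] pow_S)

text \<open>The sum telescopes: each step moves by \<open>lam\<close> times a resolvent power of
  \<open>A x\<close>, and resolvents do not increase the norm.\<close>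

lemma pow_dist:
  assumes "lam > 0" "x \<in> D" shows "norm ((J lam ^^ n) x - x) \<le> real n * lam * norm (A x)"
proof (induction n)
  case (Suc n)
  let ?y = "(J lam ^^ n) x"
  have y: "?y \<in> D" "?y \<in> S" using pow_D[OF assms] DS by auto
  have AS': "A x \<in> S" using AS assms by blast
  have eq: "J lam ?y - ?y = lam *\<^sub>R A (J lam ?y)" using J(2)[OF assms(1) y(2)] by (simp add: algebra_simps)
  have "A (J lam ?y) = (J lam ^^ Suc n) (A x)" using pow_A[OF assms, of "Suc n"] by simp
  then have "norm (J lam ?y - ?y) \<le> lam * norm (A x)"
    using pow_contr[OF assms(1) AS', of "Suc n"] assms(1) unfolding eq by simp
  moreover have "norm (J lam ?y - x) \<le> norm (J lam ?y - ?y) + norm (?y - x)"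
    using norm_triangle_ineq[of "J lam ?y - ?y" "?y - x"] by simp
  ultimately show ?case using Suc by (simp add: algebra_simps)
qed simp

text \<open>Concavity of the square root with weights \<open>mu / (lam + mu)\<close> and
  \<open>lam / (lam + mu)\<close>; after squaring, the defect is
  \<open>lam * mu * (sqrt p - sqrt q)\<^sup>2\<close>. It closes the induction in
  \<open>pow_dist_pow\<close>.\<close>

lemma weighted_sqrt:
  fixes p q lam mu R :: real
  assumes "lam > 0" "mu > 0" "p \<ge> 0" "q \<ge> 0" "(lam + mu) * R = mu * p + lam * q"
  shows "mu * sqrt p + lam * sqrt q \<le> (lam + mu) * sqrt R"
proof -
  have "0 \<le> mu * p + lam * q" using assms by (intro add_nonneg_nonneg mult_nonneg_nonneg) auto
  then have R: "R \<ge> 0" using assms(1,2) unfolding assms(5)[symmetric] by (simp add: zero_le_mult_iff)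
  have "(lam + mu)\<^sup>2 * R - (mu * sqrt p + lam * sqrt q)\<^sup>2 = lam * mu * (sqrt p - sqrt q)\<^sup>2"
  proof -
    have "(lam + mu)\<^sup>2 * R = (lam + mu) * (mu * (sqrt p)\<^sup>2 + lam * (sqrt q)\<^sup>2)"
      using assms by (simp add: power2_eq_square mult.assoc)
    then show ?thesis by (simp add: power2_eq_square algebra_simps)
  qed
  moreover have "0 \<le> lam * mu * (sqrt p - sqrt q)\<^sup>2" using assms(1,2) by simp
  ultimately have "(mu * sqrt p + lam * sqrt q)\<^sup>2 \<le> (lam + mu)\<^sup>2 * R" by linarith
  also have "\<dots> = ((lam + mu) * sqrt R)\<^sup>2" using R by (simp add: power_mult_distrib)
  finally show ?thesis by (rule power2_le_imp_le) (simp add: assms(1,2) R less_imp_le)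
qed

text \<open>Kobayashi's estimate for two implicit Euler schemes with different step sizes.\<close>
lemma pow_dist_pow:
  assumes lam: "lam > 0" and mu: "mu > 0" and x: "x \<in> D"
  shows "norm ((J lam ^^ m) x - (J mu ^^ n) x) \<le>
    norm (A x) * sqrt ((real m * lam - real n * mu)\<^sup>2 + real m * lam\<^sup>2 + real n * mu\<^sup>2)"
proof (induction m arbitrary: n)
  case 0
  have "real n * mu = sqrt ((real n * mu)\<^sup>2)" using mu by simp
  also have "\<dots> \<le> sqrt ((real n * mu)\<^sup>2 + real n * mu\<^sup>2)" by (intro real_sqrt_le_mono) simp
  finally have "real n * mu * norm (A x) \<le> sqrt ((real n * mu)\<^sup>2 + real n * mu\<^sup>2) * norm (A x)"
    by (rule mult_right_mono) simp
  then show ?case using pow_dist[OF mu x, of n] by (simp add: norm_minus_commute mult_ac)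
next
  case (Suc m)
  note IH = Suc
  show ?case
  proof (induction n)
    case 0
    have "real (Suc m) * lam = sqrt ((real (Suc m) * lam)\<^sup>2)" using lam by simp
    also have "\<dots> \<le> sqrt ((real (Suc m) * lam)\<^sup>2 + real (Suc m) * lam\<^sup>2)" by (intro real_sqrt_le_mono) simp
    finally have "real (Suc m) * lam * norm (A x) \<le> sqrt ((real (Suc m) * lam)\<^sup>2 + real (Suc m) * lam\<^sup>2) * norm (A x)"
      by (rule mult_right_mono) simp
    then show ?case using pow_dist[OF lam x, of "Suc m"] by (simp add: norm_minus_commute mult_ac)
  next
    case (Suc n)
    define xm where "xm = (J lam ^^ m) x"
    define yn where "yn = (J mu ^^ n) x"
    define X where "X = J lam xm"
    define Y where "Y = J mu yn"
    have S: "xm \<in> S" "yn \<in> S" using pow_S lam mu x DS unfolding xm_def yn_def by blast+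
    have XY: "X \<in> D" "Y \<in> D" using J S lam mu unfolding X_def Y_def by blast+
    have X: "X - xm = lam *\<^sub>R A X" and Y: "Y - yn = mu *\<^sub>R A Y"
      using J(2)[OF lam S(1)] J(2)[OF mu S(2)] by (auto simp: X_def Y_def algebra_simps)
    define d where "d = norm (X - Y)"
    define a where "a = norm (xm - Y)"
    define b where "b = norm (X - yn)"
    \<comment> \<open>Each Euler equation is multiplied by the step size of the other one, so that
      the two values of \<open>A\<close> combine into \<open>A (X - Y)\<close>, whose pairing with
      \<open>X - Y\<close> has a sign.\<close>
    have "(lam + mu) *\<^sub>R (X - Y) = mu *\<^sub>R (X - xm) - lam *\<^sub>R (Y - yn) + (mu *\<^sub>R (xm - Y) + lam *\<^sub>R (X - yn))"
      by (simp add: algebra_simps)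
    also have "\<dots> = (lam * mu) *\<^sub>R A (X - Y) + (mu *\<^sub>R (xm - Y) + lam *\<^sub>R (X - yn))"
      unfolding X Y A_diff[OF XY] by (simp add: algebra_simps)
    finally have "(lam + mu) * d\<^sup>2 = (lam * mu) * inner (A (X - Y)) (X - Y) + inner (mu *\<^sub>R (xm - Y) + lam *\<^sub>R (X - yn)) (X - Y)"
      unfolding d_def power2_norm_eq_inner by (metis inner_add_left inner_scaleR_left)
    also have "\<dots> \<le> 0 + norm (mu *\<^sub>R (xm - Y) + lam *\<^sub>R (X - yn)) * norm (X - Y)"
    proof (rule add_mono)
      show "lam * mu * inner (A (X - Y)) (X - Y) \<le> 0"
        using lam mu diss[of "X - Y"] XY subD by (simp add: subspace_diff mult_nonneg_nonpos)
    qed (rule norm_cauchy_schwarz)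
    also have "\<dots> \<le> (mu * a + lam * b) * d"
    proof -
      have "norm (mu *\<^sub>R (xm - Y) + lam *\<^sub>R (X - yn)) \<le> mu * a + lam * b"
        using norm_triangle_ineq[of "mu *\<^sub>R (xm - Y)" "lam *\<^sub>R (X - yn)"] lam mu by (simp add: a_def b_def)
      then show ?thesis by (simp add: d_def mult_right_mono)
    qed
    finally have "(lam + mu) * d * d \<le> (mu * a + lam * b) * d" by (simp add: power2_eq_square mult_ac)
    then have key: "(lam + mu) * d \<le> mu * a + lam * b"
    proof (cases "d = 0")
      case True then show ?thesis using lam mu by (simp add: a_def b_def)
    next
      case False
      then have "d > 0" by (simp add: d_def)
      then show ?thesis using \<open>(lam + mu) * d * d \<le> (mu * a + lam * b) * d\<close> by simp
    qed
    define K where "K = norm (A x)"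
    define Pq where "Pq = (real m * lam - real (Suc n) * mu)\<^sup>2 + real m * lam\<^sup>2 + real (Suc n) * mu\<^sup>2"
    define Qq where "Qq = (real (Suc m) * lam - real n * mu)\<^sup>2 + real (Suc m) * lam\<^sup>2 + real n * mu\<^sup>2"
    define R where "R = (real (Suc m) * lam - real (Suc n) * mu)\<^sup>2 + real (Suc m) * lam\<^sup>2 + real (Suc n) * mu\<^sup>2"
    have a: "a \<le> K * sqrt Pq" using IH[of "Suc n"]
      by (simp add: a_def K_def Pq_def xm_def Y_def yn_def)
    have b: "b \<le> K * sqrt Qq" using Suc by (simp add: b_def K_def Qq_def X_def xm_def yn_def)
    have "(lam + mu) * d \<le> mu * (K * sqrt Pq) + lam * (K * sqrt Qq)"
      using key mult_left_mono[OF a, of mu] mult_left_mono[OF b, of lam] lam mu by linarith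
    also have "\<dots> = K * (mu * sqrt Pq + lam * sqrt Qq)" by (simp add: algebra_simps)
    also have "\<dots> \<le> K * ((lam + mu) * sqrt R)"
    proof (intro mult_left_mono weighted_sqrt lam mu)
      \<comment> \<open>The radicand at \<open>(m + 1, n + 1)\<close> is exactly the weighted mean
        of those at \<open>(m, n + 1)\<close> and \<open>(m + 1, n)\<close>; the summands linear in
        \<open>m\<close> and \<open>n\<close> are what makes this exact.\<close>
      show "(lam + mu) * R = mu * Pq + lam * Qq"
        unfolding R_def Pq_def Qq_def by (simp add: power2_eq_square algebra_simps)
    qed (auto simp: Pq_def Qq_def K_def)
    finally have "(lam + mu) * d \<le> (lam + mu) * (K * sqrt R)" by (simp add: algebra_simps)
    then have "d \<le> K * sqrt R" using lam mu by simp
    then show ?case by (simp add: d_def K_def R_def X_def Y_def xm_def yn_def)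
  qed
qed

text \<open>As many Euler steps of size \<open>1 / Suc k\<close> as fit into the time
  \<open>t\<close>; with \<open>Suc k\<close> the step size is defined and positive already at
  \<open>k = 0\<close>.\<close>

definition P :: "nat \<Rightarrow> real \<Rightarrow> 'a \<Rightarrow> 'a" where
  "P k t = (J (1 / real (Suc k)) ^^ nat \<lfloor>t * real (Suc k)\<rfloor>)"

lemma P_est:
  assumes x: "x \<in> D" and t: "t \<ge> 0" and s: "s \<ge> 0"
  shows "norm (P k t x - P l s x) \<le> norm (A x) *
    sqrt ((\<bar>t - s\<bar> + 1 / real (Suc k) + 1 / real (Suc l))\<^sup>2 + t / real (Suc k) + s / real (Suc l))"
proof -
  define m where "m = nat \<lfloor>t * real (Suc k)\<rfloor>"
  define n where "n = nat \<lfloor>s * real (Suc l)\<rfloor>"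
  define h where "h = 1 / real (Suc k)"
  define g where "g = 1 / real (Suc l)"
  have hg: "h > 0" "g > 0" by (auto simp: h_def g_def)
  have m: "real m * h \<le> t" "t - h \<le> real m * h" using floor_grid[OF t, of k] by (simp_all add: m_def h_def)
  have n: "real n * g \<le> s" "s - g \<le> real n * g" using floor_grid[OF s, of l] by (simp_all add: n_def g_def)
  have "\<bar>real m * h - real n * g\<bar> \<le> \<bar>t - s\<bar> + h + g" using m n hg by linarith
  then have 1: "(real m * h - real n * g)\<^sup>2 \<le> (\<bar>t - s\<bar> + h + g)\<^sup>2" using hg by (simp add: abs_le_square_iff[symmetric])
  have 2: "real m * h\<^sup>2 \<le> t * h" "real n * g\<^sup>2 \<le> s * g"
    using mult_right_mono[OF m(1), of h] mult_right_mono[OF n(1), of g] hg by (simp_all add: power2_eq_square mult.assoc)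
  have "norm (P k t x - P l s x) \<le> norm (A x) * sqrt ((real m * h - real n * g)\<^sup>2 + real m * h\<^sup>2 + real n * g\<^sup>2)"
    unfolding P_def m_def n_def h_def g_def by (rule pow_dist_pow[OF _ _ x]) auto
  also have "\<dots> \<le> norm (A x) * sqrt ((\<bar>t - s\<bar> + h + g)\<^sup>2 + t * h + s * g)"
    using 1 2 by (intro mult_left_mono real_sqrt_le_mono) auto
  finally show ?thesis by (simp add: h_def g_def)
qed

section \<open>Convergence of the Euler approximations\<close>

lemma P_S: "x \<in> S \<Longrightarrow> P k t x \<in> S" unfolding P_def by (rule pow_S) auto
lemma P_contr: "x \<in> S \<Longrightarrow> norm (P k t x) \<le> norm x" unfolding P_def by (rule pow_contr) auto
lemma P_diff: "x \<in> S \<Longrightarrow> y \<in> S \<Longrightarrow> P k t (x - y) = P k t x - P k t y"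
  unfolding P_def by (rule pow_diff) auto
lemma P_add: "x \<in> S \<Longrightarrow> y \<in> S \<Longrightarrow> P k t (x + y) = P k t x + P k t y"
  unfolding P_def by (rule pow_add) auto
lemma P_scale: "x \<in> S \<Longrightarrow> P k t (c *\<^sub>R x) = c *\<^sub>R P k t x"
  unfolding P_def by (rule pow_scale) auto

lemma inverse_Suc_tendsto: "(\<lambda>n. c / real (Suc n)) \<longlonglongrightarrow> 0"
  by (rule LIMSEQ_Suc) (rule lim_const_over_n)

lemma P_Cauchy_D:
  assumes x: "x \<in> D" and t: "t \<ge> 0" shows "Cauchy (\<lambda>k. P k t x)"
proof (rule metric_CauchyI)
  fix e :: real assume e: "e > 0"
  define r where "r = (\<lambda>n. norm (A x) * sqrt ((1 / real (Suc n) + 1 / real (Suc n))\<^sup>2 + t / real (Suc n) + t / real (Suc n)))"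
  have "r \<longlonglongrightarrow> norm (A x) * sqrt ((0 + 0)\<^sup>2 + 0 + 0)" unfolding r_def
    by (intro tendsto_intros inverse_Suc_tendsto)
  then have "eventually (\<lambda>n. r n < e) sequentially" using e by (intro order_tendstoD) auto
  then obtain N where N: "r N < e" by (metis eventually_sequentially order_refl)
  show "\<exists>M. \<forall>m\<ge>M. \<forall>n\<ge>M. dist (P m t x) (P n t x) < e"
  proof (intro exI allI impI)
    fix m n assume mn: "N \<le> m" "N \<le> n"
    have i: "c / real (Suc m) \<le> c / real (Suc N)" "c / real (Suc n) \<le> c / real (Suc N)" if "c \<ge> 0" for c
      using mn that by (auto intro!: divide_left_mono)
    have "norm (P m t x - P n t x) \<le> norm (A x) * sqrt ((\<bar>t - t\<bar> + 1 / real (Suc m) + 1 / real (Suc n))\<^sup>2 + t / real (Suc m) + t / real (Suc n))"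
      by (rule P_est[OF x t t])
    also have "\<dots> \<le> r N" unfolding r_def
      using i[of 1] i[OF t] by (intro mult_left_mono real_sqrt_le_mono add_mono power_mono) auto
    finally show "dist (P m t x) (P n t x) < e" using N by (simp add: dist_norm)
  qed
qed

lemma P_Cauchy:
  assumes x: "x \<in> S" and t: "t \<ge> 0" shows "Cauchy (\<lambda>k. P k t x)"
proof (rule metric_CauchyI)
  fix e :: real assume e: "e > 0"
  obtain y where y: "y \<in> D" "norm (x - y) < e/3" using approx[OF x, of "e/3"] e by auto
  have yS: "y \<in> S" using y DS by blast
  obtain N where N: "\<And>m n. m \<ge> N \<Longrightarrow> n \<ge> N \<Longrightarrow> dist (P m t y) (P n t y) < e/3"
    using metric_CauchyD[OF P_Cauchy_D[OF y(1) t], of "e/3"] e by auto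
  have "dist (P m t x) (P n t x) < e" if "m \<ge> N" "n \<ge> N" for m n
  proof -
    have c: "norm (P k t x - P k t y) < e/3" for k
      using P_contr[of "x - y" k t] P_diff[OF x yS] y x yS subS by (simp add: subspace_diff)
    have "P m t x - P n t x = (P m t x - P m t y) + (P m t y - P n t y) + (P n t y - P n t x)" by simp
    then have "norm (P m t x - P n t x) \<le> norm (P m t x - P m t y) + norm (P m t y - P n t y) + norm (P n t y - P n t x)"
      by (simp only: norm_triangle3)
    then show ?thesis using c[of m] c[of n] N[OF that] by (simp add: dist_norm norm_minus_commute)
  qed
  then show "\<exists>M. \<forall>m\<ge>M. \<forall>n\<ge>M. dist (P m t x) (P n t x) < e" by blast
qed

definition T :: "real \<Rightarrow> 'a \<Rightarrow> 'a" where "T t x = lim (\<lambda>k. P k t x)"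

lemma T_lim: "x \<in> S \<Longrightarrow> t \<ge> 0 \<Longrightarrow> (\<lambda>k. P k t x) \<longlonglongrightarrow> T t x"
  unfolding T_def using P_Cauchy Cauchy_convergent convergent_LIMSEQ_iff by blast

section \<open>Semigroup laws, strong continuity and invariance of the domain\<close>

lemma closed_S: "closed S" using compS complete_imp_closed by blast

lemma T_S: "x \<in> S \<Longrightarrow> t \<ge> 0 \<Longrightarrow> T t x \<in> S"
  using closed_sequentially[OF closed_S _ T_lim] P_S by blast

lemma T_contr: "x \<in> S \<Longrightarrow> t \<ge> 0 \<Longrightarrow> norm (T t x) \<le> norm x"
  by (rule LIMSEQ_le_const2[OF tendsto_norm[OF T_lim]]) (auto intro: P_contr)

lemma T_add: assumes "x \<in> S" "y \<in> S" "t \<ge> 0" shows "T t (x + y) = T t x + T t y"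
proof (rule LIMSEQ_unique)
  show "(\<lambda>k. P k t (x + y)) \<longlonglongrightarrow> T t (x + y)" using assms subS by (intro T_lim subspace_add)
  show "(\<lambda>k. P k t (x + y)) \<longlonglongrightarrow> T t x + T t y"
    using assms by (simp add: P_add tendsto_add T_lim)
qed

lemma T_scale: assumes "x \<in> S" "t \<ge> 0" shows "T t (c *\<^sub>R x) = c *\<^sub>R T t x"
proof (rule LIMSEQ_unique)
  show "(\<lambda>k. P k t (c *\<^sub>R x)) \<longlonglongrightarrow> T t (c *\<^sub>R x)" using assms subS by (intro T_lim subspace_scale)
  show "(\<lambda>k. P k t (c *\<^sub>R x)) \<longlonglongrightarrow> c *\<^sub>R T t x"
    using assms by (simp add: P_scale tendsto_scaleR T_lim)
qed

lemma T_diff: "x \<in> S \<Longrightarrow> y \<in> S \<Longrightarrow> t \<ge> 0 \<Longrightarrow> T t (x - y) = T t x - T t y"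
  using T_add[of x "(-1) *\<^sub>R y" t] T_scale[of y t "-1"] subS subspace_scale[of S y "-1"] by simp

lemma T_0: "x \<in> S \<Longrightarrow> T 0 x = x"
  unfolding T_def P_def by (simp add: lim_const)

lemma T_lip: assumes x: "x \<in> D" and t: "t \<ge> 0" and s: "s \<ge> 0"
  shows "norm (T t x - T s x) \<le> norm (A x) * \<bar>t - s\<bar>"
proof (rule LIMSEQ_le)
  have xS: "x \<in> S" using x DS by blast
  show "(\<lambda>k. norm (P k t x - P k s x)) \<longlonglongrightarrow> norm (T t x - T s x)"
    by (intro tendsto_intros T_lim xS t s)
  have "(\<lambda>k. norm (A x) * sqrt ((\<bar>t - s\<bar> + 1 / real (Suc k) + 1 / real (Suc k))\<^sup>2 + t / real (Suc k) + s / real (Suc k)))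
    \<longlonglongrightarrow> norm (A x) * sqrt ((\<bar>t - s\<bar> + 0 + 0)\<^sup>2 + 0 + 0)"
    by (intro tendsto_intros inverse_Suc_tendsto)
  then show "(\<lambda>k. norm (A x) * sqrt ((\<bar>t - s\<bar> + 1 / real (Suc k) + 1 / real (Suc k))\<^sup>2 + t / real (Suc k) + s / real (Suc k)))
    \<longlonglongrightarrow> norm (A x) * \<bar>t - s\<bar>" by simp
qed (use P_est[OF x t s] in blast)

text \<open>The point of this commutation is invariance of the domain: \<open>D\<close> is the range
  of \<open>J 1\<close>, so an orbit starting in \<open>D\<close> stays in that range.\<close>

lemma T_J: assumes x: "x \<in> S" and t: "t \<ge> 0" shows "J 1 (T t x) = T t (J 1 x)"
proof (rule LIMSEQ_unique)
  have JS: "J 1 x \<in> S" using J_S x by simp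
  show "(\<lambda>k. P k t (J 1 x)) \<longlonglongrightarrow> T t (J 1 x)" using JS t by (rule T_lim)
  have c: "norm (J 1 (P k t x) - J 1 (T t x)) \<le> norm (P k t x - T t x)" for k
    using J_contr[of 1 "P k t x - T t x"] J_diff[of 1 "P k t x" "T t x"] P_S[OF x] T_S[OF x t] subS
    by (simp add: subspace_diff)
  have "(\<lambda>k. norm (P k t x - T t x)) \<longlonglongrightarrow> 0"
    using tendsto_norm[OF tendsto_diff[OF T_lim[OF x t] tendsto_const[of "T t x"]]] by simp
  then have "(\<lambda>k. J 1 (P k t x) - J 1 (T t x)) \<longlonglongrightarrow> 0"
    by (rule Lim_null_comparison[rotated]) (simp add: c)
  then have "(\<lambda>k. J 1 (P k t x)) \<longlonglongrightarrow> J 1 (T t x)" by (simp add: LIM_zero_iff)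
  then show "(\<lambda>k. P k t (J 1 x)) \<longlonglongrightarrow> J 1 (T t x)" unfolding P_def by (simp add: pow_J x)
qed

lemma T_D: assumes x: "x \<in> D" and t: "t \<ge> 0" shows "T t x \<in> D" "A (T t x) = T t (A x)"
proof -
  have xS: "x \<in> S" and Ax: "A x \<in> S" using x DS AS by auto
  define f where "f = x - A x"
  have f: "f \<in> S" using xS Ax subS by (simp add: f_def subspace_diff)
  have xf: "J 1 f = x" using J_unique[of 1 x f] x by (simp add: f_def)
  have eq: "T t x = J 1 (T t f)" using T_J[OF f t] xf by simp
  show "T t x \<in> D" unfolding eq by (rule J) (auto intro: T_S f t)
  have "T t x - A (T t x) = T t f" using J(2)[of 1 "T t f"] T_S[OF f t] unfolding eq by simp
  moreover have "T t f = T t x - T t (A x)" unfolding f_def by (rule T_diff[OF xS Ax t])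
  ultimately show "A (T t x) = T t (A x)" by simp
qed

lemma T_cong_dense:
  assumes "\<And>y. y \<in> D \<Longrightarrow> F y = G y" "x \<in> S"
    and F: "\<And>x y. x \<in> S \<Longrightarrow> y \<in> S \<Longrightarrow> norm (F x - F y) \<le> norm (x - y)"
    and G: "\<And>x y. x \<in> S \<Longrightarrow> y \<in> S \<Longrightarrow> norm (G x - G y) \<le> norm (x - y)"
  shows "F x = (G x :: 'a)"
proof -
  have "norm (F x - G x) \<le> 0 + e" if e: "e > 0" for e
  proof -
    obtain y where y: "y \<in> D" "norm (x - y) < e/2" using approx[OF assms(2), of "e/2"] e by auto
    have "F x - G x = (F x - F y) - (G x - G y)" using assms(1)[OF y(1)] by simp
    then have "norm (F x - G x) \<le> norm (F x - F y) + norm (G x - G y)" by (metis norm_triangle_ineq4)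
    then show ?thesis using F[of x y] G[of x y] y assms(2) DS by force
  qed
  then have "norm (F x - G x) \<le> 0" by (rule field_le_epsilon)
  then show ?thesis by simp
qed

lemma T_semigroup_D:
  assumes x: "x \<in> D" and t: "t \<ge> 0" and s: "s \<ge> 0" shows "T (t + s) x = T t (T s x)"
proof (rule LIMSEQ_unique)
  have xS: "x \<in> S" using x DS by blast
  have TsS: "T s x \<in> S" using T_S[OF xS s] .
  have "(\<lambda>k. P k t (P k s x) - P k t (T s x)) \<longlonglongrightarrow> 0"
  proof (rule Lim_null_comparison)
    show "\<forall>\<^sub>F k in sequentially. norm (P k t (P k s x) - P k t (T s x)) \<le> norm (P k s x - T s x)"
      using P_contr[of "P k s x - T s x" k t for k] P_diff[OF P_S[OF xS] TsS] P_S[OF xS] TsS subS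
      by (simp add: subspace_diff)
    show "(\<lambda>k. norm (P k s x - T s x)) \<longlonglongrightarrow> 0"
      using tendsto_norm[OF tendsto_diff[OF T_lim[OF xS s] tendsto_const[of "T s x"]]] by simp
  qed
  from tendsto_add[OF this T_lim[OF TsS t]]
  show "(\<lambda>k. P k t (P k s x)) \<longlonglongrightarrow> T t (T s x)" by simp
  have "(\<lambda>k. P k (t+s) x - P k t (P k s x)) \<longlonglongrightarrow> 0"
  proof (rule Lim_null_comparison)
    show "(\<lambda>k. norm (A x) / real (Suc k)) \<longlonglongrightarrow> 0" by (rule inverse_Suc_tendsto)
    have "norm (P k (t+s) x - P k t (P k s x)) \<le> norm (A x) / real (Suc k)" for k
    proof -
      define h where "h = 1 / real (Suc k)"
      have h: "h > 0" by (simp add: h_def)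
      define m where "m = nat \<lfloor>t * real (Suc k)\<rfloor>"
      define n where "n = nat \<lfloor>s * real (Suc k)\<rfloor>"
      define q where "q = nat \<lfloor>(t+s) * real (Suc k)\<rfloor>"
      have nn: "0 \<le> t * real (Suc k)" "0 \<le> s * real (Suc k)" using t s by auto
      have "(t+s) * real (Suc k) = t * real (Suc k) + s * real (Suc k)" by (simp add: algebra_simps)
      \<comment> \<open>Rounding \<open>t\<close> and \<open>s\<close> down separately loses at most
        one step compared with rounding \<open>t + s\<close>; on \<open>D\<close> such a step costs
        at most \<open>h * norm (A x)\<close>, which tends to 0.\<close>
      then have "q = m + n \<or> q = Suc (m + n)" using nn unfolding m_def n_def q_def by linarith
      moreover have Pq: "P k (t+s) x = (J h ^^ q) x" by (simp add: P_def q_def h_def)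
      moreover have Pmn: "P k t (P k s x) = (J h ^^ (m+n)) x" by (simp add: P_def m_def n_def h_def funpow_add)
      moreover have "norm (J h ((J h ^^ (m+n)) x) - (J h ^^ (m+n)) x) \<le> h * norm (A x)"
      proof -
        have "norm (J h ((J h ^^ (m+n)) x) - (J h ^^ (m+n)) x) \<le> h * norm (A ((J h ^^ (m+n)) x))"
          using pow_dist[OF h pow_D[OF h x, of "m+n"], of 1] by simp
        also have "\<dots> \<le> h * norm (A x)"
          using pow_A[OF h x, of "m+n"] pow_contr[OF h, of "A x" "m+n"] AS x h by simp
        finally show ?thesis .
      qed
      ultimately show ?thesis by (auto simp: h_def)
    qed
    then show "\<forall>\<^sub>F k in sequentially. norm (P k (t+s) x - P k t (P k s x)) \<le> norm (A x) / real (Suc k)" by simp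
  qed
  from tendsto_diff[OF T_lim[OF xS] this, of "t+s"] t s
  show "(\<lambda>k. P k t (P k s x)) \<longlonglongrightarrow> T (t+s) x" by simp
qed

lemma T_dist: "x \<in> S \<Longrightarrow> y \<in> S \<Longrightarrow> t \<ge> 0 \<Longrightarrow> norm (T t x - T t y) \<le> norm (x - y)"
  using T_contr[of "x - y" t] T_diff[of x y t] subS by (simp add: subspace_diff)

lemma T_semigroup: "x \<in> S \<Longrightarrow> t \<ge> 0 \<Longrightarrow> s \<ge> 0 \<Longrightarrow> T (t + s) x = T t (T s x)"
  by (rule T_cong_dense[where F="T (t+s)" and G="\<lambda>x. T t (T s x)"])
    (auto simp: T_semigroup_D intro: T_dist T_S intro!: order_trans[OF T_dist])

lemma T_continuous: assumes x: "x \<in> S" shows "continuous_on {0..} (\<lambda>t. T t x)"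
proof (rule continuous_onI)
  fix t e :: real assume t: "t \<in> {0..}" and e: "e > 0"
  obtain y where y: "y \<in> D" "norm (x - y) < e/4" using approx[OF x, of "e/4"] e by auto
  have yS: "y \<in> S" using y DS by blast
  define d where "d = e / (2 * (norm (A y) + 1))"
  have p: "norm (A y) + 1 > 0" by (simp add: add_nonneg_pos)
  have d: "d > 0" using e p by (simp add: d_def)
  have "dist (T s x) (T t x) \<le> e" if s: "s \<in> {0..}" "dist s t < d" for s
  proof -
    have "norm (T s y - T t y) \<le> norm (A y) * \<bar>s - t\<bar>" using T_lip[OF y(1)] s t by simp
    also have "\<dots> \<le> (norm (A y) + 1) * d" using s by (intro mult_mono) (auto simp: dist_real_def)
    also have "\<dots> = e/2" using p by (simp add: d_def field_simps)
    finally have 1: "norm (T s y - T t y) \<le> e/2" .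
    have "T s x - T t x = (T s x - T s y) + (T s y - T t y) + (T t y - T t x)" by simp
    then have "norm (T s x - T t x) \<le> norm (T s x - T s y) + norm (T s y - T t y) + norm (T t y - T t x)"
      by (simp only: norm_triangle3)
    also have "\<dots> \<le> e/4 + e/2 + e/4"
      using 1 T_dist[OF x yS, of s] T_dist[OF yS x, of t] s t y by (intro add_mono) (auto simp: norm_minus_commute)
    finally show ?thesis by (simp add: dist_norm)
  qed
  then show "\<exists>d>0. \<forall>x'\<in>{0..}. dist x' t < d \<longrightarrow> dist (T x' x) (T t x) \<le> e" using d by blast
qed

text \<open>A first-order Taylor remainder for the Euler scheme. Since \<open>A x\<close> need not
  lie in \<open>D\<close>, its displacement under resolvent powers has no direct rate; it is
  compared with a nearby \<open>g\<close> in \<open>D\<close>, at the price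
  \<open>2 * norm (A x - g)\<close>.\<close>

lemma pow_deriv:
  assumes lam: "lam > 0" and x: "x \<in> D" and g: "g \<in> D"
  shows "norm ((J lam ^^ m) x - x - (real m * lam) *\<^sub>R A x)
    \<le> real m * lam * (2 * norm (A x - g) + real m * lam * norm (A g))"
proof (induction m)
  case (Suc m)
  define d where "d = 2 * norm (A x - g)"
  define e where "e = norm (A g)"
  have Ax: "A x \<in> S" and gS: "g \<in> S" using AS x g DS by auto
  let ?y = "(J lam ^^ m) x"
  have yS: "?y \<in> S" using pow_S[OF lam] x DS by blast
  have "J lam ?y - ?y = lam *\<^sub>R (J lam ^^ Suc m) (A x)"
    using J(2)[OF lam yS] pow_A[OF lam x, of "Suc m"] by (simp add: algebra_simps)
  then have eq: "(J lam ^^ Suc m) x - x - (real (Suc m) * lam) *\<^sub>R A x =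
    (?y - x - (real m * lam) *\<^sub>R A x) + lam *\<^sub>R ((J lam ^^ Suc m) (A x) - A x)"
    by (simp add: algebra_simps)
  have "(J lam ^^ Suc m) (A x) - A x = ((J lam ^^ Suc m) (A x - g)) + ((J lam ^^ Suc m) g - g) + (g - A x)"
    using pow_diff[OF lam Ax gS, of "Suc m"] by simp
  then have "norm ((J lam ^^ Suc m) (A x) - A x) \<le> norm ((J lam ^^ Suc m) (A x - g)) + norm ((J lam ^^ Suc m) g - g) + norm (g - A x)"
    by (simp only: norm_triangle3)
  also have "\<dots> \<le> norm (A x - g) + real (Suc m) * lam * e + norm (A x - g)"
    using pow_contr[OF lam, of "A x - g" "Suc m"] pow_dist[OF lam g, of "Suc m"] Ax gS subS
    by (intro add_mono) (auto simp: e_def norm_minus_commute subspace_diff)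
  finally have 1: "norm ((J lam ^^ Suc m) (A x) - A x) \<le> d + real (Suc m) * lam * e" by (simp add: d_def)
  have "norm ((J lam ^^ Suc m) x - x - (real (Suc m) * lam) *\<^sub>R A x) \<le>
    real m * lam * (d + real m * lam * e) + lam * (d + real (Suc m) * lam * e)"
    unfolding eq using Suc lam mult_left_mono[OF 1, of lam]
    by (intro norm_triangle_le add_mono) (auto simp: d_def e_def)
  also have "\<dots> \<le> real (Suc m) * lam * (d + real (Suc m) * lam * e)"
  proof -
    have "0 \<le> real m * lam * lam * e" using lam by (simp add: e_def)
    then show ?thesis by (simp add: algebra_simps)
  qed
  finally show ?case by (simp add: d_def e_def)
qed simp

lemma T_deriv0:
  assumes x: "x \<in> D" and g: "g \<in> D" and t: "t \<ge> 0"
  shows "norm (T t x - x - t *\<^sub>R A x) \<le> t * (2 * norm (A x - g) + t * norm (A g))"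
proof (rule LIMSEQ_le)
  have xS: "x \<in> S" using x DS by blast
  define r where "r = (\<lambda>k. real (nat \<lfloor>t * real (Suc k)\<rfloor>) * (1 / real (Suc k)))"
  have r: "r \<longlonglongrightarrow> t"
  proof (rule tendsto_sandwich[of "\<lambda>k. t - 1 / real (Suc k)" _ _ "\<lambda>k. t"])
    have "t - 1 / real (Suc k) \<le> r k \<and> r k \<le> t" for k
      unfolding r_def using floor_grid[OF t, of k] by blast
    then show "\<forall>\<^sub>F k in sequentially. t - 1 / real (Suc k) \<le> r k" "\<forall>\<^sub>F k in sequentially. r k \<le> t" by auto
    show "(\<lambda>k. t - 1 / real (Suc k)) \<longlonglongrightarrow> t" using tendsto_diff[OF tendsto_const inverse_Suc_tendsto, of t 1] by simp
  qed simp
  show "(\<lambda>k. norm (P k t x - x - r k *\<^sub>R A x)) \<longlonglongrightarrow> norm (T t x - x - t *\<^sub>R A x)"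
    by (intro tendsto_intros T_lim xS t r)
  show "(\<lambda>k. r k * (2 * norm (A x - g) + r k * norm (A g))) \<longlonglongrightarrow> t * (2 * norm (A x - g) + t * norm (A g))"
    by (intro tendsto_intros r)
  show "\<exists>N. \<forall>k\<ge>N. norm (P k t x - x - r k *\<^sub>R A x) \<le> r k * (2 * norm (A x - g) + r k * norm (A g))"
    unfolding P_def r_def by (intro exI allI impI, rule pow_deriv[OF _ x g]) simp
qed

lemma T_right_deriv:
  assumes x: "x \<in> D"
  shows "((\<lambda>h. (1/h) *\<^sub>R (T h x - x)) \<longlongrightarrow> A x) (at_right 0)"
proof (rule tendstoI)
  fix e :: real assume e: "e > 0"
  obtain g where g: "g \<in> D" "norm (A x - g) < e/4" using approx[of "A x" "e/4"] AS[OF x] e by auto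
  have p: "norm (A g) + 1 > 0" by (simp add: add_nonneg_pos)
  have "\<forall>\<^sub>F h in at_right 0. h < e / (2 * (norm (A g) + 1)) \<and> h > 0"
    using e p eventually_at_right_less
    by (intro eventually_conj eventually_at_rightI[of 0 "e / (2 * (norm (A g) + 1))"]) (auto simp: eventually_at_right_less)
  then show "\<forall>\<^sub>F h in at_right 0. dist ((1/h) *\<^sub>R (T h x - x)) (A x) < e"
  proof eventually_elim
    case (elim h)
    then have h: "h > 0" by simp
    have "(1/h) *\<^sub>R (T h x - x) - A x = (1/h) *\<^sub>R (T h x - x - h *\<^sub>R A x)" using h by (simp add: algebra_simps)
    then have "norm ((1/h) *\<^sub>R (T h x - x) - A x) = (1/h) * norm (T h x - x - h *\<^sub>R A x)" using h by simp
    also have "\<dots> \<le> (1/h) * (h * (2 * norm (A x - g) + h * norm (A g)))"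
      using h T_deriv0[OF x g(1), of h] by (intro mult_left_mono) auto
    also have "\<dots> = 2 * norm (A x - g) + h * norm (A g)" using h by simp
    also have "\<dots> < e/2 + e/2"
    proof (rule add_less_le_mono)
      have "h * norm (A g) \<le> h * (norm (A g) + 1)" using h by (simp add: mult_left_mono)
      also have "\<dots> \<le> e/2" using elim p by (simp add: field_simps)
      finally show "h * norm (A g) \<le> e/2" .
    qed (use g in simp)
    finally show ?case by (simp add: dist_norm)
  qed
qed

end

section \<open>Strong and weak solutions\<close>

lemma has_vector_derivative_quotient:
  fixes f :: "real \<Rightarrow> 'a::real_normed_vector"
  shows "(f has_vector_derivative d) (at t within S) \<longleftrightarrow>
    ((\<lambda>s. (1 / (s - t)) *\<^sub>R (f s - f t)) \<longlongrightarrow> d) (at t within S)"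
proof -
  have "norm ((1 / norm (y - t)) *\<^sub>R (f y - (f t + (y - t) *\<^sub>R d))) =
      norm ((1 / (y - t)) *\<^sub>R (f y - f t) - d)" if "y \<noteq> t" for y
  proof -
    have "f y - (f t + (y - t) *\<^sub>R d) = (y - t) *\<^sub>R ((1 / (y - t)) *\<^sub>R (f y - f t) - d)"
      using that by (simp add: scaleR_diff_right)
    then show ?thesis using that by simp
  qed
  then have ev: "eventually (\<lambda>y. norm ((1 / norm (y - t)) *\<^sub>R (f y - (f t + (y - t) *\<^sub>R d))) =
      norm ((1 / (y - t)) *\<^sub>R (f y - f t) - d)) (at t within S)"
    by (auto simp: eventually_at_filter)
  have "(f has_vector_derivative d) (at t within S) \<longleftrightarrow>
    ((\<lambda>y. norm ((1 / norm (y - t)) *\<^sub>R (f y - (f t + (y - t) *\<^sub>R d)))) \<longlongrightarrow> 0) (at t within S)"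
    unfolding has_vector_derivative_def has_derivative_within
    by (simp only: bounded_linear_scaleR_left tendsto_norm_zero_iff simp_thms)
  also have "\<dots> \<longleftrightarrow> ((\<lambda>s. norm ((1 / (s - t)) *\<^sub>R (f s - f t) - d)) \<longlongrightarrow> 0) (at t within S)"
    by (rule tendsto_cong[OF ev])
  also have "\<dots> \<longleftrightarrow> ((\<lambda>s. (1 / (s - t)) *\<^sub>R (f s - f t)) \<longlongrightarrow> d) (at t within S)"
    by (simp only: tendsto_norm_zero_iff LIM_zero_iff)
  finally show ?thesis .
qed

section \<open>Differentiability of orbits and identification of the generator\<close>

context dissipative begin

lemma T_quotient:
  assumes x: "x \<in> D" and t: "t \<ge> 0"
  shows "((\<lambda>s. (1 / (s - t)) *\<^sub>R (T s x - T t x)) \<longlongrightarrow> T t (A x)) (at t within {0..})"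
proof (rule tendstoI)
  fix e :: real assume e: "e > 0"
  have xS: "x \<in> S" and AxS: "A x \<in> S" using x DS AS by auto
  obtain d where d: "d > 0" "\<And>h. 0 < h \<Longrightarrow> h < d \<Longrightarrow> dist ((1/h) *\<^sub>R (T h x - x)) (A x) < e/2"
    using tendstoD[OF T_right_deriv[OF x], of "e/2"] e unfolding eventually_at_right_field by auto
  obtain d' where d': "d' > 0" "\<And>s. s \<ge> 0 \<Longrightarrow> \<bar>s - t\<bar> < d' \<Longrightarrow> dist (T s (A x)) (T t (A x)) < e/2"
    using T_continuous[OF AxS] t e unfolding continuous_on_iff dist_real_def
    by (metis atLeast_iff half_gt_zero)
  have "dist ((1 / (s - t)) *\<^sub>R (T s x - T t x)) (T t (A x)) < e"
    if s: "s \<ge> 0" "s \<noteq> t" "\<bar>s - t\<bar> < min d d'" for s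
  proof (cases "s > t")
    case True
    define h where "h = s - t"
    have h: "h > 0" "h < d" using True s by (auto simp: h_def)
    have ThS: "T h x - x \<in> S" using T_S[OF xS] h xS subS by (simp add: subspace_diff)
    have "T s x = T t (T h x)" using T_semigroup[OF xS t, of h] h by (simp add: h_def)
    then have "(1 / (s - t)) *\<^sub>R (T s x - T t x) = T t ((1/h) *\<^sub>R (T h x - x))"
      using T_diff[OF T_S[OF xS], of h x t] xS T_scale[OF ThS t, of "1/h"] h t by (simp add: h_def)
    then have "dist ((1 / (s - t)) *\<^sub>R (T s x - T t x)) (T t (A x)) \<le> dist ((1/h) *\<^sub>R (T h x - x)) (A x)"
      using T_dist[OF subspace_scale[OF subS ThS, of "1/h"] AxS t] by (simp add: dist_norm)
    then show ?thesis using d(2)[OF h] e by simp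
  next
    \<comment> \<open>From the left the quotient is \<open>T s\<close> applied to a right quotient
      at 0, and \<open>T s\<close> itself varies with \<open>s\<close>; strong continuity of
      \<open>T s (A x)\<close> handles this extra motion.\<close>
    case False
    define h where "h = t - s"
    have h: "h > 0" "h < d" using False s by (auto simp: h_def)
    have ThS: "T h x - x \<in> S" using T_S[OF xS] h xS subS by (simp add: subspace_diff)
    have "T t x = T s (T h x)" using T_semigroup[OF xS s(1), of h] h by (simp add: h_def)
    then have "T s ((1/h) *\<^sub>R (T h x - x)) = (1/h) *\<^sub>R (T t x - T s x)"
      using T_diff[OF T_S[OF xS], of h x s] xS T_scale[OF ThS s(1), of "1/h"] h s(1) by simp
    also have "\<dots> = (1 / (s - t)) *\<^sub>R (T s x - T t x)"
    proof -
      have 1: "1 / (s - t) = - (1 / h)" using s(2) by (simp add: h_def field_simps)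
      show ?thesis unfolding 1 by (simp add: scaleR_diff_right)
    qed
    finally have "dist ((1 / (s - t)) *\<^sub>R (T s x - T t x)) (T s (A x)) \<le> dist ((1/h) *\<^sub>R (T h x - x)) (A x)"
      using T_dist[OF subspace_scale[OF subS ThS, of "1/h"] AxS s(1)] by (simp add: dist_norm)
    moreover have "dist (T s (A x)) (T t (A x)) < e/2" using d'(2) s by simp
    ultimately show ?thesis using d(2)[OF h]
      dist_triangle[of "(1 / (s - t)) *\<^sub>R (T s x - T t x)" "T t (A x)" "T s (A x)"] by simp
  qed
  then show "\<forall>\<^sub>F s in at t within {0..}. dist ((1 / (s - t)) *\<^sub>R (T s x - T t x)) (T t (A x)) < e"
    unfolding eventually_at using d(1) d'(1) by (intro exI[of _ "min d d'"]) (auto simp: dist_real_def)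
qed

lemma T_vector_derivative:
  "x \<in> D \<Longrightarrow> t \<ge> 0 \<Longrightarrow> ((\<lambda>s. T s x) has_vector_derivative T t (A x)) (at t within {0..})"
  unfolding has_vector_derivative_quotient by (rule T_quotient)

text \<open>The generator is no larger than \<open>A\<close>. Let \<open>y\<close> in
  \<open>D\<close> solve \<open>y - A y = x - w\<close>; then \<open>d = x - y\<close> has right
  derivative \<open>d\<close> at time 0. A contraction makes the quotients paired with
  \<open>d\<close> nonpositive, so \<open>inner d d \<le> 0\<close>.\<close>

lemma right_differentiable_imp_D:
  assumes x: "x \<in> S" and w: "w \<in> S" and lim: "((\<lambda>h. (1/h) *\<^sub>R (T h x - x)) \<longlongrightarrow> w) (at_right 0)"
  shows "x \<in> D"
proof -
  define y where "y = J 1 (x - w)"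
  have xw: "x - w \<in> S" using x w subS by (simp add: subspace_diff)
  have y: "y \<in> D" "y - A y = x - w" using J[of 1 "x - w"] xw by (auto simp: y_def)
  have yS: "y \<in> S" using y DS by blast
  define d where "d = x - y"
  have d: "d \<in> S" using x yS subS by (simp add: d_def subspace_diff)
  have "((\<lambda>h. (1/h) *\<^sub>R (T h x - x) - (1/h) *\<^sub>R (T h y - y)) \<longlongrightarrow> w - A y) (at_right 0)"
    by (intro tendsto_diff lim T_right_deriv y)
  moreover have "w - A y = d" using y(2) by (simp add: d_def algebra_simps)
  ultimately have 1: "((\<lambda>h. (1/h) *\<^sub>R (T h x - x) - (1/h) *\<^sub>R (T h y - y)) \<longlongrightarrow> d) (at_right 0)" by simp
  have ev: "\<forall>\<^sub>F h in at_right 0. (1/h) *\<^sub>R (T h x - x) - (1/h) *\<^sub>R (T h y - y) = (1/h) *\<^sub>R (T h d - d)"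
    using eventually_at_right_less[of "0::real"]
    by eventually_elim (simp add: d_def T_diff[OF x yS] flip: scaleR_diff_right)
  have "((\<lambda>h. (1/h) *\<^sub>R (T h d - d)) \<longlongrightarrow> d) (at_right 0)"
    using 1 by (subst tendsto_cong[OF ev, symmetric])
  then have "((\<lambda>h. inner ((1/h) *\<^sub>R (T h d - d)) d) \<longlongrightarrow> inner d d) (at_right 0)"
    by (intro tendsto_inner tendsto_const)
  moreover have "\<forall>\<^sub>F h in at_right 0. inner ((1/h) *\<^sub>R (T h d - d)) d \<le> 0"
    using eventually_at_right_less[of "0::real"]
  proof eventually_elim
    case (elim h)
    have "inner (T h d) d \<le> norm (T h d) * norm d" by (rule norm_cauchy_schwarz)
    also have "\<dots> \<le> norm d * norm d" using T_contr[OF d, of h] elim by (intro mult_right_mono) auto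
    also have "\<dots> = inner d d" by (simp add: power2_norm_eq_inner flip: power2_eq_square)
    finally show ?case using elim by (simp add: inner_diff_left divide_le_0_iff)
  qed
  ultimately have "inner d d \<le> 0" by (intro tendsto_upperbound) auto
  then have "d = 0" using inner_gt_zero_iff[of d] by linarith
  then show ?thesis using y by (simp add: d_def)
qed

text \<open>The squared norm has derivative \<open>2 * inner (A (W s)) (W s)\<close>, which is
  nonpositive, so it cannot rise above its initial value 0.\<close>

lemma energy:
  fixes W :: "real \<Rightarrow> 'a"
  assumes W: "\<And>t. t \<ge> 0 \<Longrightarrow> W t \<in> D"
    and der: "\<And>t. t \<ge> 0 \<Longrightarrow> (W has_vector_derivative A (W t)) (at t within {0..})"
    and W0: "W 0 = 0" and t: "t \<ge> 0"
  shows "W t = 0"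
proof -
  have "((\<lambda>s. inner (W s) (W s)) has_vector_derivative (inner (W s) (A (W s)) + inner (A (W s)) (W s))) (at s within {0..t})"
    if "s \<in> {0..t}" for s
    using that by (intro bounded_bilinear.has_vector_derivative[OF bounded_bilinear_inner]
        has_vector_derivative_within_subset[OF der]) auto
  then have "((\<lambda>s. inner (W s) (A (W s)) + inner (A (W s)) (W s)) has_integral
      inner (W t) (W t) - inner (W 0) (W 0)) {0..t}"
    by (intro fundamental_theorem_of_calculus[OF t]) auto
  then have "inner (W t) (W t) - inner (W 0) (W 0) \<le> 0"
  proof (rule has_integral_le)
    show "((\<lambda>_. 0) has_integral (0::real)) {0..t}" by simp
    show "inner (W s) (A (W s)) + inner (A (W s)) (W s) \<le> 0" if "s \<in> {0..t}" for s
      using diss[OF W, of s] that by (simp add: inner_commute)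
  qed
  then have "inner (W t) (W t) \<le> 0" using W0 by simp
  then show ?thesis using inner_gt_zero_iff[of "W t"] by linarith
qed

lemma strong_unique:
  fixes U :: "real \<Rightarrow> 'a"
  assumes U: "\<And>t. t \<ge> 0 \<Longrightarrow> U t \<in> D"
    and der: "\<And>t. t \<ge> 0 \<Longrightarrow> (U has_vector_derivative A (U t)) (at t within {0..})"
    and t: "t \<ge> 0"
  shows "U t = T t (U 0)"
proof -
  have x: "U 0 \<in> D" using U by simp
  have "U t - T t (U 0) = 0"
  proof (rule energy[OF _ _ _ t, of "\<lambda>t. U t - T t (U 0)"])
    fix s :: real assume s: "s \<ge> 0"
    show "U s - T s (U 0) \<in> D" using U[OF s] T_D(1)[OF x s] subD by (simp add: subspace_diff)
    have "((\<lambda>t. U t - T t (U 0)) has_vector_derivative A (U s) - T s (A (U 0))) (at s within {0..})"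
      by (intro has_vector_derivative_diff der s T_vector_derivative x)
    then show "((\<lambda>t. U t - T t (U 0)) has_vector_derivative A (U s - T s (U 0))) (at s within {0..})"
      using A_diff[OF U[OF s] T_D(1)[OF x s]] T_D(2)[OF x s] by simp
  next
    show "U 0 - T 0 (U 0) = 0" using T_0 x DS by force
  qed
  then show ?thesis by simp
qed

section \<open>Weak solutions: existence and uniqueness\<close>

lemma weak_exists_D:
  assumes x: "x \<in> D" and adj: "\<And>w. w \<in> D \<Longrightarrow> inner (A w) v = inner w v'" and t: "t \<ge> 0"
  shows "inner (T t x) v = inner x v + integral {0..t} (\<lambda>s. inner (T s x) v')"
proof -
  have "((\<lambda>s. inner (T s x) v) has_vector_derivative inner (T s x) v') (at s within {0..t})"
    if s: "s \<in> {0..t}" for s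
  proof -
    have "((\<lambda>s. T s x) has_vector_derivative T s (A x)) (at s within {0..t})"
      by (rule has_vector_derivative_within_subset[OF T_vector_derivative[OF x]]) (use s in auto)
    then have "((\<lambda>s. inner (T s x) v) has_vector_derivative inner (T s (A x)) v) (at s within {0..t})"
      by (rule bounded_linear.has_vector_derivative[OF bounded_linear_inner_left])
    moreover have "inner (T s (A x)) v = inner (T s x) v'" using adj[OF T_D(1)[OF x]] T_D(2)[OF x] s by force
    ultimately show ?thesis by simp
  qed
  then have "((\<lambda>s. inner (T s x) v') has_integral inner (T t x) v - inner (T 0 x) v) {0..t}"
    by (intro fundamental_theorem_of_calculus[OF t]) auto
  then show ?thesis using T_0 x DS by (auto dest!: integral_unique)
qed

text \<open>The defect \<open>G\<close> in the weak identity vanishes on the dense set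
  \<open>D\<close> by \<open>weak_exists_D\<close>, and it is Lipschitz in the initial value, hence
  zero on all of \<open>S\<close>.\<close>

lemma weak_exists:
  assumes x: "x \<in> S" and adj: "\<And>w. w \<in> D \<Longrightarrow> inner (A w) v = inner w v'" and t: "t \<ge> 0"
  shows "inner (T t x) v = inner x v + integral {0..t} (\<lambda>s. inner (T s x) v')"
proof -
  have ig: "(\<lambda>s. inner (T s y) v') integrable_on {0..t}" if "y \<in> S" for y
    using continuous_on_subset[OF T_continuous[OF that]]
    by (intro integrable_continuous_real continuous_on_inner continuous_on_const) auto
  define G where "G = (\<lambda>y. inner (T t y) v - inner y v - integral {0..t} (\<lambda>s. inner (T s y) v'))"
  have GD: "G y = 0" if "y \<in> D" for y using weak_exists_D[OF that adj t] by (simp add: G_def)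
  \<comment> \<open>A Lipschitz constant of \<open>G\<close>: \<open>2 * norm v\<close> covers the
    orbit value and the initial value, \<open>t * norm v'\<close> the time integral, and 1 is added
    so that dividing by \<open>M\<close> is possible.\<close>
  define M where "M = 2 * norm v + t * norm v' + 1"
  have M: "M > 0" using t by (simp add: M_def add_nonneg_pos)
  have Gd: "\<bar>G x - G y\<bar> \<le> M * norm (x - y)" if y: "y \<in> S" for y
  proof -
    have xy: "x - y \<in> S" using x y subS by (simp add: subspace_diff)
    have "integral {0..t} (\<lambda>s. inner (T s x) v') - integral {0..t} (\<lambda>s. inner (T s y) v')
      = integral {0..t} (\<lambda>s. inner (T s x) v' - inner (T s y) v')"
      using integral_diff[OF ig[OF x] ig[OF y]] by simp
    also have "\<dots> = integral {0..t} (\<lambda>s. inner (T s (x - y)) v')"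
      by (intro integral_cong) (simp add: T_diff[OF x y] inner_diff_left)
    finally have "G x - G y = inner (T t (x - y)) v - inner (x - y) v - integral {0..t} (\<lambda>s. inner (T s (x - y)) v')"
      by (simp add: G_def T_diff[OF x y t] inner_diff_left)
    moreover have "\<bar>inner (T t (x - y)) v\<bar> \<le> norm v * norm (x - y)"
      using Cauchy_Schwarz_ineq2[of "T t (x-y)" v] mult_right_mono[OF T_contr[OF xy t], of "norm v"] by (simp add: mult_ac)
    moreover have "\<bar>inner (x - y) v\<bar> \<le> norm v * norm (x - y)"
      using Cauchy_Schwarz_ineq2[of "x-y" v] by (simp add: mult_ac)
    moreover have "norm (integral {0..t} (\<lambda>s. inner (T s (x - y)) v')) \<le> integral {0..t} (\<lambda>s. norm (x - y) * norm v')"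
    proof (rule integral_norm_bound_integral[OF ig[OF xy]])
      fix s assume "s \<in> {0..t}"
      then show "norm (inner (T s (x - y)) v') \<le> norm (x - y) * norm v'"
        using Cauchy_Schwarz_ineq2[of "T s (x-y)" v'] mult_right_mono[OF T_contr[OF xy], of s "norm v'"] by force
    qed (rule integrable_const_ivl)
    moreover have "integral {0..t} (\<lambda>s. norm (x - y) * norm v') = t * norm v' * norm (x - y)" using t by simp
    moreover have "M * norm (x - y) = norm v * norm (x - y) + norm v * norm (x - y) + t * norm v' * norm (x - y) + norm (x - y)"
      by (simp add: M_def algebra_simps)
    ultimately show ?thesis using norm_ge_zero[of "x - y"] unfolding real_norm_def by linarith
  qed
  have "\<bar>G x\<bar> \<le> 0 + e" if e: "e > 0" for e
  proof -
    obtain y where y: "y \<in> D" "norm (x - y) < e / M" using approx[OF x, of "e/M"] e M by auto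
    have "\<bar>G x\<bar> \<le> M * norm (x - y)" using Gd[of y] GD[OF y(1)] y DS by auto
    also have "\<dots> \<le> M * (e / M)" using y M by (intro mult_left_mono) auto
    finally show ?thesis using M by simp
  qed
  then have "\<bar>G x\<bar> \<le> 0" by (rule field_le_epsilon)
  then show ?thesis by (simp add: G_def)
qed

text \<open>\<open>v\<close> is the adjoint of \<open>J 1\<close> applied to \<open>f\<close>,
  obtained from Riesz. It produces, for every \<open>f\<close>, a pair \<open>(v, v - f)\<close> in
  the graph of the adjoint of \<open>A\<close>; these pairs are all that uniqueness of weak
  solutions has to test with.\<close>

lemma adjoint_resolvent:
  assumes f: "f \<in> S"
  obtains v where "v \<in> S" "\<And>x. x \<in> S \<Longrightarrow> inner (J 1 x) f = inner x v"
    "\<And>w. w \<in> D \<Longrightarrow> inner (A w) v = inner w (v - f)"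
proof -
  have "\<exists>v\<in>S. \<forall>x\<in>S. inner (J 1 x) f = inner x v"
  proof (rule riesz_on_subspace[OF subS compS, where C="norm f"])
    show "\<bar>inner (J 1 x) f\<bar> \<le> norm f * norm x" if "x \<in> S" for x
      using Cauchy_Schwarz_ineq2[of "J 1 x" f] mult_right_mono[OF J_contr[of 1, OF _ that], of "norm f"]
      by (simp add: mult_ac)
  qed (simp_all add: J_add J_scale inner_add_left)
  then obtain v where v: "v \<in> S" "\<And>x. x \<in> S \<Longrightarrow> inner (J 1 x) f = inner x v" by blast
  have "inner (A w) v = inner w (v - f)" if w: "w \<in> D" for w
  proof -
    have "w - A w \<in> S" using w DS AS subS by (simp add: subspace_diff subset_iff)
    moreover have "J 1 (w - A w) = w" using J_unique[of 1 w] w by simp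
    ultimately show ?thesis using v(2)[of "w - A w"] by (simp add: inner_diff_left inner_diff_right)
  qed
  then show ?thesis using that v by blast
qed

text \<open>The integral \<open>\<integral>\<^sub>0\<^sup>t w\<close> is a strong solution with zero initial value: the vectors \<open>v\<close> from
  \<open>adjoint_resolvent\<close> show that it lies in the domain.\<close>
lemma weak_zero:
  fixes w :: "real \<Rightarrow> 'a"
  assumes w: "\<And>t. t \<ge> 0 \<Longrightarrow> w t \<in> S" and cont: "continuous_on {0..} w"
    and weak: "\<And>v v' t. v \<in> S \<Longrightarrow> v' \<in> S \<Longrightarrow> (\<And>x. x \<in> D \<Longrightarrow> inner (A x) v = inner x v') \<Longrightarrow> t \<ge> 0 \<Longrightarrow>
      inner (w t) v = integral {0..t} (\<lambda>s. inner (w s) v')"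
    and t: "t \<ge> 0"
  shows "w t = 0"
proof -
  have cont': "continuous_on {0..t} w" for t by (rule continuous_on_subset[OF cont]) auto
  define W where "W = (\<lambda>t. integral {0..t} w)"
  have inn: "inner (W t) v = integral {0..t} (\<lambda>s. inner (w s) v)" for t v
    using integral_linear[OF integrable_continuous_real[OF cont'] bounded_linear_inner_left[of v]]
    by (simp add: W_def o_def)
  have WS: "W t \<in> S" if "t \<ge> 0" for t
  proof -
    \<comment> \<open>The residual of the projection onto \<open>S\<close> is orthogonal to every
      value \<open>w s\<close> and thus to their integral, so the integral does not leave
      \<open>S\<close>.\<close>
    obtain p where p: "p \<in> S" "\<forall>m\<in>S. inner (W t - p) m = 0"
      using closest_point_complete_subspace[OF subS compS] by blast
    have "inner (W t) (W t - p) = integral {0..t} (\<lambda>s. 0)"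
      unfolding inn using p w by (intro integral_cong) (simp add: inner_commute)
    then have "inner (W t - p) (W t - p) = 0" using p by (simp add: inner_diff_left inner_diff_right inner_commute)
    then show ?thesis using p by simp
  qed
  have key: "W t \<in> D" "A (W t) = w t" if t: "t \<ge> 0" for t
  proof -
    \<comment> \<open>\<open>q\<close> is the defect in the resolvent equation
      \<open>W t - A (W t) = W t - w t\<close>. Tested with the adjoint resolvent of
      \<open>q\<close> itself, the weak identity yields \<open>inner q q = 0\<close>.\<close>
    define q where "q = W t - J 1 (W t - w t)"
    have d: "W t - w t \<in> S" using WS w t subS by (simp add: subspace_diff)
    have qS: "q \<in> S" using WS[OF t] J_S[OF _ d] subS by (simp add: q_def subspace_diff)
    obtain v where v: "v \<in> S" "\<And>x. x \<in> S \<Longrightarrow> inner (J 1 x) q = inner x v"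
      "\<And>w. w \<in> D \<Longrightarrow> inner (A w) v = inner w (v - q)" using adjoint_resolvent[OF qS] by blast
    have "inner (w t) v = inner (W t) (v - q)"
      unfolding inn using weak[OF v(1) _ v(3) t] v(1) qS subS by (simp add: subspace_diff)
    moreover have "inner (J 1 (W t - w t)) q = inner (W t - w t) v" by (rule v(2)[OF d])
    ultimately have "inner q q = 0" by (simp add: q_def inner_diff_left inner_diff_right)
    then have eq: "W t = J 1 (W t - w t)" by (simp add: q_def)
    show "W t \<in> D" using J(1)[OF _ d, of 1] eq by simp
    show "A (W t) = w t" using J(2)[OF _ d, of 1] eq by simp
  qed
  have "W t = 0" if "t \<ge> 0" for t
  proof (rule energy[OF key(1) _ _ that])
    fix s :: real assume s: "s \<ge> 0"
    have "(W has_vector_derivative w s) (at s within {0..s+1})"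
      unfolding W_def using s by (intro integral_has_vector_derivative cont') auto
    \<comment> \<open>The derivative of the integral is known on the compact interval; near
      \<open>s\<close> that interval and the half line coincide.\<close>
    moreover have "at s within {0..s+1} = at s within {0..}"
      by (rule at_within_nhd[of _ "{s-1<..<s+1}"]) auto
    ultimately have "(W has_vector_derivative w s) (at s within {0..})" by simp
    then show "(W has_vector_derivative A (W s)) (at s within {0..})" using key(2)[OF s] by simp
  qed (simp_all add: W_def)
  then show ?thesis using key(2)[OF t] t A_0 by simp
qed

text \<open>Resolvents inherit the commutation by uniqueness, then Euler powers and their limit do.
  Taken with multiplication by a complex number, it makes the semigroup complex linear although its
  construction is real.\<close>

lemma T_commute:
  assumes i: "bounded_linear i" and iS: "\<And>x. x \<in> S \<Longrightarrow> i x \<in> S" and iD: "\<And>x. x \<in> D \<Longrightarrow> i x \<in> D"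
    and iA: "\<And>x. x \<in> D \<Longrightarrow> A (i x) = i (A x)" and x: "x \<in> S" and t: "t \<ge> 0"
  shows "T t (i x) = i (T t x)"
proof -
  interpret i: bounded_linear i by fact
  have "J lam (i f) = i (J lam f)" if "lam > 0" "f \<in> S" for lam f
  proof (rule J_unique[OF that(1)])
    show "i (J lam f) \<in> D" using J(1)[OF that] iD by blast
    show "i (J lam f) - lam *\<^sub>R A (i (J lam f)) = i f"
      using J[OF that] iA by (simp flip: i.scaleR i.diff)
  qed
  then have "(J lam ^^ n) (i x) = i ((J lam ^^ n) x)" if "lam > 0" for lam n
    using that pow_S[OF that x] by (induction n) auto
  then have "P k t (i x) = i (P k t x)" for k unfolding P_def by simp
  moreover have "(\<lambda>k. i (P k t x)) \<longlonglongrightarrow> i (T t x)" by (intro i.tendsto T_lim x t)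
  ultimately show ?thesis using LIMSEQ_unique[OF T_lim[OF iS[OF x] t]] by simp
qed

end

section \<open>Hilbert spaces given by representatives\<close>

text \<open>A space given by representatives: \<open>Phi\<close> sends a representative to the vector it stands for in a
  Hilbert space on which \<open>cx\<close> is multiplication by complex scalars.\<close>
locale represented_dissipative =
  fixes H D :: "'s set" and A :: "'s \<Rightarrow> 's" and Phi :: "'s \<Rightarrow> 'a::{real_inner,banach}" and cx :: "complex \<Rightarrow> 'a \<Rightarrow> 'a"
    and nrm :: "'s \<Rightarrow> real" and lin :: "complex \<Rightarrow> 's \<Rightarrow> complex \<Rightarrow> 's \<Rightarrow> 's" and ip :: "'s \<Rightarrow> 's \<Rightarrow> complex" and K :: real
  assumes subH: "subspace (Phi ` H)" and compH: "complete (Phi ` H)"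
    and cx_linear: "\<And>c. bounded_linear (cx c)" and cx_real: "\<And>r x. cx (of_real r) x = r *\<^sub>R x"
    and cx_ii: "\<And>x y. inner (cx \<i> x) y = - inner x (cx \<i> y)"
    and nrm: "\<And>U. U \<in> H \<Longrightarrow> nrm U = norm (Phi U)"
    and lin_H: "\<And>U V c d. U \<in> H \<Longrightarrow> V \<in> H \<Longrightarrow> lin c U d V \<in> H"
    and Phi_lin: "\<And>U V c d. U \<in> H \<Longrightarrow> V \<in> H \<Longrightarrow> Phi (lin c U d V) = cx c (Phi U) + cx d (Phi V)"
    and ip: "\<And>U V. U \<in> H \<Longrightarrow> V \<in> H \<Longrightarrow> ip U V = Complex (inner (Phi U) (Phi V)) (inner (Phi U) (cx \<i> (Phi V)))"
    and DH: "D \<subseteq> H" and AH: "\<And>U. U \<in> D \<Longrightarrow> A U \<in> H"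
    and D_cong: "\<And>U V. U \<in> D \<Longrightarrow> V \<in> H \<Longrightarrow> Phi V = Phi U \<Longrightarrow> V \<in> D \<and> Phi (A V) = Phi (A U)"
    and lin_D: "\<And>U V c d. U \<in> D \<Longrightarrow> V \<in> D \<Longrightarrow> lin c U d V \<in> D \<and> Phi (A (lin c U d V)) = cx c (Phi (A U)) + cx d (Phi (A V))"
    and dissipative: "\<And>U. U \<in> D \<Longrightarrow> inner (Phi (A U)) (Phi U) \<le> 0"
    and surjective: "\<And>V. V \<in> H \<Longrightarrow> \<exists>U\<in>D. Phi (A U) = Phi V"
    and bounded_below: "\<And>U. U \<in> D \<Longrightarrow> norm (Phi U) \<le> K * norm (Phi (A U))"
begin

text \<open>The operator induced on vectors; by \<open>D_cong\<close> the choice of the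
  representative in \<open>D\<close> does not affect the value.\<close>

definition AX :: "'a \<Rightarrow> 'a" where "AX x = Phi (A (SOME U. U \<in> D \<and> Phi U = x))"

lemma D_in_H: "U \<in> D \<Longrightarrow> U \<in> H" using DH by blast

lemma AX_Phi: assumes U: "U \<in> D" shows "AX (Phi U) = Phi (A U)"
proof -
  have "(SOME V. V \<in> D \<and> Phi V = Phi U) \<in> D \<and> Phi (SOME V. V \<in> D \<and> Phi V = Phi U) = Phi U"
    by (rule someI[of "\<lambda>V. V \<in> D \<and> Phi V = Phi U" U]) (simp add: U)
  then show ?thesis unfolding AX_def using D_cong[OF U] D_in_H by blast
qed

lemma Phi_D_iff: "U \<in> H \<Longrightarrow> Phi U \<in> Phi ` D \<longleftrightarrow> U \<in> D"
  using D_cong by blast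

lemma cx_zero: "cx 0 x = 0" and cx_one: "cx 1 x = x" and cx_minus_one: "cx (-1) x = - x"
  using cx_real[of 0 x] cx_real[of 1 x] cx_real[of "-1" x] by simp_all

lemma Phi_diff: "U \<in> H \<Longrightarrow> V \<in> H \<Longrightarrow> nrm (lin 1 U (-1) V) = norm (Phi U - Phi V)"
  by (simp add: nrm lin_H Phi_lin cx_one cx_minus_one)

lemma Phi_quotient:
  assumes "U \<in> H" "V \<in> H" "W \<in> H"
  shows "nrm (lin 1 (lin (of_real (1/h)) U (of_real (-1/h)) V) (-1) W) = norm ((1/h) *\<^sub>R (Phi U - Phi V) - Phi W)"
proof -
  have "Phi (lin (of_real (1/h)) U (of_real (-1/h)) V) = (1/h) *\<^sub>R (Phi U - Phi V)"
    unfolding Phi_lin[OF assms(1,2)] cx_real by (simp add: scaleR_diff_right)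
  then show ?thesis using assms by (simp add: Phi_diff lin_H)
qed

lemma cx_H: assumes "x \<in> Phi ` H" shows "cx c x \<in> Phi ` H"
proof -
  obtain U where U: "U \<in> H" "x = Phi U" using assms by blast
  have "Phi (lin c U 0 U) = cx c x" using U by (simp add: Phi_lin cx_zero)
  then show ?thesis using lin_H[OF U(1) U(1), of c 0] by (metis imageI)
qed

lemma cx_D: assumes "x \<in> Phi ` D" shows "cx c x \<in> Phi ` D" "AX (cx c x) = cx c (AX x)"
proof -
  obtain U where U: "U \<in> D" "x = Phi U" using assms by blast
  have eq: "Phi (lin c U 0 U) = cx c x" using U D_in_H by (simp add: Phi_lin cx_zero)
  have l: "lin c U 0 U \<in> D" "Phi (A (lin c U 0 U)) = cx c (Phi (A U))" using lin_D[OF U(1) U(1), of c 0] by (simp_all add: cx_zero)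
  show "cx c x \<in> Phi ` D" using l(1) eq by (metis imageI)
  have "AX (cx c x) = Phi (A (lin c U 0 U))" using AX_Phi[OF l(1)] eq by simp
  then show "AX (cx c x) = cx c (AX x)" unfolding l(2) U(2) AX_Phi[OF U(1)] .
qed

sublocale X: dissipative "Phi ` H" "Phi ` D" AX K
proof
  have add: "x + y \<in> Phi ` D \<and> AX (x + y) = AX x + AX y" if xy: "x \<in> Phi ` D" "y \<in> Phi ` D" for x y
  proof -
    obtain U where U: "U \<in> D" "x = Phi U" using xy by blast
    obtain V where V: "V \<in> D" "y = Phi V" using xy by blast
    have eq: "Phi (lin 1 U 1 V) = x + y" using U V D_in_H by (simp add: Phi_lin cx_one)
    have l: "lin 1 U 1 V \<in> D" "Phi (A (lin 1 U 1 V)) = Phi (A U) + Phi (A V)"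
      using lin_D[OF U(1) V(1), of 1 1] by (simp_all add: cx_one)
    have "x + y \<in> Phi ` D" using l(1) eq by (metis imageI)
    moreover have "AX (x + y) = AX x + AX y"
      unfolding eq[symmetric] AX_Phi[OF l(1)] l(2) unfolding U(2) V(2) AX_Phi[OF U(1)] AX_Phi[OF V(1)] ..
    ultimately show ?thesis by blast
  qed
  have scale: "r *\<^sub>R x \<in> Phi ` D \<and> AX (r *\<^sub>R x) = r *\<^sub>R AX x" if "x \<in> Phi ` D" for r x
    using cx_D[OF that, of "of_real r"] by (simp add: cx_real)
  show "subspace (Phi ` H)" "complete (Phi ` H)" by (rule subH compH)+
  show "Phi ` D \<subseteq> Phi ` H" using DH by blast
  show "subspace (Phi ` D)" unfolding subspace_def
  proof (intro conjI ballI allI)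
    obtain V where "V \<in> H" using subspace_0[OF subH] by blast
    then obtain U where "U \<in> D" using surjective by blast
    then show "0 \<in> Phi ` D" using scale[of "Phi U" 0] by simp
  qed (use add scale in auto)
  show "AX (x + y) = AX x + AX y" if "x \<in> Phi ` D" "y \<in> Phi ` D" for x y using add[OF that] by blast
  show "AX (r *\<^sub>R x) = r *\<^sub>R AX x" if "x \<in> Phi ` D" for r x using scale[OF that] by blast
  show "AX x \<in> Phi ` H" if "x \<in> Phi ` D" for x using that AH by (auto simp: AX_Phi)
  show "inner (AX x) x \<le> 0" if "x \<in> Phi ` D" for x using that dissipative by (auto simp: AX_Phi)
  show "norm x \<le> K * norm (AX x)" if "x \<in> Phi ` D" for x using that bounded_below by (auto simp: AX_Phi)
  show "\<exists>x\<in>Phi ` D. AX x = f" if "f \<in> Phi ` H" for f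
  proof -
    obtain V where V: "V \<in> H" "f = Phi V" using \<open>f \<in> Phi ` H\<close> by blast
    obtain U where U: "U \<in> D" "Phi (A U) = Phi V" using surjective[OF V(1)] by blast
    show ?thesis by (rule bexI[of _ "Phi U"]) (use U V in \<open>simp_all add: AX_Phi\<close>)
  qed
qed

text \<open>Some state standing for the vector \<open>X.T t (Phi U)\<close>. States are therefore
  never claimed to be equal as functions; the semigroup laws hold at norm distance 0, the
  identification made in the definitions.\<close>

definition sg :: "real \<Rightarrow> 's \<Rightarrow> 's" where "sg t U = (SOME V. V \<in> H \<and> Phi V = X.T t (Phi U))"

lemma sg:
  assumes "U \<in> H" "t \<ge> 0" shows "sg t U \<in> H" "Phi (sg t U) = X.T t (Phi U)"
proof -
  have "\<exists>V. V \<in> H \<and> Phi V = X.T t (Phi U)" using X.T_S[of "Phi U" t] assms by auto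
  then have "sg t U \<in> H \<and> Phi (sg t U) = X.T t (Phi U)" unfolding sg_def by (rule someI_ex)
  then show "sg t U \<in> H" "Phi (sg t U) = X.T t (Phi U)" by auto
qed

lemma T_cx: "x \<in> Phi ` H \<Longrightarrow> t \<ge> 0 \<Longrightarrow> X.T t (cx c x) = cx c (X.T t x)"
  by (rule X.T_commute[OF cx_linear]) (auto intro: cx_H cx_D)

lemma limit_iff:
  assumes "\<forall>\<^sub>F t in F. nrm' t = norm (f t - l)"
  shows "(nrm' \<longlongrightarrow> 0) F \<longleftrightarrow> (f \<longlongrightarrow> (l::'a)) F"
  unfolding tendsto_cong[OF assms] tendsto_norm_zero_iff by (rule LIM_zero_iff)

lemma continuous_iff:
  fixes U :: "real \<Rightarrow> 's"
  assumes U: "\<And>t. t \<ge> 0 \<Longrightarrow> U t \<in> H"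
  shows "(\<forall>t0\<ge>0. ((\<lambda>t. nrm (lin 1 (U t) (-1) (U t0))) \<longlongrightarrow> 0) (at t0 within {0..})) \<longleftrightarrow>
    continuous_on {0..} (\<lambda>t. Phi (U t))"
proof -
  have "((\<lambda>t. nrm (lin 1 (U t) (-1) (U t0))) \<longlongrightarrow> 0) (at t0 within {0..}) \<longleftrightarrow> ((\<lambda>t. Phi (U t)) \<longlongrightarrow> Phi (U t0)) (at t0 within {0..})"
    if "t0 \<ge> 0" for t0
    by (rule limit_iff) (use U that in \<open>auto simp: eventually_at_filter Phi_diff\<close>)
  then show ?thesis unfolding continuous_on_def by auto
qed

section \<open>The contraction semigroup on representatives and its generator\<close>

lemma sg_contraction_semigroup: "C0_contraction_semigroup H nrm lin sg"
  unfolding C0_contraction_semigroup_def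
proof (intro conjI allI impI ballI)
  fix t :: real and U assume tU: "t \<ge> 0" "U \<in> H"
  show "sg t U \<in> H" using sg tU by blast
  show "nrm (sg t U) \<le> nrm U" using tU X.T_contr[of "Phi U" t] by (simp add: nrm sg)
  fix V c d assume V: "V \<in> H"
  have "X.T t (cx c (Phi U) + cx d (Phi V)) = cx c (X.T t (Phi U)) + cx d (X.T t (Phi V))"
    using tU V by (simp add: X.T_add cx_H T_cx)
  then show "nrm (lin 1 (sg t (lin c U d V)) (-1) (lin c (sg t U) d (sg t V))) = 0"
    using tU V by (simp add: Phi_diff sg lin_H Phi_lin)
next
  fix U assume U: "U \<in> H"
  show "nrm (lin 1 (sg 0 U) (-1) U) = 0" using U by (simp add: Phi_diff sg X.T_0)
  have c: "((\<lambda>t. X.T t (Phi U)) \<longlongrightarrow> X.T 0 (Phi U)) (at_right 0)"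
    using X.T_continuous[of "Phi U"] U unfolding continuous_on_def by (auto intro: tendsto_within_subset)
  show "((\<lambda>t. nrm (lin 1 (sg t U) (-1) U)) \<longlongrightarrow> 0) (at_right 0)"
    by (subst limit_iff[where f = "\<lambda>t. X.T t (Phi U)" and l = "Phi U"])
      (use U c in \<open>auto simp: eventually_at_filter Phi_diff sg X.T_0\<close>)
  fix t s :: real assume ts: "t \<ge> 0" "s \<ge> 0"
  show "nrm (lin 1 (sg (t + s) U) (-1) (sg t (sg s U))) = 0"
    using U ts X.T_semigroup[of "Phi U" t s] by (simp add: Phi_diff sg)
qed

lemma right_quotient_iff:
  assumes U: "U \<in> H" and W: "W \<in> H"
  shows "((\<lambda>h. nrm (lin 1 (lin (of_real (1/h)) (sg h U) (of_real (-1/h)) U) (-1) W)) \<longlongrightarrow> 0) (at_right 0) \<longleftrightarrow>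
    ((\<lambda>h. (1/h) *\<^sub>R (X.T h (Phi U) - Phi U)) \<longlongrightarrow> Phi W) (at_right 0)"
proof (rule limit_iff)
  show "\<forall>\<^sub>F h in at_right 0. nrm (lin 1 (lin (of_real (1/h)) (sg h U) (of_real (-1/h)) U) (-1) W) =
      norm ((1/h) *\<^sub>R (X.T h (Phi U) - Phi U) - Phi W)"
    using eventually_at_right_less[of 0]
  proof eventually_elim
    case (elim h)
    then have h: "h \<ge> 0" by simp
    show ?case unfolding Phi_quotient[OF sg(1)[OF U h] U W] sg(2)[OF U h] ..
  qed
qed

lemma sg_generator: "is_generator H nrm lin sg D A"
  unfolding is_generator_def
proof (intro conjI ballI)
  show "D \<subseteq> H" by (rule DH)
next
  fix U assume U: "U \<in> D"
  show "A U \<in> H" by (rule AH[OF U])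
  show "((\<lambda>h. nrm (lin 1 (lin (of_real (1/h)) (sg h U) (of_real (-1/h)) U) (-1) (A U))) \<longlongrightarrow> 0) (at_right 0)"
    unfolding right_quotient_iff[OF D_in_H[OF U] AH[OF U]] AX_Phi[OF U, symmetric] by (rule X.T_right_deriv) (use U in simp)
next
  fix U assume U: "U \<in> H"
  show "U \<in> D \<longleftrightarrow> (\<exists>W\<in>H. ((\<lambda>h. nrm (lin 1 (lin (of_real (1/h)) (sg h U) (of_real (-1/h)) U) (-1) W)) \<longlongrightarrow> 0) (at_right 0))"
  proof
    assume D: "U \<in> D"
    have "((\<lambda>h. nrm (lin 1 (lin (of_real (1/h)) (sg h U) (of_real (-1/h)) U) (-1) (A U))) \<longlongrightarrow> 0) (at_right 0)"
      unfolding right_quotient_iff[OF U AH[OF D]] AX_Phi[OF D, symmetric] by (rule X.T_right_deriv) (use D in simp)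
    then show "\<exists>W\<in>H. ((\<lambda>h. nrm (lin 1 (lin (of_real (1/h)) (sg h U) (of_real (-1/h)) U) (-1) W)) \<longlongrightarrow> 0) (at_right 0)"
      using AH[OF D] by blast
  next
    assume "\<exists>W\<in>H. ((\<lambda>h. nrm (lin 1 (lin (of_real (1/h)) (sg h U) (of_real (-1/h)) U) (-1) W)) \<longlongrightarrow> 0) (at_right 0)"
    then obtain W where W: "W \<in> H" "((\<lambda>h. (1/h) *\<^sub>R (X.T h (Phi U) - Phi U)) \<longlongrightarrow> Phi W) (at_right 0)"
      using right_quotient_iff[OF U] by blast
    have "Phi U \<in> Phi ` D" by (rule X.right_differentiable_imp_D[OF _ _ W(2)]) (use U W in auto)
    then show "U \<in> D" using Phi_D_iff[OF U] by blast
  qed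
qed

text \<open>The imaginary part of the complex pairing is the real pairing with the vector multiplied
  by the imaginary unit. Since the domain is invariant under that multiplication and
  \<open>AX\<close> commutes with it, the real identity already implies the complex one.\<close>

lemma adjoint_pair_iff:
  assumes V: "V \<in> H" and V': "V' \<in> H"
  shows "(\<forall>W\<in>D. ip (A W) V = ip W V') \<longleftrightarrow> (\<forall>x\<in>Phi ` D. inner (AX x) (Phi V) = inner x (Phi V'))"
    "(\<forall>W\<in>D. ip (A W) V = ip W V') \<Longrightarrow> x \<in> Phi ` D \<Longrightarrow> inner (AX x) (cx \<i> (Phi V)) = inner x (cx \<i> (Phi V'))"
proof -
  have i: "ip (A W) V = ip W V' \<longleftrightarrow> inner (AX (Phi W)) (Phi V) = inner (Phi W) (Phi V') \<and>
      inner (AX (Phi W)) (cx \<i> (Phi V)) = inner (Phi W) (cx \<i> (Phi V'))" if "W \<in> D" for W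
    using that V V' by (simp add: ip AH D_in_H AX_Phi)
  show "(\<forall>W\<in>D. ip (A W) V = ip W V') \<longleftrightarrow> (\<forall>x\<in>Phi ` D. inner (AX x) (Phi V) = inner x (Phi V'))"
  proof
    assume r: "\<forall>x\<in>Phi ` D. inner (AX x) (Phi V) = inner x (Phi V')"
    have "inner (AX x) (cx \<i> (Phi V)) = inner x (cx \<i> (Phi V'))" if x: "x \<in> Phi ` D" for x
      using r[rule_format, OF cx_D(1)[OF x, of \<i>]] unfolding cx_D(2)[OF x] cx_ii by simp
    then show "\<forall>W\<in>D. ip (A W) V = ip W V'" using i r by blast
  qed (use i in blast)
  show "(\<forall>W\<in>D. ip (A W) V = ip W V') \<Longrightarrow> x \<in> Phi ` D \<Longrightarrow> inner (AX x) (cx \<i> (Phi V)) = inner x (cx \<i> (Phi V'))"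
    using i by blast
qed

lemma integral_ip:
  fixes U :: "real \<Rightarrow> 's"
  assumes U: "\<And>t. t \<ge> 0 \<Longrightarrow> U t \<in> H" and c: "continuous_on {0..} (\<lambda>t. Phi (U t))" and V: "V \<in> H"
  shows "integral {0..t} (\<lambda>s. ip (U s) V) =
    Complex (integral {0..t} (\<lambda>s. inner (Phi (U s)) (Phi V))) (integral {0..t} (\<lambda>s. inner (Phi (U s)) (cx \<i> (Phi V))))"
proof -
  have c': "continuous_on {0..t} (\<lambda>t. Phi (U t))" by (rule continuous_on_subset[OF c]) auto
  have i: "(\<lambda>s. inner (Phi (U s)) v) integrable_on {0..t}" for v
    by (rule integrable_continuous_real) (intro continuous_on_inner c' continuous_on_const)
  have "((\<lambda>s. of_real (inner (Phi (U s)) (Phi V)) + \<i> * of_real (inner (Phi (U s)) (cx \<i> (Phi V)))) has_integral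
     (of_real (integral {0..t} (\<lambda>s. inner (Phi (U s)) (Phi V))) + \<i> * of_real (integral {0..t} (\<lambda>s. inner (Phi (U s)) (cx \<i> (Phi V)))))) {0..t}"
    by (intro has_integral_add has_integral_mult_right has_integral_of_real integrable_integral i)
  then have "((\<lambda>s. ip (U s) V) has_integral Complex (integral {0..t} (\<lambda>s. inner (Phi (U s)) (Phi V)))
     (integral {0..t} (\<lambda>s. inner (Phi (U s)) (cx \<i> (Phi V))))) {0..t}"
    unfolding complex_eq[symmetric] Complex_eq[symmetric]
    by (rule has_integral_eq[rotated]) (simp add: ip U V)
  then show ?thesis by (rule integral_unique)
qed

lemma sg_continuous: "U \<in> H \<Longrightarrow> continuous_on {0..} (\<lambda>t. Phi (sg t U))"
proof -
  assume U: "U \<in> H"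
  have "continuous_on {0..} (\<lambda>t. X.T t (Phi U))" by (rule X.T_continuous) (use U in simp)
  then show ?thesis by (rule continuous_on_eq) (simp add: sg U)
qed

section \<open>Weak and strong solutions on representatives\<close>

lemma sg_weak_solution:
  assumes U: "U \<in> H" shows "weak_solution H nrm lin ip D A U (\<lambda>t. sg t U)"
  unfolding weak_solution_def
proof (intro conjI ballI impI)
  show "\<forall>t0\<ge>0. ((\<lambda>t. nrm (lin 1 (sg t U) (-1) (sg t0 U))) \<longlongrightarrow> 0) (at t0 within {0..})"
    using sg_continuous[OF U] sg(1)[OF U] by (subst continuous_iff)
  show "nrm (lin 1 (sg 0 U) (-1) U) = 0" using U by (simp add: Phi_diff sg X.T_0)
  fix V V' assume V: "V \<in> H" and V': "V' \<in> H" and p: "\<forall>W\<in>D. ip (A W) V = ip W V'"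
  show "\<forall>t\<ge>0. ip (sg t U) V = ip U V + integral {0..t} (\<lambda>s. ip (sg s U) V')"
  proof (intro allI impI)
    fix t :: real assume t: "t \<ge> 0"
    have e: "inner (X.T t (Phi U)) v = inner (Phi U) v + integral {0..t} (\<lambda>s. inner (Phi (sg s U)) v')"
      if "\<And>x. x \<in> Phi ` D \<Longrightarrow> inner (AX x) v = inner x v'" for v v'
    proof -
      have "integral {0..t} (\<lambda>s. inner (Phi (sg s U)) v') = integral {0..t} (\<lambda>s. inner (X.T s (Phi U)) v')"
        by (rule Henstock_Kurzweil_Integration.integral_cong) (simp add: sg U)
      then show ?thesis using X.weak_exists[of "Phi U", OF _ that t] U by simp
    qed
    have "inner (X.T t (Phi U)) (Phi V) = inner (Phi U) (Phi V) + integral {0..t} (\<lambda>s. inner (Phi (sg s U)) (Phi V'))"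
      using p adjoint_pair_iff(1)[OF V V'] by (intro e) blast
    moreover have "inner (X.T t (Phi U)) (cx \<i> (Phi V)) = inner (Phi U) (cx \<i> (Phi V)) + integral {0..t} (\<lambda>s. inner (Phi (sg s U)) (cx \<i> (Phi V')))"
      by (rule e) (rule adjoint_pair_iff(2)[OF V V' p])
    moreover have "integral {0..t} (\<lambda>s. ip (sg s U) V') = Complex (integral {0..t} (\<lambda>s. inner (Phi (sg s U)) (Phi V')))
        (integral {0..t} (\<lambda>s. inner (Phi (sg s U)) (cx \<i> (Phi V'))))"
      by (rule integral_ip[of "\<lambda>t. sg t U", OF sg(1)[OF U] sg_continuous[OF U] V'])
    ultimately show "ip (sg t U) V = ip U V + integral {0..t} (\<lambda>s. ip (sg s U) V')"
      unfolding ip[OF sg(1)[OF U t] V] ip[OF U V] sg(2)[OF U t]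
      by (simp add: complex_eq_iff)
  qed
qed (use U sg in blast)

text \<open>The difference from the semigroup orbit is a weak solution with zero data in the real
  sense. Real adjoint pairs of vectors are lifted to states, where the complex weak identity
  applies, and its real part is kept.\<close>

lemma weak_solution_unique:
  assumes U0: "U0 \<in> H" and w: "weak_solution H nrm lin ip D A U0 U" and t: "t \<ge> 0"
  shows "nrm (lin 1 (U t) (-1) (sg t U0)) = 0"
proof -
  have U: "\<And>t. t \<ge> 0 \<Longrightarrow> U t \<in> H" using w by (simp add: weak_solution_def)
  have c: "continuous_on {0..} (\<lambda>t. Phi (U t))"
  proof (subst continuous_iff[OF U, symmetric])
    show "\<forall>t0\<ge>0. ((\<lambda>t. nrm (lin 1 (U t) (-1) (U t0))) \<longlongrightarrow> 0) (at t0 within {0..})"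
      using w unfolding weak_solution_def by (elim conjE)
  qed
  have "Phi (U t) - X.T t (Phi U0) = 0"
  proof (rule X.weak_zero[where w = "\<lambda>t. Phi (U t) - X.T t (Phi U0)", OF _ _ _ t])
    show "Phi (U s) - X.T s (Phi U0) \<in> Phi ` H" if "s \<ge> 0" for s
      using that U X.T_S[of "Phi U0" s] U0 by (intro subspace_diff subH) auto
    show "continuous_on {0..} (\<lambda>t. Phi (U t) - X.T t (Phi U0))"
      by (intro continuous_on_diff c X.T_continuous) (use U0 in simp)
    fix v v' and r :: real
    assume "v \<in> Phi ` H" "v' \<in> Phi ` H" and adj: "\<And>x. x \<in> Phi ` D \<Longrightarrow> inner (AX x) v = inner x v'" and r: "r \<ge> 0"
    then obtain V V' where V: "V \<in> H" "v = Phi V" and V': "V' \<in> H" "v' = Phi V'" by blast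
    have "\<forall>W\<in>D. ip (A W) V = ip W V'" using adjoint_pair_iff(1)[OF V(1) V'(1)] adj V(2) V'(2) by blast
    then have "ip (U r) V = ip U0 V + integral {0..r} (\<lambda>s. ip (U s) V')"
      using w V(1) V'(1) r unfolding weak_solution_def by (elim conjE) simp
    moreover have "integral {0..r} (\<lambda>s. ip (U s) V') =
        Complex (integral {0..r} (\<lambda>s. inner (Phi (U s)) (Phi V'))) (integral {0..r} (\<lambda>s. inner (Phi (U s)) (cx \<i> (Phi V'))))"
      by (rule integral_ip[of U, OF U c V'(1)])
    ultimately have 1: "inner (Phi (U r)) v = inner (Phi U0) v + integral {0..r} (\<lambda>s. inner (Phi (U s)) v')"
      unfolding ip[OF U[OF r] V(1)] ip[OF U0 V(1)] V(2) V'(2) by (simp add: complex_eq_iff)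
    have 2: "inner (X.T r (Phi U0)) v = inner (Phi U0) v + integral {0..r} (\<lambda>s. inner (X.T s (Phi U0)) v')"
    proof (rule X.weak_exists[OF _ _ r])
      show "Phi U0 \<in> Phi ` H" using U0 by simp
    qed (rule adj)
    have i: "(\<lambda>s. inner (Phi (U s)) v') integrable_on {0..r}" "(\<lambda>s. inner (X.T s (Phi U0)) v') integrable_on {0..r}"
      using U0 by (auto intro!: integrable_continuous_real continuous_on_inner continuous_on_const
          continuous_on_subset[OF c] continuous_on_subset[OF X.T_continuous])
    show "inner (Phi (U r) - X.T r (Phi U0)) v = integral {0..r} (\<lambda>s. inner (Phi (U s) - X.T s (Phi U0)) v')"
      using 1 2 i by (simp add: inner_diff_left Henstock_Kurzweil_Integration.integral_diff)
  qed
  then show ?thesis using U[OF t] U0 t by (simp add: Phi_diff sg)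
qed

lemma quotient_iff:
  fixes U :: "real \<Rightarrow> 's"
  assumes U: "\<And>t. t \<ge> 0 \<Longrightarrow> U t \<in> H" and W: "W \<in> H" and t0: "t0 \<ge> 0"
  shows "((\<lambda>t. nrm (lin 1 (lin (of_real (1/(t - t0))) (U t) (of_real (-1/(t - t0))) (U t0)) (-1) W)) \<longlongrightarrow> 0) (at t0 within {0..})
    \<longleftrightarrow> ((\<lambda>t. (1/(t - t0)) *\<^sub>R (Phi (U t) - Phi (U t0))) \<longlongrightarrow> Phi W) (at t0 within {0..})"
proof (rule limit_iff)
  have "nrm (lin 1 (lin (of_real (1/(t - t0))) (U t) (of_real (-1/(t - t0))) (U t0)) (-1) W) =
      norm ((1/(t - t0)) *\<^sub>R (Phi (U t) - Phi (U t0)) - Phi W)" if "t \<ge> 0" for t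
    by (rule Phi_quotient[OF U[OF that] U[OF t0] W])
  then show "\<forall>\<^sub>F t in at t0 within {0..}. nrm (lin 1 (lin (of_real (1/(t - t0))) (U t) (of_real (-1/(t - t0))) (U t0)) (-1) W) =
      norm ((1/(t - t0)) *\<^sub>R (Phi (U t) - Phi (U t0)) - Phi W)"
    by (simp only: eventually_at_filter atLeast_iff) (simp add: always_eventually)
qed

lemma sg_D: assumes U: "U \<in> D" and t: "t \<ge> 0" shows "sg t U \<in> D" "Phi (A (sg t U)) = X.T t (AX (Phi U))"
proof -
  note s = sg[OF D_in_H[OF U] t]
  have T: "X.T t (Phi U) \<in> Phi ` D" "AX (X.T t (Phi U)) = X.T t (AX (Phi U))" using X.T_D[of "Phi U" t] U t by auto
  show D: "sg t U \<in> D" using T(1) Phi_D_iff[OF s(1)] s(2) by simp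
  show "Phi (A (sg t U)) = X.T t (AX (Phi U))" unfolding AX_Phi[OF D, symmetric] s(2) by (rule T(2))
qed

lemma sg_strong_solution:
  assumes U: "U \<in> D" shows "strong_solution H nrm lin D A U (\<lambda>t. sg t U)"
proof -
  note UH = D_in_H[OF U]
  have AU: "A (sg t U) \<in> H" if "t \<ge> 0" for t by (rule AH[OF sg_D(1)[OF U that]])
  have cA: "continuous_on {0..} (\<lambda>t. Phi (A (sg t U)))"
  proof (subst continuous_on_cong[OF refl])
    show "Phi (A (sg t U)) = X.T t (AX (Phi U))" if "t \<in> {0..}" for t using sg_D(2)[OF U] that by simp
    show "continuous_on {0..} (\<lambda>t. X.T t (AX (Phi U)))" by (rule X.T_continuous) (use U AH in \<open>simp add: AX_Phi\<close>)
  qed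
  have c1: "((\<lambda>t. nrm (lin 1 (sg t U) (-1) (sg t0 U))) \<longlongrightarrow> 0) (at t0 within {0..})" if "t0 \<ge> 0" for t0
    using continuous_iff[of "\<lambda>t. sg t U", OF sg(1)[OF UH]] sg_continuous[OF UH] that by blast
  have c2: "((\<lambda>t. nrm (lin 1 (A (sg t U)) (-1) (A (sg t0 U)))) \<longlongrightarrow> 0) (at t0 within {0..})" if "t0 \<ge> 0" for t0
    using continuous_iff[of "\<lambda>t. A (sg t U)", OF AU] cA that by blast
  have q: "((\<lambda>t. nrm (lin 1 (lin (of_real (1/(t - t0))) (sg t U) (of_real (-1/(t - t0))) (sg t0 U)) (-1) (A (sg t0 U)))) \<longlongrightarrow> 0) (at t0 within {0..})"
    if t0: "t0 \<ge> 0" for t0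
  proof (subst quotient_iff[of "\<lambda>t. sg t U", OF sg(1)[OF UH] AU[OF t0] t0])
    have "((\<lambda>s. (1 / (s - t0)) *\<^sub>R (X.T s (Phi U) - X.T t0 (Phi U))) \<longlongrightarrow> X.T t0 (AX (Phi U))) (at t0 within {0..})"
      by (rule X.T_quotient[OF _ t0]) (use U in simp)
    then show "((\<lambda>t. (1/(t - t0)) *\<^sub>R (Phi (sg t U) - Phi (sg t0 U))) \<longlongrightarrow> Phi (A (sg t0 U))) (at t0 within {0..})"
      unfolding sg_D(2)[OF U t0]
      by (rule Lim_transform_eventually) (auto simp: eventually_at_filter sg[OF UH] t0)
  qed
  show ?thesis unfolding strong_solution_def
  proof (intro conjI exI[of _ "\<lambda>t. A (sg t U)"])
    show "\<forall>t0\<ge>0. ((\<lambda>t. nrm (lin 1 (sg t U) (-1) (sg t0 U)) + nrm (lin 1 (A (sg t U)) (-1) (A (sg t0 U)))) \<longlongrightarrow> 0) (at t0 within {0..})"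
      using tendsto_add[OF c1 c2] by simp
    show "nrm (lin 1 (sg 0 U) (-1) U) = 0" using UH by (simp add: Phi_diff sg X.T_0)
  qed (use c2 q AU sg_D(1)[OF U] in \<open>auto simp: Phi_diff\<close>)
qed

lemma strong_solution_unique:
  assumes U0: "U0 \<in> H" and w: "strong_solution H nrm lin D A U0 U" and t: "t \<ge> 0"
  shows "nrm (lin 1 (U t) (-1) (sg t U0)) = 0"
proof -
  obtain U' where UD: "\<forall>t\<ge>0. U t \<in> D" and U': "\<forall>t\<ge>0. U' t \<in> H"
    and q: "\<forall>t0\<ge>0. ((\<lambda>t. nrm (lin 1 (lin (of_real (1/(t - t0))) (U t) (of_real (-1/(t - t0))) (U t0)) (-1) (U' t0))) \<longlongrightarrow> 0) (at t0 within {0..})"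
    and e: "\<forall>t\<ge>0. nrm (lin 1 (U' t) (-1) (A (U t))) = 0" and i: "nrm (lin 1 (U 0) (-1) U0) = 0"
    using w unfolding strong_solution_def by (elim conjE exE) (rule that)
  note UD = UD[rule_format] and U' = U'[rule_format] and q = q[rule_format] and e = e[rule_format]
  have U: "\<And>t. t \<ge> 0 \<Longrightarrow> U t \<in> H" using UD D_in_H by blast
  have P': "Phi (U' s) = AX (Phi (U s))" if "s \<ge> 0" for s
    using e[OF that] U'[OF that] AH[OF UD[OF that]] by (simp add: Phi_diff AX_Phi UD that)
  have "Phi (U t) = X.T t (Phi (U 0))"
  proof (rule X.strong_unique[OF _ _ t])
    fix s :: real assume s: "s \<ge> 0"
    show "Phi (U s) \<in> Phi ` D" using UD[OF s] by blast
    show "((\<lambda>t. Phi (U t)) has_vector_derivative AX (Phi (U s))) (at s within {0..})"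
      unfolding has_vector_derivative_quotient P'[OF s, symmetric]
      by (rule iffD1[OF quotient_iff[of U, OF U U'[OF s] s] q[OF s]])
  qed
  moreover have "Phi (U 0) = Phi U0" using i U[of 0] U0 by (simp add: Phi_diff)
  ultimately show ?thesis using U[OF t] U0 t by (simp add: Phi_diff sg)
qed

end

section \<open>Square integrable functions as a real Hilbert space\<close>

definition sqint :: "('a::euclidean_space \<Rightarrow> complex) \<Rightarrow> bool" where
  "sqint f \<longleftrightarrow> f \<in> borel_measurable lebesgue \<and> integrable lebesgue (\<lambda>x. (cmod (f x))\<^sup>2)"

lemma sqint_measurable: "sqint f \<Longrightarrow> f \<in> borel_measurable lebesgue"
  by (simp add: sqint_def)

lemma sqint_integrable: "sqint f \<Longrightarrow> integrable lebesgue (\<lambda>x. (cmod (f x))\<^sup>2)"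
  by (simp add: sqint_def)

lemma sqint_bound:
  assumes "f \<in> borel_measurable lebesgue" "integrable lebesgue g" "AE x in lebesgue. (cmod (f x))\<^sup>2 \<le> g x"
  shows "sqint f"
  unfolding sqint_def
proof
  show "integrable lebesgue (\<lambda>x. (cmod (f x))\<^sup>2)"
    using assms by (intro Bochner_Integration.integrable_bound[OF assms(2)]) auto
qed fact

lemma sqint_zero [simp]: "sqint (\<lambda>x. 0)" by (simp add: sqint_def)

lemma cmod_add_sq: "(cmod (a + b))\<^sup>2 \<le> 2 * (cmod a)\<^sup>2 + 2 * (cmod b)\<^sup>2"
proof -
  have "(cmod (a + b))\<^sup>2 \<le> (cmod a + cmod b)\<^sup>2" by (intro power_mono norm_triangle_ineq) auto
  also have "\<dots> \<le> 2 * (cmod a)\<^sup>2 + 2 * (cmod b)\<^sup>2"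
    using zero_le_power2[of "cmod a - cmod b"] by (simp add: power2_eq_square algebra_simps)
  finally show ?thesis .
qed

lemma sqint_add: assumes "sqint f" "sqint g" shows "sqint (\<lambda>x. f x + g x)"
proof (rule sqint_bound)
  note [measurable] = assms[THEN sqint_measurable]
  show "(\<lambda>x. f x + g x) \<in> borel_measurable lebesgue" by measurable
  show "integrable lebesgue (\<lambda>x. 2 * (cmod (f x))\<^sup>2 + 2 * (cmod (g x))\<^sup>2)"
    using assms by (auto simp: sqint_def)
qed (simp add: cmod_add_sq)

lemma sqint_cmult: "sqint f \<Longrightarrow> sqint (\<lambda>x. c * f x)"
  by (auto simp: sqint_def norm_mult power_mult_distrib)

lemma sqint_scaleR: "sqint f \<Longrightarrow> sqint (\<lambda>x. c *\<^sub>R f x)"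
  by (auto simp: sqint_def power_mult_distrib)

lemma sqint_minus: "sqint f \<Longrightarrow> sqint (\<lambda>x. - f x)"
  by (auto simp: sqint_def)

lemma sqint_diff: "sqint f \<Longrightarrow> sqint g \<Longrightarrow> sqint (\<lambda>x. f x - g x)"
  using sqint_add[OF _ sqint_minus, of f g] by simp

lemma cmod_mult_le: "cmod (a * b) \<le> (cmod a)\<^sup>2 + (cmod b)\<^sup>2"
proof -
  have "2 * (cmod a * cmod b) \<le> (cmod a)\<^sup>2 + (cmod b)\<^sup>2" using sum_squares_bound[of "cmod a" "cmod b"] by simp
  moreover have "0 \<le> cmod a * cmod b" by simp
  ultimately show ?thesis unfolding norm_mult by linarith
qed

lemma sqint_mult_integrable: assumes "sqint f" "sqint g" shows "integrable lebesgue (\<lambda>x. f x * g x)"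
proof (rule Bochner_Integration.integrable_bound)
  note [measurable] = assms[THEN sqint_measurable]
  show "integrable lebesgue (\<lambda>x. (cmod (f x))\<^sup>2 + (cmod (g x))\<^sup>2)" using assms by (auto simp: sqint_def)
  show "(\<lambda>x. f x * g x) \<in> borel_measurable lebesgue" by measurable
qed (use cmod_mult_le in auto)

lemma sqint_cnj: "sqint f \<Longrightarrow> sqint (\<lambda>x. cnj (f x))"
  unfolding sqint_def by (auto intro!: borel_measurable_continuous_on[where f=cnj] continuous_intros)

lemma sqint_cong_AE:
  assumes "sqint f" "g \<in> borel_measurable lebesgue" "AE x in lebesgue. f x = g x" shows "sqint g"
  by (rule sqint_bound[OF assms(2) sqint_integrable[OF assms(1)]]) (use assms(3) in eventually_elim, simp)

definition l2rel :: "('a::euclidean_space \<Rightarrow> complex) \<Rightarrow> ('a \<Rightarrow> complex) \<Rightarrow> bool" where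
  "l2rel f g \<longleftrightarrow> sqint f \<and> sqint g \<and> (AE x in lebesgue. f x = g x)"

\<comment> \<open>A partial quotient, because only square integrable functions have a class. A type
  of its own gives access to the real Hilbert space theory above; complex scalars return later as
  the operators \<open>csc\<close>.\<close>
quotient_type (overloaded) 'a l2 = "'a::euclidean_space \<Rightarrow> complex" / partial: l2rel
proof (rule part_equivpI)
  show "\<exists>x. l2rel x x" by (rule exI[of _ "\<lambda>x. 0"]) (simp add: l2rel_def)
  show "symp l2rel" by (auto simp: symp_def l2rel_def eq_commute)
  show "transp l2rel" by (auto simp: transp_def l2rel_def elim: eventually_elim2)
qed

lemma inner_cong_AE:
  assumes "l2rel f f'" "l2rel g g'"
  shows "(LINT x|lebesgue. f x * cnj (g x)) = (LINT x|lebesgue. f' x * cnj (g' x))"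
proof -
  note s = assms[unfolded l2rel_def]
  have "sqint f" "sqint f'" "sqint (\<lambda>x. cnj (g x))" "sqint (\<lambda>x. cnj (g' x))" using s sqint_cnj by auto
  note [measurable] = this[THEN sqint_measurable]
  show ?thesis by (rule integral_cong_AE; (measurable)?) (use s in auto)
qed

instantiation l2 :: (euclidean_space) real_inner
begin

lift_definition zero_l2 :: "'a l2" is "\<lambda>x. 0" by (simp add: l2rel_def)
lift_definition plus_l2 :: "'a l2 \<Rightarrow> 'a l2 \<Rightarrow> 'a l2" is "\<lambda>f g x. f x + g x"
  by (auto simp: l2rel_def sqint_add)
lift_definition minus_l2 :: "'a l2 \<Rightarrow> 'a l2 \<Rightarrow> 'a l2" is "\<lambda>f g x. f x - g x"
  by (auto simp: l2rel_def sqint_diff)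
lift_definition uminus_l2 :: "'a l2 \<Rightarrow> 'a l2" is "\<lambda>f x. - f x"
  by (auto simp: l2rel_def sqint_minus)
lift_definition scaleR_l2 :: "real \<Rightarrow> 'a l2 \<Rightarrow> 'a l2" is "\<lambda>c f x. c *\<^sub>R f x"
  by (auto simp: l2rel_def sqint_scaleR)
lift_definition inner_l2 :: "'a l2 \<Rightarrow> 'a l2 \<Rightarrow> real" is "\<lambda>f g. Re (LINT x|lebesgue. f x * cnj (g x))"
  by (simp add: inner_cong_AE)
definition norm_l2 :: "'a l2 \<Rightarrow> real" where "norm_l2 x = sqrt (inner x x)"
definition dist_l2 :: "'a l2 \<Rightarrow> 'a l2 \<Rightarrow> real" where "dist_l2 x y = norm (x - y)"
definition sgn_l2 :: "'a l2 \<Rightarrow> 'a l2" where "sgn_l2 x = scaleR (inverse (norm x)) x"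
definition uniformity_l2 :: "('a l2 \<times> 'a l2) filter" where
  "uniformity_l2 = (INF e\<in>{0 <..}. principal {(x, y). dist x y < e})"
definition open_l2 :: "'a l2 set \<Rightarrow> bool" where
  "open_l2 U = (\<forall>x\<in>U. eventually (\<lambda>(x', y). x' = x \<longrightarrow> y \<in> U) uniformity)"

instance
proof
  fix x y z :: "'a l2" and r s :: real
  show "dist x y = norm (x - y)" by (rule dist_l2_def)
  show "x + y + z = x + (y + z)" by transfer (auto simp: l2rel_def sqint_add add.assoc)
  show "x + y = y + x" by transfer (auto simp: l2rel_def sqint_add add.commute)
  show "0 + x = x" by transfer (auto simp: l2rel_def)
  show "- x + x = 0" by transfer (auto simp: l2rel_def)
  show "x - y = x + - y" by transfer (auto simp: l2rel_def sqint_diff)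
  show "r *\<^sub>R (x + y) = r *\<^sub>R x + r *\<^sub>R y"
    by transfer (use sqint_add sqint_scaleR in \<open>auto simp: l2rel_def scaleR_right_distrib\<close>)
  show "(r + s) *\<^sub>R x = r *\<^sub>R x + s *\<^sub>R x"
    by transfer (use sqint_add sqint_scaleR in \<open>auto simp: l2rel_def scaleR_left_distrib\<close>)
  show "r *\<^sub>R s *\<^sub>R x = (r * s) *\<^sub>R x"
    by transfer (use sqint_scaleR in \<open>auto simp: l2rel_def\<close>)
  show "1 *\<^sub>R x = x" by transfer (auto simp: l2rel_def)
  show "sgn x = scaleR (inverse (norm x)) x" by (rule sgn_l2_def)
  show "(uniformity :: ('a l2 \<times> 'a l2) filter) = (INF e\<in>{0 <..}. principal {(x, y). dist x y < e})"
    by (rule uniformity_l2_def)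
  show "open U = (\<forall>x\<in>U. eventually (\<lambda>(x', y). x' = x \<longrightarrow> y \<in> U) uniformity)" for U :: "'a l2 set"
    by (rule open_l2_def)
  show "inner x y = inner y x"
  proof transfer
    fix f g :: "'a \<Rightarrow> complex" assume "l2rel f f" "l2rel g g"
    have "(LINT x|lebesgue. g x * cnj (f x)) = (LINT x|lebesgue. cnj (f x * cnj (g x)))" by (simp add: mult.commute)
    also have "\<dots> = cnj (LINT x|lebesgue. f x * cnj (g x))" by (rule Bochner_Integration.integral_cnj)
    finally show "Re (LINT x|lebesgue. f x * cnj (g x)) = Re (LINT x|lebesgue. g x * cnj (f x))" by simp
  qed
  show "inner (x + y) z = inner x z + inner y z"
    by transfer (simp add: l2rel_def distrib_right Bochner_Integration.integral_add sqint_mult_integrable sqint_cnj)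
  show "inner (r *\<^sub>R x) y = r * inner x y"
    by transfer simp
  have inn: "Re (LINT x|lebesgue. f x * cnj (f x)) = (LINT x|lebesgue. (cmod (f x))\<^sup>2)" for f :: "'a \<Rightarrow> complex"
  proof -
    have "(LINT x|lebesgue. f x * cnj (f x)) = (LINT x|lebesgue. complex_of_real ((cmod (f x))\<^sup>2))"
      by (simp add: complex_mult_cnj cmod_power2)
    then show ?thesis by (simp only: integral_complex_of_real Re_complex_of_real)
  qed
  show "0 \<le> inner x x" by transfer (simp add: inn)
  show "(inner x x = 0) = (x = 0)"
  proof transfer
    fix f :: "'a \<Rightarrow> complex" assume "l2rel f f"
    then have f: "sqint f" by (simp add: l2rel_def)
    show "(Re (LINT x|lebesgue. f x * cnj (f x)) = 0) = l2rel f (\<lambda>x. 0)"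
      unfolding inn l2rel_def using integral_nonneg_eq_0_iff_AE[OF sqint_integrable[OF f]] f by simp
  qed
  show "norm x = sqrt (inner x x)" by (rule norm_l2_def)
qed

end

section \<open>Classes of square integrable functions and complex scalars\<close>

definition cls :: "('a::euclidean_space \<Rightarrow> complex) \<Rightarrow> 'a l2" where "cls = abs_l2"

lemma cls_eq_iff: "sqint f \<Longrightarrow> sqint g \<Longrightarrow> cls f = cls g \<longleftrightarrow> (AE x in lebesgue. f x = g x)"
  unfolding cls_def using Quotient3_rel[OF Quotient3_l2, of f g] by (simp add: l2rel_def)

lemma cls_cong_AE: "sqint f \<Longrightarrow> g \<in> borel_measurable lebesgue \<Longrightarrow> AE x in lebesgue. f x = g x \<Longrightarrow> cls f = cls g"
  using cls_eq_iff sqint_cong_AE by blast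

lemma cls_ex: obtains f where "sqint f" "x = cls f"
proof
  show "sqint (rep_l2 x)" using Quotient3_rep_reflp[OF Quotient3_l2, of x] by (simp add: l2rel_def)
  show "x = cls (rep_l2 x)" unfolding cls_def using Quotient3_abs_rep[OF Quotient3_l2, of x] by simp
qed

lemma cls_add: "sqint f \<Longrightarrow> sqint g \<Longrightarrow> cls (\<lambda>x. f x + g x) = cls f + cls g"
  unfolding cls_def by (simp add: plus_l2.abs_eq eq_onp_def l2rel_def)

lemma cls_diff: "sqint f \<Longrightarrow> sqint g \<Longrightarrow> cls (\<lambda>x. f x - g x) = cls f - cls g"
  unfolding cls_def by (simp add: minus_l2.abs_eq eq_onp_def l2rel_def)

lemma cls_scaleR: "sqint f \<Longrightarrow> cls (\<lambda>x. c *\<^sub>R f x) = c *\<^sub>R cls f"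
  unfolding cls_def by (simp add: scaleR_l2.abs_eq eq_onp_def l2rel_def)

lemma cls_zero: "cls (\<lambda>x. 0) = 0"
  unfolding cls_def by (simp add: zero_l2_def)

lemma inner_cls: "sqint f \<Longrightarrow> sqint g \<Longrightarrow> inner (cls f) (cls g) = Re (LINT x|lebesgue. f x * cnj (g x))"
  unfolding cls_def by (simp add: inner_l2.abs_eq eq_onp_def l2rel_def)

lemma norm_cls: "sqint f \<Longrightarrow> (norm (cls f))\<^sup>2 = (LINT x|lebesgue. (cmod (f x))\<^sup>2)"
proof -
  assume f: "sqint f"
  have "(LINT x|lebesgue. f x * cnj (f x)) = (LINT x|lebesgue. complex_of_real ((cmod (f x))\<^sup>2))"
    by (simp add: complex_mult_cnj cmod_power2)
  then show ?thesis unfolding power2_norm_eq_inner inner_cls[OF f f]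
    by (simp only: integral_complex_of_real Re_complex_of_real)
qed

lift_definition csc :: "complex \<Rightarrow> 'a::euclidean_space l2 \<Rightarrow> 'a l2" is "\<lambda>c f x. c * f x"
  by (auto simp: l2rel_def sqint_cmult)

lemma csc_cls: "sqint f \<Longrightarrow> csc c (cls f) = cls (\<lambda>x. c * f x)"
  unfolding cls_def by (simp add: csc.abs_eq eq_onp_def l2rel_def)

lemma bounded_linear_csc: "bounded_linear (csc c)"
proof (rule bounded_linear_intro[where K="cmod c"])
  show "csc c (x + y) = csc c x + csc c y" for x y :: "'a l2"
    by transfer (use sqint_add sqint_cmult in \<open>auto simp: l2rel_def distrib_left\<close>)
  show "csc c (r *\<^sub>R x) = r *\<^sub>R csc c x" for r and x :: "'a l2"
    by transfer (use sqint_scaleR sqint_cmult in \<open>auto simp: l2rel_def\<close>)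
  show "norm (csc c x) \<le> norm x * cmod c" for x :: "'a l2"
  proof -
    obtain f where f: "sqint f" "x = cls f" by (rule cls_ex)
    have "(norm (csc c x))\<^sup>2 = (norm x * cmod c)\<^sup>2"
      unfolding f(2) csc_cls[OF f(1)] norm_cls[OF f(1)] norm_cls[OF sqint_cmult[OF f(1)]] power_mult_distrib
      by (simp add: norm_mult power_mult_distrib mult.commute)
    then have "norm (csc c x) = norm x * cmod c" by (rule power2_eq_imp_eq) simp_all
    then show ?thesis by simp
  qed
qed

text \<open>The pointwise half of Riesz-Fischer on a space of infinite measure. Squared increments
  decay like \<open>(1/4)^n\<close>, so they stay summable after weighting by \<open>2^n\<close>,
  and the weighted sum is finite almost everywhere; this controls the increments themselves.\<close>

lemma sqint_AE_limit:
  fixes f :: "nat \<Rightarrow> 'a::euclidean_space \<Rightarrow> complex"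
  assumes f: "\<And>n. sqint (f n)"
    and d: "\<And>n. (norm (cls (f (Suc n)) - cls (f n)))\<^sup>2 \<le> (1/4)^n"
  obtains g where "g \<in> borel_measurable lebesgue" "AE x in lebesgue. (\<lambda>n. f n x) \<longlonglongrightarrow> g x"
proof -
  note [measurable] = sqint_measurable[OF f]
  define a where "a = (\<lambda>n x. f (Suc n) x - f n x)"
  have sa: "sqint (a n)" for n unfolding a_def by (intro sqint_diff f)
  note [measurable] = sqint_measurable[OF sa]
  have int: "(LINT x|lebesgue. (cmod (a n x))\<^sup>2) \<le> (1/4)^n" for n
    using d[of n] norm_cls[OF sa[of n]] cls_diff[OF f[of "Suc n"] f[of n]] by (simp add: a_def)
  have nn: "(\<integral>\<^sup>+x. ennreal (2^n * (cmod (a n x))\<^sup>2) \<partial>lebesgue) \<le> ennreal ((1/2)^n)" for n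
  proof -
    have "(\<integral>\<^sup>+x. ennreal (2^n * (cmod (a n x))\<^sup>2) \<partial>lebesgue) = ennreal (LINT x|lebesgue. 2^n * (cmod (a n x))\<^sup>2)"
      by (intro nn_integral_eq_integral) (auto intro!: sqint_integrable sa)
    also have "\<dots> \<le> ennreal (2^n * (1/4)^n)" using int[of n] by (intro ennreal_leI) simp
    also have "2^n * (1/4)^n = ((1/2)^n :: real)" by (simp flip: power_mult_distrib)
    finally show ?thesis .
  qed
  have "(\<integral>\<^sup>+x. (\<Sum>n. ennreal (2^n * (cmod (a n x))\<^sup>2)) \<partial>lebesgue) = (\<Sum>n. \<integral>\<^sup>+x. ennreal (2^n * (cmod (a n x))\<^sup>2) \<partial>lebesgue)"
    by (rule nn_integral_suminf) measurable
  also have "\<dots> \<le> (\<Sum>n. ennreal ((1/2)^n))" by (intro suminf_le nn) auto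
  also have "\<dots> = ennreal (\<Sum>n. (1/2)^n)" by (intro suminf_ennreal2) (auto intro: summable_geometric)
  also have "\<dots> < \<infinity>" by simp
  finally have "(\<integral>\<^sup>+x. (\<Sum>n. ennreal (2^n * (cmod (a n x))\<^sup>2)) \<partial>lebesgue) \<noteq> \<infinity>" by simp
  then have ae: "AE x in lebesgue. (\<Sum>n. ennreal (2^n * (cmod (a n x))\<^sup>2)) \<noteq> \<infinity>"
    by (intro nn_integral_PInf_AE) measurable
  have conv: "convergent (\<lambda>n. f n x)" if "(\<Sum>n. ennreal (2^n * (cmod (a n x))\<^sup>2)) \<noteq> \<infinity>" for x
  proof -
    have s1: "summable (\<lambda>n. 2^n * (cmod (a n x))\<^sup>2)" using that by (intro summable_suminf_not_top) auto
    have "summable (\<lambda>n. a n x)"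
    proof (rule summable_norm_cancel, rule summable_comparison_test)
      show "summable (\<lambda>n. (1/2)^n + 2^n * (cmod (a n x))\<^sup>2)" by (intro summable_add s1 summable_geometric) simp
      show "\<exists>N. \<forall>n\<ge>N. norm (norm (a n x)) \<le> (1/2)^n + 2^n * (cmod (a n x))\<^sup>2"
      proof (intro exI allI impI)
        fix n :: nat
        define t where "t = (2::real)^n"
        have t: "t > 0" by (simp add: t_def)
        \<comment> \<open>The inequality of arithmetic and geometric means with weight
          \<open>t = 2^n\<close> bounds \<open>cmod (a n x)\<close> by two summable
          sequences.\<close>
        have "0 \<le> (1 - t * cmod (a n x))\<^sup>2 / t" using t by simp
        also have "\<dots> = 1/t + t * (cmod (a n x))\<^sup>2 - 2 * cmod (a n x)"
          using t by (simp add: power2_eq_square field_simps)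
        finally have "cmod (a n x) \<le> 1/t + t * (cmod (a n x))\<^sup>2"
          using norm_ge_zero[of "a n x"] by linarith
        then show "norm (norm (a n x)) \<le> (1/2)^n + 2^n * (cmod (a n x))\<^sup>2"
          by (simp add: t_def power_one_over)
      qed
    qed
    then have "convergent (\<lambda>N. \<Sum>n<N. a n x)" by (simp only: summable_iff_convergent)
    moreover have "(\<Sum>n<N. a n x) = f N x - f 0 x" for N unfolding a_def by (rule sum_lessThan_telescope)
    ultimately have "convergent (\<lambda>N. f N x - f 0 x)" by simp
    from convergent_add[OF this convergent_const[of "f 0 x"]] show ?thesis by simp
  qed
  show ?thesis
  proof
    show "(\<lambda>x. lim (\<lambda>n. f n x)) \<in> borel_measurable lebesgue" by measurable
    show "AE x in lebesgue. (\<lambda>n. f n x) \<longlonglongrightarrow> lim (\<lambda>n. f n x)"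
      using ae by eventually_elim (use conv convergent_LIMSEQ_iff in blast)
  qed
qed

text \<open>Completeness follows along a subsequence with geometrically small increments: it
  converges almost everywhere, and Fatou's lemma upgrades the pointwise limit to a limit in
  norm.\<close>

instance l2 :: (euclidean_space) banach
proof
  fix X :: "nat \<Rightarrow> 'a l2" assume X: "Cauchy X"
  have "\<forall>n. \<exists>N. \<forall>i\<ge>N. \<forall>j\<ge>N. norm (X i - X j) < (1/2)^n"
    by (intro allI CauchyD[OF X]) simp
  then obtain N where N: "\<And>n i j. i \<ge> N n \<Longrightarrow> j \<ge> N n \<Longrightarrow> norm (X i - X j) < (1/2)^n" by metis
  \<comment> \<open>The partial sums of \<open>N\<close> increase and dominate \<open>N n\<close>,
    which makes \<open>X (r n)\<close> a subsequence with increments below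
    \<open>(1/2)^n\<close>.\<close>
  define r where "r = (\<lambda>n. \<Sum>k\<le>n. N k)"
  have r: "r n \<ge> N n" "r (Suc n) \<ge> r n" for n by (auto simp: r_def member_le_sum)
  have rm: "r n \<le> r m" if "n \<le> m" for n m using lift_Suc_mono_le[of r, OF r(2) that] .
  have "\<forall>n. \<exists>f. sqint f \<and> X (r n) = cls f" by (metis cls_ex)
  then obtain f where f: "\<And>n. sqint (f n)" "\<And>n. X (r n) = cls (f n)" by metis
  have d: "(norm (cls (f (Suc n)) - cls (f n)))\<^sup>2 \<le> (1/4)^n" for n
  proof -
    have "norm (X (r (Suc n)) - X (r n)) < (1/2)^n" using r[of n] by (intro N) auto
    then have "(norm (X (r (Suc n)) - X (r n)))\<^sup>2 \<le> ((1/2)^n)\<^sup>2" by (intro power_mono) auto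
    also have "((1/2)^n)\<^sup>2 = ((1/4)^n :: real)" by (simp only: power2_eq_square power_mult_distrib[symmetric]) simp
    finally show ?thesis by (simp add: f)
  qed
  obtain g where gm [measurable]: "g \<in> borel_measurable lebesgue" and lim: "AE x in lebesgue. (\<lambda>n. f n x) \<longlonglongrightarrow> g x"
    using sqint_AE_limit[OF f(1) d] by blast
  note [measurable] = sqint_measurable[OF f(1)]
  \<comment> \<open>Fatou in the index \<open>m\<close>, with \<open>n\<close> fixed: the Cauchy
    bound for \<open>f m - f n\<close> passes to the pointwise limit and also shows that
    \<open>g - f n\<close> is square integrable.\<close>
  have fat: "(\<integral>\<^sup>+x. ennreal ((cmod (g x - f n x))\<^sup>2) \<partial>lebesgue) \<le> ennreal (((1/2)^n)\<^sup>2)" for n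
  proof -
    have "(\<integral>\<^sup>+x. ennreal ((cmod (g x - f n x))\<^sup>2) \<partial>lebesgue) = (\<integral>\<^sup>+x. liminf (\<lambda>m. ennreal ((cmod (f m x - f n x))\<^sup>2)) \<partial>lebesgue)"
    proof (rule nn_integral_cong_AE, use lim in eventually_elim)
      fix x assume "(\<lambda>m. f m x) \<longlonglongrightarrow> g x"
      then have "(\<lambda>m. ennreal ((cmod (f m x - f n x))\<^sup>2)) \<longlonglongrightarrow> ennreal ((cmod (g x - f n x))\<^sup>2)"
        by (intro tendsto_intros)
      then show "ennreal ((cmod (g x - f n x))\<^sup>2) = liminf (\<lambda>m. ennreal ((cmod (f m x - f n x))\<^sup>2))"
        by (rule lim_imp_Liminf[OF sequentially_bot, symmetric])
    qed
    also have "\<dots> \<le> liminf (\<lambda>m. \<integral>\<^sup>+x. ennreal ((cmod (f m x - f n x))\<^sup>2) \<partial>lebesgue)"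
      by (rule nn_integral_liminf) measurable
    also have "\<dots> \<le> liminf (\<lambda>m::nat. ennreal (((1/2)^n)\<^sup>2))"
    proof (rule Liminf_mono, rule eventually_sequentiallyI[of n])
      fix m assume m: "n \<le> m"
      have "(\<integral>\<^sup>+x. ennreal ((cmod (f m x - f n x))\<^sup>2) \<partial>lebesgue) = ennreal (LINT x|lebesgue. (cmod (f m x - f n x))\<^sup>2)"
        by (intro nn_integral_eq_integral sqint_integrable sqint_diff f) auto
      also have "(LINT x|lebesgue. (cmod (f m x - f n x))\<^sup>2) = (norm (X (r m) - X (r n)))\<^sup>2"
        using norm_cls[OF sqint_diff[OF f(1)[of m] f(1)[of n]]] by (simp add: cls_diff f)
      also have "\<dots> \<le> ((1/2)^n)\<^sup>2" using r(1)[of n] rm[OF m] N[of n "r m" "r n"] by (intro power_mono) auto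
      finally show "(\<integral>\<^sup>+x. ennreal ((cmod (f m x - f n x))\<^sup>2) \<partial>lebesgue) \<le> ennreal (((1/2)^n)\<^sup>2)"
        by (simp add: ennreal_leI)
    qed
    also have "\<dots> = ennreal (((1/2)^n)\<^sup>2)" by (simp add: Liminf_const)
    finally show ?thesis .
  qed
  have gf: "sqint (\<lambda>x. g x - f n x)" for n
    unfolding sqint_def
  proof
    show "integrable lebesgue (\<lambda>x. (cmod (g x - f n x))\<^sup>2)"
      using fat[of n] by (intro integrableI_nonneg) (auto simp: le_less_trans)
  qed measurable
  then have g: "sqint g" using sqint_add[OF gf[of 0] f(1)[of 0]] by simp
  have lim2: "norm (cls g - X (r n)) \<le> (1/2)^n" for n
  proof -
    have "ennreal ((norm (cls g - X (r n)))\<^sup>2) = (\<integral>\<^sup>+x. ennreal ((cmod (g x - f n x))\<^sup>2) \<partial>lebesgue)"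
      unfolding f(2) cls_diff[OF g f(1), symmetric] norm_cls[OF gf]
      by (rule nn_integral_eq_integral[symmetric]) (auto intro: sqint_integrable gf)
    also have "\<dots> \<le> ennreal (((1/2)^n)\<^sup>2)" by (rule fat)
    finally have "(norm (cls g - X (r n)))\<^sup>2 \<le> ((1/2)^n)\<^sup>2" by (subst (asm) ennreal_le_iff) auto
    then show ?thesis by (rule power2_le_imp_le) simp
  qed
  have "X \<longlonglongrightarrow> cls g"
  proof (rule metric_LIMSEQ_I)
    fix e :: real assume "e > 0"
    then obtain n where n: "(1/2)^n < e/2" using real_arch_pow_inv[of "e/2" "1/2"] by auto
    have "dist (X i) (cls g) < e" if "i \<ge> N n" for i
    proof -
      have "norm (X i - X (r n)) < (1/2)^n" using that r(1) by (intro N) auto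
      then show ?thesis using lim2[of n] n dist_triangle[of "X i" "cls g" "X (r n)"]
        by (simp add: dist_norm norm_minus_commute)
    qed
    then show "\<exists>no. \<forall>i\<ge>no. dist (X i) (cls g) < e" by blast
  qed
  then show "convergent X" by (auto simp: convergent_def)
qed

section \<open>Primitives of integrable functions\<close>

lemma AE_lebesgue_iff: "(AE x in lebesgue. P x) \<longleftrightarrow> (AE x in lborel. P x)"
  by (rule AE_completion_iff)

text \<open>Fubini and parameter integrals are used on products of Borel measures, while function
  spaces live over the completed measure. This replacement is the bridge between the two.\<close>

lemma borel_version:
  fixes f :: "'a::euclidean_space \<Rightarrow> complex"
  assumes "f \<in> borel_measurable lebesgue"
  obtains f' where "f' \<in> borel_measurable borel" "AE x in lebesgue. f x = f' x"
proof -
  have "(\<lambda>x. Re (f x)) \<in> borel_measurable lebesgue" "(\<lambda>x. Im (f x)) \<in> borel_measurable lebesgue"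
    using assms by measurable
  from this[THEN completion_ex_borel_measurable_real] obtain r i where
    r: "r \<in> borel_measurable lborel" "AE x in lborel. Re (f x) = r x" and
    i: "i \<in> borel_measurable lborel" "AE x in lborel. Im (f x) = i x" by blast
  show ?thesis
  proof
    show "(\<lambda>x. Complex (r x) (i x)) \<in> borel_measurable borel"
      using r(1) i(1) by (simp add: borel_measurable_complex_iff)
    show "AE x in lebesgue. f x = Complex (r x) (i x)"
      unfolding AE_lebesgue_iff using r(2) i(2) by eventually_elim (simp add: complex_eq_iff)
  qed
qed

lemma measurable_lebesgueI:
  fixes f :: "'a::euclidean_space \<Rightarrow> complex"
  assumes "f \<in> borel_measurable borel" shows "f \<in> borel_measurable lebesgue"
  using measurable_completion[of f lborel borel] assms by simp

lemma measurable_cong_AE_lebesgue: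
  fixes f :: "'a::euclidean_space \<Rightarrow> complex"
  assumes "f \<in> borel_measurable lebesgue" "AE x in lebesgue. f x = g x"
  shows "g \<in> borel_measurable lebesgue"
proof (rule measurableI)
  fix A :: "complex set" assume A: "A \<in> sets borel"
  show "g -` A \<inter> space lebesgue \<in> sets lebesgue"
  proof (rule completion.in_sets_AE)
    show "AE x in lebesgue. (x \<in> f -` A \<inter> space lebesgue) = (x \<in> g -` A \<inter> space lebesgue)"
      using assms(2) by eventually_elim auto
    show "f -` A \<inter> space lebesgue \<in> sets lebesgue" using assms(1) A by (rule measurable_sets)
  qed auto
qed auto

lemma integrable_cong_AE_lebesgue:
  fixes f g :: "'a::euclidean_space \<Rightarrow> complex"
  assumes "integrable lebesgue f" "AE x in lebesgue. f x = g x" shows "integrable lebesgue g"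
  using assms measurable_cong_AE_lebesgue[OF borel_measurable_integrable[OF assms(1)] assms(2)]
  by (subst integrable_cong_AE[of g _ f]) (auto elim: eventually_mono)

text \<open>Completeness of the measure makes the two functions measurable together; if neither is,
  both integrals take the default value 0. No measurability has to be checked when it is
  applied.\<close>

lemma integral_cong_AE_lebesgue:
  fixes f g :: "'a::euclidean_space \<Rightarrow> complex"
  assumes "AE x in lebesgue. f x = g x"
  shows "integral\<^sup>L lebesgue f = integral\<^sup>L lebesgue g"
proof (cases "f \<in> borel_measurable lebesgue")
  case True then show ?thesis using assms measurable_cong_AE_lebesgue by (intro integral_cong_AE) auto
next
  case False
  have "AE x in lebesgue. g x = f x" using assms by (auto elim: eventually_mono)
  then have "g \<notin> borel_measurable lebesgue" using False measurable_cong_AE_lebesgue by blast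
  then show ?thesis using False by (metis borel_measurable_integrable not_integrable_integral_eq)
qed

text \<open>A primitive based at minus infinity. For a function extended by zero from an interval it
  is the primitive from the left end point, and beyond the right end point it is constantly the
  total integral, so boundary conditions become statements about integrals.\<close>

definition prim :: "(real \<Rightarrow> complex) \<Rightarrow> real \<Rightarrow> complex" where
  "prim f x = (LINT t|lebesgue. indicator {..<x} t *\<^sub>R f t)"

lemma prim_cong_AE: assumes "AE x in lebesgue. f x = g x" shows "prim f = prim g"
  unfolding prim_def fun_eq_iff
  by (intro allI integral_cong_AE_lebesgue) (use assms in \<open>auto elim: eventually_mono\<close>)

lemma integrable_indicator: "integrable lebesgue f \<Longrightarrow> integrable lebesgue (\<lambda>t. indicator {..<x::real} t *\<^sub>R (f t :: complex))"
  by (rule integrable_mult_indicator) auto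

lemma prim_lborel: "f \<in> borel_measurable borel \<Longrightarrow> prim f x = (LINT t|lborel. indicator {..<x} t *\<^sub>R f t)"
  unfolding prim_def by (rule integral_completion) simp

lemma prim_add: "integrable lebesgue f \<Longrightarrow> integrable lebesgue g \<Longrightarrow> prim (\<lambda>x. f x + g x) x = prim f x + prim g x"
  unfolding prim_def scaleR_add_right
  by (rule Bochner_Integration.integral_add) (auto intro: integrable_indicator)

lemma prim_diff: "integrable lebesgue f \<Longrightarrow> integrable lebesgue g \<Longrightarrow> prim (\<lambda>x. f x - g x) x = prim f x - prim g x"
  unfolding prim_def scaleR_diff_right
  by (rule Bochner_Integration.integral_diff) (auto intro: integrable_indicator)

lemma prim_cmult: "prim (\<lambda>x. c * f x) x = c * prim f x"
  unfolding prim_def mult_scaleR_right[symmetric] by (rule integral_mult_right_zero)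

lemma prim_minus: "prim (\<lambda>x. - f x) x = - prim f x"
  using prim_cmult[of "-1"] by simp

lemma prim_cnj: "prim (\<lambda>x. cnj (f x)) x = cnj (prim f x)"
  unfolding prim_def by (simp flip: Bochner_Integration.integral_cnj)

lemma prim_bound: assumes "integrable lebesgue f" shows "cmod (prim f x) \<le> (LINT t|lebesgue. cmod (f t))"
  unfolding prim_def
  using assms by (intro Bochner_Integration.integral_norm_bound_integral[OF integrable_indicator]) (auto split: split_indicator)

lemma prim_left: "(\<And>t. t < x \<Longrightarrow> f t = 0) \<Longrightarrow> prim f x = 0"
  unfolding prim_def by (subst Bochner_Integration.integral_cong[OF refl, of _ _ "\<lambda>t. 0"]) (auto split: split_indicator)

lemma prim_right: "(\<And>t. t \<ge> x \<Longrightarrow> f t = 0) \<Longrightarrow> prim f x = integral\<^sup>L lebesgue f"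
  unfolding prim_def by (intro Bochner_Integration.integral_cong refl) (auto split: split_indicator)

lemma prim_continuous: assumes f: "integrable lebesgue f" shows "continuous_on A (prim f)"
proof -
  have "isCont (prim f) x" for x
    unfolding continuous_at_sequentially o_def
  proof (intro allI impI)
    fix u :: "nat \<Rightarrow> real" assume u: "u \<longlonglongrightarrow> x"
    show "(\<lambda>n. prim f (u n)) \<longlonglongrightarrow> prim f x"
      unfolding prim_def
    proof (rule integral_dominated_convergence)
      show "integrable lebesgue (\<lambda>t. cmod (f t))" using f by simp
      show "AE t in lebesgue. (\<lambda>n. indicator {..<u n} t *\<^sub>R f t) \<longlonglongrightarrow> indicator {..<x} t *\<^sub>R f t"
        unfolding AE_lebesgue_iff using AE_lborel_singleton[of x]
      proof eventually_elim
        case (elim t)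
        have "\<forall>\<^sub>F n in sequentially. indicator {..<u n} t *\<^sub>R f t = indicator {..<x} t *\<^sub>R f t"
        proof (cases "t < x")
          case True
          then have "\<forall>\<^sub>F n in sequentially. t < u n" using order_tendstoD(1)[OF u] by blast
          then show ?thesis by eventually_elim (use True in \<open>auto split: split_indicator\<close>)
        next
          case False
          then have "\<forall>\<^sub>F n in sequentially. u n < t" using order_tendstoD(2)[OF u] elim by simp
          then show ?thesis by eventually_elim (use False in \<open>auto split: split_indicator\<close>)
        qed
        then show ?case by (rule tendsto_eventually)
      qed
    qed (auto intro!: borel_measurable_integrable integrable_indicator f split: split_indicator)
  qed
  then show ?thesis by (simp add: continuous_at_imp_continuous_on)
qed

lemma prim_measurable: "integrable lebesgue f \<Longrightarrow> prim f \<in> borel_measurable borel"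
  using prim_continuous[of f UNIV] borel_measurable_continuous_onI by blast

lemma bounded_mult_integrable:
  fixes f g :: "'a::euclidean_space \<Rightarrow> complex"
  assumes "f \<in> borel_measurable lebesgue" "\<And>x. cmod (f x) \<le> M" "integrable lebesgue g"
  shows "integrable lebesgue (\<lambda>x. f x * g x)"
proof (rule Bochner_Integration.integrable_bound)
  show "integrable lebesgue (\<lambda>x. M * cmod (g x))" using assms by simp
  show "(\<lambda>x. f x * g x) \<in> borel_measurable lebesgue"
    using assms by (intro borel_measurable_times) auto
  show "AE x in lebesgue. norm (f x * g x) \<le> norm (M * cmod (g x))"
  proof (rule AE_I2)
    fix x
    have "cmod (f x) * cmod (g x) \<le> M * cmod (g x)" using assms(2) by (intro mult_right_mono) auto
    then show "norm (f x * g x) \<le> norm (M * cmod (g x))" by (simp add: norm_mult)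
  qed
qed

lemma prim_mult_integrable:
  assumes "integrable lebesgue f" "integrable lebesgue g" shows "integrable lebesgue (\<lambda>x. prim f x * g x)"
  by (rule bounded_mult_integrable[OF measurable_lebesgueI[OF prim_measurable[OF assms(1)]] prim_bound[OF assms(1)] assms(2)])

text \<open>Fubini for the product of \<open>f\<close> and \<open>g\<close>: the two integrals on
  the left collect the half planes on either side of the diagonal, which is a null set. For a factor
  with zero integral no boundary term remains.\<close>

lemma prim_ibp:
  assumes f: "integrable lebesgue f" and g: "integrable lebesgue g"
  shows "(LINT x|lebesgue. prim f x * g x) + (LINT x|lebesgue. f x * prim g x)
    = integral\<^sup>L lebesgue f * integral\<^sup>L lebesgue g"
proof -
  obtain f' where f': "f' \<in> borel_measurable borel" "AE x in lebesgue. f x = f' x"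
    using borel_version[OF borel_measurable_integrable[OF f]] by blast
  obtain g' where g': "g' \<in> borel_measurable borel" "AE x in lebesgue. g x = g' x"
    using borel_version[OF borel_measurable_integrable[OF g]] by blast
  note [measurable] = f'(1) g'(1)
  have if': "integrable lborel f'" using integrable_cong_AE_lebesgue[OF f f'(2)] by (subst (asm) integrable_completion) auto
  have ig': "integrable lborel g'" using integrable_cong_AE_lebesgue[OF g g'(2)] by (subst (asm) integrable_completion) auto
  have pf: "prim f' = prim f" using prim_cong_AE[OF f'(2)] by simp
  have pg: "prim g' = prim g" using prim_cong_AE[OF g'(2)] by simp
  have pm[measurable]: "prim f \<in> borel_measurable borel" "prim g \<in> borel_measurable borel"
    using prim_measurable f g by auto
  have A: "(LINT x|lebesgue. prim f x * g x) = (LINT x|lborel. prim f x * g' x)"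
  proof -
    have "(LINT x|lebesgue. prim f x * g x) = (LINT x|lebesgue. prim f x * g' x)"
      by (rule integral_cong_AE_lebesgue) (use g'(2) in \<open>auto elim: eventually_mono\<close>)
    also have "\<dots> = (LINT x|lborel. prim f x * g' x)" by (rule integral_completion) measurable
    finally show ?thesis .
  qed
  have B: "(LINT x|lebesgue. f x * prim g x) = (LINT x|lborel. f' x * prim g x)"
  proof -
    have "(LINT x|lebesgue. f x * prim g x) = (LINT x|lebesgue. f' x * prim g x)"
      by (rule integral_cong_AE_lebesgue) (use f'(2) in \<open>auto elim: eventually_mono\<close>)
    also have "\<dots> = (LINT x|lborel. f' x * prim g x)" by (rule integral_completion) measurable
    finally show ?thesis .
  qed
  have C: "integral\<^sup>L lebesgue f = integral\<^sup>L lborel f'" "integral\<^sup>L lebesgue g = integral\<^sup>L lborel g'"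
    using integral_cong_AE_lebesgue[OF f'(2)] integral_cong_AE_lebesgue[OF g'(2)]
      integral_completion[of f' lborel] integral_completion[of g' lborel] f'(1) g'(1) by auto
  \<comment> \<open>The product restricted to \<open>t < x\<close>; its two iterated integrals give
    one term of the formula directly and the other by complement.\<close>
  define K where "K = (\<lambda>(t,x). indicator {t<..} x *\<^sub>R (g' x * f' t) :: complex)"
  have Km[measurable]: "K \<in> borel_measurable (lborel \<Otimes>\<^sub>M lborel)"
  proof -
    have "K = (\<lambda>p. (if fst p < snd p then g' (snd p) * f' (fst p) else 0))"
      by (auto simp: K_def fun_eq_iff split: split_indicator)
    also have "\<dots> \<in> borel_measurable (lborel \<Otimes>\<^sub>M lborel)" by measurable
    finally show ?thesis .
  qed
  have fg: "integrable (lborel \<Otimes>\<^sub>M lborel) (\<lambda>(t,x). g' x * f' t)"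
  proof (rule lborel_pair.Fubini_integrable)
    show "(\<lambda>(t,x). g' x * f' t) \<in> borel_measurable (lborel \<Otimes>\<^sub>M lborel)" by measurable
    show "integrable lborel (\<lambda>t. LINT x|lborel. norm (case (t, x) of (t, x) \<Rightarrow> g' x * f' t))"
      using if' by (simp add: norm_mult)
    show "AE t in lborel. integrable lborel (\<lambda>x. case (t, x) of (t, x) \<Rightarrow> g' x * f' t)" using ig' by simp
  qed
  have KI: "integrable (lborel \<Otimes>\<^sub>M lborel) K"
    by (rule Bochner_Integration.integrable_bound[OF fg Km]) (auto simp: K_def split: split_indicator)
  have 1: "(LINT t|lborel. f' t * (integral\<^sup>L lborel g' - prim g t)) = (LINT t|lborel. LINT x|lborel. K (t, x))"
  proof (intro Bochner_Integration.integral_cong refl)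
    fix t
    have "(LINT x|lborel. K (t, x)) = (LINT x|lborel. (g' x - indicator {..<t} x *\<^sub>R g' x) * f' t)"
    proof (rule integral_cong_AE)
      show "AE x in lborel. K (t, x) = (g' x - indicator {..<t} x *\<^sub>R g' x) * f' t"
        using AE_lborel_singleton[of t] by eventually_elim (auto simp: K_def split: split_indicator)
      show "(\<lambda>x. K (t, x)) \<in> borel_measurable lborel" unfolding K_def by simp
    qed measurable
    also have "\<dots> = (integral\<^sup>L lborel g' - (LINT x|lborel. indicator {..<t} x *\<^sub>R g' x)) * f' t"
      using ig' integrable_mult_indicator[OF _ ig', of "{..<t}"] by simp
    also have "(LINT x|lborel. indicator {..<t} x *\<^sub>R g' x) = prim g t"
      using prim_lborel[OF g'(1), of t] pg by simp
    finally show "f' t * (integral\<^sup>L lborel g' - prim g t) = (LINT x|lborel. K (t, x))" by (simp add: mult.commute)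
  qed
  have 2: "(LINT x|lborel. prim f x * g' x) = (LINT x|lborel. LINT t|lborel. K (t, x))"
  proof (intro Bochner_Integration.integral_cong refl)
    fix x
    have "(LINT t|lborel. K (t, x)) = (LINT t|lborel. g' x * (indicator {..<x} t *\<^sub>R f' t))"
      by (intro Bochner_Integration.integral_cong refl) (auto simp: K_def split: split_indicator)
    also have "\<dots> = g' x * prim f' x" by (simp only: prim_lborel[OF f'(1)] integral_mult_right_zero)
    finally show "prim f x * g' x = (LINT t|lborel. K (t, x))" by (simp add: pf mult.commute)
  qed
  have 3: "(LINT t|lborel. LINT x|lborel. K (t, x)) = (LINT x|lborel. LINT t|lborel. K (t, x))"
    using lborel_pair.Fubini_integral[of "\<lambda>t x. K (t, x)"] KI by (simp add: case_prod_unfold)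
  have ifg: "integrable lborel (\<lambda>t. f' t * prim g t)"
  proof -
    have "integrable lebesgue (\<lambda>t. prim g t * f' t)"
      by (rule prim_mult_integrable[OF g integrable_cong_AE_lebesgue[OF f f'(2)]])
    then show ?thesis by (subst (asm) integrable_completion) (auto simp: mult.commute)
  qed
  have "(LINT t|lborel. f' t * (integral\<^sup>L lborel g' - prim g t)) =
    (LINT t|lborel. f' t * integral\<^sup>L lborel g') - (LINT t|lborel. f' t * prim g t)"
    unfolding right_diff_distrib using if' ifg by (intro Bochner_Integration.integral_diff) auto
  also have "(LINT t|lborel. f' t * integral\<^sup>L lborel g') = integral\<^sup>L lborel f' * integral\<^sup>L lborel g'" by simp
  finally show ?thesis using 1 2 3 unfolding A B C by simp
qed

text \<open>Half lines form a generator of the Borel sets that is stable under intersection, so the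
  integral vanishes over every Borel set by the induction over disjoint families; the total integral
  is what the complement step uses.\<close>

lemma AE_zero_if_prim_zero:
  assumes f: "integrable lebesgue f" and p: "\<And>x. prim f x = 0" and t: "integral\<^sup>L lebesgue f = 0"
  shows "AE x in lebesgue. f x = 0"
proof -
  obtain f' where f': "f' \<in> borel_measurable borel" "AE x in lebesgue. f x = f' x"
    using borel_version[OF borel_measurable_integrable[OF f]] by blast
  note [measurable] = f'(1)
  have if': "integrable lborel f'" using integrable_cong_AE_lebesgue[OF f f'(2)] by (subst (asm) integrable_completion) auto
  have t': "integral\<^sup>L lborel f' = 0"
    using integral_cong_AE_lebesgue[OF f'(2)] integral_completion[of f' lborel] t by auto
  have si: "set_integrable lborel A f'" if "A \<in> sets lborel" for A
    unfolding set_integrable_def using that if' by (rule integrable_mult_indicator)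
  have Int_stable_lessThan: "Int_stable (range (lessThan :: real \<Rightarrow> real set))"
  proof -
    have "{..<a} \<inter> {..<b} = {..<min a b}" for a b :: real by auto
    then show ?thesis unfolding Int_stable_def by (auto simp del: lessThan_Int_lessThan intro: rangeI)
  qed
  have subset_Pow: "range (lessThan :: real \<Rightarrow> real set) \<subseteq> Pow UNIV" by simp
  have "set_lebesgue_integral lborel A f' = 0" if "A \<in> sigma_sets UNIV (range lessThan)" for A
    using Int_stable_lessThan subset_Pow that
  proof (induction rule: sigma_sets_induct_disjoint)
    case (basic A)
    then obtain x where "A = {..<x}" by auto
    then show ?case using p[of x] prim_cong_AE[OF f'(2)] prim_lborel[OF f'(1), of x]
      by (simp add: set_lebesgue_integral_def)
  next
    case (compl A)
    then have A: "A \<in> sets lborel" by (simp add: borel_Iio)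
    have "set_lebesgue_integral lborel (UNIV - A) f' = (LINT x|lborel. f' x - indicator A x *\<^sub>R f' x)"
      unfolding set_lebesgue_integral_def
      by (intro Bochner_Integration.integral_cong refl) (auto split: split_indicator)
    also have "\<dots> = integral\<^sup>L lborel f' - set_lebesgue_integral lborel A f'"
      unfolding set_lebesgue_integral_def
      using if' si[OF A] by (intro Bochner_Integration.integral_diff) (auto simp: set_integrable_def)
    finally show ?case using compl t' by simp
  next
    case (union A)
    then have A: "A i \<in> sets lborel" for i by (auto simp: borel_Iio)
    have "set_lebesgue_integral lborel (\<Union>i. A i) f' = (\<Sum>i. set_lebesgue_integral lborel (A i) f')"
      using union(1) A by (intro lebesgue_integral_countable_add si) (auto simp: disjoint_family_on_def)
    then show ?case using union by simp
  qed (simp add: set_lebesgue_integral_def)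
  then have "AE x in lborel. f' x = 0"
    by (intro sigma_finite_measure.density_zero[OF sigma_finite_lborel if']) (simp add: borel_Iio)
  then show ?thesis using f'(2) unfolding AE_lebesgue_iff by eventually_elim simp
qed

section \<open>Smooth cut-off functions\<close>

definition smooth :: "(real \<Rightarrow> real) \<Rightarrow> bool" where
  "smooth f \<longleftrightarrow> (\<forall>n x. ((deriv ^^ n) f) differentiable (at x))"

text \<open>Higher derivatives need no closed formula: it is enough to exhibit a class of
  differentiable functions that contains \<open>f\<close> and is stable under
  \<open>deriv\<close>.\<close>

lemma smooth_coinduct:
  assumes "f \<in> F" and "\<And>g x. g \<in> F \<Longrightarrow> g differentiable (at x)" and "\<And>g. g \<in> F \<Longrightarrow> deriv g \<in> F"
  shows "smooth f"
proof -
  have "(deriv ^^ n) f \<in> F" for n using assms(1,3) by (induction n) auto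
  then show ?thesis using assms(2) by (auto simp: smooth_def)
qed

lemma smooth_differentiable: "smooth f \<Longrightarrow> f differentiable (at x)"
  unfolding smooth_def by (metis funpow_0)

lemma smooth_deriv: "smooth f \<Longrightarrow> smooth (deriv f)"
  unfolding smooth_def by (metis funpow_Suc_right o_apply)

lemma smooth_DERIV: "smooth f \<Longrightarrow> (f has_real_derivative deriv f x) (at x)"
  using smooth_differentiable DERIV_deriv_iff_real_differentiable by blast

lemma smooth_continuous: "smooth f \<Longrightarrow> continuous_on A f"
  using smooth_DERIV DERIV_isCont continuous_at_imp_continuous_on by blast

lemma smooth_antiderivative:
  assumes "\<And>x. (F has_real_derivative f x) (at x)" "smooth f" shows "smooth F"
proof (rule smooth_coinduct[of _ "insert F {g. smooth g}"])
  have "deriv F = f" using assms(1) by (auto simp: fun_eq_iff intro: DERIV_imp_deriv)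
  then show "deriv g \<in> insert F {g. smooth g}" if "g \<in> insert F {g. smooth g}" for g
    using that assms(2) smooth_deriv by auto
  show "g differentiable at x" if "g \<in> insert F {g. smooth g}" for g x
    using that assms(1) smooth_differentiable real_differentiable_def by blast
qed simp

lemma smooth_affine_combination:
  assumes "smooth g" "smooth h"
  shows "smooth (\<lambda>x. p * g (r * x + s) + q * h (k * x + l))"
proof (rule smooth_coinduct[of _ "{f. \<exists>g h p q. smooth g \<and> smooth h \<and> f = (\<lambda>x. p * g (r * x + s) + q * h (k * x + l))}"])
  fix f assume "f \<in> {f. \<exists>g h p q. smooth g \<and> smooth h \<and> f = (\<lambda>x. p * g (r * x + s) + q * h (k * x + l))}"
  then obtain g h p q where gh: "smooth g" "smooth h" and f: "f = (\<lambda>x. p * g (r * x + s) + q * h (k * x + l))" by blast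
  have D: "(f has_real_derivative (p * r) * deriv g (r * x + s) + (q * k) * deriv h (k * x + l)) (at x)" for x
    unfolding f
    by (auto intro!: derivative_eq_intros DERIV_chain2[OF smooth_DERIV[OF gh(1)]] DERIV_chain2[OF smooth_DERIV[OF gh(2)]])
  show "f differentiable at x" for x using D real_differentiable_def by blast
  have "deriv f = (\<lambda>x. (p * r) * deriv g (r * x + s) + (q * k) * deriv h (k * x + l))"
    using D by (auto simp: fun_eq_iff intro: DERIV_imp_deriv)
  then show "deriv f \<in> {f. \<exists>g h p q. smooth g \<and> smooth h \<and> f = (\<lambda>x. p * g (r * x + s) + q * h (k * x + l))}"
    using gh smooth_deriv by blast
qed (use assms in blast)

text \<open>The standard bump \<open>exp (- 1 / (x * (1 - x)))\<close> with a rational prefactor.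
  The prefactor makes the family stable under differentiation, as \<open>smooth_coinduct\<close>
  requires.\<close>

definition bump_poly :: "real poly \<Rightarrow> nat \<Rightarrow> real \<Rightarrow> real" where
  "bump_poly p k x = (if 0 < x \<and> x < 1 then poly p x / (x * (1 - x)) ^ k * exp (- 1 / (x * (1 - x))) else 0)"

lemma power_over_fact_le_exp:
  fixes y :: real assumes "y \<ge> 0" shows "y ^ n / fact n \<le> exp y"
proof -
  have s: "summable (\<lambda>n. y ^ n /\<^sub>R fact n)" by (rule summable_exp_generic)
  have "sum (\<lambda>n. y ^ n /\<^sub>R fact n) {n} \<le> (\<Sum>n. y ^ n /\<^sub>R fact n)"
    using assms by (intro sum_le_suminf[OF s]) auto
  then show ?thesis by (simp add: exp_def divide_inverse mult.commute)
qed

text \<open>One term of the exponential series gives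
  \<open>exp (- 1 / q) \<le> fact (k + 2) * q ^ (k + 2)\<close>. After division by
  \<open>q ^ k\<close> a factor \<open>q\<^sup>2\<close> is left, which is flat enough for a zero
  derivative at the end points.\<close>

lemma bump_poly_bound:
  obtains C where "C \<ge> 0" "\<And>x. x \<in> {0<..<1} \<Longrightarrow> \<bar>bump_poly p k x\<bar> \<le> C * (x * (1 - x))\<^sup>2"
proof -
  have "compact (poly p ` {0..1})" by (intro compact_continuous_image continuous_intros compact_Icc)
  then obtain M where M: "\<And>x. x \<in> {0..1} \<Longrightarrow> \<bar>poly p x\<bar> \<le> M"
    using compact_imp_bounded[THEN bounded_iff[THEN iffD1]] by (metis imageI real_norm_def)
  have M0: "M \<ge> 0" using M[of 0] by simp
  show ?thesis
  proof
    show "0 \<le> M * fact (k + 2)" using M0 by simp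
    fix x :: real assume x: "x \<in> {0<..<1}"
    define q where "q = x * (1 - x)"
    have q: "q > 0" using x by (simp add: q_def)
    have "(1 / q) ^ (k + 2) / fact (k + 2) \<le> exp (1 / q)" using q by (intro power_over_fact_le_exp) simp
    then have "inverse (exp (1 / q)) \<le> inverse ((1 / q) ^ (k + 2) / fact (k + 2))"
      using q by (intro le_imp_inverse_le) auto
    then have "exp (- (1 / q)) \<le> fact (k + 2) * q ^ (k + 2)"
      by (simp add: exp_minus power_one_over mult_ac)
    then have "exp (- 1 / q) / q ^ k \<le> fact (k + 2) * q\<^sup>2"
      using q by (simp add: divide_le_eq power_add power2_eq_square mult_ac)
    then have "\<bar>poly p x\<bar> * (exp (- 1 / q) / q ^ k) \<le> M * (fact (k + 2) * q\<^sup>2)"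
      using M[of x] x M0 q by (intro mult_mono) auto
    then show "\<bar>bump_poly p k x\<bar> \<le> M * fact (k + 2) * (x * (1 - x))\<^sup>2"
      using x q unfolding bump_poly_def q_def[symmetric] by (simp add: abs_mult mult_ac)
  qed
qed

text \<open>With \<open>q = x * (1 - x)\<close>, coded as \<open>[:0,1,-1:]\<close>, and its
  derivative \<open>[:1,-2:]\<close>, the three terms are those of the product rule for
  \<open>p\<close>, \<open>q ^ k\<close> and the exponential, brought to the common denominator
  \<open>q ^ (k + 2)\<close>.\<close>

lemma bump_poly_DERIV:
  "(bump_poly p k has_real_derivative
     bump_poly (pderiv p * [:0,1,-1:]^2 - smult (real k) (p * [:1,-2:] * [:0,1,-1:]) + p * [:1,-2:]) (k + 2) x) (at x)"
proof (cases "0 < x \<and> x < 1")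
  case True
  define q where "q = (\<lambda>x::real. x * (1 - x))"
  have q0: "q x > 0" using True by (simp add: q_def)
  have dq: "(q has_real_derivative 1 - 2 * x) (at x)"
    unfolding q_def by (auto intro!: derivative_eq_intros)
  have pq: "poly [:0,1,-1:] x = q x" "poly [:1,-2:] x = 1 - 2 * x" by (auto simp: q_def algebra_simps)
  have "((\<lambda>x. poly p x / q x ^ k * exp (- 1 / q x)) has_real_derivative
    (poly (pderiv p) x / q x ^ k - poly p x * (real k * q x ^ (k - 1) * (1 - 2 * x)) / (q x ^ k * q x ^ k)) * exp (- 1 / q x)
     + poly p x / q x ^ k * (exp (- 1 / q x) * ((1 - 2 * x) / (q x * q x)))) (at x)"
    using q0 by (auto intro!: derivative_eq_intros poly_DERIV dq simp: field_simps)
  moreover have "(poly (pderiv p) x / q x ^ k - poly p x * (real k * q x ^ (k - 1) * (1 - 2 * x)) / (q x ^ k * q x ^ k)) * exp (- 1 / q x)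
     + poly p x / q x ^ k * (exp (- 1 / q x) * ((1 - 2 * x) / (q x * q x)))
    = poly (pderiv p * [:0,1,-1:]^2 - smult (real k) (p * [:1,-2:] * [:0,1,-1:]) + p * [:1,-2:]) x / q x ^ (k + 2) * exp (- 1 / q x)"
  proof -
    have "real k * q x ^ (k - 1) * q x = real k * q x ^ k" by (cases k) auto
    then have e: "real k * q x ^ (k - 1) = real k * q x ^ k / q x" using q0 by (simp add: field_simps)
    show ?thesis unfolding e poly_add poly_diff poly_mult poly_smult poly_power pq
      using q0 by (simp add: field_simps power2_eq_square)
  qed
  ultimately have D: "((\<lambda>x. poly p x / q x ^ k * exp (- 1 / q x)) has_real_derivative
    bump_poly (pderiv p * [:0,1,-1:]^2 - smult (real k) (p * [:1,-2:] * [:0,1,-1:]) + p * [:1,-2:]) (k + 2) x) (at x)"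
    using True by (simp only: bump_poly_def q_def if_True simp_thms)
  show ?thesis
    by (rule has_field_derivative_transform_within_open[OF D, of "{0<..<1}"]) (use True in \<open>auto simp: bump_poly_def q_def\<close>)
next
  case False
  obtain C where C: "C \<ge> 0" "\<And>x. x \<in> {0<..<1} \<Longrightarrow> \<bar>bump_poly p k x\<bar> \<le> C * (x * (1 - x))\<^sup>2"
    using bump_poly_bound[of p k] by blast
  \<comment> \<open>One quadratic bound around \<open>x\<close> treats the end points 0 and 1 and
    the exterior points alike, since any \<open>x\<close> outside the open interval is at least as
    far from \<open>y\<close> as one of the end points.\<close>
  have b: "\<bar>bump_poly p k y\<bar> \<le> C * (y - x)\<^sup>2" for y
  proof (cases "y \<in> {0<..<1}")
    case True
    have "\<bar>bump_poly p k y\<bar> \<le> C * (y * (1 - y))\<^sup>2" by (rule C(2)[OF True])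
    also have "\<dots> \<le> C * (y - x)\<^sup>2"
    proof (intro mult_left_mono C(1))
      have "0 \<le> y * (1 - y)" using True by simp
      moreover have "y * (1 - y) \<le> y" "y * (1 - y) \<le> 1 - y"
        using True mult_left_mono[of "1 - y" 1 y] mult_right_mono[of y 1 "1 - y"] by auto
      moreover have "y \<le> \<bar>y - x\<bar> \<or> 1 - y \<le> \<bar>y - x\<bar>" using False by auto
      ultimately have "\<bar>y * (1 - y)\<bar> \<le> \<bar>y - x\<bar>" by linarith
      then show "(y * (1 - y))\<^sup>2 \<le> (y - x)\<^sup>2" by (simp only: abs_le_square_iff)
    qed
    finally show ?thesis .
  next
    case False
    then have "bump_poly p k y = 0" by (auto simp: bump_poly_def)
    then show ?thesis using C(1) by simp
  qed
  have x0: "bump_poly p' k' x = 0" for p' k' using False by (auto simp: bump_poly_def)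
  have "((\<lambda>y. (bump_poly p k y - bump_poly p k x) / (y - x)) \<longlongrightarrow> 0) (at x)"
  proof (rule Lim_null_comparison)
    show "\<forall>\<^sub>F y in at x. norm ((bump_poly p k y - bump_poly p k x) / (y - x)) \<le> C * \<bar>y - x\<bar>"
      unfolding eventually_at_filter
      using b by (intro always_eventually) (auto simp: x0 divide_le_eq power2_eq_square mult_ac)
    show "((\<lambda>y. C * \<bar>y - x\<bar>) \<longlongrightarrow> 0) (at x)" by (auto intro!: tendsto_eq_intros)
  qed
  then show ?thesis unfolding has_field_derivative_iff x0 .
qed

lemma smooth_bump_poly: "smooth (bump_poly p k)"
proof (rule smooth_coinduct[of _ "{bump_poly p k |p k. True}"])
  fix g assume "g \<in> {bump_poly p k |p k. True}"
  then obtain p k where g: "g = bump_poly p k" by blast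
  show "g differentiable at x" for x
    unfolding g using bump_poly_DERIV real_differentiable_def by blast
  have "deriv g = bump_poly (pderiv p * [:0,1,-1:]^2 - smult (real k) (p * [:1,-2:] * [:0,1,-1:]) + p * [:1,-2:]) (k + 2)"
    unfolding g using DERIV_imp_deriv[OF bump_poly_DERIV] by (intro ext)
  then show "deriv g \<in> {bump_poly p k |p k. True}" by blast
qed blast

lemma integral_from_zero_DERIV:
  fixes f :: "real \<Rightarrow> real"
  assumes c: "\<And>A. continuous_on A f" and z: "\<And>x. x \<le> 0 \<Longrightarrow> f x = 0"
  shows "((\<lambda>x. integral {0..x} f) has_real_derivative f x) (at x)"
proof -
  \<comment> \<open>For negative upper limit the interval from 0 is empty. As \<open>f\<close>
    vanishes to the left of 0, the base point can be moved left of both 0 and \<open>x\<close>,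
    which makes \<open>x\<close> interior.\<close>
  define m where "m = min 0 x - 1"
  have eq: "integral {0..y} f = integral {m..y} f" if "y > m" for y
  proof (cases "y \<ge> 0")
    case True
    have "integral {m..0} f + integral {0..y} f = integral {m..y} f"
      using True by (intro Henstock_Kurzweil_Integration.integral_combine integrable_continuous_real c) (auto simp: m_def)
    moreover have "integral {m..0} f = integral {m..0} (\<lambda>_. 0)" by (intro integral_cong) (auto simp: z)
    ultimately show ?thesis by simp
  next
    case False
    have "integral {m..y} f = integral {m..y} (\<lambda>_. 0)" using False by (intro integral_cong) (auto simp: z)
    then show ?thesis using False by simp
  qed
  have "((\<lambda>y. integral {m..y} f) has_real_derivative f x) (at x within {m..x+1})"
    unfolding has_real_derivative_iff_has_vector_derivative
    by (rule integral_has_vector_derivative[OF c]) (auto simp: m_def)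
  moreover have "at x within {m..x+1} = at x" by (rule at_within_interior) (auto simp: m_def)
  ultimately have "((\<lambda>y. integral {m..y} f) has_real_derivative f x) (at x)" by simp
  then show ?thesis
    by (rule has_field_derivative_transform_within_open[of _ _ _ "{m<..}"]) (use eq in \<open>auto simp: m_def\<close>)
qed

section \<open>Smooth ramps and steps obtained from the bump\<close>

definition bump :: "real \<Rightarrow> real" where "bump = bump_poly 1 0"
definition bump_mass :: real where "bump_mass = integral {0..1} bump"
definition ramp1 :: "real \<Rightarrow> real" where "ramp1 x = integral {0..x} bump / bump_mass"
definition ramp2 :: "real \<Rightarrow> real" where "ramp2 x = integral {0..x} ramp1"

lemma bump_nonneg: "bump x \<ge> 0" by (simp add: bump_def bump_poly_def)
lemma bump_zero: "x \<le> 0 \<or> x \<ge> 1 \<Longrightarrow> bump x = 0" by (auto simp: bump_def bump_poly_def)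
lemma bump_smooth: "smooth bump" by (simp add: bump_def smooth_bump_poly)

lemma bump_integrable: "bump integrable_on {c..d}"
  by (intro integrable_continuous_real smooth_continuous bump_smooth)

lemma bump_mass_pos: "bump_mass > 0"
proof -
  have "bump_mass \<ge> 0" unfolding bump_mass_def by (intro integral_nonneg bump_integrable bump_nonneg)
  moreover have "bump_mass \<noteq> 0"
  proof
    assume "bump_mass = 0"
    then have "\<forall>x\<in>{0..1}. bump x = 0"
      unfolding bump_mass_def
      using integral_eq_0_iff[of 0 1 bump] smooth_continuous[OF bump_smooth] bump_nonneg by auto
    then have "bump (1/2) = 0" by simp
    then show False by (simp add: bump_def bump_poly_def)
  qed
  ultimately show ?thesis by simp
qed

lemma ramp1_DERIV: "(ramp1 has_real_derivative bump x / bump_mass) (at x)"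
  unfolding ramp1_def
  by (intro DERIV_cdivide integral_from_zero_DERIV smooth_continuous bump_smooth bump_zero) simp

lemma ramp1_smooth: "smooth ramp1"
proof (rule smooth_antiderivative[OF ramp1_DERIV])
  show "smooth (\<lambda>x. bump x / bump_mass)"
    using smooth_affine_combination[OF bump_smooth bump_smooth, of "1/bump_mass" 1 0 0 1 0] by simp
qed

lemma ramp1_zero: "x \<le> 0 \<Longrightarrow> ramp1 x = 0"
  by (cases "x = 0") (auto simp: ramp1_def)

lemma ramp1_mono: "x \<le> y \<Longrightarrow> ramp1 x \<le> ramp1 y"
  by (rule DERIV_nonneg_imp_nondecreasing[of x y ramp1])
    (use ramp1_DERIV bump_nonneg bump_mass_pos in \<open>auto intro!: exI divide_nonneg_pos\<close>)

lemma ramp1_one: assumes "x \<ge> 1" shows "ramp1 x = 1"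
proof -
  have "integral {0..1} bump + integral {1..x} bump = integral {0..x} bump"
    using assms by (intro Henstock_Kurzweil_Integration.integral_combine bump_integrable) auto
  moreover have "integral {1..x} bump = integral {1..x} (\<lambda>_. 0)" by (intro integral_cong) (auto simp: bump_zero)
  ultimately show ?thesis using bump_mass_pos by (simp add: ramp1_def bump_mass_def)
qed

lemma ramp1_range: "0 \<le> ramp1 x" "ramp1 x \<le> 1"
proof -
  show "0 \<le> ramp1 x" using ramp1_mono[of 0 x] ramp1_zero[of x] ramp1_zero[of 0] by (cases "x \<ge> 0") auto
  show "ramp1 x \<le> 1" using ramp1_mono[of x 1] ramp1_one[of x] ramp1_one[of 1] by (cases "x \<ge> 1") auto
qed

lemma ramp2_DERIV: "(ramp2 has_real_derivative ramp1 x) (at x)"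
  unfolding ramp2_def by (intro integral_from_zero_DERIV smooth_continuous ramp1_smooth ramp1_zero)

lemma ramp2_smooth: "smooth ramp2"
  by (rule smooth_antiderivative[OF ramp2_DERIV ramp1_smooth])

lemma ramp2_zero: "x \<le> 0 \<Longrightarrow> ramp2 x = 0"
  by (cases "x = 0") (auto simp: ramp2_def)

lemma ramp2_linear: assumes "x \<ge> 1" shows "ramp2 x = x - 1 + ramp2 1"
proof -
  have "integral {0..1} ramp1 + integral {1..x} ramp1 = integral {0..x} ramp1"
    using assms by (intro Henstock_Kurzweil_Integration.integral_combine integrable_continuous_real smooth_continuous ramp1_smooth) auto
  moreover have "integral {1..x} ramp1 = integral {1..x} (\<lambda>_. 1)" by (intro integral_cong) (auto simp: ramp1_one)
  ultimately show ?thesis using assms by (simp add: ramp2_def)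
qed

text \<open>A smooth passage from 0 to 1 whose derivative approximates the normalized indicator of
  the interval from \<open>c\<close> to \<open>d\<close>. Both ramps have slope 1 once they are past
  their transition, so their difference becomes constant.\<close>

definition step_fun :: "nat \<Rightarrow> real \<Rightarrow> real \<Rightarrow> real \<Rightarrow> real" where
  "step_fun n c d x = (ramp2 (real n * (x - c)) - ramp2 (real n * (x - d))) / (real n * (d - c))"

lemma step_fun_smooth: "smooth (step_fun n c d)"
proof -
  have "step_fun n c d = (\<lambda>x. (1 / (real n * (d - c))) * ramp2 (real n * x + - real n * c) + (- 1 / (real n * (d - c))) * ramp2 (real n * x + - real n * d))"
    by (auto simp: step_fun_def fun_eq_iff right_diff_distrib diff_divide_distrib)
  then show ?thesis by (simp only: smooth_affine_combination[OF ramp2_smooth ramp2_smooth])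
qed

lemma step_fun_DERIV: assumes "n > 0"
  shows "(step_fun n c d has_real_derivative (ramp1 (real n * (x - c)) - ramp1 (real n * (x - d))) / (d - c)) (at x)"
proof -
  have 1: "((\<lambda>x. ramp2 (real n * (x - c))) has_real_derivative ramp1 (real n * (x - c)) * real n) (at x)" for c
    by (rule DERIV_chain2[OF ramp2_DERIV]) (auto intro!: derivative_eq_intros)
  have "(step_fun n c d has_real_derivative (ramp1 (real n * (x - c)) * real n - ramp1 (real n * (x - d)) * real n) / (real n * (d - c))) (at x)"
    unfolding step_fun_def by (intro DERIV_cdivide DERIV_diff 1)
  then show ?thesis using assms by (simp flip: left_diff_distrib)
qed

lemma step_fun_left: "x \<le> c \<Longrightarrow> c \<le> d \<Longrightarrow> step_fun n c d x = 0"
  by (simp add: step_fun_def ramp2_zero mult_nonneg_nonpos)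

lemma step_fun_right: assumes "n > 0" "c < d" "x \<ge> d + 1 / real n" shows "step_fun n c d x = 1"
proof -
  have "1 \<le> real n * (x - d)" using assms by (simp add: field_simps)
  moreover have "real n * (x - d) \<le> real n * (x - c)" using assms by (intro mult_left_mono) auto
  ultimately have "ramp2 (real n * (x - c)) - ramp2 (real n * (x - d)) = real n * (x - c) - real n * (x - d)"
    by (simp add: ramp2_linear[of "real n * (x - c)"] ramp2_linear[of "real n * (x - d)"])
  also have "\<dots> = real n * (d - c)" by (simp add: algebra_simps)
  finally show ?thesis using assms by (simp add: step_fun_def)
qed

text \<open>The exceptional null set in \<open>rho_deriv\<close> depends on the test function. Testing with countably many
  functions suffices for a common null set.\<close>
definition test_family :: "real \<Rightarrow> real \<Rightarrow> (real \<Rightarrow> real) set" where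
  "test_family a b = (\<lambda>(n, c, d, c', d') x. step_fun n c d x - step_fun n c' d' x) `
     {(n, c, d, c', d'). n > 0 \<and> {c, d, c', d'} \<subseteq> \<rat> \<and> a < c \<and> c < d \<and> d + 1 / real n < b \<and>
        a < c' \<and> c' < d' \<and> d' + 1 / real n < b}"

lemma countable_test_family: "countable (test_family a b)"
proof -
  have "{(n, c, d, c', d'). n > 0 \<and> {c, d, c', d'} \<subseteq> \<rat> \<and> a < c \<and> c < d \<and> d + 1 / real n < b \<and>
        a < c' \<and> c' < d' \<and> d' + 1 / real n < b} \<subseteq> UNIV \<times> \<rat> \<times> \<rat> \<times> \<rat> \<times> \<rat>" by auto
  then have "countable {(n, c, d, c', d'). n > 0 \<and> {c, d, c', d'} \<subseteq> \<rat> \<and> a < c \<and> c < d \<and> d + 1 / real n < b \<and>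
        a < c' \<and> c' < d' \<and> d' + 1 / real n < b}"
    by (rule countable_subset) (intro countable_SIGMA countableI_type countable_rat)
  then show ?thesis unfolding test_family_def by (rule countable_image)
qed

text \<open>Each step equals 1 exactly from \<open>d + 1 / real n\<close> on, so the difference of
  two steps vanishes again to the right and has compact support inside the interval.\<close>

lemma test_family_test_fun: assumes "phi \<in> test_family a b" shows "test_fun a b phi"
proof -
  obtain n c d c' d' where phi: "phi = (\<lambda>x. step_fun n c d x - step_fun n c' d' x)"
    and p: "n > 0" "a < c" "c < d" "d + 1 / real n < b" "a < c'" "c' < d'" "d' + 1 / real n < b"
    using assms by (auto simp: test_family_def)
  have "smooth phi" unfolding phi
    using smooth_affine_combination[OF step_fun_smooth step_fun_smooth, of 1 n c d 1 0 "-1" n c' d' 1 0] by simp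
  moreover have "phi x = 0" if "x \<notin> {min c c'..max (d + 1 / real n) (d' + 1 / real n)}" for x
    using that p step_fun_left[of x c d n] step_fun_left[of x c' d' n]
      step_fun_right[of n c d x] step_fun_right[of n c' d' x] unfolding phi by (auto simp: not_le)
  moreover have "c \<le> d + 1 / real n" using p by (intro add_increasing2) auto
  then have "a < min c c'" "min c c' \<le> max (d + 1 / real n) (d' + 1 / real n)" "max (d + 1 / real n) (d' + 1 / real n) < b"
    using p by (auto simp: min_le_iff_disj le_max_iff_disj)
  ultimately show ?thesis unfolding test_fun_def smooth_def by blast
qed

section \<open>Weak derivatives on an interval\<close>

definition zext :: "real \<Rightarrow> real \<Rightarrow> (real \<Rightarrow> complex) \<Rightarrow> real \<Rightarrow> complex" where
  "zext a b f x = indicator {a<..<b} x *\<^sub>R f x"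

abbreviation eqon :: "real \<Rightarrow> real \<Rightarrow> (real \<Rightarrow> complex) \<Rightarrow> (real \<Rightarrow> complex) \<Rightarrow> bool" where
  "eqon a b f g \<equiv> (AE x in lebesgue. x \<in> {a<..<b} \<longrightarrow> f x = g x)"

lemma zext_in [simp]: "x \<in> {a<..<b} \<Longrightarrow> zext a b f x = f x" and zext_out: "x \<notin> {a<..<b} \<Longrightarrow> zext a b f x = 0"
  by (auto simp: zext_def)

lemma zext_zext [simp]: "zext a b (zext a b f) = zext a b f"
  by (auto simp: zext_def fun_eq_iff split: split_indicator)

lemma zext_measurable: "f \<in> borel_measurable lebesgue \<Longrightarrow> zext a b f \<in> borel_measurable lebesgue"
  unfolding zext_def by (intro borel_measurable_scaleR borel_measurable_indicator) auto

lemma zext_add: "zext a b (\<lambda>x. f x + g x) = (\<lambda>x. zext a b f x + zext a b g x)"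
  by (auto simp: zext_def fun_eq_iff split: split_indicator)

lemma zext_diff: "zext a b (\<lambda>x. f x - g x) = (\<lambda>x. zext a b f x - zext a b g x)"
  by (auto simp: zext_def fun_eq_iff split: split_indicator)

lemma zext_mult: "zext a b (\<lambda>x. f x * g x) = (\<lambda>x. f x * zext a b g x)"
  by (auto simp: zext_def fun_eq_iff split: split_indicator)

lemma eqon_zext: "eqon a b f g \<longleftrightarrow> (AE x in lebesgue. zext a b f x = zext a b g x)"
proof
  assume "eqon a b f g"
  then show "AE x in lebesgue. zext a b f x = zext a b g x"
    by eventually_elim (auto simp: zext_def split: split_indicator)
next
  assume "AE x in lebesgue. zext a b f x = zext a b g x"
  then show "eqon a b f g" by eventually_elim (auto simp: zext_def split: split_indicator_asm)
qed

lemma eqon_trans: "eqon a b f g \<Longrightarrow> eqon a b g h \<Longrightarrow> eqon a b f h"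
  by (auto elim: eventually_elim2)

lemma eqon_sym: "eqon a b f g \<Longrightarrow> eqon a b g f"
  by (auto elim: eventually_mono)

lemma L2_iff: "L2 a b f \<longleftrightarrow> sqint (zext a b f)"
proof -
  have "(cmod (zext a b f x))\<^sup>2 = indicator {a<..<b} x *\<^sub>R (cmod (f x))\<^sup>2" for x
    by (auto simp: zext_def split: split_indicator)
  then show ?thesis
    unfolding L2_def sqint_def set_borel_measurable_def set_integrable_def zext_def by simp
qed

lemma L2_cong: "L2 a b f \<Longrightarrow> eqon a b f g \<Longrightarrow> L2 a b g"
  unfolding L2_iff eqon_zext using measurable_cong_AE_lebesgue sqint_measurable sqint_cong_AE by metis

lemma sqint_zext: "sqint f \<Longrightarrow> sqint (zext a b f)"
proof (rule sqint_bound[OF _ sqint_integrable])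
  assume f: "sqint f"
  show "zext a b f \<in> borel_measurable lebesgue"
    by (intro zext_measurable sqint_measurable f)
qed (auto simp: zext_def split: split_indicator)

lemma L2_sqint: "sqint f \<Longrightarrow> L2 a b f" by (simp add: L2_iff sqint_zext)

lemma L2_bounded:
  assumes "zext a b f \<in> borel_measurable lebesgue" "\<And>x. x \<in> {a<..<b} \<Longrightarrow> cmod (f x) \<le> M"
  shows "L2 a b f"
  unfolding L2_iff
proof (rule sqint_bound[OF assms(1)])
  have "integrable lebesgue (indicator {a<..<b} :: real \<Rightarrow> real)"
  proof (rule integrable_real_indicator)
    show "emeasure lebesgue {a<..<b} < \<infinity>"
      by (cases "a \<le> b") (simp_all add: emeasure_lborel_Ioo)
  qed simp
  then show "integrable lebesgue (\<lambda>x. indicator {a<..<b} x * M\<^sup>2)" by simp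
  show "AE x in lebesgue. (cmod (zext a b f x))\<^sup>2 \<le> indicator {a<..<b} x * M\<^sup>2"
    using assms(2) by (intro AE_I2) (auto simp: zext_def intro!: power_mono split: split_indicator)
qed

lemma L2_const: "L2 a b (\<lambda>_. c)"
  by (rule L2_bounded[of _ _ _ "cmod c"]) (auto intro!: zext_measurable)

lemma L2_add: "L2 a b f \<Longrightarrow> L2 a b g \<Longrightarrow> L2 a b (\<lambda>x. f x + g x)"
  unfolding L2_iff zext_add by (rule sqint_add)

lemma L2_diff: "L2 a b f \<Longrightarrow> L2 a b g \<Longrightarrow> L2 a b (\<lambda>x. f x - g x)"
  unfolding L2_iff zext_diff by (rule sqint_diff)

lemma zext_cmult: "zext a b (\<lambda>x. c * f x) = (\<lambda>x. c * zext a b f x)"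
  by (auto simp: zext_def fun_eq_iff)

lemma L2_cmult: "L2 a b f \<Longrightarrow> L2 a b (\<lambda>x. c * f x)"
  unfolding L2_iff zext_cmult by (rule sqint_cmult)

lemma L2_integrable: assumes "L2 a b f" shows "integrable lebesgue (zext a b f)"
proof -
  have "zext a b f = (\<lambda>x. zext a b f x * zext a b (\<lambda>_. 1) x)"
    by (auto simp: zext_def fun_eq_iff split: split_indicator)
  moreover have "integrable lebesgue (\<lambda>x. zext a b f x * zext a b (\<lambda>_. 1) x)"
    using assms L2_const[of a b 1] unfolding L2_iff by (rule sqint_mult_integrable)
  ultimately show ?thesis by simp
qed

lemma sqint_supported_integrable:
  fixes a b :: real
  assumes "sqint f" "\<And>x. x \<notin> {a<..<b} \<Longrightarrow> f x = 0" shows "integrable lebesgue f"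
proof -
  have "zext a b f = f" using assms(2) by (auto simp: fun_eq_iff zext_def split: split_indicator)
  then show ?thesis using L2_integrable[OF L2_sqint[OF assms(1)], of a b] by simp
qed

lemma L2_prim: assumes "integrable lebesgue f" shows "L2 a b (prim f)"
  by (rule L2_bounded[OF zext_measurable[OF measurable_lebesgueI[OF prim_measurable[OF assms]]] prim_bound[OF assms]])

section \<open>Test functions and weak derivatives\<close>

lemma set_integral_zext:
  "(LINT x:{a<..<b}|lebesgue. h x * f x) = (LINT x|lebesgue. h x * zext a b f x)"
  by (simp add: set_lebesgue_integral_def zext_def)

lemma weak_deriv_iff: "weak_deriv a b f g \<longleftrightarrow> (\<forall>phi. test_fun a b phi \<longrightarrow>
    (LINT x|lebesgue. complex_of_real (deriv phi x) * zext a b f x) =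
    - (LINT x|lebesgue. complex_of_real (phi x) * zext a b g x))"
  unfolding weak_deriv_def set_integral_zext ..

lemma weak_deriv_cong:
  assumes "weak_deriv a b f g" "eqon a b f f'" "eqon a b g g'" shows "weak_deriv a b f' g'"
proof -
  have "(LINT x|lebesgue. h x * zext a b f' x) = (LINT x|lebesgue. h x * zext a b f x)"
    "(LINT x|lebesgue. h x * zext a b g' x) = (LINT x|lebesgue. h x * zext a b g x)" for h
    by (rule integral_cong_AE_lebesgue, use assms(2)[unfolded eqon_zext] assms(3)[unfolded eqon_zext] in eventually_elim, simp)+
  then show ?thesis using assms(1) unfolding weak_deriv_iff by simp
qed

text \<open>Describes a test function as the primitive of its own derivative, with zero total
  integral; integrating by parts against it is then the instance of \<open>prim_ibp\<close> without
  boundary term.\<close>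

lemma test_fun_prim:
  assumes t: "test_fun a b phi"
  defines "D \<equiv> (\<lambda>x. complex_of_real (deriv phi x))"
  shows "integrable lebesgue D" "prim D x = complex_of_real (phi x)" "integral\<^sup>L lebesgue D = 0"
    "x \<notin> {a<..<b} \<Longrightarrow> D x = 0"
proof -
  have sm: "smooth phi" using t by (simp add: test_fun_def smooth_def)
  obtain c d where cd: "a < c" "c \<le> d" "d < b" "\<And>x. x \<notin> {c..d} \<Longrightarrow> phi x = 0"
    using t unfolding test_fun_def by blast
  have D0: "D x = 0" if "x \<notin> {c..d}" for x
  proof -
    have "((\<lambda>_. 0) has_real_derivative 0) (at x)" by simp
    then have "(phi has_real_derivative 0) (at x)"
      by (rule has_field_derivative_transform_within_open[of _ _ _ "- {c..d}"])
        (use that cd in \<open>auto intro: open_Compl\<close>)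
    then show ?thesis by (simp add: D_def DERIV_imp_deriv)
  qed
  show "x \<notin> {a<..<b} \<Longrightarrow> D x = 0" using D0 cd by auto
  have Dc: "continuous_on A D" for A
    unfolding D_def by (intro continuous_intros smooth_continuous smooth_deriv sm)
  have Dm: "D \<in> borel_measurable borel" using borel_measurable_continuous_onI[OF Dc] .
  have der: "((\<lambda>x. complex_of_real (phi x)) has_vector_derivative D x) (at x within A)" for x A
    unfolding D_def
    by (intro has_vector_derivative_of_real) (use smooth_DERIV[OF sm] in \<open>auto simp: has_real_derivative_iff_has_vector_derivative intro: has_vector_derivative_at_within\<close>)
  have F: "has_bochner_integral lborel (\<lambda>x. indicator {l..u} x *\<^sub>R D x) (complex_of_real (phi u) - complex_of_real (phi l))"
    if "l \<le> u" for l u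
    by (rule has_bochner_integral_FTC_Icc[OF that der Dc])
  have "(\<lambda>x. indicator {c..d} x *\<^sub>R D x) = D" using D0 by (auto simp: fun_eq_iff split: split_indicator)
  then have "integrable lborel D" using F[OF cd(2)] by (auto simp: has_bochner_integral_iff)
  then show I: "integrable lebesgue D" using Dm by (simp add: integrable_completion)
  have P: "prim D x = complex_of_real (phi x)" for x
  proof -
    define l where "l = min c x - 1"
    have l: "l \<le> x" "l < c" by (auto simp: l_def)
    have "prim D x = (LINT t|lborel. indicator {..<x} t *\<^sub>R D t)" by (rule prim_lborel[OF Dm])
    also have "\<dots> = (LINT t|lborel. indicator {l..x} t *\<^sub>R D t)"
    proof (rule integral_cong_AE)
      show "AE t in lborel. indicator {..<x} t *\<^sub>R D t = indicator {l..x} t *\<^sub>R D t"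
        using AE_lborel_singleton[of x] by eventually_elim (use l D0 in \<open>auto split: split_indicator\<close>)
    qed (use Dm in measurable)
    also have "\<dots> = complex_of_real (phi x) - complex_of_real (phi l)"
      using F[OF l(1)] by (rule has_bochner_integral_integral_eq)
    also have "phi l = 0" using cd l by auto
    finally show ?thesis by simp
  qed
  then show "prim D x = complex_of_real (phi x)" .
  have "prim D (d + 1) = integral\<^sup>L lebesgue D" using D0 by (intro prim_right) auto
  then show "integral\<^sup>L lebesgue D = 0" using P[of "d + 1"] cd(4)[of "d + 1"] by simp
qed

lemma test_fun_ibp:
  assumes t: "test_fun a b phi" and G: "integrable lebesgue G"
  shows "(LINT x|lebesgue. complex_of_real (deriv phi x) * prim G x) = - (LINT x|lebesgue. complex_of_real (phi x) * G x)"
  using prim_ibp[OF test_fun_prim(1)[OF t] G] test_fun_prim(2,3)[OF t] by (simp add: add_eq_0_iff2)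

lemma weak_deriv_prim:
  assumes "integrable lebesgue (zext a b g)"
  shows "weak_deriv a b (\<lambda>x. k + prim (zext a b g) x) g"
  unfolding weak_deriv_iff
proof (intro allI impI)
  fix phi assume t: "test_fun a b phi"
  note D = test_fun_prim[OF t]
  let ?D = "\<lambda>x. complex_of_real (deriv phi x)"
  have "(LINT x|lebesgue. ?D x * zext a b (\<lambda>x. k + prim (zext a b g) x) x)
    = (LINT x|lebesgue. ?D x * k + ?D x * prim (zext a b g) x)"
    by (intro Bochner_Integration.integral_cong refl) (use D(4) in \<open>auto simp: zext_def distrib_left split: split_indicator\<close>)
  also have "\<dots> = (LINT x|lebesgue. ?D x * k) + (LINT x|lebesgue. ?D x * prim (zext a b g) x)"
    using D(1) prim_mult_integrable[OF assms D(1)] by (intro Bochner_Integration.integral_add) (auto simp: mult.commute)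
  also have "\<dots> = - (LINT x|lebesgue. complex_of_real (phi x) * zext a b g x)"
    using D(3) test_fun_ibp[OF t assms] by simp
  finally show "(LINT x|lebesgue. ?D x * zext a b (\<lambda>x. k + prim (zext a b g) x) x)
    = - (LINT x|lebesgue. complex_of_real (phi x) * zext a b g x)" .
qed

lemma ramp1_quotient_measurable:
  "(\<lambda>x. complex_of_real ((ramp1 (real n * (x - c)) - ramp1 (real n * (x - d))) / (d - c))) \<in> borel_measurable borel"
  unfolding divide_inverse
  by (intro borel_measurable_continuous_onI continuous_intros
      continuous_on_compose2[OF smooth_continuous[OF ramp1_smooth, of UNIV]]) auto

text \<open>Dominated convergence: the slopes of the steps are bounded by
  \<open>1 / (d - c)\<close>. The limiting interval is open at \<open>c\<close> and closed at
  \<open>d\<close> because \<open>ramp1\<close> is 0 at 0.\<close>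

lemma step_limit:
  assumes h: "integrable lebesgue h" and cd: "c < d"
  shows "(\<lambda>n. LINT x|lebesgue. complex_of_real ((ramp1 (real n * (x - c)) - ramp1 (real n * (x - d))) / (d - c)) * h x)
    \<longlonglongrightarrow> (LINT x|lebesgue. complex_of_real (indicator {c<..d} x / (d - c)) * h x)"
proof (rule integral_dominated_convergence)
  note [measurable] = ramp1_quotient_measurable
  have hm: "h \<in> borel_measurable lebesgue" using h by auto
  show "(\<lambda>x. complex_of_real ((ramp1 (real n * (x - c)) - ramp1 (real n * (x - d))) / (d - c)) * h x) \<in> borel_measurable lebesgue" for n
    by (intro borel_measurable_times hm measurable_lebesgueI) measurable
  show "(\<lambda>x. complex_of_real (indicator {c<..d} x / (d - c)) * h x) \<in> borel_measurable lebesgue"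
    by (intro borel_measurable_times hm measurable_lebesgueI) measurable
  show "integrable lebesgue (\<lambda>x. (1 / (d - c)) * cmod (h x))" using h by simp
  show "AE x in lebesgue. norm (complex_of_real ((ramp1 (real n * (x - c)) - ramp1 (real n * (x - d))) / (d - c)) * h x) \<le> (1 / (d - c)) * cmod (h x)" for n
  proof (rule AE_I2)
    fix x
    have "\<bar>ramp1 (real n * (x - c)) - ramp1 (real n * (x - d))\<bar> \<le> 1"
      using ramp1_range[of "real n * (x - c)"] ramp1_range[of "real n * (x - d)"] by linarith
    then have "\<bar>(ramp1 (real n * (x - c)) - ramp1 (real n * (x - d))) / (d - c)\<bar> \<le> 1 / (d - c)"
      using cd by (simp add: divide_right_mono)
    then have "\<bar>(ramp1 (real n * (x - c)) - ramp1 (real n * (x - d))) / (d - c)\<bar> * cmod (h x) \<le> (1 / (d - c)) * cmod (h x)"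
      by (rule mult_right_mono) simp
    then show "norm (complex_of_real ((ramp1 (real n * (x - c)) - ramp1 (real n * (x - d))) / (d - c)) * h x) \<le> (1 / (d - c)) * cmod (h x)"
      unfolding norm_mult norm_of_real .
  qed
  have lim: "(\<lambda>n. ramp1 (real n * (x - c))) \<longlonglongrightarrow> indicator {c<..} x" for x c
  proof (cases "x > c")
    case True
    obtain N where N: "1 / (x - c) < real N" using reals_Archimedean2 by blast
    have "ramp1 (real n * (x - c)) = 1" if "n \<ge> N" for n
    proof (rule ramp1_one)
      have "1 < real N * (x - c)" using N True by (simp add: field_simps)
      also have "\<dots> \<le> real n * (x - c)" using that True by (intro mult_right_mono) auto
      finally show "1 \<le> real n * (x - c)" by simp
    qed
    then have "\<forall>\<^sub>F n in sequentially. ramp1 (real n * (x - c)) = 1" by (auto simp: eventually_sequentially)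
    then show ?thesis using True by (simp add: tendsto_eventually)
  next
    case False
    then show ?thesis by (simp add: ramp1_zero mult_nonneg_nonpos)
  qed
  show "AE x in lebesgue. (\<lambda>n. complex_of_real ((ramp1 (real n * (x - c)) - ramp1 (real n * (x - d))) / (d - c)) * h x)
      \<longlonglongrightarrow> complex_of_real (indicator {c<..d} x / (d - c)) * h x"
  proof (rule AE_I2)
    fix x
    have "(\<lambda>n. complex_of_real ((ramp1 (real n * (x - c)) - ramp1 (real n * (x - d))) / (d - c)) * h x)
      \<longlonglongrightarrow> complex_of_real ((indicator {c<..} x - indicator {d<..} x) / (d - c)) * h x"
      using cd by (intro tendsto_intros lim) auto
    moreover have "indicator {c<..} x - indicator {d<..} x = (indicator {c<..d} x :: real)"
      using cd by (auto split: split_indicator)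
    ultimately show "(\<lambda>n. complex_of_real ((ramp1 (real n * (x - c)) - ramp1 (real n * (x - d))) / (d - c)) * h x)
      \<longlonglongrightarrow> complex_of_real (indicator {c<..d} x / (d - c)) * h x" by simp
  qed
qed

text \<open>Continuity spreads the equality of values of \<open>prim k\<close> from the rationals to
  \<open>[a, b]\<close>, where its value at \<open>a\<close> is 0; outside, the support of
  \<open>k\<close> keeps it constant. The rational form matches what a countable set of test
  functions can detect.\<close>

lemma AE_zero_if_rational_increments_zero:
  assumes k: "integrable lebesgue k" and ab: "a < b" and out: "\<And>x. x \<notin> {a<..<b} \<Longrightarrow> k x = 0"
    and z: "\<And>c d. c \<in> \<rat> \<Longrightarrow> d \<in> \<rat> \<Longrightarrow> a < c \<Longrightarrow> c < d \<Longrightarrow> d < b \<Longrightarrow> prim k c = prim k d"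
  shows "AE x in lebesgue. k x = 0"
proof -
  obtain q where q: "q \<in> \<rat>" "a < q" "q < b" using Rats_dense_in_real[OF ab] by blast
  have zq: "prim k c = prim k q" if "c \<in> \<rat>" "a < c" "c < b" for c
  proof (cases c q rule: linorder_cases)
    case less show ?thesis by (rule z[OF that(1) q(1) that(2) less q(3)])
  next
    case greater show ?thesis by (rule z[OF q(1) that(1) q(2) greater that(3), symmetric])
  qed simp
  have c: "continuous_on UNIV (prim k)" by (rule prim_continuous[OF k])
  have near: "prim k x = prim k q" if x: "x \<in> {a..b}" for x
  proof (rule ccontr)
    assume ne: "prim k x \<noteq> prim k q"
    then obtain e where e: "e > 0" "\<And>y. \<bar>y - x\<bar> < e \<Longrightarrow> dist (prim k y) (prim k x) < dist (prim k x) (prim k q)"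
      using c unfolding continuous_on_iff dist_real_def by (metis UNIV_I zero_less_dist_iff)
    have "max a (x - e) < min b (x + e)" using ab x e(1) by auto
    then obtain y where "y \<in> \<rat>" "max a (x - e) < y" "y < min b (x + e)" using Rats_dense_in_real by blast
    then have "prim k y = prim k q" "\<bar>y - x\<bar> < e" using zq by auto
    then show False using e(2)[of y] by (simp add: dist_commute)
  qed
  have a0: "prim k a = 0" using out by (intro prim_left) auto
  then have q0: "prim k q = 0" using near[of a] ab by simp
  have all: "prim k x = 0" for x
  proof (cases "x \<in> {a..b}")
    case True then show ?thesis using near q0 by simp
  next
    case False
    show ?thesis
    proof (cases "x < a")
      case True then show ?thesis using out by (intro prim_left) auto
    next
      case F: False
      then have "prim k x = prim k b"
        using False out prim_right[of b k] prim_right[of x k] by auto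
      then show ?thesis using near[of b] q0 ab by simp
    qed
  qed
  have "integral\<^sup>L lebesgue k = prim k b" using out by (intro prim_right[symmetric]) auto
  then show ?thesis using all by (intro AE_zero_if_prim_zero[OF k]) auto
qed

text \<open>The difference \<open>h\<close> of \<open>F\<close> and the primitive of
  \<open>G\<close> pairs to zero with the derivatives of the tests. These approximate differences of
  two normalized indicators, so all rational averages of \<open>h\<close> equal one constant, and
  \<open>h\<close> is that constant almost everywhere.\<close>

lemma du_bois_reymond:
  assumes ab: "a < b" and F: "integrable lebesgue F" and G: "integrable lebesgue G"
    and Fo: "\<And>x. x \<notin> {a<..<b} \<Longrightarrow> F x = 0"
    and w: "\<And>phi. phi \<in> test_family a b \<Longrightarrow>
      (LINT x|lebesgue. complex_of_real (deriv phi x) * F x) = - (LINT x|lebesgue. complex_of_real (phi x) * G x)"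
  shows "\<exists>c. eqon a b F (\<lambda>x. c + prim G x)"
proof -
  define h where "h = (\<lambda>x. F x - zext a b (prim G) x)"
  have hI: "integrable lebesgue h" unfolding h_def
    by (intro Bochner_Integration.integrable_diff F L2_integrable L2_prim G)
  have ho: "x \<notin> {a<..<b} \<Longrightarrow> h x = 0" for x using Fo by (simp add: h_def zext_out)
  have h0: "(LINT x|lebesgue. complex_of_real (deriv phi x) * h x) = 0" if phi: "phi \<in> test_family a b" for phi
  proof -
    have t: "test_fun a b phi" by (rule test_family_test_fun[OF phi])
    note D = test_fun_prim[OF t]
    have "continuous_on UNIV (deriv phi)" using t by (intro smooth_continuous smooth_deriv) (simp add: test_fun_def smooth_def)
    have Dm: "(\<lambda>x. complex_of_real (deriv phi x)) \<in> borel_measurable lebesgue" using D(1) by auto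
    have DF: "integrable lebesgue (\<lambda>x. complex_of_real (deriv phi x) * F x)"
    proof -
      have cont: "continuous_on {a..b} (deriv phi)" using \<open>continuous_on UNIV (deriv phi)\<close> continuous_on_subset by blast
      obtain M where "\<forall>y\<in>deriv phi ` {a..b}. norm y \<le> M"
        using compact_imp_bounded[OF compact_continuous_image[OF cont compact_Icc]] unfolding bounded_iff by blast
      then have M: "\<And>x. x \<in> {a..b} \<Longrightarrow> \<bar>deriv phi x\<bar> \<le> M" by auto
      have "M \<ge> 0" using M[of a] ab by simp
      then have "cmod (complex_of_real (deriv phi x)) \<le> M" for x
        using M[of x] D(4)[of x] by (cases "x \<in> {a<..<b}") auto
      then show ?thesis by (rule bounded_mult_integrable[OF Dm _ F])
    qed
    have "(LINT x|lebesgue. complex_of_real (deriv phi x) * h x)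
      = (LINT x|lebesgue. complex_of_real (deriv phi x) * F x - complex_of_real (deriv phi x) * prim G x)"
      by (intro Bochner_Integration.integral_cong refl) (use D(4) in \<open>auto simp: h_def zext_def right_diff_distrib split: split_indicator\<close>)
    also have "\<dots> = (LINT x|lebesgue. complex_of_real (deriv phi x) * F x) - (LINT x|lebesgue. complex_of_real (deriv phi x) * prim G x)"
      using DF prim_mult_integrable[OF G D(1)] by (intro Bochner_Integration.integral_diff) (auto simp: mult.commute)
    finally show ?thesis using w[OF phi] test_fun_ibp[OF t G] by simp
  qed
  \<comment> \<open>The mean of \<open>h\<close> over the interval from \<open>c\<close> to
    \<open>d\<close>; it arises as the limit of pairings with the derivative of one step
    function.\<close>
  define avg where "avg = (\<lambda>c d. LINT x|lebesgue. complex_of_real (indicator {c<..d} x / (d - c)) * h x)"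
  have avg: "avg c d = avg c' d'"
    if r: "{c, d, c', d'} \<subseteq> \<rat>" "a < c" "c < d" "d < b" "a < c'" "c' < d'" "d' < b" for c d c' d'
  proof (rule LIMSEQ_unique)
    show "(\<lambda>n. LINT x|lebesgue. complex_of_real ((ramp1 (real n * (x - c)) - ramp1 (real n * (x - d))) / (d - c)) * h x) \<longlonglongrightarrow> avg c d"
      unfolding avg_def by (rule step_limit[OF hI r(3)])
    have ev: "\<forall>\<^sub>F n in sequentially. (LINT x|lebesgue. complex_of_real ((ramp1 (real n * (x - c')) - ramp1 (real n * (x - d'))) / (d' - c')) * h x)
      = (LINT x|lebesgue. complex_of_real ((ramp1 (real n * (x - c)) - ramp1 (real n * (x - d))) / (d - c)) * h x)"
    proof -
      have "\<forall>\<^sub>F n in sequentially. 1 / real n < b - d" "\<forall>\<^sub>F n in sequentially. 1 / real n < b - d'"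
        using order_tendstoD(2)[OF lim_1_over_n[where 'a=real]] r by auto
      then show ?thesis using eventually_gt_at_top[of 0]
      proof eventually_elim
        case (elim n)
        let ?s = "\<lambda>c d x. complex_of_real ((ramp1 (real n * (x - c)) - ramp1 (real n * (x - d))) / (d - c))"
        let ?phi = "\<lambda>x. step_fun n c d x - step_fun n c' d' x"
        have "?phi \<in> test_family a b" unfolding test_family_def
          using elim r by (intro image_eqI[of _ _ "(n, c, d, c', d')"]) auto
        from h0[OF this] have "(LINT x|lebesgue. complex_of_real (deriv ?phi x) * h x) = 0" .
        moreover have "complex_of_real (deriv ?phi x) = ?s c d x - ?s c' d' x" for x
          by (subst DERIV_imp_deriv[OF DERIV_diff[OF step_fun_DERIV step_fun_DERIV]]) (use elim in auto)
        ultimately have "(LINT x|lebesgue. ?s c d x * h x - ?s c' d' x * h x) = 0" by (simp only: left_diff_distrib)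
        moreover have "integrable lebesgue (\<lambda>x. ?s c d x * h x)" if "c < d" for c d
        proof (rule bounded_mult_integrable[OF _ _ hI, of _ "1 / (d - c)"])
          show "?s c d \<in> borel_measurable lebesgue"
            by (intro measurable_lebesgueI ramp1_quotient_measurable)
          fix x
          have "\<bar>ramp1 (real n * (x - c)) - ramp1 (real n * (x - d))\<bar> \<le> 1"
            using ramp1_range[of "real n * (x - c)"] ramp1_range[of "real n * (x - d)"] by linarith
          then show "cmod (?s c d x) \<le> 1 / (d - c)" unfolding norm_of_real using that by (simp add: divide_right_mono)
        qed
        ultimately show ?case using r by (simp add: Bochner_Integration.integral_diff)
      qed
    qed
    have "(\<lambda>n. LINT x|lebesgue. complex_of_real ((ramp1 (real n * (x - c')) - ramp1 (real n * (x - d'))) / (d' - c')) * h x) \<longlonglongrightarrow> avg c' d'"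
      unfolding avg_def by (rule step_limit[OF hI r(6)])
    then show "(\<lambda>n. LINT x|lebesgue. complex_of_real ((ramp1 (real n * (x - c)) - ramp1 (real n * (x - d))) / (d - c)) * h x) \<longlonglongrightarrow> avg c' d'"
      using tendsto_cong[OF ev] by blast
  qed
  obtain q where q: "q \<in> \<rat>" "a < q" "q < b" using Rats_dense_in_real[OF ab] by blast
  obtain q' where q': "q' \<in> \<rat>" "q < q'" "q' < b" using Rats_dense_in_real[OF q(3)] by blast
  define m where "m = avg q q'"
  define k where "k = (\<lambda>x. h x - zext a b (\<lambda>_. m) x)"
  have kI: "integrable lebesgue k" unfolding k_def
    by (intro Bochner_Integration.integrable_diff hI L2_integrable L2_const)
  have "AE x in lebesgue. k x = 0"
  proof (rule AE_zero_if_rational_increments_zero[OF kI ab])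
    show "x \<notin> {a<..<b} \<Longrightarrow> k x = 0" for x using ho by (simp add: k_def zext_out)
    fix c d assume r: "c \<in> \<rat>" "d \<in> \<rat>" "a < c" "c < d" "d < b"
    have hi: "integrable lebesgue (\<lambda>x. indicator {c<..d} x *\<^sub>R h x)" by (rule integrable_mult_indicator[OF _ hI]) auto
    have "prim k d - prim k c = (LINT t|lebesgue. indicator {..<d} t *\<^sub>R k t - indicator {..<c} t *\<^sub>R k t)"
      unfolding prim_def by (intro Bochner_Integration.integral_diff[symmetric] integrable_indicator kI)
    also have "\<dots> = (LINT t|lebesgue. indicator {c<..d} t *\<^sub>R h t - indicator {c<..d} t *\<^sub>R m)"
    proof (rule integral_cong_AE_lebesgue)
      show "AE t in lebesgue. indicator {..<d} t *\<^sub>R k t - indicator {..<c} t *\<^sub>R k t = indicator {c<..d} t *\<^sub>R h t - indicator {c<..d} t *\<^sub>R m"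
        unfolding AE_lebesgue_iff using AE_lborel_singleton[of c] AE_lborel_singleton[of d]
        by eventually_elim (use r in \<open>auto simp: k_def zext_def split: split_indicator\<close>)
    qed
    also have "\<dots> = (LINT t|lebesgue. indicator {c<..d} t *\<^sub>R h t) - (LINT t|lebesgue. indicator {c<..d} t *\<^sub>R m)"
    proof (intro Bochner_Integration.integral_diff hi integrable_scaleR_left integrable_real_indicator)
      show "emeasure lebesgue {c<..d} < \<infinity>" using r by (simp add: emeasure_lborel_Ioc)
    qed simp
    also have "(LINT t|lebesgue. indicator {c<..d} t *\<^sub>R m) = complex_of_real (d - c) * m"
      using r by (simp add: scaleR_conv_of_real)
    also have "(LINT t|lebesgue. indicator {c<..d} t *\<^sub>R h t) = complex_of_real (d - c) * avg c d"
    proof -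
      have "complex_of_real (d - c) * avg c d = (LINT x|lebesgue. complex_of_real (d - c) * (complex_of_real (indicator {c<..d} x / (d - c)) * h x))"
        unfolding avg_def by (rule integral_mult_right_zero[symmetric])
      also have "\<dots> = (LINT t|lebesgue. indicator {c<..d} t *\<^sub>R h t)"
        using r by (intro Bochner_Integration.integral_cong refl) (auto split: split_indicator)
      finally show ?thesis by simp
    qed
    also have "avg c d = m" unfolding m_def using r q q' by (intro avg) auto
    finally show "prim k c = prim k d" by simp
  qed
  then have "eqon a b F (\<lambda>x. m + prim G x)"
    by eventually_elim (auto simp: k_def h_def zext_def diff_eq_eq)
  then show ?thesis by blast
qed

lemma AE_eq_imp_eq:
  fixes p q :: "real \<Rightarrow> complex"
  assumes ab: "a < b" and p: "continuous_on {a..b} p" and q: "continuous_on {a..b} q"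
    and e: "eqon a b p q" and x: "x \<in> {a..b}"
  shows "p x = q x"
proof -
  define U where "U = {a<..<b} \<inter> (\<lambda>x. p x - q x) -` (- {0})"
  have "continuous_on {a<..<b} (\<lambda>x. p x - q x)"
    by (intro continuous_on_diff continuous_on_subset[OF p] continuous_on_subset[OF q]) auto
  then have "open U" unfolding U_def by (intro continuous_open_preimage) auto
  moreover have "negligible U"
  proof -
    have "AE x in lebesgue. x \<notin> U" using e by eventually_elim (auto simp: U_def)
    moreover have "U \<in> sets lebesgue" using \<open>open U\<close> by simp
    ultimately have "U \<in> null_sets lebesgue" by (simp add: AE_iff_null_sets)
    then show ?thesis by (simp add: negligible_iff_null_sets)
  qed
  ultimately have "U = {}" using open_not_negligible by blast
  then have z: "p x - q x = 0" if "x \<in> {a<..<b}" for x using that by (auto simp: U_def)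
  have cl: "closure {a<..<b} = {a..b}" using ab by simp
  have "p x - q x = 0"
    by (rule continuous_constant_on_closure[of "{a<..<b}"]) (use z cl p q x in \<open>auto intro: continuous_on_diff\<close>)
  then show ?thesis by simp
qed

lemma weak_deriv_imp_prim:
  assumes ab: "a < b" and f: "L2 a b f" and g: "L2 a b g" and w: "weak_deriv a b f g"
  shows "\<exists>c. eqon a b f (\<lambda>x. c + prim (zext a b g) x)"
proof -
  have "\<exists>c. eqon a b (zext a b f) (\<lambda>x. c + prim (zext a b g) x)"
    by (rule du_bois_reymond[OF ab L2_integrable[OF f] L2_integrable[OF g] zext_out])
      (use w test_family_test_fun in \<open>auto simp: weak_deriv_iff\<close>)
  then show ?thesis by (auto elim!: eventually_mono)
qed

section \<open>Sobolev functions as primitives\<close>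

lemma prim_at_left: "prim (zext a b g) a = 0"
  by (rule prim_left) (simp add: zext_out)

lemma prim_at_right: "prim (zext a b g) b = integral\<^sup>L lebesgue (zext a b g)"
  by (rule prim_right) (simp add: zext_out)

lemma L2_deriv_unique:
  assumes ab: "a < b" and g: "L2 a b g" and g': "L2 a b g'"
    and e: "eqon a b (\<lambda>x. c + prim (zext a b g) x) (\<lambda>x. c' + prim (zext a b g') x)"
  shows "c = c'" "eqon a b g g'"
proof -
  have eq: "c + prim (zext a b g) x = c' + prim (zext a b g') x" if "x \<in> {a..b}" for x
    by (rule AE_eq_imp_eq[OF ab _ _ e that])
      (intro continuous_intros prim_continuous L2_integrable g g')+
  show cc: "c = c'" using eq[of a] ab by (simp add: prim_at_left)
  define k where "k = (\<lambda>x. zext a b g x - zext a b g' x)"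
  have k: "integrable lebesgue k" unfolding k_def by (intro Bochner_Integration.integrable_diff L2_integrable g g')
  have ko: "x \<notin> {a<..<b} \<Longrightarrow> k x = 0" for x by (simp add: k_def zext_out)
  have pk: "prim k x = 0" if "x \<in> {a..b}" for x
    using prim_diff[OF L2_integrable[OF g] L2_integrable[OF g'], of x] eq[OF that] cc by (simp add: k_def)
  have "AE x in lebesgue. k x = 0"
    by (rule AE_zero_if_rational_increments_zero[OF k ab ko]) (simp_all add: pk)
  then show "eqon a b g g'" unfolding eqon_zext by eventually_elim (simp add: k_def)
qed

text \<open>Trades weak derivatives for explicit continuous representatives. Sobolev functions are
  handled below as a constant plus a primitive, and \<open>prim_H1\<close> reads the chosen
  derivative \<open>wd\<close> back from such a form.\<close>

lemma H1_iff:
  assumes ab: "a < b"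
  shows "H1 a b f \<longleftrightarrow> (\<exists>c g. L2 a b g \<and> eqon a b f (\<lambda>x. c + prim (zext a b g) x))"
proof
  assume "H1 a b f"
  then show "\<exists>c g. L2 a b g \<and> eqon a b f (\<lambda>x. c + prim (zext a b g) x)"
    unfolding H1_def using weak_deriv_imp_prim[OF ab] by blast
next
  assume "\<exists>c g. L2 a b g \<and> eqon a b f (\<lambda>x. c + prim (zext a b g) x)"
  then obtain c g where g: "L2 a b g" and e: "eqon a b f (\<lambda>x. c + prim (zext a b g) x)" by blast
  have "L2 a b f"
    by (rule L2_cong[OF L2_add[OF L2_const L2_prim[OF L2_integrable[OF g]]] eqon_sym[OF e]])
  moreover have "weak_deriv a b f g"
    by (rule weak_deriv_cong[OF weak_deriv_prim[OF L2_integrable[OF g]] eqon_sym[OF e]]) simp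
  ultimately show "H1 a b f" using g by (auto simp: H1_def)
qed

lemma wd_L2: "H1 a b f \<Longrightarrow> L2 a b (wd a b f)"
  and wd_weak_deriv: "H1 a b f \<Longrightarrow> weak_deriv a b f (wd a b f)"
  using someI_ex[of "\<lambda>g. L2 a b g \<and> weak_deriv a b f g"] unfolding wd_def H1_def by blast+

lemma wd_prim: "a < b \<Longrightarrow> H1 a b f \<Longrightarrow> \<exists>c. eqon a b f (\<lambda>x. c + prim (zext a b (wd a b f)) x)"
  by (rule weak_deriv_imp_prim) (simp_all add: wd_L2 wd_weak_deriv H1_def)

lemma prim_H1:
  assumes ab: "a < b" and g: "L2 a b g" and e: "eqon a b f (\<lambda>x. c + prim (zext a b g) x)"
  shows "H1 a b f" "eqon a b (wd a b f) g"
proof -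
  show h: "H1 a b f" unfolding H1_iff[OF ab] using g e by blast
  obtain c' where c': "eqon a b f (\<lambda>x. c' + prim (zext a b (wd a b f)) x)" using wd_prim[OF ab h] by blast
  have "eqon a b (\<lambda>x. c' + prim (zext a b (wd a b f)) x) (\<lambda>x. c + prim (zext a b g) x)"
    by (rule eqon_trans[OF eqon_sym[OF c'] e])
  then show "eqon a b (wd a b f) g" by (rule L2_deriv_unique(2)[OF ab wd_L2[OF h] g])
qed

lemma H1_cong:
  assumes ab: "a < b" and h: "H1 a b f" and e: "eqon a b f f'"
  shows "H1 a b f'" "eqon a b (wd a b f') (wd a b f)"
proof -
  obtain c where "eqon a b f (\<lambda>x. c + prim (zext a b (wd a b f)) x)" using wd_prim[OF ab h] by blast
  then have "eqon a b f' (\<lambda>x. c + prim (zext a b (wd a b f)) x)" by (rule eqon_trans[OF eqon_sym[OF e]])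
  from prim_H1[OF ab wd_L2[OF h] this] show "H1 a b f'" "eqon a b (wd a b f') (wd a b f)" .
qed

lemma H1L_iff:
  assumes b: "0 < b"
  shows "H1L b f \<longleftrightarrow> (\<exists>p. L2 0 b p \<and> eqon 0 b f (prim (zext 0 b p)))"
proof
  assume "H1L b f"
  then obtain f' where h: "H1 0 b f" and f': "continuous_on {0..b} f'" "eqon 0 b f f'" "f' 0 = 0"
    unfolding H1L_def cont_rep_def by blast
  obtain c where c: "eqon 0 b f (\<lambda>x. c + prim (zext 0 b (wd 0 b f)) x)" using wd_prim[OF b h] by blast
  have "f' 0 = c + prim (zext 0 b (wd 0 b f)) 0"
    by (rule AE_eq_imp_eq[OF b f'(1) _ eqon_trans[OF eqon_sym[OF f'(2)] c]])
      (use b in \<open>auto intro!: continuous_intros prim_continuous L2_integrable wd_L2 h\<close>)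
  then have "c = 0" using f'(3) by (simp add: prim_at_left)
  then show "\<exists>p. L2 0 b p \<and> eqon 0 b f (prim (zext 0 b p))" using c wd_L2[OF h] by auto
next
  assume "\<exists>p. L2 0 b p \<and> eqon 0 b f (prim (zext 0 b p))"
  then obtain p where p: "L2 0 b p" "eqon 0 b f (prim (zext 0 b p))" by blast
  have "H1 0 b f" by (rule prim_H1[OF b p(1), of f 0]) (use p(2) in simp)
  then show "H1L b f" unfolding H1L_def cont_rep_def
    using p by (auto intro!: exI[of _ "prim (zext 0 b p)"] prim_continuous L2_integrable prim_at_left)
qed

text \<open>The condition at 0 removes the constant of integration. The condition at
  \<open>L\<close> then says that the primitive ends at 0, that is, that the derivative has zero
  mean.\<close>

lemma H10_iff:
  assumes L: "0 < L"
  shows "H10 0 L f \<longleftrightarrow> (\<exists>p. L2 0 L p \<and> integral\<^sup>L lebesgue (zext 0 L p) = 0 \<and> eqon 0 L f (prim (zext 0 L p)))"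
proof
  assume "H10 0 L f"
  then obtain f' where h: "H1 0 L f" and f': "continuous_on {0..L} f'" "eqon 0 L f f'" "f' 0 = 0" "f' L = 0"
    unfolding H10_def cont_rep_def by blast
  obtain c where c: "eqon 0 L f (\<lambda>x. c + prim (zext 0 L (wd 0 L f)) x)" using wd_prim[OF L h] by blast
  have eq: "f' x = c + prim (zext 0 L (wd 0 L f)) x" if "x \<in> {0..L}" for x
    by (rule AE_eq_imp_eq[OF L f'(1) _ eqon_trans[OF eqon_sym[OF f'(2)] c] that])
      (auto intro!: continuous_intros prim_continuous L2_integrable wd_L2 h)
  have "c = 0" using f'(3) eq[of 0] L by (simp add: prim_at_left)
  moreover from this have "integral\<^sup>L lebesgue (zext 0 L (wd 0 L f)) = 0"
    using f'(4) eq[of L] L by (simp add: prim_at_right)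
  ultimately show "\<exists>p. L2 0 L p \<and> integral\<^sup>L lebesgue (zext 0 L p) = 0 \<and> eqon 0 L f (prim (zext 0 L p))"
    using c wd_L2[OF h] by auto
next
  assume "\<exists>p. L2 0 L p \<and> integral\<^sup>L lebesgue (zext 0 L p) = 0 \<and> eqon 0 L f (prim (zext 0 L p))"
  then obtain p where p: "L2 0 L p" "integral\<^sup>L lebesgue (zext 0 L p) = 0" "eqon 0 L f (prim (zext 0 L p))" by blast
  have "H1 0 L f" by (rule prim_H1[OF L p(1), of f 0]) (use p(3) in simp)
  then show "H10 0 L f" unfolding H10_def cont_rep_def
    using p by (auto intro!: exI[of _ "prim (zext 0 L p)"] prim_continuous L2_integrable prim_at_left simp: prim_at_right)
qed

lemma H10_wd:
  assumes L: "0 < L" and p: "L2 0 L p" "integral\<^sup>L lebesgue (zext 0 L p) = 0" "eqon 0 L f (prim (zext 0 L p))"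
  shows "H10 0 L f" "eqon 0 L (wd 0 L f) p"
proof -
  show "H10 0 L f" unfolding H10_iff[OF L] using p by blast
  show "eqon 0 L (wd 0 L f) p" by (rule prim_H1(2)[OF L p(1), of f 0]) (use p(3) in simp)
qed

lemma H10_wdD:
  assumes L: "0 < L" and h: "H10 0 L f"
  shows "L2 0 L (wd 0 L f)" "integral\<^sup>L lebesgue (zext 0 L (wd 0 L f)) = 0" "eqon 0 L f (prim (zext 0 L (wd 0 L f)))"
proof -
  obtain p where p: "L2 0 L p" "integral\<^sup>L lebesgue (zext 0 L p) = 0" "eqon 0 L f (prim (zext 0 L p))"
    using h H10_iff[OF L] by blast
  have w: "eqon 0 L (wd 0 L f) p" by (rule H10_wd(2)[OF L p])
  show "L2 0 L (wd 0 L f)" by (rule L2_cong[OF p(1) eqon_sym[OF w]])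
  have ae: "AE x in lebesgue. zext 0 L p x = zext 0 L (wd 0 L f) x" using eqon_sym[OF w] by (simp only: eqon_zext)
  show "integral\<^sup>L lebesgue (zext 0 L (wd 0 L f)) = 0" using integral_cong_AE_lebesgue[OF ae] p by simp
  show "eqon 0 L f (prim (zext 0 L (wd 0 L f)))" using p(3) prim_cong_AE[OF ae] by simp
qed

lemma H10_H1: "H10 a b f \<Longrightarrow> H1 a b f" by (simp add: H10_def)
lemma H1L_H1: "H1L b f \<Longrightarrow> H1 0 b f" by (simp add: H1L_def)
lemma H1_L2: "H1 a b f \<Longrightarrow> L2 a b f" by (simp add: H1_def)

lemma H10_cong: "0 < L \<Longrightarrow> H10 0 L f \<Longrightarrow> eqon 0 L f f' \<Longrightarrow> H10 0 L f'"
  by (rule H10_wd(1)[OF _ H10_wdD(1,2) eqon_trans[OF eqon_sym H10_wdD(3)]])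

lemma L2_lincomb: "L2 a b f \<Longrightarrow> L2 a b g \<Longrightarrow> L2 a b (\<lambda>x. c * f x + d * g x)"
  by (intro L2_add L2_cmult)

lemma H1_lincomb:
  assumes ab: "a < b" and f: "H1 a b f" and g: "H1 a b g"
  shows "H1 a b (\<lambda>x. c * f x + d * g x)" "eqon a b (wd a b (\<lambda>x. c * f x + d * g x)) (\<lambda>x. c * wd a b f x + d * wd a b g x)"
proof -
  obtain k where k: "eqon a b f (\<lambda>x. k + prim (zext a b (wd a b f)) x)" using wd_prim[OF ab f] by blast
  obtain l where l: "eqon a b g (\<lambda>x. l + prim (zext a b (wd a b g)) x)" using wd_prim[OF ab g] by blast
  note F = L2_integrable[OF wd_L2[OF f]] and G = L2_integrable[OF wd_L2[OF g]]
  have P: "prim (zext a b (\<lambda>x. c * wd a b f x + d * wd a b g x)) x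
     = c * prim (zext a b (wd a b f)) x + d * prim (zext a b (wd a b g)) x" for x
    unfolding zext_add zext_cmult using F G by (subst prim_add) (auto simp: prim_cmult)
  have e: "eqon a b (\<lambda>x. c * f x + d * g x) (\<lambda>x. (c * k + d * l) + prim (zext a b (\<lambda>x. c * wd a b f x + d * wd a b g x)) x)"
    unfolding P using k l by eventually_elim (auto simp: algebra_simps)
  show "H1 a b (\<lambda>x. c * f x + d * g x)" "eqon a b (wd a b (\<lambda>x. c * f x + d * g x)) (\<lambda>x. c * wd a b f x + d * wd a b g x)"
    by (rule prim_H1[OF ab L2_lincomb[OF wd_L2[OF f] wd_L2[OF g]] e])+
qed

lemma H10_lincomb:
  assumes L: "0 < L" and f: "H10 0 L f" and g: "H10 0 L g"
  shows "H10 0 L (\<lambda>x. c * f x + d * g x)"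
proof -
  note F = H10_wdD[OF L f] and G = H10_wdD[OF L g]
  note FI = L2_integrable[OF F(1)] and GI = L2_integrable[OF G(1)]
  have P: "prim (zext 0 L (\<lambda>x. c * wd 0 L f x + d * wd 0 L g x)) x
     = c * prim (zext 0 L (wd 0 L f)) x + d * prim (zext 0 L (wd 0 L g)) x" for x
    unfolding zext_add zext_cmult using FI GI by (subst prim_add) (auto simp: prim_cmult)
  show ?thesis
  proof (rule H10_wd(1)[OF L L2_lincomb[OF F(1) G(1)]])
    show "integral\<^sup>L lebesgue (zext 0 L (\<lambda>x. c * wd 0 L f x + d * wd 0 L g x)) = 0"
      unfolding zext_add zext_cmult using FI GI F(2) G(2) by simp
    show "eqon 0 L (\<lambda>x. c * f x + d * g x) (prim (zext 0 L (\<lambda>x. c * wd 0 L f x + d * wd 0 L g x)))"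
      unfolding P using F(3) G(3) by eventually_elim auto
  qed
qed

section \<open>Slices of functions of two variables\<close>

text \<open>Lebesgue measure on the plane is the completion of the product of Borel measures, so the
  exceptional set is first enclosed in a Borel null set, whose slices are null for almost every
  parameter in either order.\<close>

lemma AE_slices:
  assumes "AE p in lebesgue. P (p :: real \<times> real)"
  shows "AE x in lebesgue. AE r in lebesgue. P (x, r)" "AE r in lebesgue. AE x in lebesgue. P (x, r)"
proof -
  have "AE p in lborel \<Otimes>\<^sub>M lborel. P p" using assms unfolding AE_lebesgue_iff lborel_prod .
  then obtain N where N: "{p \<in> space (lborel \<Otimes>\<^sub>M lborel). \<not> P p} \<subseteq> N" "N \<in> null_sets (lborel \<Otimes>\<^sub>M lborel)"
    by (auto elim: AE_E simp: null_sets_def)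
  have P: "P p" if "p \<notin> N" for p using N(1) that by (auto simp: space_pair_measure)
  have Nm[measurable]: "N \<in> sets (lborel \<Otimes>\<^sub>M lborel)" using N(2) by auto
  have 1: "AE x in lborel. AE r in lborel. (x, r) \<notin> N"
    using lborel_pair.AE_pair[OF AE_not_in[OF N(2)]] by simp
  have "AE r in lborel. AE x in lborel. (x, r) \<notin> N"
  proof (subst lborel_pair.AE_commute[symmetric])
    show "{x \<in> space (lborel \<Otimes>\<^sub>M lborel). (fst x, snd x) \<notin> N} \<in> sets (lborel \<Otimes>\<^sub>M lborel)"
      by measurable
  qed (rule 1)
  then show "AE r in lebesgue. AE x in lebesgue. P (x, r)"
    unfolding AE_lebesgue_iff by (rule eventually_mono) (auto elim: eventually_mono intro: P)
  show "AE x in lebesgue. AE r in lebesgue. P (x, r)"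
    using 1 unfolding AE_lebesgue_iff by (rule eventually_mono) (auto elim: eventually_mono intro: P)
qed

lemma AE_eq_from_slices:
  fixes F G :: "real \<times> real \<Rightarrow> complex"
  assumes F: "F \<in> borel_measurable lebesgue" and G: "G \<in> borel_measurable lebesgue"
    and e: "(AE x in lebesgue. AE r in lebesgue. F (x, r) = G (x, r)) \<or> (AE r in lebesgue. AE x in lebesgue. F (x, r) = G (x, r))"
  shows "AE p in lebesgue. F p = G p"
proof -
  obtain F' where F': "F' \<in> borel_measurable borel" "AE p in lebesgue. F p = F' p" using borel_version[OF F] by blast
  obtain G' where G': "G' \<in> borel_measurable borel" "AE p in lebesgue. G p = G' p" using borel_version[OF G] by blast
  have "F' \<in> borel_measurable (lborel \<Otimes>\<^sub>M lborel)" "G' \<in> borel_measurable (lborel \<Otimes>\<^sub>M lborel)"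
    using F'(1) G'(1) by (simp_all add: lborel_prod)
  note [measurable] = this
  note sF = AE_slices[OF F'(2)] and sG = AE_slices[OF G'(2)]
  have m: "{p \<in> space (lborel \<Otimes>\<^sub>M lborel). F' (fst p, snd p) = G' (fst p, snd p)} \<in> sets (lborel \<Otimes>\<^sub>M lborel)"
    by measurable
  have "AE x in lborel. AE r in lborel. F' (x, r) = G' (x, r)"
    using e
  proof
    assume a: "AE x in lebesgue. AE r in lebesgue. F (x, r) = G (x, r)"
    show ?thesis using a sF(1) sG(1) unfolding AE_lebesgue_iff
    proof eventually_elim
      case (elim x)
      then show ?case by eventually_elim simp
    qed
  next
    assume a: "AE r in lebesgue. AE x in lebesgue. F (x, r) = G (x, r)"
    have "AE r in lborel. AE x in lborel. F' (x, r) = G' (x, r)"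
      using a sF(2) sG(2) unfolding AE_lebesgue_iff
    proof eventually_elim
      case (elim r)
      then show ?case by eventually_elim simp
    qed
    then show ?thesis by (subst lborel_pair.AE_commute[OF m])
  qed
  then have "AE p in lborel \<Otimes>\<^sub>M lborel. F' (fst p, snd p) = G' (fst p, snd p)"
    by (subst (asm) lborel_pair.AE_pair_iff[OF m])
  then have "AE p in lebesgue. F' p = G' p" unfolding AE_lebesgue_iff lborel_prod by simp
  then show ?thesis using F'(2) G'(2) by eventually_elim simp
qed

lemma measurable_slices:
  fixes F :: "real \<times> real \<Rightarrow> complex"
  assumes F: "F \<in> borel_measurable lebesgue"
  shows "AE x in lebesgue. (\<lambda>r. F (x, r)) \<in> borel_measurable lebesgue"
    "AE r in lebesgue. (\<lambda>x. F (x, r)) \<in> borel_measurable lebesgue"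
proof -
  obtain F' where F': "F' \<in> borel_measurable borel" "AE p in lebesgue. F p = F' p" using borel_version[OF F] by blast
  have "F' \<in> borel_measurable (borel \<Otimes>\<^sub>M borel)" using F'(1) by (simp add: borel_prod)
  note [measurable] = this
  have "(\<lambda>r. F' (x, r)) \<in> borel_measurable borel" "(\<lambda>x. F' (x, r)) \<in> borel_measurable borel" for x r
    by measurable
  note m = this[THEN measurable_lebesgueI]
  show "AE x in lebesgue. (\<lambda>r. F (x, r)) \<in> borel_measurable lebesgue"
    using AE_slices(1)[OF F'(2)]
    by eventually_elim (rule measurable_cong_AE_lebesgue[OF m(1)], auto elim: eventually_mono)
  show "AE r in lebesgue. (\<lambda>x. F (x, r)) \<in> borel_measurable lebesgue"
    using AE_slices(2)[OF F'(2)]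
    by eventually_elim (rule measurable_cong_AE_lebesgue[OF m(2)], auto elim: eventually_mono)
qed

lemma integral_slices:
  fixes F :: "real \<times> real \<Rightarrow> complex"
  assumes F: "integrable lebesgue F"
  shows "AE x in lebesgue. integrable lebesgue (\<lambda>r. F (x, r))"
    "AE r in lebesgue. integrable lebesgue (\<lambda>x. F (x, r))"
    "integrable lebesgue (\<lambda>x. LINT r|lebesgue. F (x, r))"
    "integrable lebesgue (\<lambda>r. LINT x|lebesgue. F (x, r))"
    "(LINT x|lebesgue. LINT r|lebesgue. F (x, r)) = integral\<^sup>L lebesgue F"
    "(LINT r|lebesgue. LINT x|lebesgue. F (x, r)) = integral\<^sup>L lebesgue F"
proof -
  obtain F' where F': "F' \<in> borel_measurable borel" "AE p in lebesgue. F p = F' p"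
    using borel_version[OF borel_measurable_integrable[OF F]] by blast
  have "F' \<in> borel_measurable (borel \<Otimes>\<^sub>M borel)" using F'(1) by (simp add: borel_prod)
  note [measurable] = this
  have I0: "integrable lborel F'"
    using integrable_cong_AE_lebesgue[OF F F'(2)] F'(1) by (subst (asm) integrable_completion) auto
  then have I: "integrable (lborel \<Otimes>\<^sub>M lborel) F'" by (simp add: lborel_prod)
  have I': "integrable (lborel \<Otimes>\<^sub>M lborel) (case_prod (\<lambda>x r. F' (x, r)))" using I by (simp add: case_prod_unfold)
  have T: "integral\<^sup>L lebesgue F = integral\<^sup>L (lborel \<Otimes>\<^sub>M lborel) F'"
    using integral_cong_AE_lebesgue[OF F'(2)] integral_completion[of F' lborel] F'(1) by (simp add: lborel_prod)
  have m: "(\<lambda>r. F' (x, r)) \<in> borel_measurable borel" "(\<lambda>x. F' (x, r)) \<in> borel_measurable borel" for x r by measurable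
  have s: "AE x in lborel. integrable lborel (\<lambda>r. F' (x, r))" by (rule lborel_pair.AE_integrable_fst'[OF I])
  have sI: "integrable lborel (\<lambda>x. LINT r|lborel. F' (x, r))" by (rule lborel_pair.integrable_fst'[OF I])
  have sT: "(LINT x|lborel. LINT r|lborel. F' (x, r)) = integral\<^sup>L (lborel \<Otimes>\<^sub>M lborel) F'"
    using lborel_pair.integral_fst'[OF I] by simp
  have t: "AE r in lborel. integrable lborel (\<lambda>x. F' (x, r))" by (rule lborel_pair.AE_integrable_snd[OF I'])
  have tI: "integrable lborel (\<lambda>r. LINT x|lborel. F' (x, r))" by (rule lborel_pair.integrable_snd[OF I'])
  have tT: "(LINT r|lborel. LINT x|lborel. F' (x, r)) = integral\<^sup>L (lborel \<Otimes>\<^sub>M lborel) F'"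
    using lborel_pair.integral_snd[OF I'] by (simp add: case_prod_unfold)
  note sl = AE_slices[OF F'(2)]
  have c1: "(LINT r|lebesgue. F' (x, r)) = (LINT r|lborel. F' (x, r))" for x by (rule integral_completion) (simp add: m)
  have c2: "(LINT x|lebesgue. F' (x, r)) = (LINT x|lborel. F' (x, r))" for r by (rule integral_completion) (simp add: m)
  have e1: "AE x in lebesgue. (LINT r|lborel. F' (x, r)) = (LINT r|lebesgue. F (x, r))"
    using sl(1)
  proof eventually_elim
    case (elim x) show ?case using integral_cong_AE_lebesgue[OF elim] c1 by simp
  qed
  have e2: "AE r in lebesgue. (LINT x|lborel. F' (x, r)) = (LINT x|lebesgue. F (x, r))"
    using sl(2)
  proof eventually_elim
    case (elim r) show ?case using integral_cong_AE_lebesgue[OF elim] c2 by simp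
  qed
  show "AE x in lebesgue. integrable lebesgue (\<lambda>r. F (x, r))"
    using sl(1) s unfolding AE_lebesgue_iff
  proof eventually_elim
    case (elim x)
    have i: "integrable lebesgue (\<lambda>r. F' (x, r))" using elim(2) by (subst integrable_completion) (simp_all add: m)
    show ?case by (rule integrable_cong_AE_lebesgue[OF i]) (use elim(1) in \<open>auto simp: AE_lebesgue_iff elim: eventually_mono\<close>)
  qed
  show "AE r in lebesgue. integrable lebesgue (\<lambda>x. F (x, r))"
    using sl(2) t unfolding AE_lebesgue_iff
  proof eventually_elim
    case (elim r)
    have i: "integrable lebesgue (\<lambda>x. F' (x, r))" using elim(2) by (subst integrable_completion) (simp_all add: m)
    show ?case by (rule integrable_cong_AE_lebesgue[OF i]) (use elim(1) in \<open>auto simp: AE_lebesgue_iff elim: eventually_mono\<close>)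
  qed
  have j1: "(\<lambda>x. LINT r|lborel. F' (x, r)) \<in> borel_measurable lborel" "(\<lambda>r. LINT x|lborel. F' (x, r)) \<in> borel_measurable lborel"
    using sI tI by auto
  show "integrable lebesgue (\<lambda>x. LINT r|lebesgue. F (x, r))"
    by (rule integrable_cong_AE_lebesgue[OF _ e1]) (use sI j1 in \<open>simp add: integrable_completion\<close>)
  show "integrable lebesgue (\<lambda>r. LINT x|lebesgue. F (x, r))"
    by (rule integrable_cong_AE_lebesgue[OF _ e2]) (use tI j1 in \<open>simp add: integrable_completion\<close>)
  show "(LINT x|lebesgue. LINT r|lebesgue. F (x, r)) = integral\<^sup>L lebesgue F"
    using integral_cong_AE_lebesgue[OF e1] integral_completion[OF j1(1)] sT T by simp
  show "(LINT r|lebesgue. LINT x|lebesgue. F (x, r)) = integral\<^sup>L lebesgue F"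
    using integral_cong_AE_lebesgue[OF e2] integral_completion[OF j1(2)] tT T by simp
qed

lemma AE_fst_snd:
  assumes "AE r in lebesgue. P (r :: real)"
  shows "AE p in lebesgue. P (fst (p :: real \<times> real))" "AE p in lebesgue. P (snd (p :: real \<times> real))"
proof -
  obtain M where M: "{r. \<not> P r} \<subseteq> M" "M \<in> null_sets lborel"
    using assms unfolding AE_lebesgue_iff by (auto elim: AE_E simp: null_sets_def)
  have [measurable]: "M \<in> sets lborel" using M by auto
  have PM: "P r" if "r \<notin> M" for r using M(1) that by blast
  have "AE p in lborel \<Otimes>\<^sub>M lborel. fst p \<notin> M"
  proof (rule lborel_pair.AE_pair_measure)
    show "{p \<in> space (lborel \<Otimes>\<^sub>M lborel). fst p \<notin> M} \<in> sets (lborel \<Otimes>\<^sub>M lborel)" by measurable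
    show "AE x in lborel. AE y in lborel. fst (x, y) \<notin> M"
      using AE_not_in[OF M(2)] by eventually_elim simp
  qed
  then show "AE p in lebesgue. P (fst (p :: real \<times> real))"
    unfolding AE_lebesgue_iff lborel_prod by (rule eventually_mono) (rule PM)
  have "AE p in lborel \<Otimes>\<^sub>M lborel. snd p \<notin> M"
  proof (rule lborel_pair.AE_pair_measure)
    show "{p \<in> space (lborel \<Otimes>\<^sub>M lborel). snd p \<notin> M} \<in> sets (lborel \<Otimes>\<^sub>M lborel)" by measurable
    show "AE x in lborel. AE y in lborel. snd (x, y) \<notin> M"
      using AE_not_in[OF M(2)] by simp
  qed
  then show "AE p in lebesgue. P (snd (p :: real \<times> real))"
    unfolding AE_lebesgue_iff lborel_prod by (rule eventually_mono) (rule PM)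
qed

section \<open>Square norms of slices and of primitives\<close>

definition sqn :: "('a::euclidean_space \<Rightarrow> complex) \<Rightarrow> real" where
  "sqn f = (LINT x|lebesgue. (cmod (f x))\<^sup>2)"

lemma sqn_nonneg: "sqn f \<ge> 0" by (simp add: sqn_def)

lemma sqn_cls: "sqint f \<Longrightarrow> (norm (cls f))\<^sup>2 = sqn f" by (simp add: norm_cls sqn_def)

lemma sqint_slices:
  fixes F :: "real \<times> real \<Rightarrow> complex"
  assumes F: "sqint F"
  shows "AE x in lebesgue. sqint (\<lambda>r. F (x, r))" "AE r in lebesgue. sqint (\<lambda>x. F (x, r))"
    "integrable lebesgue (\<lambda>x. sqn (\<lambda>r. F (x, r)))" "integrable lebesgue (\<lambda>r. sqn (\<lambda>x. F (x, r)))"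
    "(LINT x|lebesgue. sqn (\<lambda>r. F (x, r))) = sqn F" "(LINT r|lebesgue. sqn (\<lambda>x. F (x, r))) = sqn F"
proof -
  define K where "K = (\<lambda>p. complex_of_real ((cmod (F p))\<^sup>2))"
  have K: "integrable lebesgue K" unfolding K_def complex_of_real_integrable_eq by (rule sqint_integrable[OF F])
  note I = integral_slices[OF K, unfolded K_def complex_of_real_integrable_eq integral_complex_of_real of_real_eq_iff, folded sqn_def]
  show "AE x in lebesgue. sqint (\<lambda>r. F (x, r))"
    using I(1) measurable_slices(1)[OF sqint_measurable[OF F]] by eventually_elim (simp add: sqint_def)
  show "AE r in lebesgue. sqint (\<lambda>x. F (x, r))"
    using I(2) measurable_slices(2)[OF sqint_measurable[OF F]] by eventually_elim (simp add: sqint_def)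
  show "integrable lebesgue (\<lambda>x. sqn (\<lambda>r. F (x, r)))" "integrable lebesgue (\<lambda>r. sqn (\<lambda>x. F (x, r)))"
    "(LINT x|lebesgue. sqn (\<lambda>r. F (x, r))) = sqn F" "(LINT r|lebesgue. sqn (\<lambda>x. F (x, r))) = sqn F"
    using I(3-6) .
qed

lemma product_integrable:
  fixes f g :: "real \<Rightarrow> real"
  assumes f: "integrable lebesgue f" and g: "integrable lebesgue g"
  shows "integrable lebesgue (\<lambda>p. f (fst p) * g (snd p))"
proof -
  obtain f' where f': "f' \<in> borel_measurable lborel" "AE x in lborel. f x = f' x"
    using completion_ex_borel_measurable_real[OF borel_measurable_integrable[OF f]] by blast
  obtain g' where g': "g' \<in> borel_measurable lborel" "AE x in lborel. g x = g' x"
    using completion_ex_borel_measurable_real[OF borel_measurable_integrable[OF g]] by blast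
  note [measurable] = f'(1) g'(1)
  have mf: "f' \<in> borel_measurable lebesgue" "g' \<in> borel_measurable lebesgue"
    using f'(1) g'(1) by (auto intro: measurable_completion)
  have "integrable lebesgue f'" using f f'(2) mf by (subst integrable_cong_AE[of f' _ f]) (auto simp: AE_lebesgue_iff elim: eventually_mono)
  then have if': "integrable lborel f'" using f'(1) by (simp add: integrable_completion)
  have "integrable lebesgue g'" using g g'(2) mf by (subst integrable_cong_AE[of g' _ g]) (auto simp: AE_lebesgue_iff elim: eventually_mono)
  then have ig': "integrable lborel g'" using g'(1) by (simp add: integrable_completion)
  have "integrable (lborel \<Otimes>\<^sub>M lborel) (\<lambda>p. f' (fst p) * g' (snd p))"
  proof (rule lborel_pair.Fubini_integrable)
    show "(\<lambda>p. f' (fst p) * g' (snd p)) \<in> borel_measurable (lborel \<Otimes>\<^sub>M lborel)" by measurable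
    show "integrable lborel (\<lambda>x. LINT y|lborel. norm (f' (fst (x, y)) * g' (snd (x, y))))"
      using if' by (simp add: abs_mult)
    show "AE x in lborel. integrable lborel (\<lambda>y. f' (fst (x, y)) * g' (snd (x, y)))" using ig' by simp
  qed
  then have "integrable lborel (\<lambda>p. f' (fst p) * g' (snd p))" by (simp add: lborel_prod)
  then have I: "integrable lebesgue (\<lambda>p. f' (fst p) * g' (snd p))"
    by (subst integrable_completion) (auto intro: borel_measurable_integrable)
  have "AE p in lborel \<Otimes>\<^sub>M lborel. f (fst p) * g (snd p) = f' (fst p) * g' (snd p)"
  proof -
    obtain N where N: "{x. f x \<noteq> f' x} \<subseteq> N" "N \<in> null_sets lborel"
      using f'(2) by (auto elim: AE_E simp: null_sets_def)
    obtain M where M: "{x. g x \<noteq> g' x} \<subseteq> M" "M \<in> null_sets lborel"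
      using g'(2) by (auto elim: AE_E simp: null_sets_def)
    have ae0: "AE p in lborel \<Otimes>\<^sub>M lborel. fst p \<notin> N \<and> snd p \<notin> M"
    proof (rule lborel_pair.AE_pair_measure)
      have [measurable]: "N \<in> sets lborel" "M \<in> sets lborel" using N M by auto
      show "{p \<in> space (lborel \<Otimes>\<^sub>M lborel). fst p \<notin> N \<and> snd p \<notin> M} \<in> sets (lborel \<Otimes>\<^sub>M lborel)" by measurable
      show "AE x in lborel. AE y in lborel. fst (x, y) \<notin> N \<and> snd (x, y) \<notin> M"
        using AE_not_in[OF N(2)]
      proof eventually_elim
        case (elim x)
        show ?case using AE_not_in[OF M(2)] by eventually_elim (use elim in simp)
      qed
    qed
    have fN: "f x = f' x" if "x \<notin> N" for x using N(1) that by blast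
    have gM: "g x = g' x" if "x \<notin> M" for x using M(1) that by blast
    from ae0 show ?thesis by (rule eventually_mono) (simp add: fN gM)
  qed
  then have ae: "AE p in lebesgue. complex_of_real (f' (fst p) * g' (snd p)) = complex_of_real (f (fst p) * g (snd p))"
    unfolding AE_lebesgue_iff lborel_prod by (rule eventually_mono) (simp only:)
  have "integrable lebesgue (\<lambda>p. complex_of_real (f (fst p) * g (snd p)))"
    by (rule integrable_cong_AE_lebesgue[OF _ ae]) (simp only: complex_of_real_integrable_eq I)
  then show ?thesis by (simp only: complex_of_real_integrable_eq)
qed

text \<open>Cauchy-Schwarz against the indicator of the interval, carried out with classes in
  \<open>l2\<close>.\<close>

lemma integral_cmod_zext_le:
  assumes f: "sqint f" and ab: "a \<le> b"
  shows "(LINT x|lebesgue. cmod (zext a b f x))\<^sup>2 \<le> (b - a) * sqn f"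
proof -
  define h where "h = (\<lambda>x. complex_of_real (cmod (zext a b f x)))"
  have mh: "h \<in> borel_measurable lebesgue" unfolding h_def
    using sqint_measurable[OF sqint_zext[OF f, of a b]] by measurable
  have h: "sqint h"
    by (rule sqint_bound[OF mh sqint_integrable[OF sqint_zext[OF f, of a b]]]) (simp add: h_def)
  define w where "w = zext a b (\<lambda>_. 1)"
  have w: "sqint w" using L2_const[of a b 1] by (simp add: L2_iff w_def)
  have "inner (cls h) (cls w) = Re (LINT x|lebesgue. h x * cnj (w x))" by (rule inner_cls[OF h w])
  also have "(LINT x|lebesgue. h x * cnj (w x)) = (LINT x|lebesgue. complex_of_real (cmod (zext a b f x)))"
    by (intro Bochner_Integration.integral_cong refl) (auto simp: h_def w_def zext_def split: split_indicator)
  finally have 1: "inner (cls h) (cls w) = (LINT x|lebesgue. cmod (zext a b f x))"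
    by (simp only: integral_complex_of_real Re_complex_of_real)
  have 2: "inner (cls w) (cls w) = b - a"
  proof -
    have "inner (cls w) (cls w) = (LINT x|lebesgue. indicator {a<..<b} x)"
      unfolding power2_norm_eq_inner[symmetric] norm_cls[OF w]
      by (intro Bochner_Integration.integral_cong refl) (auto simp: w_def zext_def split: split_indicator)
    then show ?thesis using ab by simp
  qed
  have "sqn (zext a b f) \<le> sqn f"
    unfolding sqn_def
    by (intro Bochner_Integration.integral_mono sqint_integrable sqint_zext f) (auto simp: zext_def split: split_indicator)
  then have 3: "inner (cls h) (cls h) \<le> sqn f"
    unfolding power2_norm_eq_inner[symmetric] norm_cls[OF h] by (simp add: h_def sqn_def)
  have "(inner (cls h) (cls w))\<^sup>2 \<le> inner (cls h) (cls h) * inner (cls w) (cls w)" by (rule Cauchy_Schwarz_ineq)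
  also have "\<dots> \<le> sqn f * (b - a)" unfolding 2 using 3 ab by (intro mult_right_mono) auto
  finally show ?thesis unfolding 1 by (simp add: mult.commute)
qed

text \<open>Hoelder continuity of exponent 1/2; applied to slices, it is the source of the
  continuity of traces in the delay variable.\<close>

lemma prim_increment_le:
  assumes f: "sqint f" and i: "integrable lebesgue f" and xy: "y \<le> x"
  shows "(cmod (prim f x - prim f y))\<^sup>2 \<le> (x - y) * sqn f"
proof -
  have "prim f x - prim f y = (LINT t|lebesgue. indicator {..<x} t *\<^sub>R f t - indicator {..<y} t *\<^sub>R f t)"
    unfolding prim_def by (intro Bochner_Integration.integral_diff[symmetric] integrable_indicator i)
  also have "\<dots> = (LINT t|lebesgue. zext y x f t)"
  proof (rule integral_cong_AE_lebesgue)
    show "AE t in lebesgue. indicator {..<x} t *\<^sub>R f t - indicator {..<y} t *\<^sub>R f t = zext y x f t"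
      unfolding AE_lebesgue_iff using AE_lborel_singleton[of y]
      by eventually_elim (use xy in \<open>auto simp: zext_def split: split_indicator\<close>)
  qed
  also have "cmod (LINT t|lebesgue. zext y x f t) \<le> (LINT t|lebesgue. cmod (zext y x f t))"
    by (rule integral_norm_bound)
  finally have "(cmod (prim f x - prim f y))\<^sup>2 \<le> (LINT t|lebesgue. cmod (zext y x f t))\<^sup>2" by (rule power_mono) simp
  also have "\<dots> \<le> (x - y) * sqn f" by (rule integral_cmod_zext_le[OF f xy])
  finally show ?thesis .
qed

lemma prim_le:
  assumes f: "sqint f" and o: "\<And>t. t \<notin> {a<..<b} \<Longrightarrow> f t = 0" and ab: "a \<le> b"
  shows "(cmod (prim f x))\<^sup>2 \<le> (b - a) * sqn f"
proof -
  have i: "integrable lebesgue f" by (rule sqint_supported_integrable[OF f o])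
  have z: "zext a b f = f" using o by (auto simp: fun_eq_iff zext_def split: split_indicator)
  have "(cmod (prim f x))\<^sup>2 \<le> (LINT t|lebesgue. cmod (zext a b f t))\<^sup>2"
    unfolding z by (intro power_mono prim_bound i) simp
  also have "\<dots> \<le> (b - a) * sqn f" by (rule integral_cmod_zext_le[OF f ab])
  finally show ?thesis .
qed

lemma measurable_prim_slice:
  fixes F :: "real \<times> real \<Rightarrow> complex"
  assumes F: "F \<in> borel_measurable borel"
  shows "(\<lambda>p. prim (\<lambda>s. F (fst p, s)) (snd p)) \<in> borel_measurable borel"
    "(\<lambda>p. prim (\<lambda>t. F (t, snd p)) (fst p)) \<in> borel_measurable borel"
proof -
  have "F \<in> borel_measurable (borel \<Otimes>\<^sub>M borel)" using F by (simp add: borel_prod)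
  note [measurable] = this
  have m: "(\<lambda>s. F (x, s)) \<in> borel_measurable borel" "(\<lambda>t. F (t, r)) \<in> borel_measurable borel" for x r by measurable
  have "(\<lambda>p. prim (\<lambda>s. F (fst p, s)) (snd p)) = (\<lambda>p. LINT s|lborel. (if s < snd p then F (fst p, s) else 0))"
    by (auto simp: fun_eq_iff prim_lborel[OF m(1)] intro!: Bochner_Integration.integral_cong)
  also have "\<dots> \<in> borel_measurable (borel \<Otimes>\<^sub>M borel)" by measurable
  finally show "(\<lambda>p. prim (\<lambda>s. F (fst p, s)) (snd p)) \<in> borel_measurable borel" by (simp add: borel_prod)
  have "(\<lambda>p. prim (\<lambda>t. F (t, snd p)) (fst p)) = (\<lambda>p. LINT t|lborel. (if t < fst p then F (t, snd p) else 0))"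
    by (auto simp: fun_eq_iff prim_lborel[OF m(2)] intro!: Bochner_Integration.integral_cong)
  also have "\<dots> \<in> borel_measurable (borel \<Otimes>\<^sub>M borel)" by measurable
  finally show "(\<lambda>p. prim (\<lambda>t. F (t, snd p)) (fst p)) \<in> borel_measurable borel" by (simp add: borel_prod)
qed

section \<open>The delay space\<close>

definition z2 :: "real \<Rightarrow> (real \<Rightarrow> real \<Rightarrow> complex) \<Rightarrow> real \<times> real \<Rightarrow> complex" where
  "z2 b w p = indicator ({0<..<b} \<times> {0<..<1}) p *\<^sub>R w (fst p) (snd p)"

abbreviation Q2 :: "real \<Rightarrow> (real \<times> real) set" where "Q2 b \<equiv> {0<..<b} \<times> {0<..<1}"

lemma Q2_sets: "Q2 b \<in> sets borel" "Q2 b \<in> sets lebesgue"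
proof -
  have "open (Q2 b)" by (intro open_Times) auto
  then show "Q2 b \<in> sets borel" "Q2 b \<in> sets lebesgue" by auto
qed

lemma z2_slice_x: "r \<in> {0<..<1} \<Longrightarrow> (\<lambda>x. z2 b w (x, r)) = zext 0 b (\<lambda>x. w x r)"
  by (auto simp: z2_def zext_def fun_eq_iff split: split_indicator)

lemma z2_out: "p \<notin> Q2 b \<Longrightarrow> z2 b w p = 0"
  by (auto simp: z2_def split: split_indicator)

lemma z2_out1: "x \<notin> {0<..<b} \<Longrightarrow> z2 b w (x, r) = 0" and z2_out2: "r \<notin> {0<..<1} \<Longrightarrow> z2 b w (x, r) = 0"
  by (auto intro!: z2_out)

lemma z2_lincomb: "z2 b (\<lambda>x r. c * w x r + d * w' x r) = (\<lambda>p. c * z2 b w p + d * z2 b w' p)"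
  by (auto simp: z2_def fun_eq_iff split: split_indicator)

lemma z2_id: "(\<And>p. p \<notin> Q2 b \<Longrightarrow> F p = 0) \<Longrightarrow> z2 b (\<lambda>x r. F (x, r)) = F"
  by (auto simp: z2_def fun_eq_iff split: split_indicator)

lemma z2_measurable:
  assumes "(\<lambda>(x, r). w x r) \<in> borel_measurable lebesgue" shows "z2 b w \<in> borel_measurable lebesgue"
proof -
  have "z2 b w = (\<lambda>p. indicator (Q2 b) p *\<^sub>R (case p of (x, r) \<Rightarrow> w x r))" by (auto simp: z2_def fun_eq_iff)
  also have "\<dots> \<in> borel_measurable lebesgue"
    using Q2_sets by (intro borel_measurable_scaleR assms borel_measurable_indicator)
  finally show ?thesis .
qed

lemma integrable_indicator_Ioo: "integrable lebesgue (indicator {a<..<b::real} :: real \<Rightarrow> real)"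
proof (rule integrable_real_indicator)
  show "emeasure lebesgue {a<..<b} < \<infinity>" by (cases "a \<le> b") (simp_all add: emeasure_lborel_Ioo)
qed simp

lemma Q2_indicator: "indicator (Q2 b) p = (indicator {0<..<b} (fst p) * indicator {0<..<1} (snd p) :: real)"
  by (cases p) (auto split: split_indicator)

lemma sqint_integrable_Q2:
  assumes F: "sqint F" and o: "\<And>p. p \<notin> Q2 b \<Longrightarrow> F p = 0" shows "integrable lebesgue F"
proof -
  have "integrable lebesgue (\<lambda>p :: real \<times> real. indicator {0<..<b} (fst p) * indicator {0<..<1} (snd p) :: real)"
    by (rule product_integrable[OF integrable_indicator_Ioo integrable_indicator_Ioo])
  then have I: "integrable lebesgue (indicator (Q2 b) :: _ \<Rightarrow> real)" by (simp only: Q2_indicator[symmetric])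
  have "sqint (\<lambda>p. indicator (Q2 b) p *\<^sub>R (1::complex))"
  proof (rule sqint_bound[OF _ I])
    show "(\<lambda>p. indicator (Q2 b) p *\<^sub>R (1::complex)) \<in> borel_measurable lebesgue"
      using Q2_sets by (intro borel_measurable_scaleR borel_measurable_indicator borel_measurable_const)
  qed (auto split: split_indicator)
  from sqint_mult_integrable[OF F this] have "integrable lebesgue (\<lambda>p. F p * indicator (Q2 b) p *\<^sub>R (1::complex))" by simp
  moreover have "(\<lambda>p. F p * indicator (Q2 b) p *\<^sub>R (1::complex)) = F"
  proof
    show "F p * indicator (Q2 b) p *\<^sub>R (1::complex) = F p" for p by (cases "p \<in> Q2 b") (simp_all add: o)
  qed
  ultimately show ?thesis by simp
qed

text \<open>A Borel version that still vanishes everywhere off the rectangle. Exact support spares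
  null sets in the primitives along slices, and boundedness of the rectangle gives
  integrability.\<close>

lemma supported_borel_version:
  assumes F: "sqint F" and o: "\<And>p. p \<notin> Q2 b \<Longrightarrow> F p = 0"
  obtains F' where "F' \<in> borel_measurable borel" "sqint F'" "AE p in lebesgue. F p = F' p"
    "\<And>p. p \<notin> Q2 b \<Longrightarrow> F' p = 0" "integrable lebesgue F'"
proof -
  obtain F1 where F1: "F1 \<in> borel_measurable borel" "AE p in lebesgue. F p = F1 p"
    using borel_version[OF sqint_measurable[OF F]] by blast
  define F' where "F' = (\<lambda>p. indicator (Q2 b) p *\<^sub>R F1 p)"
  have m: "F' \<in> borel_measurable borel" unfolding F'_def
    using Q2_sets F1(1) by (intro borel_measurable_scaleR borel_measurable_indicator)
  have ae: "AE p in lebesgue. F p = F' p"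
    using F1(2)
  proof eventually_elim
    case (elim p)
    show ?case by (cases "p \<in> Q2 b") (simp_all add: F'_def elim[symmetric] o)
  qed
  have s: "sqint F'" by (rule sqint_cong_AE[OF F measurable_lebesgueI[OF m] ae])
  have out: "F' p = 0" if "p \<notin> Q2 b" for p using that by (auto simp: F'_def split: split_indicator)
  show ?thesis using that[OF m s ae out sqint_integrable_Q2[OF s out]] by blast
qed

lemma sqint_prim_x:
  assumes b: "b > 0" and m: "F \<in> borel_measurable borel" and F: "sqint F" and o: "\<And>p. p \<notin> Q2 b \<Longrightarrow> F p = 0"
  shows "sqint (\<lambda>p. indicator (Q2 b) p *\<^sub>R prim (\<lambda>t. F (t, snd p)) (fst p))"
proof (rule sqint_bound)
  show "(\<lambda>p. indicator (Q2 b) p *\<^sub>R prim (\<lambda>t. F (t, snd p)) (fst p)) \<in> borel_measurable lebesgue"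
    using Q2_sets measurable_prim_slice[OF m]
    by (intro measurable_lebesgueI borel_measurable_scaleR borel_measurable_indicator)
  show "integrable lebesgue (\<lambda>p. (b * indicator {0<..<b} (fst p)) * sqn (\<lambda>x. F (x, snd p)))"
    by (intro product_integrable integrable_mult_right integrable_indicator_Ioo sqint_slices F)
  show "AE p in lebesgue. (cmod (indicator (Q2 b) p *\<^sub>R prim (\<lambda>t. F (t, snd p)) (fst p)))\<^sup>2
      \<le> (b * indicator {0<..<b} (fst p)) * sqn (\<lambda>x. F (x, snd p))"
    using AE_fst_snd(2)[OF sqint_slices(2)[OF F]]
  proof eventually_elim
    case (elim p)
    have "(cmod (prim (\<lambda>t. F (t, snd p)) (fst p)))\<^sup>2 \<le> (b - 0) * sqn (\<lambda>x. F (x, snd p))"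
      using b o by (intro prim_le[OF elim]) auto
    then show ?case by (cases "p \<in> Q2 b") (auto simp: Q2_indicator b sqn_nonneg less_imp_le split: split_indicator)
  qed
qed

lemma sqint_prim_r:
  assumes m: "F \<in> borel_measurable borel" and F: "sqint F" and o: "\<And>p. p \<notin> Q2 b \<Longrightarrow> F p = 0"
  shows "sqint (\<lambda>p. indicator (Q2 b) p *\<^sub>R prim (\<lambda>s. F (fst p, s)) (snd p))"
proof (rule sqint_bound)
  show "(\<lambda>p. indicator (Q2 b) p *\<^sub>R prim (\<lambda>s. F (fst p, s)) (snd p)) \<in> borel_measurable lebesgue"
    using Q2_sets measurable_prim_slice[OF m]
    by (intro measurable_lebesgueI borel_measurable_scaleR borel_measurable_indicator)
  show "integrable lebesgue (\<lambda>p :: real \<times> real. sqn (\<lambda>s. F (fst p, s)) * indicator {0<..<1} (snd p))"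
    by (intro product_integrable integrable_indicator_Ioo sqint_slices F)
  show "AE p :: real \<times> real in lebesgue. (cmod (indicator (Q2 b) p *\<^sub>R prim (\<lambda>s. F (fst p, s)) (snd p)))\<^sup>2
      \<le> sqn (\<lambda>s. F (fst p, s)) * indicator {0<..<1} (snd p)"
    using AE_fst_snd(1)[OF sqint_slices(1)[OF F]]
  proof eventually_elim
    case (elim p)
    have "(cmod (prim (\<lambda>s. F (fst p, s)) (snd p)))\<^sup>2 \<le> (1 - 0) * sqn (\<lambda>s. F (fst p, s))"
      using o by (intro prim_le[OF elim]) auto
    then show ?case by (cases "p \<in> Q2 b") (auto simp: Q2_indicator sqn_nonneg split: split_indicator)
  qed
qed

text \<open>Reduces the delay space to its derivative: almost every slice is the primitive of the
  derivative from 0, and square integrability of the derivative is the only quantitative condition,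
  that of the function itself following by a Poincare estimate in \<open>x\<close>.\<close>

lemma W_deriv_iff:
  assumes b: "b > 0"
  shows "W_deriv b e w \<longleftrightarrow> (\<lambda>(x, r). e x r) \<in> borel_measurable lebesgue \<and> (\<lambda>(x, r). w x r) \<in> borel_measurable lebesgue \<and>
    sqint (z2 b w) \<and> (AE r in lebesgue. r \<in> {0<..<1} \<longrightarrow> eqon 0 b (\<lambda>x. e x r) (prim (\<lambda>x. z2 b w (x, r))))"
proof
  assume W: "W_deriv b e w"
  have m: "(\<lambda>(x, r). e x r) \<in> borel_measurable lebesgue" "(\<lambda>(x, r). w x r) \<in> borel_measurable lebesgue"
    and ae: "AE r in lebesgue. r \<in> {0<..<1} \<longrightarrow> H1L b (\<lambda>x. e x r) \<and> L2 0 b (\<lambda>x. w x r) \<and> weak_deriv 0 b (\<lambda>x. e x r) (\<lambda>x. w x r)"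
    and I: "integrable lebesgue (\<lambda>p. indicator (Q2 b) p *\<^sub>R (case p of (x, r) \<Rightarrow> (cmod (e x r))\<^sup>2 + (cmod (w x r))\<^sup>2))"
    using W unfolding W_deriv_def set_integrable_def by auto
  have s: "sqint (z2 b w)"
    by (rule sqint_bound[OF z2_measurable[OF m(2)] I]) (auto simp: z2_def split: split_indicator)
  have "AE r in lebesgue. r \<in> {0<..<1} \<longrightarrow> eqon 0 b (\<lambda>x. e x r) (prim (\<lambda>x. z2 b w (x, r)))"
    using ae
  proof eventually_elim
    case (elim r)
    show ?case
    proof
      assume r: "r \<in> {0<..<1}"
      then have h: "H1L b (\<lambda>x. e x r)" "L2 0 b (\<lambda>x. w x r)" "weak_deriv 0 b (\<lambda>x. e x r) (\<lambda>x. w x r)" using elim by auto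
      obtain c where c: "eqon 0 b (\<lambda>x. e x r) (\<lambda>x. c + prim (zext 0 b (\<lambda>x. w x r)) x)"
        using weak_deriv_imp_prim[OF b H1_L2[OF H1L_H1[OF h(1)]] h(2,3)] by blast
      obtain p where p: "L2 0 b p" "eqon 0 b (\<lambda>x. e x r) (prim (zext 0 b p))" using h(1) unfolding H1L_iff[OF b] by blast
      have "c = 0"
        by (rule L2_deriv_unique(1)[OF b h(2) p(1), of c 0]) (use eqon_trans[OF eqon_sym[OF c] p(2)] in simp)
      then show "eqon 0 b (\<lambda>x. e x r) (prim (\<lambda>x. z2 b w (x, r)))" using c by (simp add: z2_slice_x[OF r])
    qed
  qed
  then show "(\<lambda>(x, r). e x r) \<in> borel_measurable lebesgue \<and> (\<lambda>(x, r). w x r) \<in> borel_measurable lebesgue \<and>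
    sqint (z2 b w) \<and> (AE r in lebesgue. r \<in> {0<..<1} \<longrightarrow> eqon 0 b (\<lambda>x. e x r) (prim (\<lambda>x. z2 b w (x, r))))"
    using m s by blast
next
  assume "(\<lambda>(x, r). e x r) \<in> borel_measurable lebesgue \<and> (\<lambda>(x, r). w x r) \<in> borel_measurable lebesgue \<and>
    sqint (z2 b w) \<and> (AE r in lebesgue. r \<in> {0<..<1} \<longrightarrow> eqon 0 b (\<lambda>x. e x r) (prim (\<lambda>x. z2 b w (x, r))))"
  then have m: "(\<lambda>(x, r). e x r) \<in> borel_measurable lebesgue" "(\<lambda>(x, r). w x r) \<in> borel_measurable lebesgue"
    and s: "sqint (z2 b w)"
    and ae: "AE r in lebesgue. r \<in> {0<..<1} \<longrightarrow> eqon 0 b (\<lambda>x. e x r) (prim (\<lambda>x. z2 b w (x, r)))" by auto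
  have 1: "AE r in lebesgue. r \<in> {0<..<1} \<longrightarrow> H1L b (\<lambda>x. e x r) \<and> L2 0 b (\<lambda>x. w x r) \<and> weak_deriv 0 b (\<lambda>x. e x r) (\<lambda>x. w x r)"
    using ae sqint_slices(2)[OF s]
  proof eventually_elim
    case (elim r)
    show ?case
    proof
      assume r: "r \<in> {0<..<1}"
      have l: "L2 0 b (\<lambda>x. w x r)" using elim(2) unfolding z2_slice_x[OF r] L2_iff .
      have e: "eqon 0 b (\<lambda>x. e x r) (prim (zext 0 b (\<lambda>x. w x r)))" using elim(1) r by (simp only: z2_slice_x[OF r])
      have "weak_deriv 0 b (\<lambda>x. 0 + prim (zext 0 b (\<lambda>x. w x r)) x) (\<lambda>x. w x r)"
        by (rule weak_deriv_prim[OF L2_integrable[OF l]])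
      then have "weak_deriv 0 b (\<lambda>x. e x r) (\<lambda>x. w x r)"
        by (rule weak_deriv_cong) (use eqon_sym[OF e] in simp_all)
      then show "H1L b (\<lambda>x. e x r) \<and> L2 0 b (\<lambda>x. w x r) \<and> weak_deriv 0 b (\<lambda>x. e x r) (\<lambda>x. w x r)"
        using l e H1L_iff[OF b] by blast
    qed
  qed
  obtain F where F: "F \<in> borel_measurable borel" "sqint F" "AE p in lebesgue. z2 b w p = F p" "\<And>p. p \<notin> Q2 b \<Longrightarrow> F p = 0" "integrable lebesgue F"
    using supported_borel_version[OF s z2_out] by blast
  \<comment> \<open>The primitive in \<open>x\<close> of a Borel version of the derivative. It is
    square integrable by \<open>sqint_prim_x\<close> and agrees with \<open>z2 b e\<close> on almost
    every slice.\<close>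
  define E where "E = (\<lambda>p. indicator (Q2 b) p *\<^sub>R prim (\<lambda>t. F (t, snd p)) (fst p))"
  have E: "sqint E" unfolding E_def by (rule sqint_prim_x[OF b F(1,2,4)])
  have "AE p in lebesgue. E p = z2 b e p"
  proof (rule AE_eq_from_slices[OF sqint_measurable[OF E] z2_measurable[OF m(1)]], rule disjI2)
    show "AE r in lebesgue. AE x in lebesgue. E (x, r) = z2 b e (x, r)"
      using ae AE_slices(2)[OF F(3)]
    proof eventually_elim
      case (elim r)
      show ?case
      proof (cases "r \<in> {0<..<1}")
        case True
        have "prim (\<lambda>t. F (t, r)) = prim (\<lambda>x. z2 b w (x, r))" using prim_cong_AE[OF elim(2)] by simp
        moreover have "eqon 0 b (\<lambda>x. e x r) (prim (\<lambda>x. z2 b w (x, r)))" using elim(1) True by blast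
        ultimately show ?thesis
          by (auto simp: E_def z2_def split: split_indicator elim!: eventually_mono)
      qed (simp add: E_def z2_def)
    qed
  qed
  then have e2: "sqint (z2 b e)" by (rule sqint_cong_AE[OF E z2_measurable[OF m(1)]])
  have "integrable lebesgue (\<lambda>p. (cmod (z2 b e p))\<^sup>2 + (cmod (z2 b w p))\<^sup>2)"
    by (intro Bochner_Integration.integrable_add sqint_integrable e2 s)
  moreover have "(\<lambda>p. (cmod (z2 b e p))\<^sup>2 + (cmod (z2 b w p))\<^sup>2) =
    (\<lambda>p. indicator (Q2 b) p *\<^sub>R (case p of (x, r) \<Rightarrow> (cmod (e x r))\<^sup>2 + (cmod (w x r))\<^sup>2))"
    by (auto simp: fun_eq_iff z2_def split: split_indicator)
  ultimately have I: "set_integrable lebesgue (Q2 b) (\<lambda>(x, r). (cmod (e x r))\<^sup>2 + (cmod (w x r))\<^sup>2)"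
    unfolding set_integrable_def by simp
  show "W_deriv b e w" unfolding W_deriv_def using m 1 I by blast
qed

lemma W_deriv_sqint: "b > 0 \<Longrightarrow> W_deriv b e w \<Longrightarrow> sqint (z2 b w)"
  by (simp add: W_deriv_iff)

lemma sqint_slice_L2: "sqint (\<lambda>x. z2 b w (x, r)) \<Longrightarrow> r \<in> {0<..<1} \<Longrightarrow> L2 0 b (\<lambda>x. w x r)"
  by (simp add: L2_iff z2_slice_x)

lemma W_deriv_cong:
  assumes b: "b > 0" and W: "W_deriv b e w" and m: "(\<lambda>(x, r). e' x r) \<in> borel_measurable lebesgue"
    and ae: "AE p in lebesgue. z2 b e p = z2 b e' p"
  shows "W_deriv b e' w"
proof -
  note W' = W[unfolded W_deriv_iff[OF b]]
  have "AE r in lebesgue. r \<in> {0<..<1} \<longrightarrow> eqon 0 b (\<lambda>x. e' x r) (prim (\<lambda>x. z2 b w (x, r)))"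
    using AE_slices(2)[OF ae] W'[THEN conjunct2, THEN conjunct2, THEN conjunct2]
  proof eventually_elim
    case (elim r)
    show ?case
    proof
      assume r: "r \<in> {0<..<1}"
      have "eqon 0 b (\<lambda>x. e' x r) (\<lambda>x. e x r)"
        using elim(1) unfolding eqon_zext z2_slice_x[OF r, symmetric] by (rule eventually_mono) simp
      then show "eqon 0 b (\<lambda>x. e' x r) (prim (\<lambda>x. z2 b w (x, r)))" by (rule eqon_trans[OF _ elim(2)[rule_format, OF r]])
    qed
  qed
  then show ?thesis unfolding W_deriv_iff[OF b] using W' m by blast
qed

lemma W_deriv_unique:
  assumes b: "b > 0" and W: "W_deriv b e w" and W': "W_deriv b e' w'"
    and ae: "AE p in lebesgue. z2 b e p = z2 b e' p"
  shows "AE p in lebesgue. z2 b w p = z2 b w' p"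
proof -
  have m: "(\<lambda>(x, r). e' x r) \<in> borel_measurable lebesgue" using W' by (simp add: W_deriv_def)
  note V = W_deriv_cong[OF b W m ae]
  note s = W_deriv_sqint[OF b V] W_deriv_sqint[OF b W']
  show ?thesis
  proof (rule AE_eq_from_slices[OF s[THEN sqint_measurable]], rule disjI2)
    show "AE r in lebesgue. AE x in lebesgue. z2 b w (x, r) = z2 b w' (x, r)"
      using V[unfolded W_deriv_iff[OF b], THEN conjunct2, THEN conjunct2, THEN conjunct2]
        W'[unfolded W_deriv_iff[OF b], THEN conjunct2, THEN conjunct2, THEN conjunct2]
        sqint_slices(2)[OF s(1)] sqint_slices(2)[OF s(2)]
    proof eventually_elim
      case (elim r)
      show ?case
      proof (cases "r \<in> {0<..<1}")
        case True
        note l = sqint_slice_L2[OF elim(3) True] sqint_slice_L2[OF elim(4) True]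
        have "eqon 0 b (\<lambda>x. 0 + prim (zext 0 b (\<lambda>x. w x r)) x) (\<lambda>x. 0 + prim (zext 0 b (\<lambda>x. w' x r)) x)"
          using eqon_trans[OF eqon_sym[OF elim(1)[rule_format, OF True]] elim(2)[rule_format, OF True]]
          by (simp add: z2_slice_x[OF True])
        from L2_deriv_unique(2)[OF b l this] show ?thesis
          unfolding eqon_zext z2_slice_x[OF True, symmetric] .
      qed (simp add: z2_out2)
    qed
  qed
qed

text \<open>Together with \<open>W_deriv_unique\<close> this makes a delay state and its
  x-derivative interchangeable, so that \<open>\<eta>\<close> can be represented by
  \<open>\<eta>\<close> differentiated in \<open>x\<close>.\<close>

lemma W_deriv_determines:
  assumes b: "b > 0" and W: "W_deriv b e w" and W': "W_deriv b e' w'"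
    and ae: "AE p in lebesgue. z2 b w p = z2 b w' p"
  shows "AE p in lebesgue. z2 b e p = z2 b e' p"
proof (rule AE_eq_from_slices)
  show "z2 b e \<in> borel_measurable lebesgue" "z2 b e' \<in> borel_measurable lebesgue"
    using W W' by (auto intro: z2_measurable simp: W_deriv_def)
  show "(AE x in lebesgue. AE r in lebesgue. z2 b e (x, r) = z2 b e' (x, r)) \<or> (AE r in lebesgue. AE x in lebesgue. z2 b e (x, r) = z2 b e' (x, r))"
  proof (rule disjI2)
    show "AE r in lebesgue. AE x in lebesgue. z2 b e (x, r) = z2 b e' (x, r)"
      using W[unfolded W_deriv_iff[OF b], THEN conjunct2, THEN conjunct2, THEN conjunct2]
        W'[unfolded W_deriv_iff[OF b], THEN conjunct2, THEN conjunct2, THEN conjunct2] AE_slices(2)[OF ae]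
    proof eventually_elim
      case (elim r)
      show ?case
      proof (cases "r \<in> {0<..<1}")
        case True
        have "eqon 0 b (\<lambda>x. e x r) (\<lambda>x. e' x r)"
          using eqon_trans[OF elim(1)[rule_format, OF True] eqon_sym] elim(2)[rule_format, OF True] prim_cong_AE[OF elim(3)]
          by (simp add: eqon_sym)
        then show ?thesis unfolding eqon_zext z2_slice_x[OF True, symmetric] .
      qed (simp add: z2_out2)
    qed
  qed
qed

lemma Wx_W_deriv: "Wmem b e \<Longrightarrow> W_deriv b e (Wx b e)"
  using someI_ex[of "W_deriv b e"] unfolding Wmem_def Wx_def by simp

lemma Wx_unique: "b > 0 \<Longrightarrow> W_deriv b e w \<Longrightarrow> AE p in lebesgue. z2 b (Wx b e) p = z2 b w p"
proof -
  assume b: "b > 0" and W: "W_deriv b e w"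
  have "Wmem b e" using W by (auto simp: Wmem_def)
  from W_deriv_unique[OF b Wx_W_deriv[OF this] W] show ?thesis by simp
qed

lemma W_deriv_lincomb:
  assumes b: "b > 0" and W: "W_deriv b e w" and W': "W_deriv b e' w'"
  shows "W_deriv b (\<lambda>x r. c * e x r + d * e' x r) (\<lambda>x r. c * w x r + d * w' x r)"
  unfolding W_deriv_iff[OF b]
proof (intro conjI)
  note V = W[unfolded W_deriv_iff[OF b]] and V' = W'[unfolded W_deriv_iff[OF b]]
  have lin: "(\<lambda>(x, r). c * f x r + d * g x r) \<in> borel_measurable lebesgue"
    if "(\<lambda>(x, r). f x r) \<in> borel_measurable lebesgue" "(\<lambda>(x, r). g x r) \<in> borel_measurable lebesgue" for f g :: "real \<Rightarrow> real \<Rightarrow> complex"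
  proof -
    have "(\<lambda>p. c * (case p of (x, r) \<Rightarrow> f x r) + d * (case p of (x, r) \<Rightarrow> g x r)) \<in> borel_measurable lebesgue"
      by (intro borel_measurable_add borel_measurable_times that borel_measurable_const)
    then show ?thesis by (simp add: case_prod_unfold)
  qed
  show "(\<lambda>(x, r). c * e x r + d * e' x r) \<in> borel_measurable lebesgue"
    "(\<lambda>(x, r). c * w x r + d * w' x r) \<in> borel_measurable lebesgue" using V V' by (intro lin; blast)+
  show "sqint (z2 b (\<lambda>x r. c * w x r + d * w' x r))"
    unfolding z2_lincomb using V V' by (intro sqint_add sqint_cmult) auto
  show "AE r in lebesgue. r \<in> {0<..<1} \<longrightarrow> eqon 0 b (\<lambda>x. c * e x r + d * e' x r) (prim (\<lambda>x. z2 b (\<lambda>x r. c * w x r + d * w' x r) (x, r)))"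
    using V[THEN conjunct2, THEN conjunct2, THEN conjunct2] V'[THEN conjunct2, THEN conjunct2, THEN conjunct2]
      sqint_slices(2)[OF W_deriv_sqint[OF b W]] sqint_slices(2)[OF W_deriv_sqint[OF b W']]
  proof eventually_elim
    case (elim r)
    show ?case
    proof
      assume r: "r \<in> {0<..<1}"
      have i: "integrable lebesgue (\<lambda>x. z2 b w (x, r))" "integrable lebesgue (\<lambda>x. z2 b w' (x, r))"
        by (rule sqint_supported_integrable[OF elim(3) z2_out1], simp)
          (rule sqint_supported_integrable[OF elim(4) z2_out1], simp)
      have P: "prim (\<lambda>x. c * z2 b w (x, r) + d * z2 b w' (x, r)) x = c * prim (\<lambda>x. z2 b w (x, r)) x + d * prim (\<lambda>x. z2 b w' (x, r)) x" for x
        using i by (subst prim_add) (auto simp: prim_cmult)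
      show "eqon 0 b (\<lambda>x. c * e x r + d * e' x r) (prim (\<lambda>x. z2 b (\<lambda>x r. c * w x r + d * w' x r) (x, r)))"
        unfolding z2_lincomb P using elim(1)[rule_format, OF r] elim(2)[rule_format, OF r] by eventually_elim auto
    qed
  qed
qed

lemma W_construct:
  assumes b: "b > 0" and F: "sqint F" and o: "\<And>p. p \<notin> Q2 b \<Longrightarrow> F p = 0"
  obtains e w where "W_deriv b e w" "AE p in lebesgue. z2 b w p = F p"
proof -
  obtain F' where F': "F' \<in> borel_measurable borel" "sqint F'" "AE p in lebesgue. F p = F' p" "\<And>p. p \<notin> Q2 b \<Longrightarrow> F' p = 0" "integrable lebesgue F'"
    using supported_borel_version[OF F o] by blast
  have z: "z2 b (\<lambda>x r. F' (x, r)) = F'" by (rule z2_id[OF F'(4)])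
  have "W_deriv b (\<lambda>x r. prim (\<lambda>t. F' (t, r)) x) (\<lambda>x r. F' (x, r))"
    unfolding W_deriv_iff[OF b] z
    using measurable_lebesgueI[OF measurable_prim_slice(2)[OF F'(1)]] measurable_lebesgueI[OF F'(1)] F'(2)
    by (simp add: case_prod_unfold)
  moreover have "AE p in lebesgue. z2 b (\<lambda>x r. F' (x, r)) p = F p"
    unfolding z using F'(3) by (rule eventually_mono) simp
  ultimately show ?thesis by (rule that)
qed

section \<open>The derivative in the delay variable\<close>

text \<open>Fubini on the product of a half line in \<open>x\<close> with the whole
  \<open>r\<close>-axis: averaging in the delay variable commutes with the primitive in
  \<open>x\<close>.\<close>

lemma bounded_mult_prim_swap:
  fixes F :: "real \<times> real \<Rightarrow> complex" and h :: "real \<Rightarrow> complex"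
  assumes F: "integrable lebesgue F" and hm: "h \<in> borel_measurable borel" and hb: "\<And>r. cmod (h r) \<le> M"
  shows "(LINT r|lebesgue. h r * prim (\<lambda>t. F (t, r)) x) = prim (\<lambda>t. LINT r|lebesgue. h r * F (t, r)) x"
    "integrable lebesgue (\<lambda>t. LINT r|lebesgue. h r * F (t, r))"
    "AE x in lebesgue. integrable lebesgue (\<lambda>r. h r * F (x, r))"
proof -
  have hm2: "(\<lambda>p :: real \<times> real. h (snd p)) \<in> borel_measurable lebesgue"
  proof (rule measurable_lebesgueI)
    have "(\<lambda>p :: real \<times> real. h (snd p)) \<in> borel_measurable (borel \<Otimes>\<^sub>M borel)" using hm by measurable
    then show "(\<lambda>p :: real \<times> real. h (snd p)) \<in> borel_measurable borel" by (simp add: borel_prod)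
  qed
  have hF: "integrable lebesgue (\<lambda>p. h (snd p) * F p)" by (rule bounded_mult_integrable[OF hm2 hb F])
  show "integrable lebesgue (\<lambda>t. LINT r|lebesgue. h r * F (t, r))" using integral_slices(3)[OF hF] by simp
  show "AE x in lebesgue. integrable lebesgue (\<lambda>r. h r * F (x, r))" using integral_slices(1)[OF hF] by simp
  define K where "K = (\<lambda>p. indicator ({..<x} \<times> UNIV) p *\<^sub>R (h (snd p) * F p))"
  have "open ({..<x} \<times> (UNIV :: real set))" by (intro open_Times) auto
  then have S: "{..<x} \<times> (UNIV :: real set) \<in> sets lebesgue" by simp
  have K: "integrable lebesgue K" unfolding K_def by (rule integrable_mult_indicator[OF S hF])
  have 1: "K (t, r) = indicator {..<x} t *\<^sub>R (h r * F (t, r))" for t r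
    by (auto simp: K_def split: split_indicator)
  have "(LINT r|lebesgue. h r * prim (\<lambda>t. F (t, r)) x) = (LINT r|lebesgue. LINT t|lebesgue. K (t, r))"
    unfolding 1 prim_def integral_mult_right_zero[symmetric] mult_scaleR_right ..
  also have "\<dots> = (LINT t|lebesgue. LINT r|lebesgue. K (t, r))"
    using integral_slices(5,6)[OF K] by simp
  also have "\<dots> = prim (\<lambda>t. LINT r|lebesgue. h r * F (t, r)) x"
    unfolding 1 prim_def by simp
  finally show "(LINT r|lebesgue. h r * prim (\<lambda>t. F (t, r)) x) = prim (\<lambda>t. LINT r|lebesgue. h r * F (t, r)) x" .
qed

lemma test_fun_bounds:
  assumes t: "test_fun a b phi"
  obtains M where "(\<lambda>x. complex_of_real (phi x)) \<in> borel_measurable borel" "(\<lambda>x. complex_of_real (deriv phi x)) \<in> borel_measurable borel"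
    "\<And>x. cmod (complex_of_real (phi x)) \<le> M" "\<And>x. cmod (complex_of_real (deriv phi x)) \<le> M"
    "\<And>x. x \<notin> {a<..<b} \<Longrightarrow> phi x = 0"
proof -
  have sm: "smooth phi" using t by (simp add: test_fun_def smooth_def)
  have out: "phi x = 0" if "x \<notin> {a<..<b}" for x using t that by (force simp: test_fun_def)
  have D: "deriv phi x = 0" if "x \<notin> {a<..<b}" for x using test_fun_prim(4)[OF t that] by simp
  have bd: "\<exists>M. \<forall>x. \<bar>f x\<bar> \<le> M" if f: "continuous_on UNIV f" and o: "\<And>x. x \<notin> {a<..<b} \<Longrightarrow> f x = 0" for f :: "real \<Rightarrow> real"
  proof -
    have cont: "continuous_on {a..b} f" using f continuous_on_subset by blast
    obtain M where M: "\<forall>y\<in>f ` {a..b}. norm y \<le> M"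
      using compact_imp_bounded[OF compact_continuous_image[OF cont compact_Icc]] unfolding bounded_iff by blast
    have "\<bar>f x\<bar> \<le> max M 0" for x
    proof (cases "x \<in> {a<..<b}")
      case True
      then have "norm (f x) \<le> M" using M by auto
      then show ?thesis by simp
    qed (simp add: o)
    then show ?thesis by blast
  qed
  obtain M1 where M1: "\<forall>x. \<bar>phi x\<bar> \<le> M1" using bd[OF smooth_continuous[OF sm] out] by blast
  obtain M2 where M2: "\<forall>x. \<bar>deriv phi x\<bar> \<le> M2" using bd[OF smooth_continuous[OF smooth_deriv[OF sm]] D] by blast
  show ?thesis
  proof (rule that[of "max M1 M2", OF _ _ _ _ out])
    show "(\<lambda>x. complex_of_real (phi x)) \<in> borel_measurable borel" "(\<lambda>x. complex_of_real (deriv phi x)) \<in> borel_measurable borel"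
      by (intro borel_measurable_continuous_onI continuous_intros smooth_continuous smooth_deriv sm)+
    show "cmod (complex_of_real (phi x)) \<le> max M1 M2" "cmod (complex_of_real (deriv phi x)) \<le> max M1 M2" for x
      using M1 M2 by (auto simp: le_max_iff_disj)
  qed
qed

lemma W_deriv_slice_r:
  assumes b: "b > 0" and W: "W_deriv b e w"
    and Fb: "F \<in> borel_measurable borel" and Fs: "sqint F" and ae: "AE p in lebesgue. z2 b w p = F p" and Fo: "\<And>p. p \<notin> Q2 b \<Longrightarrow> F p = 0"
  shows "AE x in lebesgue. AE r in lebesgue. z2 b e (x, r) = indicator (Q2 b) (x, r) *\<^sub>R prim (\<lambda>t. F (t, r)) x"
proof -
  have m: "(\<lambda>(x, r). prim (\<lambda>t. F (t, r)) x) \<in> borel_measurable lebesgue"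
    using measurable_lebesgueI[OF measurable_prim_slice(2)[OF Fb]] by (simp add: case_prod_unfold)
  have z: "z2 b (\<lambda>x r. F (x, r)) = F" by (rule z2_id[OF Fo])
  have "W_deriv b (\<lambda>x r. prim (\<lambda>t. F (t, r)) x) (\<lambda>x r. F (x, r))"
    unfolding W_deriv_iff[OF b] z using m measurable_lebesgueI[OF Fb] Fs by (simp add: case_prod_unfold)
  from W_deriv_determines[OF b W this] ae z
  have "AE p in lebesgue. z2 b e p = z2 b (\<lambda>x r. prim (\<lambda>t. F (t, r)) x) p" by simp
  from AE_slices(1)[OF this] show ?thesis by (simp add: z2_def)
qed

text \<open>Moves the tested equation from \<open>\<eta>\<close> to its x-derivative. Testing in the
  delay variable commutes with the primitive in \<open>x\<close>, so the equation for
  \<open>\<eta>\<close> says that the primitives of two integrable functions coincide on the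
  interval, which forces the functions to coincide.\<close>

lemma rho_equation_iff:
  assumes b: "b > 0" and W: "W_deriv b e w" and Z: "W_deriv b ze om"
    and F: "F \<in> borel_measurable borel" "sqint F" "AE p in lebesgue. z2 b w p = F p" "\<And>p. p \<notin> Q2 b \<Longrightarrow> F p = 0" "integrable lebesgue F"
    and G: "G \<in> borel_measurable borel" "sqint G" "AE p in lebesgue. z2 b om p = G p" "\<And>p. p \<notin> Q2 b \<Longrightarrow> G p = 0" "integrable lebesgue G"
    and t: "test_fun 0 1 phi"
  shows "(AE x in lebesgue. x \<in> {0<..<b} \<longrightarrow>
          (LINT r:{0<..<1}|lebesgue. complex_of_real (deriv phi r) * e x r) =
          - (LINT r:{0<..<1}|lebesgue. complex_of_real (phi r) * ze x r)) \<longleftrightarrow>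
    (AE x in lebesgue. (LINT r|lebesgue. complex_of_real (deriv phi r) * F (x, r)) = - (LINT r|lebesgue. complex_of_real (phi r) * G (x, r)))"
    (is "?L \<longleftrightarrow> ?R")
proof -
  obtain M where M: "(\<lambda>x. complex_of_real (phi x)) \<in> borel_measurable borel" "(\<lambda>x. complex_of_real (deriv phi x)) \<in> borel_measurable borel"
    "\<And>x. cmod (complex_of_real (phi x)) \<le> M" "\<And>x. cmod (complex_of_real (deriv phi x)) \<le> M"
    "\<And>x. x \<notin> {0<..<1} \<Longrightarrow> phi x = 0" by (rule test_fun_bounds[OF t]) blast
  have D0: "deriv phi r = 0" if "r \<notin> {0<..<1}" for r using test_fun_prim(4)[OF t that] by simp
  define kF where "kF = (\<lambda>x. LINT r|lebesgue. complex_of_real (deriv phi r) * F (x, r))"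
  define kG where "kG = (\<lambda>x. LINT r|lebesgue. complex_of_real (phi r) * G (x, r))"
  note sF = bounded_mult_prim_swap[OF F(5) M(2) M(4), folded kF_def]
  note sG = bounded_mult_prim_swap[OF G(5) M(1) M(3), folded kG_def]
  have kF0: "kF x = 0" "kG x = 0" if "x \<notin> {0<..<b}" for x using that F(4) G(4) by (auto simp: kF_def kG_def)
  have gen: "(LINT r:{0<..<1}|lebesgue. h r * u x r) = prim k x"
    if x: "x \<in> {0<..<b}" and ae: "AE r in lebesgue. z2 b u (x, r) = indicator (Q2 b) (x, r) *\<^sub>R prim (\<lambda>t. H (t, r)) x"
      and sw: "(LINT r|lebesgue. h r * prim (\<lambda>t. H (t, r)) x) = prim k x" and h0: "\<And>r. r \<notin> {0<..<1} \<Longrightarrow> h r = 0"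
    for h :: "real \<Rightarrow> complex" and u H k x
  proof -
    have "(LINT r:{0<..<1}|lebesgue. h r * u x r) = (LINT r|lebesgue. h r * prim (\<lambda>t. H (t, r)) x)"
      unfolding set_lebesgue_integral_def
    proof (rule integral_cong_AE_lebesgue, use ae in eventually_elim)
      fix r assume e: "z2 b u (x, r) = indicator (Q2 b) (x, r) *\<^sub>R prim (\<lambda>t. H (t, r)) x"
      show "indicat_real {0<..<1} r *\<^sub>R (h r * u x r) = h r * prim (\<lambda>t. H (t, r)) x"
        using e x h0[of r] by (cases "r \<in> {0<..<1}") (auto simp: z2_def)
    qed
    then show ?thesis using sw by simp
  qed
  have slW: "AE x in lebesgue. AE r in lebesgue. z2 b e (x, r) = indicator (Q2 b) (x, r) *\<^sub>R prim (\<lambda>t. F (t, r)) x"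
    by (rule W_deriv_slice_r[OF b W F(1-3)]) (rule F(4))
  have slZ: "AE x in lebesgue. AE r in lebesgue. z2 b ze (x, r) = indicator (Q2 b) (x, r) *\<^sub>R prim (\<lambda>t. G (t, r)) x"
    by (rule W_deriv_slice_r[OF b Z G(1-3)]) (rule G(4))
  have "?L \<longleftrightarrow> (AE x in lebesgue. x \<in> {0<..<b} \<longrightarrow> prim kF x = - prim kG x)"
  proof -
    have "AE x in lebesgue. (x \<in> {0<..<b} \<longrightarrow>
          (LINT r:{0<..<1}|lebesgue. complex_of_real (deriv phi r) * e x r) =
          - (LINT r:{0<..<1}|lebesgue. complex_of_real (phi r) * ze x r)) \<longleftrightarrow> (x \<in> {0<..<b} \<longrightarrow> prim kF x = - prim kG x)"
      using slW slZ
    proof eventually_elim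
      case (elim x)
      have "(LINT r:{0<..<1}|lebesgue. complex_of_real (deriv phi r) * e x r) = prim kF x" if "x \<in> {0<..<b}"
        by (rule gen[OF that elim(1) sF(1)]) (subst D0, simp_all)
      moreover have "(LINT r:{0<..<1}|lebesgue. complex_of_real (phi r) * ze x r) = prim kG x" if "x \<in> {0<..<b}"
        by (rule gen[OF that elim(2) sG(1)]) (subst M(5), simp_all)
      ultimately show ?case by metis
    qed
    then show ?thesis by (rule eventually_cong) assumption
  qed
  also have "\<dots> \<longleftrightarrow> (AE x in lebesgue. kF x = - kG x)"
  proof
    assume e: "AE x in lebesgue. x \<in> {0<..<b} \<longrightarrow> prim kF x = - prim kG x"
    define k where "k = (\<lambda>x. kF x + kG x)"
    have kI: "integrable lebesgue k" unfolding k_def by (intro Bochner_Integration.integrable_add sF(2) sG(2))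
    have pk: "prim k x = 0" if "x \<in> {0..b}" for x
    proof (rule AE_eq_imp_eq[OF b prim_continuous[OF kI] _ _ that, where q = "\<lambda>_. 0"])
      show "eqon 0 b (prim k) (\<lambda>_. 0)"
        unfolding k_def prim_add[OF sF(2) sG(2)] using e by eventually_elim auto
    qed simp
    have "AE x in lebesgue. k x = 0"
    proof (rule AE_zero_if_rational_increments_zero[OF kI b])
      show "x \<notin> {0<..<b} \<Longrightarrow> k x = 0" for x by (simp add: k_def kF0)
    qed (simp add: pk)
    then show "AE x in lebesgue. kF x = - kG x" by eventually_elim (simp add: k_def add_eq_0_iff2)
  next
    assume "AE x in lebesgue. kF x = - kG x"
    then have "prim kF = prim (\<lambda>x. - kG x)" by (rule prim_cong_AE)
    then show "AE x in lebesgue. x \<in> {0<..<b} \<longrightarrow> prim kF x = - prim kG x" by (simp add: prim_minus)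
  qed
  finally show ?thesis unfolding kF_def kG_def .
qed

text \<open>On almost every line of fixed \<open>x\<close> the derivative equation is an ordinary
  one-dimensional weak equation, solved by the du Bois-Reymond argument. The constant
  \<open>c\<close> depends on \<open>x\<close>; its measurability is settled only in
  \<open>trace_construct\<close>.\<close>

lemma rho_deriv_iff:
  assumes b: "b > 0" and W: "W_deriv b e w" and Z: "W_deriv b ze om"
  shows "rho_deriv b e ze \<longleftrightarrow> (AE x in lebesgue. \<exists>c. eqon 0 1 (\<lambda>r. z2 b w (x, r)) (\<lambda>r. c + prim (\<lambda>s. z2 b om (x, s)) r))"
proof -
  obtain F where F: "F \<in> borel_measurable borel" "sqint F" "AE p in lebesgue. z2 b w p = F p" "\<And>p. p \<notin> Q2 b \<Longrightarrow> F p = 0" "integrable lebesgue F"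
    using supported_borel_version[OF W_deriv_sqint[OF b W] z2_out] by blast
  obtain G where G: "G \<in> borel_measurable borel" "sqint G" "AE p in lebesgue. z2 b om p = G p" "\<And>p. p \<notin> Q2 b \<Longrightarrow> G p = 0" "integrable lebesgue G"
    using supported_borel_version[OF W_deriv_sqint[OF b Z] z2_out] by blast
  have Wm: "Wmem b ze" using Z by (auto simp: Wmem_def)
  have out: "F (x, r) = 0" "G (x, r) = 0" if "r \<notin> {0<..<1}" for x r using that F(4) G(4) by auto
  have ver: "(AE x in lebesgue. \<exists>c. eqon 0 1 (\<lambda>r. z2 b w (x, r)) (\<lambda>r. c + prim (\<lambda>s. z2 b om (x, s)) r)) \<longleftrightarrow>
    (AE x in lebesgue. \<exists>c. eqon 0 1 (\<lambda>r. F (x, r)) (\<lambda>r. c + prim (\<lambda>s. G (x, s)) r))"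
  proof (rule eventually_cong)
    show "AE x in lebesgue. (AE r in lebesgue. z2 b w (x, r) = F (x, r)) \<and> (AE r in lebesgue. z2 b om (x, r) = G (x, r))"
      using AE_slices(1)[OF F(3)] AE_slices(1)[OF G(3)] by eventually_elim simp
    fix x assume a: "(AE r in lebesgue. z2 b w (x, r) = F (x, r)) \<and> (AE r in lebesgue. z2 b om (x, r) = G (x, r))"
    have p: "prim (\<lambda>s. z2 b om (x, s)) = prim (\<lambda>s. G (x, s))" by (rule prim_cong_AE[OF conjunct2[OF a]])
    have "eqon 0 1 (\<lambda>r. z2 b w (x, r)) q \<longleftrightarrow> eqon 0 1 (\<lambda>r. F (x, r)) q" for q
      by (rule eventually_cong[OF conjunct1[OF a]]) simp
    then show "(\<exists>c. eqon 0 1 (\<lambda>r. z2 b w (x, r)) (\<lambda>r. c + prim (\<lambda>s. z2 b om (x, s)) r)) \<longleftrightarrow>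
      (\<exists>c. eqon 0 1 (\<lambda>r. F (x, r)) (\<lambda>r. c + prim (\<lambda>s. G (x, s)) r))" unfolding p by simp
  qed
  show ?thesis unfolding ver
  proof
    assume R: "rho_deriv b e ze"
    have "AE x in lebesgue. \<forall>phi\<in>test_family 0 1.
      (LINT r|lebesgue. complex_of_real (deriv phi r) * F (x, r)) = - (LINT r|lebesgue. complex_of_real (phi r) * G (x, r))"
    proof (subst AE_ball_countable[OF countable_test_family], intro ballI)
      fix phi assume "phi \<in> test_family 0 1"
      then have t: "test_fun 0 1 phi" by (rule test_family_test_fun)
      show "AE x in lebesgue. (LINT r|lebesgue. complex_of_real (deriv phi r) * F (x, r)) = - (LINT r|lebesgue. complex_of_real (phi r) * G (x, r))"
        using R t rho_equation_iff[OF b W Z F G t, THEN iffD1] unfolding rho_deriv_def by blast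
    qed
    then show "AE x in lebesgue. \<exists>c. eqon 0 1 (\<lambda>r. F (x, r)) (\<lambda>r. c + prim (\<lambda>s. G (x, s)) r)"
      using integral_slices(1)[OF F(5)] integral_slices(1)[OF G(5)]
    proof eventually_elim
      case (elim x)
      show ?case by (rule du_bois_reymond[OF zero_less_one elim(2,3)]) (use out elim(1) in auto)
    qed
  next
    assume c: "AE x in lebesgue. \<exists>c. eqon 0 1 (\<lambda>r. F (x, r)) (\<lambda>r. c + prim (\<lambda>s. G (x, s)) r)"
    show "rho_deriv b e ze" unfolding rho_deriv_def
    proof (intro conjI Wm allI impI)
      fix phi assume t: "test_fun 0 1 phi"
      show "AE x in lebesgue. x \<in> {0<..<b} \<longrightarrow>
          (LINT r:{0<..<1}|lebesgue. complex_of_real (deriv phi r) * e x r) =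
          - (LINT r:{0<..<1}|lebesgue. complex_of_real (phi r) * ze x r)"
        proof (rule rho_equation_iff[OF b W Z F G t, THEN iffD2])
        show "AE x in lebesgue. (LINT r|lebesgue. complex_of_real (deriv phi r) * F (x, r)) = - (LINT r|lebesgue. complex_of_real (phi r) * G (x, r))" using c integral_slices(1)[OF G(5)]
      proof eventually_elim
        case (elim x)
        then obtain c where c: "eqon 0 1 (\<lambda>r. F (x, r)) (\<lambda>r. c + prim (\<lambda>s. G (x, s)) r)" by blast
        have z: "zext 0 1 (\<lambda>s. G (x, s)) = (\<lambda>s. G (x, s))" "zext 0 1 (\<lambda>s. F (x, s)) = (\<lambda>s. F (x, s))"
          using out by (auto simp: zext_def fun_eq_iff split: split_indicator)
        have "weak_deriv 0 1 (\<lambda>r. c + prim (zext 0 1 (\<lambda>s. G (x, s))) r) (\<lambda>s. G (x, s))"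
          by (rule weak_deriv_prim) (simp only: z elim(2))
        then have "weak_deriv 0 1 (\<lambda>r. F (x, r)) (\<lambda>s. G (x, s))"
          by (rule weak_deriv_cong) (use eqon_sym[OF c] z in simp_all)
        then show ?case using t unfolding weak_deriv_iff z by blast
      qed
      qed
    qed
  qed
qed

section \<open>Traces in the delay variable\<close>

text \<open>The embedding of the Sobolev space into a product of \<open>l2\<close> spaces under
  which \<open>h1norm2\<close> is a squared Hilbert norm, so that convergence in
  \<open>trace_rep\<close> becomes continuity of a curve.\<close>

definition hvec :: "real \<Rightarrow> (real \<Rightarrow> complex) \<Rightarrow> real l2 \<times> real l2" where
  "hvec b f = (cls (zext 0 b f), cls (zext 0 b (wd 0 b f)))"

lemma hvec_norm: assumes b: "b > 0" and f: "H1 0 b f" shows "h1norm2 b f = (norm (hvec b f))\<^sup>2"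
proof -
  have s: "sqint (zext 0 b f)" "sqint (zext 0 b (wd 0 b f))"
    using H1_L2[OF f] wd_L2[OF f] by (simp_all add: L2_iff)
  have "h1norm2 b f = (LINT x|lebesgue. (cmod (zext 0 b f x))\<^sup>2 + (cmod (zext 0 b (wd 0 b f) x))\<^sup>2)"
    unfolding h1norm2_def set_lebesgue_integral_def
    by (intro Bochner_Integration.integral_cong refl) (auto simp: zext_def split: split_indicator)
  also have "\<dots> = (norm (cls (zext 0 b f)))\<^sup>2 + (norm (cls (zext 0 b (wd 0 b f))))\<^sup>2"
    unfolding norm_cls[OF s(1)] norm_cls[OF s(2)]
    by (intro Bochner_Integration.integral_add sqint_integrable s)
  finally show ?thesis by (simp add: hvec_def norm_Pair)
qed

lemma cls_zext_cong: "L2 a b f \<Longrightarrow> eqon a b f g \<Longrightarrow> cls (zext a b f) = cls (zext a b g)"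
  unfolding L2_iff eqon_zext using cls_cong_AE measurable_cong_AE_lebesgue sqint_measurable by metis

lemma cls_zext_eqD: "L2 a b f \<Longrightarrow> L2 a b g \<Longrightarrow> cls (zext a b f) = cls (zext a b g) \<Longrightarrow> eqon a b f g"
  unfolding L2_iff eqon_zext by (simp add: cls_eq_iff)

lemma hvec_cong: assumes "b > 0" "H1 0 b f" "eqon 0 b f g" shows "hvec b f = hvec b g"
  unfolding hvec_def
  using cls_zext_cong[OF H1_L2[OF assms(2)] assms(3)] cls_zext_cong[OF wd_L2[OF assms(2)] eqon_sym[OF H1_cong(2)[OF assms]]]
  by simp

lemma H1_diff:
  assumes b: "b > 0" and f: "H1 0 b f" and g: "H1 0 b g"
  shows "H1 0 b (\<lambda>x. f x - g x)" "hvec b (\<lambda>x. f x - g x) = hvec b f - hvec b g"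
proof -
  have l: "H1 0 b (\<lambda>x. 1 * f x + (-1) * g x)" "eqon 0 b (wd 0 b (\<lambda>x. 1 * f x + (-1) * g x)) (\<lambda>x. 1 * wd 0 b f x + (-1) * wd 0 b g x)"
    by (rule H1_lincomb[OF b f g])+
  show h: "H1 0 b (\<lambda>x. f x - g x)" using l(1) by simp
  have w: "eqon 0 b (wd 0 b (\<lambda>x. f x - g x)) (\<lambda>x. wd 0 b f x - wd 0 b g x)" using l(2) by simp
  have s: "sqint (zext 0 b f)" "sqint (zext 0 b g)" "sqint (zext 0 b (wd 0 b f))" "sqint (zext 0 b (wd 0 b g))"
    using H1_L2[OF f] H1_L2[OF g] wd_L2[OF f] wd_L2[OF g] by (simp_all add: L2_iff)
  show "hvec b (\<lambda>x. f x - g x) = hvec b f - hvec b g"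
    unfolding hvec_def cls_zext_cong[OF wd_L2[OF h] w] zext_diff using s by (simp add: cls_diff)
qed

lemma hvec_eqD: "b > 0 \<Longrightarrow> H1 0 b f \<Longrightarrow> H1 0 b g \<Longrightarrow> hvec b f = hvec b g \<Longrightarrow> eqon 0 b f g"
  by (rule cls_zext_eqD[OF H1_L2 H1_L2]) (simp_all add: hvec_def)

lemma AE_eq_continuous_unit:
  fixes p q :: "real \<Rightarrow> 'a::real_normed_vector"
  assumes p: "continuous_on {0..1} p" and q: "continuous_on {0..1} q"
    and e: "AE x in lebesgue. x \<in> {0<..<1} \<longrightarrow> p x = q x" and x: "x \<in> {0..1}"
  shows "p x = q x"
proof -
  define d where "d = (\<lambda>x. complex_of_real (norm (p x - q x)))"
  have "d x = (\<lambda>_. 0) x"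
  proof (rule AE_eq_imp_eq[OF zero_less_one _ _ _ x])
    show "continuous_on {0..1} d" unfolding d_def by (intro continuous_intros p q)
    show "eqon 0 1 d (\<lambda>_. 0)" using e by eventually_elim (simp add: d_def)
  qed simp
  then show ?thesis by (simp add: d_def)
qed

lemma trace_rep_hvec:
  assumes b: "b > 0" and t: "trace_rep b e et" and H: "AE r in lebesgue. r \<in> {0<..<1} \<longrightarrow> H1 0 b (\<lambda>x. e x r)"
  shows "continuous_on {0..1} (\<lambda>r. hvec b (et r))"
    "AE r in lebesgue. r \<in> {0<..<1} \<longrightarrow> hvec b (et r) = hvec b (\<lambda>x. e x r)"
proof -
  have h: "H1 0 b (et r)" if "r \<in> {0..1}" for r using t that by (auto simp: trace_rep_def intro: H1L_H1)
  show "continuous_on {0..1} (\<lambda>r. hvec b (et r))"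
    unfolding continuous_on_def
  proof
    fix r0 :: real assume r0: "r0 \<in> {0..1}"
    have 1: "((\<lambda>r. h1norm2 b (\<lambda>x. et r x - et r0 x)) \<longlongrightarrow> 0) (at r0 within {0..1})"
      using t r0 unfolding trace_rep_def by blast
    have "\<forall>\<^sub>F r in at r0 within {0..1}. r \<in> {0..1}" by (simp add: eventually_at_filter)
    then have ev: "\<forall>\<^sub>F r in at r0 within {0..1}. h1norm2 b (\<lambda>x. et r x - et r0 x) = (norm (hvec b (et r) - hvec b (et r0)))\<^sup>2"
    proof eventually_elim
      case (elim r)
      show ?case using hvec_norm[OF b H1_diff(1)[OF b h[OF elim] h[OF r0]]] H1_diff(2)[OF b h[OF elim] h[OF r0]] by simp
    qed
    have "((\<lambda>r. (norm (hvec b (et r) - hvec b (et r0)))\<^sup>2) \<longlongrightarrow> 0) (at r0 within {0..1})"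
      using 1 tendsto_cong[OF ev] by simp
    then have "((\<lambda>r. sqrt ((norm (hvec b (et r) - hvec b (et r0)))\<^sup>2)) \<longlongrightarrow> sqrt 0) (at r0 within {0..1})"
      by (rule tendsto_real_sqrt)
    then have "((\<lambda>r. hvec b (et r) - hvec b (et r0)) \<longlongrightarrow> 0) (at r0 within {0..1})"
      by (simp add: tendsto_norm_zero_iff)
    then show "((\<lambda>r. hvec b (et r)) \<longlongrightarrow> hvec b (et r0)) (at r0 within {0..1})" by (simp add: LIM_zero_iff)
  qed
  have "AE r in lebesgue. r \<in> {0<..<1} \<longrightarrow> h1norm2 b (\<lambda>x. et r x - e x r) = 0"
    using t by (auto simp: trace_rep_def)
  then show "AE r in lebesgue. r \<in> {0<..<1} \<longrightarrow> hvec b (et r) = hvec b (\<lambda>x. e x r)"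
    using H
  proof eventually_elim
    case (elim r)
    show ?case
    proof
      assume r: "r \<in> {0<..<1}"
      then have "r \<in> {0..1}" by auto
      from hvec_norm[OF b H1_diff(1)[OF b h[OF this]]] H1_diff(2)[OF b h[OF this]] elim r
      show "hvec b (et r) = hvec b (\<lambda>x. e x r)" by simp
    qed
  qed
qed

text \<open>Both representatives are continuous curves in the Sobolev space and agree with
  \<open>e\<close> for almost every parameter, so they agree at every parameter, including the end
  points where traces are taken.\<close>

lemma trace_rep_unique:
  assumes b: "b > 0" and W: "W_deriv b e w" and t: "trace_rep b e et" and t': "trace_rep b e et'" and r: "r \<in> {0..1}"
  shows "eqon 0 b (et r) (et' r)"
proof -
  have H: "AE r in lebesgue. r \<in> {0<..<1} \<longrightarrow> H1 0 b (\<lambda>x. e x r)"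
    using W unfolding W_deriv_def by (auto elim!: eventually_mono intro: H1L_H1)
  note p = trace_rep_hvec[OF b t H] and q = trace_rep_hvec[OF b t' H]
  have "hvec b (et r) = hvec b (et' r)"
    by (rule AE_eq_continuous_unit[OF p(1) q(1) _ r]) (use p(2) q(2) in \<open>eventually_elim, simp\<close>)
  then show ?thesis using t t' r by (intro hvec_eqD[OF b]) (auto simp: trace_rep_def intro: H1L_H1)
qed

text \<open>The trace at \<open>r\<close> has x-derivative \<open>g\<close> plus the primitive in
  the delay variable of the derivative \<open>om\<close>. Its increments are controlled in
  \<open>L2\<close> by Cauchy-Schwarz on each line of fixed \<open>x\<close>, and the primitive in
  \<open>x\<close> carries this control to the Sobolev norm.\<close>

lemma trace_construct:
  assumes b: "b > 0" and W: "W_deriv b e w" and Z: "W_deriv b ze om" and rho: "rho_deriv b e ze"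
  obtains g where "sqint g" "\<And>x. x \<notin> {0<..<b} \<Longrightarrow> g x = 0"
    "AE x in lebesgue. eqon 0 1 (\<lambda>r. z2 b w (x, r)) (\<lambda>r. g x + prim (\<lambda>s. z2 b om (x, s)) r)"
    "\<And>r. r \<in> {0..1} \<Longrightarrow> sqint (\<lambda>x. g x + prim (\<lambda>s. z2 b om (x, s)) r)"
    "trace_rep b e (\<lambda>r. prim (\<lambda>x. g x + prim (\<lambda>s. z2 b om (x, s)) r))"
proof -
  obtain F where F: "F \<in> borel_measurable borel" "sqint F" "AE p in lebesgue. z2 b w p = F p" "\<And>p. p \<notin> Q2 b \<Longrightarrow> F p = 0" "integrable lebesgue F"
    using supported_borel_version[OF W_deriv_sqint[OF b W] z2_out] by blast
  obtain G where G: "G \<in> borel_measurable borel" "sqint G" "AE p in lebesgue. z2 b om p = G p" "\<And>p. p \<notin> Q2 b \<Longrightarrow> G p = 0" "integrable lebesgue G"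
    using supported_borel_version[OF W_deriv_sqint[OF b Z] z2_out] by blast
  have out: "F (x, r) = 0" "G (x, r) = 0" if "r \<notin> {0<..<1}" for x r using that F(4) G(4) by auto
  have out': "F (x, r) = 0" "G (x, r) = 0" if "x \<notin> {0<..<b}" for x r using that F(4) G(4) by auto
  define PG where "PG = (\<lambda>p. indicator (Q2 b) p *\<^sub>R prim (\<lambda>s. G (fst p, s)) (snd p))"
  have PG: "sqint PG" unfolding PG_def by (rule sqint_prim_r[OF G(1,2)]) (rule G(4))
  define D where "D = (\<lambda>p. F p - PG p)"
  have D: "sqint D" unfolding D_def by (intro sqint_diff F PG)
  have Do: "p \<notin> Q2 b \<Longrightarrow> D p = 0" for p using F(4) by (simp add: D_def PG_def)
  have DI: "integrable lebesgue D" by (rule sqint_integrable_Q2[OF D Do])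
  \<comment> \<open>Averaging over the unit interval turns the constant of integration on each line
    into a formula, which makes it measurable and square integrable in \<open>x\<close>. It is the
    x-derivative of the trace at 0.\<close>
  define g where "g = (\<lambda>x. LINT r|lebesgue. D (x, r))"
  have g0: "g x = 0" if "x \<notin> {0<..<b}" for x
  proof -
    have "D (x, r) = 0" for r using that by (intro Do) auto
    then show ?thesis by (simp add: g_def)
  qed
  have gm: "g \<in> borel_measurable lebesgue" unfolding g_def using integral_slices(3)[OF DI] by auto
  have gs: "sqint g"
  proof (rule sqint_bound[OF gm sqint_slices(3)[OF D]])
    show "AE x in lebesgue. (cmod (g x))\<^sup>2 \<le> sqn (\<lambda>r. D (x, r))"
      using sqint_slices(1)[OF D]
    proof eventually_elim
      case (elim x)
      have o: "t \<notin> {0<..<1} \<Longrightarrow> D (x, t) = 0" for t by (rule Do) auto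
      have "g x = prim (\<lambda>r. D (x, r)) 1" unfolding g_def by (rule prim_right[symmetric]) (auto intro: o)
      then show ?case using prim_le[OF elim, of 0 1 1] o by simp
    qed
  qed
  have rel: "AE x in lebesgue. eqon 0 1 (\<lambda>r. F (x, r)) (\<lambda>r. g x + prim (\<lambda>s. G (x, s)) r)"
    using rho[unfolded rho_deriv_iff[OF b W Z]] AE_slices(1)[OF F(3)] AE_slices(1)[OF G(3)]
  proof eventually_elim
    case (elim x)
    then obtain c where c: "eqon 0 1 (\<lambda>r. z2 b w (x, r)) (\<lambda>r. c + prim (\<lambda>s. z2 b om (x, s)) r)" by blast
    have p: "prim (\<lambda>s. z2 b om (x, s)) = prim (\<lambda>s. G (x, s))" by (rule prim_cong_AE[OF elim(3)])
    have c': "eqon 0 1 (\<lambda>r. F (x, r)) (\<lambda>r. c + prim (\<lambda>s. G (x, s)) r)"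
      using c elim(2) unfolding p by eventually_elim simp
    show ?case
    proof (cases "x \<in> {0<..<b}")
      case True
      have "g x = (LINT r|lebesgue. zext 0 1 (\<lambda>_. c) r)" unfolding g_def
      proof (rule integral_cong_AE_lebesgue, use c' in eventually_elim)
        fix r assume "r \<in> {0<..<1} \<longrightarrow> F (x, r) = c + prim (\<lambda>s. G (x, s)) r"
        then show "D (x, r) = zext 0 1 (\<lambda>_. c) r"
          using True out[of r x] by (cases "r \<in> {0<..<1}") (auto simp: D_def PG_def zext_out)
      qed
      also have "\<dots> = c" unfolding zext_def by (simp add: scaleR_conv_of_real)
      finally show ?thesis using c' by simp
    next
      case False
      have "prim (\<lambda>s. G (x, s)) r = 0" for r by (rule prim_left) (simp add: out'[OF False])
      then show ?thesis using False out' g0 by simp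
    qed
  qed
  define Tr where "Tr = (\<lambda>r x. g x + prim (\<lambda>s. G (x, s)) r)"
  have Gb: "AE x in lebesgue. (cmod (prim (\<lambda>s. G (x, s)) r))\<^sup>2 \<le> sqn (\<lambda>s. G (x, s))" for r
    using sqint_slices(1)[OF G(2)]
  proof eventually_elim
    case (elim x) show ?case using prim_le[OF elim, of 0 1 r] out by simp
  qed
  have pm: "(\<lambda>x. prim (\<lambda>s. G (x, s)) r) \<in> borel_measurable lebesgue" for r
  proof (rule measurable_lebesgueI)
    have "(\<lambda>p. prim (\<lambda>s. G (fst p, s)) (snd p)) \<in> borel_measurable (borel \<Otimes>\<^sub>M borel)"
      using measurable_prim_slice(1)[OF G(1)] by (simp add: borel_prod)
    from measurable_compose[OF measurable_Pair2'[of r borel borel] this]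
    show "(\<lambda>x. prim (\<lambda>s. G (x, s)) r) \<in> borel_measurable borel" by simp
  qed
  have ps: "sqint (\<lambda>x. prim (\<lambda>s. G (x, s)) r)" for r
    by (rule sqint_bound[OF pm sqint_slices(3)[OF G(2)] Gb])
  have Ts: "sqint (Tr r)" for r unfolding Tr_def by (intro sqint_add gs ps)
  have To: "Tr r x = 0" if "x \<notin> {0<..<b}" for r x
  proof -
    have "prim (\<lambda>s. G (x, s)) r = 0" by (rule prim_left) (simp add: out'[OF that])
    then show ?thesis using g0[OF that] by (simp add: Tr_def)
  qed
  have Tz: "zext 0 b (Tr r) = Tr r" for r using To by (auto simp: zext_def fun_eq_iff split: split_indicator)
  have TL: "L2 0 b (Tr r)" for r by (rule L2_sqint[OF Ts])
  have TI: "integrable lebesgue (Tr r)" for r by (rule sqint_supported_integrable[OF Ts To])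
  have h: "H1L b (prim (Tr r))" for r unfolding H1L_iff[OF b] using TL[of r] Tz[of r] by (intro exI[of _ "Tr r"]) simp
  have wdT: "eqon 0 b (wd 0 b (prim (Tr r))) (Tr r)" for r
    by (rule prim_H1(2)[OF b TL, of _ 0]) (simp add: Tz)
  have hv: "hvec b (prim (Tr r)) = (cls (zext 0 b (prim (Tr r))), cls (Tr r))" for r
    unfolding hvec_def using cls_zext_cong[OF wd_L2[OF H1L_H1[OF h]] wdT[of r]] by (simp add: Tz)
  \<comment> \<open>\<open>prim_increment_le\<close> on almost every line of fixed \<open>x\<close>,
    integrated over \<open>x\<close>.\<close>
  have inc: "(norm (cls (Tr r) - cls (Tr s)))\<^sup>2 \<le> \<bar>r - s\<bar> * sqn G" for r s
  proof -
    have a: "(norm (cls (Tr r) - cls (Tr s)))\<^sup>2 \<le> (r - s) * sqn G" if "s \<le> r" for r s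
    proof -
      have sd: "sqint (\<lambda>x. Tr r x - Tr s x)" by (intro sqint_diff Ts)
      have "(norm (cls (Tr r) - cls (Tr s)))\<^sup>2 = (LINT x|lebesgue. (cmod (Tr r x - Tr s x))\<^sup>2)"
        unfolding cls_diff[OF Ts Ts, symmetric] by (rule norm_cls[OF sd])
      also have "\<dots> \<le> (LINT x|lebesgue. (r - s) * sqn (\<lambda>s. G (x, s)))"
      proof (rule integral_mono_AE[OF sqint_integrable[OF sd]])
        show "integrable lebesgue (\<lambda>x. (r - s) * sqn (\<lambda>s. G (x, s)))"
          by (intro integrable_mult_right sqint_slices(3)[OF G(2)])
        show "AE x in lebesgue. (cmod (Tr r x - Tr s x))\<^sup>2 \<le> (r - s) * sqn (\<lambda>s. G (x, s))"
          using sqint_slices(1)[OF G(2)]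
        proof eventually_elim
          case (elim x)
          have "integrable lebesgue (\<lambda>s. G (x, s))" by (rule sqint_supported_integrable[OF elim out(2)])
          from prim_increment_le[OF elim this that] show ?case by (simp add: Tr_def)
        qed
      qed
      also have "\<dots> = (r - s) * sqn G" using sqint_slices(5)[OF G(2)] by simp
      finally show ?thesis .
    qed
    show ?thesis using a[of s r] a[of r s] by (cases "s \<le> r") (auto simp: norm_minus_commute abs_if)
  qed
  \<comment> \<open>In the constant \<open>b * b + 1\<close>, the summand \<open>b * b\<close> comes
    from bounding a primitive on an interval of length \<open>b\<close> by its derivative, and 1
    from the derivative itself.\<close>
  have hd: "h1norm2 b (\<lambda>x. prim (Tr r) x - prim (Tr s) x) \<le> (b * b + 1) * (\<bar>r - s\<bar> * sqn G)" for r s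
  proof -
    have sd: "sqint (\<lambda>x. Tr r x - Tr s x)" by (intro sqint_diff Ts)
    have N: "(norm (cls (Tr r) - cls (Tr s)))\<^sup>2 = sqn (\<lambda>x. Tr r x - Tr s x)"
      unfolding cls_diff[OF Ts Ts, symmetric] by (rule sqn_cls[OF sd])
    have pd: "prim (Tr r) x - prim (Tr s) x = prim (\<lambda>x. Tr r x - Tr s x) x" for x
      by (rule prim_diff[OF TI TI, symmetric])
    have sz: "sqint (zext 0 b (prim (Tr r)))" for r using H1_L2[OF H1L_H1[OF h]] by (simp add: L2_iff)
    have 1: "(norm (cls (zext 0 b (prim (Tr r))) - cls (zext 0 b (prim (Tr s)))))\<^sup>2 \<le> b * (b * sqn (\<lambda>x. Tr r x - Tr s x))"
    proof -
      have sz': "sqint (\<lambda>x. zext 0 b (prim (Tr r)) x - zext 0 b (prim (Tr s)) x)" by (intro sqint_diff sz)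
      have "(norm (cls (zext 0 b (prim (Tr r))) - cls (zext 0 b (prim (Tr s)))))\<^sup>2
        = (LINT x|lebesgue. (cmod (zext 0 b (prim (Tr r)) x - zext 0 b (prim (Tr s)) x))\<^sup>2)"
        unfolding cls_diff[OF sz sz, symmetric] by (rule norm_cls[OF sz'])
      also have "\<dots> \<le> (LINT x|lebesgue. indicator {0<..<b} x * (b * sqn (\<lambda>x. Tr r x - Tr s x)))"
      proof (rule integral_mono_AE[OF sqint_integrable[OF sz']])
        show "integrable lebesgue (\<lambda>x. indicator {0<..<b} x * (b * sqn (\<lambda>x. Tr r x - Tr s x)))"
          by (intro integrable_mult_left integrable_indicator_Ioo)
        show "AE x in lebesgue. (cmod (zext 0 b (prim (Tr r)) x - zext 0 b (prim (Tr s)) x))\<^sup>2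
          \<le> indicator {0<..<b} x * (b * sqn (\<lambda>x. Tr r x - Tr s x))"
        proof (rule AE_I2)
          fix x
          have "(cmod (prim (\<lambda>x. Tr r x - Tr s x) x))\<^sup>2 \<le> (b - 0) * sqn (\<lambda>x. Tr r x - Tr s x)"
            by (rule prim_le[OF sd]) (use To b in auto)
          then show "(cmod (zext 0 b (prim (Tr r)) x - zext 0 b (prim (Tr s)) x))\<^sup>2
            \<le> indicator {0<..<b} x * (b * sqn (\<lambda>x. Tr r x - Tr s x))"
            by (cases "x \<in> {0<..<b}") (auto simp: pd zext_out)
        qed
      qed
      also have "\<dots> = b * (b * sqn (\<lambda>x. Tr r x - Tr s x))" using b by simp
      finally show ?thesis .
    qed
    have "h1norm2 b (\<lambda>x. prim (Tr r) x - prim (Tr s) x) = (norm (hvec b (prim (Tr r)) - hvec b (prim (Tr s))))\<^sup>2"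
      using hvec_norm[OF b H1_diff(1)[OF b H1L_H1[OF h] H1L_H1[OF h]]] H1_diff(2)[OF b H1L_H1[OF h] H1L_H1[OF h]] by simp
    also have "\<dots> = (norm (cls (zext 0 b (prim (Tr r))) - cls (zext 0 b (prim (Tr s)))))\<^sup>2 + (norm (cls (Tr r) - cls (Tr s)))\<^sup>2"
      unfolding hv by (simp add: norm_Pair)
    also have "\<dots> \<le> b * (b * sqn (\<lambda>x. Tr r x - Tr s x)) + sqn (\<lambda>x. Tr r x - Tr s x)" using 1 N by simp
    also have "\<dots> = (b * b + 1) * sqn (\<lambda>x. Tr r x - Tr s x)" by (simp add: algebra_simps)
    also have "\<dots> \<le> (b * b + 1) * (\<bar>r - s\<bar> * sqn G)" using inc[of r s] N by (intro mult_left_mono) auto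
    finally show ?thesis .
  qed
  have tr: "trace_rep b e (\<lambda>r. prim (Tr r))"
    unfolding trace_rep_def
  proof (intro conjI ballI h)
    fix r0 :: real assume "r0 \<in> {0..1}"
    show "((\<lambda>r. h1norm2 b (\<lambda>x. prim (Tr r) x - prim (Tr r0) x)) \<longlongrightarrow> 0) (at r0 within {0..1})"
    proof (rule tendsto_sandwich)
      show "\<forall>\<^sub>F r in at r0 within {0..1}. 0 \<le> h1norm2 b (\<lambda>x. prim (Tr r) x - prim (Tr r0) x)"
        using hvec_norm[OF b H1_diff(1)[OF b H1L_H1[OF h] H1L_H1[OF h]]] by simp
      show "\<forall>\<^sub>F r in at r0 within {0..1}. h1norm2 b (\<lambda>x. prim (Tr r) x - prim (Tr r0) x) \<le> (b * b + 1) * (\<bar>r - r0\<bar> * sqn G)"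
        using hd by simp
      have "((\<lambda>r. (b * b + 1) * (\<bar>r - r0\<bar> * sqn G)) \<longlongrightarrow> (b * b + 1) * (\<bar>r0 - r0\<bar> * sqn G)) (at r0 within {0..1})"
        by (intro tendsto_intros)
      then show "((\<lambda>r. (b * b + 1) * (\<bar>r - r0\<bar> * sqn G)) \<longlongrightarrow> 0) (at r0 within {0..1})" by simp
    qed simp
  next
    have DT: "AE p in lebesgue. F p = z2 b (\<lambda>x r. Tr r x) p"
    proof (rule AE_eq_from_slices[OF sqint_measurable[OF F(2)]], rule z2_measurable)
      have "(\<lambda>p :: real \<times> real. g (fst p)) \<in> borel_measurable lebesgue"
      proof -
        obtain g' where g': "g' \<in> borel_measurable borel" "AE x in lebesgue. g x = g' x" using borel_version[OF gm] by blast
        have "(\<lambda>p :: real \<times> real. g' (fst p)) \<in> borel_measurable (borel \<Otimes>\<^sub>M borel)" using g'(1) by measurable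
        then have "(\<lambda>p :: real \<times> real. g' (fst p)) \<in> borel_measurable lebesgue" by (intro measurable_lebesgueI) (simp add: borel_prod)
        moreover have "AE p in lebesgue. g' (fst (p :: real \<times> real)) = g (fst p)"
          using AE_fst_snd(1)[OF g'(2)] by eventually_elim simp
        ultimately show ?thesis by (rule measurable_cong_AE_lebesgue)
      qed
      then have "(\<lambda>p. g (fst p) + prim (\<lambda>s. G (fst p, s)) (snd p)) \<in> borel_measurable lebesgue"
        by (intro borel_measurable_add measurable_lebesgueI[OF measurable_prim_slice(1)[OF G(1)]])
      then show "(\<lambda>(x, r). Tr r x) \<in> borel_measurable lebesgue" by (simp add: Tr_def case_prod_unfold)
      show "(AE x in lebesgue. AE r in lebesgue. F (x, r) = z2 b (\<lambda>x r. Tr r x) (x, r)) \<or>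
        (AE r in lebesgue. AE x in lebesgue. F (x, r) = z2 b (\<lambda>x r. Tr r x) (x, r))"
      proof (rule disjI1, use rel in eventually_elim)
        fix x assume e: "eqon 0 1 (\<lambda>r. F (x, r)) (\<lambda>r. g x + prim (\<lambda>s. G (x, s)) r)"
        show "AE r in lebesgue. F (x, r) = z2 b (\<lambda>x r. Tr r x) (x, r)"
          using e
        proof eventually_elim
          case (elim r)
          then show ?case using F(4)[of "(x, r)"] by (cases "(x, r) \<in> Q2 b") (auto simp: z2_def Tr_def)
        qed
      qed
    qed
    show "AE r in lebesgue. r \<in> {0<..<1} \<longrightarrow> h1norm2 b (\<lambda>x. prim (Tr r) x - e x r) = 0"
      using AE_slices(2)[OF DT] AE_slices(2)[OF F(3)] W[unfolded W_deriv_iff[OF b], THEN conjunct2, THEN conjunct2, THEN conjunct2]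
    proof eventually_elim
      case (elim r)
      show ?case
      proof
        assume r: "r \<in> {0<..<1}"
        have "AE x in lebesgue. z2 b w (x, r) = Tr r x"
          using elim(1,2)
        proof eventually_elim
          case (elim x)
          then show ?case using To[of x r] r by (cases "x \<in> {0<..<b}") (auto simp: z2_def)
        qed
        then have p: "prim (\<lambda>x. z2 b w (x, r)) = prim (Tr r)" by (rule prim_cong_AE)
        have e: "eqon 0 b (\<lambda>x. e x r) (prim (Tr r))" using elim(3) r p by simp
        have he: "H1 0 b (\<lambda>x. e x r)" by (rule H1_cong(1)[OF b H1L_H1[OF h] eqon_sym[OF e]])
        have "hvec b (\<lambda>x. prim (Tr r) x - e x r) = 0"
          using H1_diff(2)[OF b H1L_H1[OF h] he] hvec_cong[OF b he e] by simp
        then show "h1norm2 b (\<lambda>x. prim (Tr r) x - e x r) = 0"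
          using hvec_norm[OF b H1_diff(1)[OF b H1L_H1[OF h] he]] by simp
      qed
    qed
  qed
  have pz: "AE x in lebesgue. prim (\<lambda>s. z2 b om (x, s)) = prim (\<lambda>s. G (x, s))"
    using AE_slices(1)[OF G(3)] by eventually_elim (rule prim_cong_AE)
  have TA: "AE x in lebesgue. Tr r x = g x + prim (\<lambda>s. z2 b om (x, s)) r" for r
    using pz by eventually_elim (simp add: Tr_def)
  show ?thesis
  proof (rule that[OF gs g0])
    show "AE x in lebesgue. eqon 0 1 (\<lambda>r. z2 b w (x, r)) (\<lambda>r. g x + prim (\<lambda>s. z2 b om (x, s)) r)"
      using rel pz AE_slices(1)[OF F(3)]
    proof eventually_elim
      case (elim x)
      show ?case unfolding elim(2) using elim(1,3) by eventually_elim simp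
    qed
    show "sqint (\<lambda>x. g x + prim (\<lambda>s. z2 b om (x, s)) r)" for r
      by (rule sqint_cong_AE[OF Ts measurable_cong_AE_lebesgue[OF sqint_measurable[OF Ts] TA] TA])
    have "prim (\<lambda>x. g x + prim (\<lambda>s. z2 b om (x, s)) r) = prim (Tr r)" for r
      by (rule prim_cong_AE[symmetric]) (rule TA)
    then show "trace_rep b e (\<lambda>r. prim (\<lambda>x. g x + prim (\<lambda>s. z2 b om (x, s)) r))" using tr by simp
  qed
qed

text \<open>\<open>eta_tr\<close> is an arbitrary choice among representatives. The constructed one
  shows that a choice exists, and uniqueness identifies the two at every parameter up to null sets
  in \<open>x\<close>.\<close>

lemma eta_tr_eq:
  assumes b: "b > 0" and W: "W_deriv b e w" and Z: "W_deriv b ze om" and rho: "rho_deriv b e ze"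
  obtains g where "sqint g" "\<And>x. x \<notin> {0<..<b} \<Longrightarrow> g x = 0"
    "AE x in lebesgue. eqon 0 1 (\<lambda>r. z2 b w (x, r)) (\<lambda>r. g x + prim (\<lambda>s. z2 b om (x, s)) r)"
    "\<And>r. r \<in> {0..1} \<Longrightarrow> sqint (\<lambda>x. g x + prim (\<lambda>s. z2 b om (x, s)) r)"
    "\<And>r. r \<in> {0..1} \<Longrightarrow> eqon 0 b (eta_tr b e r) (prim (\<lambda>x. g x + prim (\<lambda>s. z2 b om (x, s)) r))"
proof (rule trace_construct[OF b W Z rho])
  fix g assume g: "sqint g" "\<And>x. x \<notin> {0<..<b} \<Longrightarrow> g x = 0"
    "AE x in lebesgue. eqon 0 1 (\<lambda>r. z2 b w (x, r)) (\<lambda>r. g x + prim (\<lambda>s. z2 b om (x, s)) r)"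
    "\<And>r. r \<in> {0..1} \<Longrightarrow> sqint (\<lambda>x. g x + prim (\<lambda>s. z2 b om (x, s)) r)"
    "trace_rep b e (\<lambda>r. prim (\<lambda>x. g x + prim (\<lambda>s. z2 b om (x, s)) r))"
  have "trace_rep b e (eta_tr b e)"
    unfolding eta_tr_def using someI_ex[of "trace_rep b e"] g(5) by auto
  then have "eqon 0 b (eta_tr b e r) (prim (\<lambda>x. g x + prim (\<lambda>s. z2 b om (x, s)) r))" if "r \<in> {0..1}" for r
    using trace_rep_unique[OF b W _ g(5) that] by blast
  then show ?thesis using that g by blast
qed

section \<open>The wave operator as a relation\<close>

lemma prim_zext_le: "x \<le> b \<Longrightarrow> b \<le> L \<Longrightarrow> prim (zext 0 L p) x = prim (zext 0 b p) x"
  unfolding prim_def zext_def by (intro Bochner_Integration.integral_cong refl) (auto split: split_indicator)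

lemma eqon_mono: "eqon 0 L f g \<Longrightarrow> b \<le> L \<Longrightarrow> eqon 0 b f g"
  by (erule eventually_mono) auto

lemma L2_mono: assumes "L2 0 L f" "b \<le> L" shows "L2 0 b f"
proof -
  have "zext 0 b f = zext 0 b (zext 0 L f)" using assms(2) by (auto simp: zext_def fun_eq_iff split: split_indicator)
  then show ?thesis using sqint_zext[of "zext 0 L f" 0 b] assms(1) by (simp add: L2_iff)
qed

lemma eqon_const_eq:
  assumes "a < b" "eqon a b (\<lambda>x. c) (\<lambda>x. d)" shows "c = d"
  by (rule AE_eq_imp_eq[OF assms(1) _ _ assms(2), of a]) (use assms(1) in auto)

lemma eqon_prim_imp_eqon:
  assumes b: "0 < b" and bL: "b \<le> L" and p: "L2 0 L p" and g: "sqint g" "\<And>x. x \<notin> {0<..<b} \<Longrightarrow> g x = 0"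
    and e: "eqon 0 b (prim (zext 0 L p)) (prim g)"
  shows "eqon 0 b p g"
proof -
  have z: "zext 0 b g = g" using g(2) by (auto simp: zext_def fun_eq_iff split: split_indicator)
  have "eqon 0 b (\<lambda>x. 0 + prim (zext 0 b p) x) (\<lambda>x. 0 + prim (zext 0 b g) x)"
    unfolding z using e by eventually_elim (use bL in \<open>auto simp: prim_zext_le[of _ b L] less_imp_le\<close>)
  then show ?thesis by (rule L2_deriv_unique(2)[OF b L2_mono[OF p bL] L2_sqint[OF g(1)]])
qed

locale wave =
  fixes L tau a k1 k2 al b ga c0 :: real
  assumes L: "L > 0" and tau: "tau > 0" and a: "a > 0" and k1: "k1 > 0" and k2: "k2 \<noteq> 0" and k12: "\<bar>k2\<bar> < k1"
    and al: "0 < al" and alb: "al < b" and bga: "b < ga" and gaL: "ga < L" and c0: "c0 > 0"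
begin

lemma b: "b > 0" and bL: "b < L" using al alb bga gaL by auto

definition cc :: "real \<Rightarrow> complex" where "cc x = complex_of_real (c0 * indicator {al<..<ga} x)"

abbreviation A where "A \<equiv> Aop L a tau k1 k2 b al ga c0"
abbreviation D where "D \<equiv> DA L a k1 k2 b"
abbreviation H where "H \<equiv> Hsp L b"

lemma sqint_cc: "sqint f \<Longrightarrow> sqint (\<lambda>x. cc x * f x)"
proof (rule sqint_bound)
  assume f: "sqint f"
  have "(\<lambda>x. cc x) \<in> borel_measurable borel" unfolding cc_def by measurable
  then show "(\<lambda>x. cc x * f x) \<in> borel_measurable lebesgue"
    by (intro borel_measurable_times measurable_lebesgueI sqint_measurable f) auto
  show "integrable lebesgue (\<lambda>x. c0\<^sup>2 * (cmod (f x))\<^sup>2)" using sqint_integrable[OF f] by simp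
  show "AE x in lebesgue. (cmod (cc x * f x))\<^sup>2 \<le> c0\<^sup>2 * (cmod (f x))\<^sup>2"
    by (auto simp: cc_def norm_mult power_mult_distrib split: split_indicator)
qed

lemma L2_cc: "L2 l m f \<Longrightarrow> L2 l m (\<lambda>x. cc x * f x)"
  unfolding L2_iff zext_mult by (rule sqint_cc)

text \<open>The derivative \<open>\<eta>\<^sub>x(x, r)\<close> of the solution of \<open>-\<tau>\<^sup>-\<^sup>1 \<eta>\<^sub>\<rho> = e'\<close>, \<open>\<eta>(\<cdot>, 0) = v\<close>, where \<open>p = v\<^sub>x\<close> and \<open>w = e'\<^sub>x\<close>.\<close>
definition Tr1 :: "(real \<Rightarrow> complex) \<Rightarrow> (real \<Rightarrow> real \<Rightarrow> complex) \<Rightarrow> real \<Rightarrow> real \<Rightarrow> complex" where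
  "Tr1 p w r x = p x - complex_of_real tau * prim (\<lambda>s. z2 b w (x, s)) r"

text \<open>The equation \<open>A U = V\<close> together with \<open>U \<in> D\<close>, integrated once; \<open>C\<close> are the constants of integration.\<close>
definition Rel :: "st \<Rightarrow> st \<Rightarrow> bool" where
  "Rel U V \<longleftrightarrow> (case U of (u, v, y, z, e) \<Rightarrow> case V of (u', v', y', z', e') \<Rightarrow>
     eqon 0 L v u' \<and> eqon 0 L z y' \<and>
     (\<exists>C. eqon 0 L (\<lambda>x. complex_of_real a * wd 0 L u x + complex_of_real (indicator {0<..<b} x) *
            (complex_of_real k1 * wd 0 L u' x + complex_of_real k2 * Tr1 (wd 0 L u') (Wx b e') 1 x))
          (\<lambda>x. C + prim (zext 0 L (\<lambda>x. v' x + cc x * y' x)) x)) \<and>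
     (\<exists>C. eqon 0 L (wd 0 L y) (\<lambda>x. C + prim (zext 0 L (\<lambda>x. z' x - cc x * u' x)) x)) \<and>
     (AE x in lebesgue. x \<in> {0<..<b} \<longrightarrow>
        eqon 0 1 (\<lambda>r. z2 b (Wx b e) (x, r)) (\<lambda>r. Tr1 (wd 0 L u') (Wx b e') r x)))"

definition st_eq :: "st \<Rightarrow> st \<Rightarrow> bool" where
  "st_eq U V \<longleftrightarrow> (case U of (u, v, y, z, e) \<Rightarrow> case V of (u', v', y', z', e') \<Rightarrow>
     eqon 0 L (wd 0 L u) (wd 0 L u') \<and> eqon 0 L v v' \<and> eqon 0 L (wd 0 L y) (wd 0 L y') \<and> eqon 0 L z z' \<and>
     (AE p in lebesgue. z2 b (Wx b e) p = z2 b (Wx b e') p))"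

lemma scaled_W:
  assumes W: "Wmem b e"
  shows "W_deriv b (\<lambda>x r. c * e x r) (\<lambda>x r. c * Wx b e x r)" "AE p in lebesgue. z2 b (Wx b (\<lambda>x r. c * e x r)) p = c * z2 b (Wx b e) p"
proof -
  show d: "W_deriv b (\<lambda>x r. c * e x r) (\<lambda>x r. c * Wx b e x r)"
    using W_deriv_lincomb[OF b Wx_W_deriv[OF W] Wx_W_deriv[OF W], of c 0] by simp
  show "AE p in lebesgue. z2 b (Wx b (\<lambda>x r. c * e x r)) p = c * z2 b (Wx b e) p"
    using Wx_unique[OF b d] z2_lincomb[of b c "Wx b e" 0 "Wx b e"] by simp
qed

lemma eta_rho_rho: "\<exists>er. rho_deriv b e er \<Longrightarrow> rho_deriv b e (eta_rho b e)"
  using someI_ex[of "rho_deriv b e"] unfolding eta_rho_def by simp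

text \<open>Each of the three differential equations is integrated once. The trace formula replaces
  the boundary values of the delay component by \<open>Tr1\<close>, and the condition at delay 0
  fixes its constant of integration.\<close>

lemma DA_Rel:
  assumes U: "U \<in> D"
  shows "A U \<in> H" "Rel U (A U)"
proof -
  obtain u v y z e where Ueq: "U = (u, v, y, z, e)" by (cases U) auto
  define S where "S = Sb L a k1 k2 b U"
  define ro where "ro = eta_rho b e"
  have H: "H10 0 L u" "L2 0 L v" "H10 0 L y" "L2 0 L z" "Wmem b e" "H2 0 L y" "H10 0 L v" "H10 0 L z" "H1 0 L S"
    "\<exists>er. rho_deriv b e er" "eqon 0 b (eta_tr b e 0) v"
    using U unfolding DA_def Hsp_def Ueq S_def by auto
  have rho: "rho_deriv b e ro" unfolding ro_def by (rule eta_rho_rho[OF H(10)])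
  have Wro: "Wmem b ro" using rho by (simp add: rho_deriv_def)
  have AU: "A U = (v, (\<lambda>x. wd 0 L S x - cc x * z x), z, (\<lambda>x. wd 0 L (wd 0 L y) x + cc x * v x), (\<lambda>x r. - ro x r / complex_of_real tau))"
    by (simp add: Aop_def Ueq S_def ro_def Let_def cc_def)
  define f5 where "f5 = (\<lambda>x r. (- 1 / complex_of_real tau) * ro x r)"
  have f5: "(\<lambda>x r. - ro x r / complex_of_real tau) = f5" by (simp add: f5_def fun_eq_iff)
  note Wf5 = scaled_W[OF Wro, of "- 1 / complex_of_real tau", folded f5_def]
  have h1y: "H1 0 L (wd 0 L y)" using H(6) by (simp add: H2_def)
  have Wm: "Wmem b f5" using Wf5(1) by (auto simp: Wmem_def)
  show "A U \<in> H" unfolding AU f5 Hsp_def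
    using H wd_L2[OF H(9)] wd_L2[OF h1y] Wm by (simp add: L2_diff L2_add L2_cc)
  obtain g where g: "sqint g" "\<And>x. x \<notin> {0<..<b} \<Longrightarrow> g x = 0"
    "AE x in lebesgue. eqon 0 1 (\<lambda>r. z2 b (Wx b e) (x, r)) (\<lambda>r. g x + prim (\<lambda>s. z2 b (Wx b ro) (x, s)) r)"
    "\<And>r. r \<in> {0..1} \<Longrightarrow> sqint (\<lambda>x. g x + prim (\<lambda>s. z2 b (Wx b ro) (x, s)) r)"
    "\<And>r. r \<in> {0..1} \<Longrightarrow> eqon 0 b (eta_tr b e r) (prim (\<lambda>x. g x + prim (\<lambda>s. z2 b (Wx b ro) (x, s)) r))"
    using eta_tr_eq[OF b Wx_W_deriv[OF H(5)] Wx_W_deriv[OF Wro] rho] by blast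
  have p0: "prim (\<lambda>s. z2 b w (x, s)) 0 = 0" for w x by (rule prim_left) (simp add: z2_out2)
  \<comment> \<open>The compatibility condition between the trace at 0 and the velocity identifies
    the constant of integration \<open>g\<close> with the derivative of \<open>v\<close> on the
    damped interval.\<close>
  have gv: "eqon 0 b (wd 0 L v) g"
  proof (rule eqon_prim_imp_eqon[OF b less_imp_le[OF bL] H10_wdD(1)[OF L H(7)] g(1,2)])
    have "eqon 0 b v (prim g)" using eqon_trans[OF eqon_sym[OF H(11)] g(5)[of 0]] by (simp add: p0)
    then show "eqon 0 b (prim (zext 0 L (wd 0 L v))) (prim g)"
      by (rule eqon_trans[OF eqon_sym[OF eqon_mono[OF H10_wdD(3)[OF L H(7)] less_imp_le[OF bL]]]])
  qed
  have sl: "AE x in lebesgue. prim (\<lambda>s. z2 b (Wx b ro) (x, s)) = (\<lambda>r. - complex_of_real tau * prim (\<lambda>s. z2 b (Wx b f5) (x, s)) r)"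
    using AE_slices(1)[OF Wf5(2)]
  proof eventually_elim
    case (elim x)
    have "prim (\<lambda>s. z2 b (Wx b f5) (x, s)) = prim (\<lambda>s. (- 1 / complex_of_real tau) * z2 b (Wx b ro) (x, s))" by (rule prim_cong_AE[OF elim])
    then have "prim (\<lambda>s. z2 b (Wx b f5) (x, s)) r = (- 1 / complex_of_real tau) * prim (\<lambda>s. z2 b (Wx b ro) (x, s)) r" for r
      by (simp only: prim_cmult)
    then show ?case using tau by (simp add: fun_eq_iff)
  qed
  have gT: "AE x in lebesgue. x \<in> {0<..<b} \<longrightarrow> (\<forall>r. g x + prim (\<lambda>s. z2 b (Wx b ro) (x, s)) r = Tr1 (wd 0 L v) (Wx b f5) r x)"
    using gv sl by eventually_elim (simp add: Tr1_def)
  show "Rel U (A U)" unfolding Rel_def Ueq AU[unfolded Ueq] f5 prod.case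
  proof (intro conjI)
    show "AE x in lebesgue. x \<in> {0<..<b} \<longrightarrow> eqon 0 1 (\<lambda>r. z2 b (Wx b e) (x, r)) (\<lambda>r. Tr1 (wd 0 L v) (Wx b f5) r x)"
      using gT g(3) by eventually_elim (auto elim: eventually_mono)
    obtain C where "eqon 0 L (wd 0 L y) (\<lambda>x. C + prim (zext 0 L (wd 0 L (wd 0 L y))) x)" using wd_prim[OF L h1y] by blast
    then show "\<exists>C. eqon 0 L (wd 0 L y) (\<lambda>x. C + prim (zext 0 L (\<lambda>x. (wd 0 L (wd 0 L y) x + cc x * v x) - cc x * v x)) x)" by auto
    obtain C where C: "eqon 0 L S (\<lambda>x. C + prim (zext 0 L (wd 0 L S)) x)" using wd_prim[OF L H(9)] by blast
    have T1: "eqon 0 b (wd 0 b (eta_tr b e 1)) (\<lambda>x. g x + prim (\<lambda>s. z2 b (Wx b ro) (x, s)) 1)"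
    proof (rule prim_H1(2)[OF b L2_sqint[OF g(4)], where c = 0])
      have z: "prim (\<lambda>s. z2 b (Wx b ro) (x, s)) 1 = 0" if "x \<notin> {0<..<b}" for x
        by (rule prim_left) (simp add: z2_out1[OF that])
      have "zext 0 b (\<lambda>x. g x + prim (\<lambda>s. z2 b (Wx b ro) (x, s)) 1) = (\<lambda>x. g x + prim (\<lambda>s. z2 b (Wx b ro) (x, s)) 1)"
        using z g(2) by (auto simp: zext_def fun_eq_iff split: split_indicator)
      then show "eqon 0 b (eta_tr b e 1) (\<lambda>x. 0 + prim (zext 0 b (\<lambda>x. g x + prim (\<lambda>s. z2 b (Wx b ro) (x, s)) 1)) x)"
        using g(5)[of 1] by simp
    qed simp
    have "eqon 0 L (\<lambda>x. complex_of_real a * wd 0 L u x + complex_of_real (indicator {0<..<b} x) *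
            (complex_of_real k1 * wd 0 L v x + complex_of_real k2 * Tr1 (wd 0 L v) (Wx b f5) 1 x)) S"
      using T1 gT unfolding S_def Ueq Sb_def prod.case
      by eventually_elim (auto split: split_indicator)
    from eqon_trans[OF this C]
    show "\<exists>C. eqon 0 L (\<lambda>x. complex_of_real a * wd 0 L u x + complex_of_real (indicator {0<..<b} x) *
            (complex_of_real k1 * wd 0 L v x + complex_of_real k2 * Tr1 (wd 0 L v) (Wx b f5) 1 x))
          (\<lambda>x. C + prim (zext 0 L (\<lambda>x. (wd 0 L S x - cc x * z x) + cc x * z x)) x)" by auto
  qed simp_all
qed

text \<open>The converse of \<open>DA_Rel\<close>: the integrated identities supply all regularity
  required by the domain, and the choices inside \<open>A\<close> can differ from \<open>V\<close>
  only on null sets. With both lemmas at hand, properties of \<open>A\<close> can be proved for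
  \<open>Rel\<close>.\<close>

lemma Rel_DA:
  assumes U: "U \<in> H" and V: "V \<in> H" and R: "Rel U V"
  shows "U \<in> D" "st_eq (A U) V"
proof -
  obtain u v y z e where Ueq: "U = (u, v, y, z, e)" by (cases U) auto
  obtain u' v' y' z' e' where Veq: "V = (u', v', y', z', e')" by (cases V) auto
  have HU: "H10 0 L u" "L2 0 L v" "H10 0 L y" "L2 0 L z" "Wmem b e" using U by (auto simp: Ueq Hsp_def)
  have HV: "H10 0 L u'" "L2 0 L v'" "H10 0 L y'" "L2 0 L z'" "Wmem b e'" using V by (auto simp: Veq Hsp_def)
  obtain C C' where R: "eqon 0 L v u'" "eqon 0 L z y'"
     "eqon 0 L (\<lambda>x. complex_of_real a * wd 0 L u x + complex_of_real (indicator {0<..<b} x) *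
            (complex_of_real k1 * wd 0 L u' x + complex_of_real k2 * Tr1 (wd 0 L u') (Wx b e') 1 x))
          (\<lambda>x. C + prim (zext 0 L (\<lambda>x. v' x + cc x * y' x)) x)"
     "eqon 0 L (wd 0 L y) (\<lambda>x. C' + prim (zext 0 L (\<lambda>x. z' x - cc x * u' x)) x)"
     "AE x in lebesgue. x \<in> {0<..<b} \<longrightarrow>
        eqon 0 1 (\<lambda>r. z2 b (Wx b e) (x, r)) (\<lambda>r. Tr1 (wd 0 L u') (Wx b e') r x)"
    using R unfolding Rel_def Ueq Veq prod.case by blast
  have v: "H10 0 L v" by (rule H10_cong[OF L HV(1) eqon_sym[OF R(1)]])
  have z: "H10 0 L z" by (rule H10_cong[OF L HV(3) eqon_sym[OF R(2)]])
  have wv: "eqon 0 L (wd 0 L v) (wd 0 L u')" by (rule H1_cong(2)[OF L H10_H1[OF HV(1)] eqon_sym[OF R(1)]])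
  have wz: "eqon 0 L (wd 0 L z) (wd 0 L y')" by (rule H1_cong(2)[OF L H10_H1[OF HV(3)] eqon_sym[OF R(2)]])
  have l: "L2 0 L (\<lambda>x. z' x - cc x * u' x)" "L2 0 L (\<lambda>x. v' x + cc x * y' x)"
    using HV H1_L2[OF H10_H1] by (auto intro!: L2_diff L2_add L2_cc)
  note y = prim_H1[OF L l(1) R(4)]
  \<comment> \<open>The last component of the operator is \<open>- 1 / tau\<close> times the delay
    derivative, so that derivative has to be \<open>- tau\<close> times the datum
    \<open>e'\<close>.\<close>
  define er where "er = (\<lambda>x r. (- complex_of_real tau) * e' x r)"
  define om where "om = (\<lambda>x r. (- complex_of_real tau) * Wx b e' x r)"
  have Wer: "W_deriv b er om" unfolding er_def om_def by (rule scaled_W(1)[OF HV(5)])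
  have pom: "prim (\<lambda>s. z2 b om (x, s)) r = - complex_of_real tau * prim (\<lambda>s. z2 b (Wx b e') (x, s)) r" for x r
  proof -
    have "(\<lambda>s. z2 b om (x, s)) = (\<lambda>s. (- complex_of_real tau) * z2 b (Wx b e') (x, s))"
      by (auto simp: om_def z2_def fun_eq_iff split: split_indicator)
    then show ?thesis by (simp only: prim_cmult)
  qed
  have T: "Tr1 p (Wx b e') r x = p x + prim (\<lambda>s. z2 b om (x, s)) r" for p r x by (simp add: Tr1_def pom)
  have zero: "prim (\<lambda>s. z2 b w (x, s)) r = 0" if "x \<notin> {0<..<b}" for w x r
    by (rule prim_left) (simp add: z2_out1[OF that])
  have rho: "rho_deriv b e er"
    unfolding rho_deriv_iff[OF b Wx_W_deriv[OF HU(5)] Wer] using R(5)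
  proof eventually_elim
    case (elim x)
    show ?case
    proof (cases "x \<in> {0<..<b}")
      case True then show ?thesis using elim unfolding T by blast
    next
      case False
      show ?thesis by (rule exI[of _ 0]) (simp add: prim_def z2_out1[OF False])
    qed
  qed
  obtain g where g: "sqint g" "\<And>x. x \<notin> {0<..<b} \<Longrightarrow> g x = 0"
    "AE x in lebesgue. eqon 0 1 (\<lambda>r. z2 b (Wx b e) (x, r)) (\<lambda>r. g x + prim (\<lambda>s. z2 b om (x, s)) r)"
    "\<And>r. r \<in> {0..1} \<Longrightarrow> sqint (\<lambda>x. g x + prim (\<lambda>s. z2 b om (x, s)) r)"
    "\<And>r. r \<in> {0..1} \<Longrightarrow> eqon 0 b (eta_tr b e r) (prim (\<lambda>x. g x + prim (\<lambda>s. z2 b om (x, s)) r))"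
    using eta_tr_eq[OF b Wx_W_deriv[OF HU(5)] Wer rho] by blast
  \<comment> \<open>Two descriptions of the same slice differ by constants only; comparing them
    recovers the trace at delay 0 from the datum \<open>u'\<close>.\<close>
  have gu: "eqon 0 b g (wd 0 L u')"
    using g(3) R(5)
  proof eventually_elim
    case (elim x)
    show ?case
    proof
      assume x: "x \<in> {0<..<b}"
      have "eqon 0 1 (\<lambda>r. g x) (\<lambda>r. wd 0 L u' x)"
        using elim(1) elim(2)[rule_format, OF x] by eventually_elim (auto simp: T)
      then show "g x = wd 0 L u' x" by (rule eqon_const_eq[OF zero_less_one])
    qed
  qed
  have gz: "AE x in lebesgue. g x = zext 0 b (wd 0 L u') x"
    using gu
  proof eventually_elim
    case (elim x) then show ?case using g(2)[of x] by (cases "x \<in> {0<..<b}") (auto simp: zext_out)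
  qed
  have tr0: "eqon 0 b (eta_tr b e 0) v"
  proof -
    have p0: "prim (\<lambda>s. z2 b om (x, s)) 0 = 0" for x by (rule prim_left) (simp add: z2_out2)
    have "eqon 0 b (eta_tr b e 0) (prim (zext 0 b (wd 0 L u')))"
      using g(5)[of 0] prim_cong_AE[OF gz] by (simp add: p0)
    then have "eqon 0 b (eta_tr b e 0) (prim (zext 0 L (wd 0 L u')))"
      by eventually_elim (use bL in \<open>auto simp: prim_zext_le[of _ b L] less_imp_le\<close>)
    then show ?thesis
      by (rule eqon_trans[OF _ eqon_sym[OF eqon_mono[OF eqon_trans[OF R(1) H10_wdD(3)[OF L HV(1)]] less_imp_le[OF bL]]]])
  qed
  have T1: "eqon 0 b (wd 0 b (eta_tr b e 1)) (\<lambda>x. g x + prim (\<lambda>s. z2 b om (x, s)) 1)"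
  proof (rule prim_H1(2)[OF b L2_sqint[OF g(4)], where c = 0])
    have "zext 0 b (\<lambda>x. g x + prim (\<lambda>s. z2 b om (x, s)) 1) = (\<lambda>x. g x + prim (\<lambda>s. z2 b om (x, s)) 1)"
      using zero g(2) by (auto simp: zext_def fun_eq_iff split: split_indicator)
    then show "eqon 0 b (eta_tr b e 1) (\<lambda>x. 0 + prim (zext 0 b (\<lambda>x. g x + prim (\<lambda>s. z2 b om (x, s)) 1)) x)"
      using g(5)[of 1] by simp
  qed simp
  define S where "S = Sb L a k1 k2 b U"
  have "eqon 0 L S (\<lambda>x. complex_of_real a * wd 0 L u x + complex_of_real (indicator {0<..<b} x) *
            (complex_of_real k1 * wd 0 L u' x + complex_of_real k2 * Tr1 (wd 0 L u') (Wx b e') 1 x))"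
    using T1 gu wv unfolding S_def Ueq Sb_def prod.case T
    by eventually_elim (auto split: split_indicator)
  note S = prim_H1[OF L l(2) eqon_trans[OF this R(3)]]
  show UD: "U \<in> D" unfolding DA_def using U HU v z y(1) S(1) rho tr0
    by (auto simp: Ueq S_def H2_def H10_H1)
  define ro where "ro = eta_rho b e"
  have rho': "rho_deriv b e ro" unfolding ro_def by (rule eta_rho_rho) (use rho in blast)
  have Wro: "Wmem b ro" using rho' by (simp add: rho_deriv_def)
  have AU: "A U = (v, (\<lambda>x. wd 0 L S x - cc x * z x), z, (\<lambda>x. wd 0 L (wd 0 L y) x + cc x * v x), (\<lambda>x r. (- 1 / complex_of_real tau) * ro x r))"
    by (simp add: Aop_def Ueq S_def ro_def Let_def cc_def)
  have s: "sqint (z2 b (Wx b ro))" "sqint (z2 b om)"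
    using W_deriv_sqint[OF b Wx_W_deriv[OF Wro]] W_deriv_sqint[OF b Wer] .
  \<comment> \<open>\<open>eta_rho\<close> is a choice. On almost every line of fixed
    \<open>x\<close> both candidates have primitives that represent the same slice up to constants,
    so the candidates agree.\<close>
  have ro_om: "AE p in lebesgue. z2 b (Wx b ro) p = z2 b om p"
  proof (rule AE_eq_from_slices[OF s[THEN sqint_measurable]], rule disjI1)
    show "AE x in lebesgue. AE r in lebesgue. z2 b (Wx b ro) (x, r) = z2 b om (x, r)"
      using rho[unfolded rho_deriv_iff[OF b Wx_W_deriv[OF HU(5)] Wer]] rho'[unfolded rho_deriv_iff[OF b Wx_W_deriv[OF HU(5)] Wx_W_deriv[OF Wro]]]
        sqint_slices(1)[OF s(1)] sqint_slices(1)[OF s(2)]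
    proof eventually_elim
      case (elim x)
      have zz: "zext 0 1 (\<lambda>r. z2 b w (x, r)) = (\<lambda>r. z2 b w (x, r))" for w
        by (auto simp: zext_def fun_eq_iff z2_out2 split: split_indicator)
      obtain c where c: "eqon 0 1 (\<lambda>r. z2 b (Wx b e) (x, r)) (\<lambda>r. c + prim (\<lambda>s. z2 b om (x, s)) r)" using elim(1) by blast
      obtain d where d: "eqon 0 1 (\<lambda>r. z2 b (Wx b e) (x, r)) (\<lambda>r. d + prim (\<lambda>s. z2 b (Wx b ro) (x, s)) r)" using elim(2) by blast
      have "eqon 0 1 (\<lambda>r. z2 b (Wx b ro) (x, r)) (\<lambda>r. z2 b om (x, r))"
        by (rule L2_deriv_unique(2)[OF zero_less_one L2_sqint[OF elim(3)] L2_sqint[OF elim(4)], of d c])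
          (unfold zz, rule eqon_trans[OF eqon_sym[OF d] c])
      then show ?case unfolding eqon_zext zz .
    qed
  qed
  show "st_eq (A U) V" unfolding st_eq_def AU Veq prod.case
  proof (intro conjI wv wz)
    show "eqon 0 L (\<lambda>x. wd 0 L S x - cc x * z x) v'" using S(2) R(2) by eventually_elim auto
    show "eqon 0 L (\<lambda>x. wd 0 L (wd 0 L y) x + cc x * v x) z'" using y(2) R(1) by eventually_elim auto
    show "AE p in lebesgue. z2 b (Wx b (\<lambda>x r. (- 1 / complex_of_real tau) * ro x r)) p = z2 b (Wx b e') p"
      using scaled_W(2)[OF Wro, of "- 1 / complex_of_real tau"] ro_om
    proof eventually_elim
      case (elim p)
      have "z2 b om p = - complex_of_real tau * z2 b (Wx b e') p" by (auto simp: om_def z2_def split: split_indicator)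
      then show ?case using elim tau by simp
    qed
  qed
qed

end

section \<open>The Hilbert space of states\<close>

definition orth :: "'a::real_inner set \<Rightarrow> 'a set" where "orth G = {x. \<forall>g\<in>G. inner x g = 0}"

lemma subspace_orth: "subspace (orth G)"
  by (auto simp: subspace_def orth_def inner_add_left)

lemma closed_orth: "closed (orth G)"
proof -
  have "closed {x. inner x g = 0}" for g :: 'a by (intro closed_Collect_eq continuous_intros)
  then have "closed (\<Inter>g\<in>G. {x. inner x g = 0})" by (intro closed_INT) auto
  moreover have "orth G = (\<Inter>g\<in>G. {x. inner x g = 0})" by (auto simp: orth_def)
  ultimately show ?thesis by simp
qed

lemma subspace_product: "subspace A \<Longrightarrow> subspace B \<Longrightarrow> subspace (A \<times> B)"
  by (auto simp: subspace_def zero_prod_def)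

text \<open>Its orthogonal complement consists of the classes supported in \<open>K\<close>.
  Expressing supports by orthogonality makes closedness, and hence completeness of the state space,
  immediate.\<close>

definition vanishing :: "'a::euclidean_space set \<Rightarrow> 'a l2 set" where
  "vanishing K = {cls g |g. sqint g \<and> (\<forall>p\<in>K. g p = 0)}"

lemma orth_vanishing_iff:
  fixes K :: "'a::euclidean_space set"
  assumes K: "K \<in> sets lebesgue" and f: "sqint f"
  shows "cls f \<in> orth (vanishing K) \<longleftrightarrow> (AE p in lebesgue. p \<notin> K \<longrightarrow> f p = 0)"
proof
  assume o: "cls f \<in> orth (vanishing K)"
  define g where "g = (\<lambda>p. indicator (- K) p *\<^sub>R f p)"
  have K': "- K \<in> sets lebesgue" using K by (metis Compl_in_sets_lebesgue)
  have gm: "g \<in> borel_measurable lebesgue"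
    unfolding g_def by (intro borel_measurable_scaleR borel_measurable_indicator K' sqint_measurable f)
  have g: "sqint g" by (rule sqint_bound[OF gm sqint_integrable[OF f]]) (auto simp: g_def split: split_indicator)
  have "cls g \<in> vanishing K" unfolding vanishing_def using g by (auto simp: g_def)
  then have "inner (cls f) (cls g) = 0" using o by (simp add: orth_def)
  moreover have "inner (cls f) (cls g) = (norm (cls g))\<^sup>2"
  proof -
    have "(LINT x|lebesgue. f x * cnj (g x)) = (LINT x|lebesgue. g x * cnj (g x))"
      by (intro Bochner_Integration.integral_cong refl) (auto simp: g_def split: split_indicator)
    then show ?thesis unfolding power2_norm_eq_inner inner_cls[OF f g] inner_cls[OF g g] by simp
  qed
  ultimately have "cls g = cls (\<lambda>_. 0)" by (simp add: cls_zero)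
  then have "AE p in lebesgue. g p = 0" using g by (simp add: cls_eq_iff)
  then show "AE p in lebesgue. p \<notin> K \<longrightarrow> f p = 0" by eventually_elim (auto simp: g_def)
next
  assume ae: "AE p in lebesgue. p \<notin> K \<longrightarrow> f p = 0"
  have "inner (cls f) (cls g) = 0" if g: "sqint g" "\<forall>p\<in>K. g p = 0" for g
  proof -
    have "(LINT x|lebesgue. f x * cnj (g x)) = (LINT x|(lebesgue :: 'a measure). 0)"
      by (rule integral_cong_AE_lebesgue) (use ae in eventually_elim, use g in auto)
    then show ?thesis unfolding inner_cls[OF f g(1)] by simp
  qed
  then show "cls f \<in> orth (vanishing K)" by (auto simp: orth_def vanishing_def)
qed

lemma orth_vanishing_ex:
  assumes K: "K \<in> sets lebesgue" and x: "x \<in> orth (vanishing K)"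
  obtains f where "sqint f" "x = cls f" "\<And>p. p \<notin> K \<Longrightarrow> f p = 0"
proof -
  obtain f where f: "sqint f" "x = cls f" by (rule cls_ex)
  have ae: "AE p in lebesgue. p \<notin> K \<longrightarrow> f p = 0" using x orth_vanishing_iff[OF K f(1)] f(2) by simp
  have ae': "AE p in lebesgue. f p = indicator K p *\<^sub>R f p" using ae by eventually_elim (auto split: split_indicator)
  have m: "(\<lambda>p. indicator K p *\<^sub>R f p) \<in> borel_measurable lebesgue"
    by (intro borel_measurable_scaleR borel_measurable_indicator K sqint_measurable f)
  show ?thesis
  proof
    show "sqint (\<lambda>p. indicator K p *\<^sub>R f p)" by (rule sqint_cong_AE[OF f(1) m ae'])
    show "x = cls (\<lambda>p. indicator K p *\<^sub>R f p)" unfolding f(2) by (rule cls_cong_AE[OF f(1) m ae'])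
  qed auto
qed

text \<open>All complex constants are included because the inner product of \<open>l2\<close> is
  real: orthogonality to all of them removes both the real and the imaginary part of the
  integral.\<close>

definition constants :: "real \<Rightarrow> real l2 set" where "constants L = {cls (zext 0 L (\<lambda>_. c)) |c. True}"

lemma orth_constants_iff:
  assumes f: "sqint f"
  shows "cls f \<in> orth (constants L) \<longleftrightarrow> integral\<^sup>L lebesgue (zext 0 L f) = 0"
proof -
  have s: "sqint (zext 0 L (\<lambda>_. c))" for c using L2_const[of 0 L c] by (simp add: L2_iff)
  have i: "inner (cls f) (cls (zext 0 L (\<lambda>_. c))) = Re (integral\<^sup>L lebesgue (zext 0 L f) * cnj c)" for c
  proof -
    have "(LINT x|lebesgue. f x * cnj (zext 0 L (\<lambda>_. c) x)) = (LINT x|lebesgue. zext 0 L f x * cnj c)"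
      by (intro Bochner_Integration.integral_cong refl) (auto simp: zext_def split: split_indicator)
    also have "\<dots> = integral\<^sup>L lebesgue (zext 0 L f) * cnj c" by (rule integral_mult_left_zero)
    finally show ?thesis unfolding inner_cls[OF f s] by simp
  qed
  show ?thesis
  proof
    assume o: "cls f \<in> orth (constants L)"
    have "inner (cls f) (cls (zext 0 L (\<lambda>_. c))) = 0" for c using o by (auto simp: orth_def constants_def)
    then have "Re (integral\<^sup>L lebesgue (zext 0 L f) * cnj (integral\<^sup>L lebesgue (zext 0 L f))) = 0"
      unfolding i by blast
    then have "(cmod (integral\<^sup>L lebesgue (zext 0 L f)))\<^sup>2 = 0" by (simp add: complex_mult_cnj cmod_power2)
    then show "integral\<^sup>L lebesgue (zext 0 L f) = 0" by simp
  qed (auto simp: orth_def constants_def i)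
qed

section \<open>States as vectors in a product of \<open>l2\<close> spaces\<close>

type_synonym X = "real l2 \<times> real l2 \<times> real l2 \<times> real l2 \<times> (real \<times> real) l2"

definition cX :: "complex \<Rightarrow> X \<Rightarrow> X" where
  "cX c x = (case x of (p, q, r, s, w) \<Rightarrow> (csc c p, csc c q, csc c r, csc c s, csc c w))"

lemma bounded_linear_cX: "bounded_linear (cX c)"
proof -
  have "bounded_linear (\<lambda>x :: X. (csc c (fst x), csc c (fst (snd x)), csc c (fst (snd (snd x))),
      csc c (fst (snd (snd (snd x)))), csc c (snd (snd (snd (snd x))))))"
    by (intro bounded_linear_Pair bounded_linear_compose[OF bounded_linear_csc]
        bounded_linear_fst bounded_linear_compose[OF bounded_linear_fst] bounded_linear_snd
        bounded_linear_compose[OF bounded_linear_snd])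
  moreover have "cX c = (\<lambda>x. (csc c (fst x), csc c (fst (snd x)), csc c (fst (snd (snd x))),
      csc c (fst (snd (snd (snd x)))), csc c (snd (snd (snd (snd x))))))"
    by (simp add: fun_eq_iff cX_def case_prod_unfold)
  ultimately show ?thesis by simp
qed

context wave begin

text \<open>The two square roots turn the weighted energy product into the plain product of the five
  factors. Positions and the delay state enter through their x-derivatives, from which they are
  recovered as primitives.\<close>

definition Phi :: "st \<Rightarrow> X" where
  "Phi U = (case U of (u, v, y, z, e) \<Rightarrow>
     (sqrt a *\<^sub>R cls (zext 0 L (wd 0 L u)), cls (zext 0 L v), cls (zext 0 L (wd 0 L y)), cls (zext 0 L z),
      sqrt (tau * \<bar>k2\<bar>) *\<^sub>R cls (z2 b (Wx b e))))"

text \<open>Being orthogonal to constants encodes \<open>u(L) = 0\<close> and \<open>y(L) = 0\<close>.\<close>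
definition SX :: "X set" where
  "SX = orth (vanishing {0<..<L} \<union> constants L) \<times> orth (vanishing {0<..<L}) \<times> orth (vanishing {0<..<L} \<union> constants L) \<times>
     orth (vanishing {0<..<L}) \<times> orth (vanishing (Q2 b))"

lemma subspace_SX: "subspace SX"
  unfolding SX_def by (intro subspace_product subspace_orth)

lemma complete_SX: "complete SX"
  unfolding SX_def complete_eq_closed by (intro closed_Times closed_orth)

lemma orth_Un: "orth (G \<union> G') = orth G \<inter> orth G'"
  by (auto simp: orth_def)

lemma state_facts: assumes "(u, v, y, z, e) \<in> H"
  shows "H10 0 L u" "L2 0 L v" "H10 0 L y" "L2 0 L z" "Wmem b e"
    "sqint (zext 0 L (wd 0 L u))" "sqint (zext 0 L v)" "sqint (zext 0 L (wd 0 L y))" "sqint (zext 0 L z)" "sqint (z2 b (Wx b e))"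
    "integral\<^sup>L lebesgue (zext 0 L (wd 0 L u)) = 0" "integral\<^sup>L lebesgue (zext 0 L (wd 0 L y)) = 0"
    "sqint (zext 0 L u)" "sqint (zext 0 L y)"
proof -
  show h: "H10 0 L u" "L2 0 L v" "H10 0 L y" "L2 0 L z" "Wmem b e" using assms by (auto simp: Hsp_def)
  show "sqint (zext 0 L (wd 0 L u))" "sqint (zext 0 L (wd 0 L y))" "sqint (zext 0 L u)" "sqint (zext 0 L y)"
    using h H10_wdD(1)[OF L] H1_L2[OF H10_H1] by (simp_all add: L2_iff)
  show "sqint (zext 0 L v)" "sqint (zext 0 L z)" using h by (simp_all add: L2_iff)
  show "sqint (z2 b (Wx b e))" by (rule W_deriv_sqint[OF b Wx_W_deriv[OF h(5)]])
  show "integral\<^sup>L lebesgue (zext 0 L (wd 0 L u)) = 0" "integral\<^sup>L lebesgue (zext 0 L (wd 0 L y)) = 0"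
    using h H10_wdD(2)[OF L] by simp_all
qed

lemma Phi_SX: "U \<in> H \<Longrightarrow> Phi U \<in> SX"
proof -
  assume U: "U \<in> H"
  obtain u v y z e where Ueq: "U = (u, v, y, z, e)" by (cases U) auto
  note h = state_facts[OF U[unfolded Ueq]]
  have v1: "cls (zext 0 L f) \<in> orth (vanishing {0<..<L})" if "sqint (zext 0 L f)" for f
    by (subst orth_vanishing_iff[OF _ that]) (auto simp: zext_out)
  have v2: "cls (z2 b (Wx b e)) \<in> orth (vanishing (Q2 b))"
    by (subst orth_vanishing_iff[OF Q2_sets(2) h(10)]) (auto intro!: AE_I2 z2_out)
  have c: "cls (zext 0 L f) \<in> orth (constants L)" if "sqint (zext 0 L f)" "integral\<^sup>L lebesgue (zext 0 L f) = 0" for f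
    by (subst orth_constants_iff[OF that(1)]) (simp add: that(2))
  show ?thesis unfolding SX_def Phi_def Ueq prod.case orth_Un
    using v1[OF h(6)] v1[OF h(7)] v1[OF h(8)] v1[OF h(9)] v2 c[OF h(6) h(11)] c[OF h(8) h(12)]
    by (auto intro!: subspace_scale subspace_orth)
qed

lemma Phi_surj: assumes x: "x \<in> SX" shows "\<exists>U\<in>H. Phi U = x"
proof -
  obtain p q r s w where xeq: "x = (p, q, r, s, w)" by (cases x) auto
  have m: "p \<in> orth (vanishing {0<..<L})" "p \<in> orth (constants L)" "q \<in> orth (vanishing {0<..<L})"
    "r \<in> orth (vanishing {0<..<L})" "r \<in> orth (constants L)" "s \<in> orth (vanishing {0<..<L})" "w \<in> orth (vanishing (Q2 b))"
    using x by (auto simp: SX_def xeq orth_Un)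
  have ex: "\<exists>f. sqint f \<and> x = cls f \<and> zext 0 L f = f" if x: "x \<in> orth (vanishing {0<..<L})" for x
  proof -
    obtain f where f: "sqint f" "x = cls f" "\<And>p. p \<notin> {0<..<L} \<Longrightarrow> f p = 0"
      by (rule orth_vanishing_ex[OF _ x]) auto
    have "zext 0 L f = f" using f(3) by (auto simp: zext_def fun_eq_iff split: split_indicator)
    then show ?thesis using f by blast
  qed
  have ex0: "\<exists>u. H10 0 L u \<and> cls (zext 0 L (wd 0 L u)) = x" if x: "x \<in> orth (vanishing {0<..<L})" "x \<in> orth (constants L)" for x
  proof -
    obtain f where f: "sqint f" "x = cls f" "zext 0 L f = f" using ex[OF x(1)] by blast
    have "integral\<^sup>L lebesgue (zext 0 L f) = 0" using x(2) orth_constants_iff[OF f(1)] f(2) by simp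
    from H10_wd[OF L L2_sqint[OF f(1)] this, of "prim (zext 0 L f)"]
    have "H10 0 L (prim (zext 0 L f))" "eqon 0 L f (wd 0 L (prim (zext 0 L f)))" using eqon_sym by auto
    then show ?thesis using cls_zext_cong[OF L2_sqint[OF f(1)]] f by metis
  qed
  have a0: "sqrt a > 0" "sqrt (tau * \<bar>k2\<bar>) > 0" using a tau k2 by auto
  obtain u where u: "H10 0 L u" "cls (zext 0 L (wd 0 L u)) = (1 / sqrt a) *\<^sub>R p"
    using ex0[of "(1 / sqrt a) *\<^sub>R p"] m subspace_scale[OF subspace_orth] by blast
  obtain y where y: "H10 0 L y" "cls (zext 0 L (wd 0 L y)) = r" using ex0[of r] m by blast
  obtain v where v: "sqint v" "q = cls v" "zext 0 L v = v" using ex[of q] m by blast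
  obtain z where z: "sqint z" "s = cls z" "zext 0 L z = z" using ex[of s] m by blast
  have "(1 / sqrt (tau * \<bar>k2\<bar>)) *\<^sub>R w \<in> orth (vanishing (Q2 b))" using m subspace_scale[OF subspace_orth] by blast
  then obtain F where F: "sqint F" "(1 / sqrt (tau * \<bar>k2\<bar>)) *\<^sub>R w = cls F" "\<And>p. p \<notin> Q2 b \<Longrightarrow> F p = 0"
    using orth_vanishing_ex[OF Q2_sets(2)] by blast
  obtain e w' where e: "W_deriv b e w'" "AE p in lebesgue. z2 b w' p = F p" using W_construct[OF b F(1,3)] by blast
  have We: "Wmem b e" using e(1) by (auto simp: Wmem_def)
  have "AE p in lebesgue. z2 b (Wx b e) p = F p" using Wx_unique[OF b e(1)] e(2) by eventually_elim simp
  then have "cls (z2 b (Wx b e)) = cls F"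
    using cls_eq_iff[OF W_deriv_sqint[OF b Wx_W_deriv[OF We]] F(1)] by simp
  note We_F = this
  have wF: "sqrt (tau * \<bar>k2\<bar>) *\<^sub>R cls F = w" unfolding F(2)[symmetric] using a0 tau k2 by simp
  have "Phi (u, v, y, z, e) = x"
    unfolding Phi_def prod.case u(2) y(2) v(3) z(3) xeq We_F wF v(2)[symmetric] z(2)[symmetric] using a0 by simp
  moreover have "(u, v, y, z, e) \<in> H" unfolding Hsp_def using u(1) y(1) We L2_sqint[OF v(1)] L2_sqint[OF z(1)] by simp
  ultimately show ?thesis by blast
qed

lemma Phi_image: "Phi ` H = SX"
  using Phi_SX Phi_surj by blast

lemma Phi_eq_iff:
  assumes U: "U \<in> H" and V: "V \<in> H" shows "Phi U = Phi V \<longleftrightarrow> st_eq U V"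
proof -
  obtain u v y z e where Ueq: "U = (u, v, y, z, e)" by (cases U) auto
  obtain u' v' y' z' e' where Veq: "V = (u', v', y', z', e')" by (cases V) auto
  note h = state_facts[OF U[unfolded Ueq]] and h' = state_facts[OF V[unfolded Veq]]
  have "sqrt a \<noteq> 0" "sqrt (tau * \<bar>k2\<bar>) \<noteq> 0" using a tau k2 by auto
  then show ?thesis unfolding Phi_def st_eq_def Ueq Veq prod.case prod.inject scaleR_cancel_left eqon_zext
    using cls_eq_iff[OF h(6) h'(6)] cls_eq_iff[OF h(7) h'(7)] cls_eq_iff[OF h(8) h'(8)] cls_eq_iff[OF h(9) h'(9)] cls_eq_iff[OF h(10) h'(10)]
    by simp
qed

lemma st_lin_H:
  assumes U: "U \<in> H" and V: "V \<in> H"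
  shows "st_lin c U d V \<in> H" "Phi (st_lin c U d V) = cX c (Phi U) + cX d (Phi V)"
proof -
  obtain u v y z e where Ueq: "U = (u, v, y, z, e)" by (cases U) auto
  obtain u' v' y' z' e' where Veq: "V = (u', v', y', z', e')" by (cases V) auto
  note h = state_facts[OF U[unfolded Ueq]] and h' = state_facts[OF V[unfolded Veq]]
  have W: "W_deriv b (\<lambda>x r. c * e x r + d * e' x r) (\<lambda>x r. c * Wx b e x r + d * Wx b e' x r)"
    by (rule W_deriv_lincomb[OF b Wx_W_deriv[OF h(5)] Wx_W_deriv[OF h'(5)]])
  have Wm: "Wmem b (\<lambda>x r. c * e x r + d * e' x r)" using W by (auto simp: Wmem_def)
  show lH: "st_lin c U d V \<in> H"
    unfolding st_lin_def Ueq Veq prod.case Hsp_def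
    using h(1-5) h'(1-5) Wm by (auto intro: H10_lincomb[OF L] L2_lincomb)
  have l1: "cls (zext 0 L (\<lambda>x. c * f x + d * g x)) = csc c (cls (zext 0 L f)) + csc d (cls (zext 0 L g))"
    if "sqint (zext 0 L f)" "sqint (zext 0 L g)" for f g
    unfolding zext_add zext_cmult using that by (simp add: csc_cls cls_add sqint_cmult)
  have l2: "cls (zext 0 L (wd 0 L (\<lambda>x. c * f x + d * g x))) = csc c (cls (zext 0 L (wd 0 L f))) + csc d (cls (zext 0 L (wd 0 L g)))"
    if f: "H10 0 L f" and g: "H10 0 L g" for f g
  proof -
    note w = H1_lincomb[OF L H10_H1[OF f] H10_H1[OF g], of c d]
    have s: "sqint (zext 0 L (wd 0 L f))" "sqint (zext 0 L (wd 0 L g))"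
      using wd_L2[OF H10_H1[OF f]] wd_L2[OF H10_H1[OF g]] by (simp_all add: L2_iff)
    show ?thesis using cls_zext_cong[OF wd_L2[OF w(1)] w(2)] l1[OF s] by simp
  qed
  have l3: "cls (z2 b (Wx b (\<lambda>x r. c * e x r + d * e' x r))) = csc c (cls (z2 b (Wx b e))) + csc d (cls (z2 b (Wx b e')))"
  proof -
    have "cls (z2 b (Wx b (\<lambda>x r. c * e x r + d * e' x r))) = cls (z2 b (\<lambda>x r. c * Wx b e x r + d * Wx b e' x r))"
      using Wx_unique[OF b W] cls_eq_iff[OF W_deriv_sqint[OF b Wx_W_deriv[OF Wm]] W_deriv_sqint[OF b W]] by simp
    also have "\<dots> = csc c (cls (z2 b (Wx b e))) + csc d (cls (z2 b (Wx b e')))"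
      unfolding z2_lincomb using h(10) h'(10) by (simp add: csc_cls cls_add sqint_cmult)
    finally show ?thesis .
  qed
  have sc: "csc c (r *\<^sub>R x) = r *\<^sub>R csc c x" for c r and x :: "'z::euclidean_space l2"
    by (rule linear_scale[OF bounded_linear.linear[OF bounded_linear_csc]])
  show "Phi (st_lin c U d V) = cX c (Phi U) + cX d (Phi V)"
    unfolding Phi_def st_lin_def Ueq Veq prod.case cX_def l3 l2[OF h(1) h'(1)] l2[OF h(3) h'(3)] l1[OF h(7) h'(7)] l1[OF h(9) h'(9)]
    by (simp add: sc scaleR_add_right)
qed

lemma Complex_inner_cls:
  assumes "sqint f" "sqint g"
  shows "Complex (inner (cls f) (cls g)) (inner (cls f) (csc \<i> (cls g))) = (LINT x|lebesgue. f x * cnj (g x))"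
proof -
  have "(LINT x|lebesgue. f x * cnj (\<i> * g x)) = (LINT x|lebesgue. (- \<i>) * (f x * cnj (g x)))"
    by (intro Bochner_Integration.integral_cong refl) simp
  also have "\<dots> = - \<i> * (LINT x|lebesgue. f x * cnj (g x))" by (rule integral_mult_right_zero)
  finally show ?thesis
    unfolding csc_cls[OF assms(2)] inner_cls[OF assms] inner_cls[OF assms(1) sqint_cmult[OF assms(2)]]
    by (simp add: complex_eq_iff)
qed

lemma inner_H_Phi:
  assumes U: "U \<in> H" and V: "V \<in> H"
  shows "inner_H L a tau k2 b U V = Complex (inner (Phi U) (Phi V)) (inner (Phi U) (cX \<i> (Phi V)))"
proof -
  obtain u v y z e where Ueq: "U = (u, v, y, z, e)" by (cases U) auto
  obtain u' v' y' z' e' where Veq: "V = (u', v', y', z', e')" by (cases V) auto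
  note h = state_facts[OF U[unfolded Ueq]] and h' = state_facts[OF V[unfolded Veq]]
  define I :: "(real \<Rightarrow> complex) \<Rightarrow> (real \<Rightarrow> complex) \<Rightarrow> complex" where "I = (\<lambda>f g. LINT x|lebesgue. f x * cnj (g x))"
  have int: "integrable lebesgue (\<lambda>x. f x * cnj (g x))" if "sqint f" "sqint g" for f g :: "real \<Rightarrow> complex"
    using that sqint_cnj sqint_mult_integrable by blast
  have 1: "(LINT x:{0<..<L}|lebesgue.
        complex_of_real a * wd 0 L u x * cnj (wd 0 L u' x) + v x * cnj (v' x)
        + wd 0 L y x * cnj (wd 0 L y' x) + z x * cnj (z' x))
     = complex_of_real a * I (zext 0 L (wd 0 L u)) (zext 0 L (wd 0 L u')) + I (zext 0 L v) (zext 0 L v')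
       + I (zext 0 L (wd 0 L y)) (zext 0 L (wd 0 L y')) + I (zext 0 L z) (zext 0 L z')"
  proof -
    have "(LINT x:{0<..<L}|lebesgue.
        complex_of_real a * wd 0 L u x * cnj (wd 0 L u' x) + v x * cnj (v' x)
        + wd 0 L y x * cnj (wd 0 L y' x) + z x * cnj (z' x))
      = (LINT x|lebesgue. complex_of_real a * (zext 0 L (wd 0 L u) x * cnj (zext 0 L (wd 0 L u') x)) + zext 0 L v x * cnj (zext 0 L v' x)
        + zext 0 L (wd 0 L y) x * cnj (zext 0 L (wd 0 L y') x) + zext 0 L z x * cnj (zext 0 L z' x))"
      unfolding set_lebesgue_integral_def
      by (intro Bochner_Integration.integral_cong refl) (auto simp: zext_def split: split_indicator)
    then show ?thesis unfolding I_def
      using int[OF h(6) h'(6)] int[OF h(7) h'(7)] int[OF h(8) h'(8)] int[OF h(9) h'(9)]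
      by (simp add: Bochner_Integration.integral_add)
  qed
  have 2: "(LINT x:{0<..<b}|lebesgue. LINT r:{0<..<1}|lebesgue. Wx b e x r * cnj (Wx b e' x r))
     = (LINT p|lebesgue. z2 b (Wx b e) p * cnj (z2 b (Wx b e') p))"
  proof -
    have i: "integrable lebesgue (\<lambda>p. z2 b (Wx b e) p * cnj (z2 b (Wx b e') p))"
      by (rule sqint_mult_integrable[OF h(10) sqint_cnj[OF h'(10)]])
    have "(LINT x:{0<..<b}|lebesgue. LINT r:{0<..<1}|lebesgue. Wx b e x r * cnj (Wx b e' x r))
      = (LINT x|lebesgue. LINT r|lebesgue. z2 b (Wx b e) (x, r) * cnj (z2 b (Wx b e') (x, r)))"
      unfolding set_lebesgue_integral_def
    proof (intro Bochner_Integration.integral_cong refl)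
      fix x
      show "indicat_real {0<..<b} x *\<^sub>R (LINT r|lebesgue. indicat_real {0<..<1} r *\<^sub>R (Wx b e x r * cnj (Wx b e' x r)))
        = (LINT r|lebesgue. z2 b (Wx b e) (x, r) * cnj (z2 b (Wx b e') (x, r)))"
        unfolding integral_scaleR_right[symmetric]
        by (intro Bochner_Integration.integral_cong refl) (auto simp: z2_def split: split_indicator)
    qed
    then show ?thesis using integral_slices(5)[OF i] by simp
  qed
  have sc: "csc c (r *\<^sub>R x) = r *\<^sub>R csc c x" for c r and x :: "'z::euclidean_space l2"
    by (rule linear_scale[OF bounded_linear.linear[OF bounded_linear_csc]])
  have aa: "sqrt a * sqrt a = a" "sqrt (tau * \<bar>k2\<bar>) * sqrt (tau * \<bar>k2\<bar>) = tau * \<bar>k2\<bar>"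
    using a tau by (simp_all del: real_sqrt_mult)
  have C: "LINT x|lebesgue. f x * cnj (g x) = Complex (inner (cls f) (cls g)) (inner (cls f) (csc \<i> (cls g)))"
    if "sqint f" "sqint g" for f g :: "'z::euclidean_space \<Rightarrow> complex"
    using Complex_inner_cls[OF that] by simp
  show ?thesis
    unfolding inner_H_def Ueq Veq prod.case 1 2 I_def C[OF h(6) h'(6)] C[OF h(7) h'(7)] C[OF h(8) h'(8)] C[OF h(9) h'(9)] C[OF h(10) h'(10)]
      Phi_def cX_def sc inner_Pair inner_scaleR_left inner_scaleR_right mult.assoc[symmetric] aa
    by (simp add: complex_eq_iff)
qed

lemma norm_H_Phi: "U \<in> H \<Longrightarrow> norm_H L a tau k2 b U = norm (Phi U)"
  unfolding norm_H_def norm_eq_sqrt_inner by (simp add: inner_H_Phi)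

end

section \<open>Solving A U = V\<close>

lemma fst_measurable:
  assumes g: "g \<in> borel_measurable lebesgue" shows "(\<lambda>p :: real \<times> real. g (fst p) :: complex) \<in> borel_measurable lebesgue"
proof -
  obtain g' where g': "g' \<in> borel_measurable borel" "AE x in lebesgue. g x = g' x" using borel_version[OF g] by blast
  have "(\<lambda>p :: real \<times> real. g' (fst p)) \<in> borel_measurable (borel \<Otimes>\<^sub>M borel)" using g'(1) by measurable
  then have "(\<lambda>p :: real \<times> real. g' (fst p)) \<in> borel_measurable lebesgue" by (intro measurable_lebesgueI) (simp add: borel_prod)
  moreover have "AE p in lebesgue. g' (fst (p :: real \<times> real)) = g (fst p)"
    using AE_fst_snd(1)[OF g'(2)] by eventually_elim simp
  ultimately show ?thesis by (rule measurable_cong_AE_lebesgue)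
qed

lemma sqint_prim_at_one:
  assumes s: "sqint (z2 b w)"
  shows "sqint (\<lambda>x. prim (\<lambda>s. z2 b w (x, s)) 1)"
    "AE x in lebesgue. (cmod (prim (\<lambda>s. z2 b w (x, s)) 1))\<^sup>2 \<le> sqn (\<lambda>s. z2 b w (x, s))"
proof -
  have i: "integrable lebesgue (z2 b w)" by (rule sqint_integrable_Q2[OF s z2_out])
  have eq: "prim (\<lambda>s. z2 b w (x, s)) 1 = (LINT s|lebesgue. z2 b w (x, s))" for x
    by (rule prim_right) (simp add: z2_out2)
  have m: "(\<lambda>x. prim (\<lambda>s. z2 b w (x, s)) 1) \<in> borel_measurable lebesgue"
    unfolding eq using integral_slices(3)[OF i] by auto
  show le: "AE x in lebesgue. (cmod (prim (\<lambda>s. z2 b w (x, s)) 1))\<^sup>2 \<le> sqn (\<lambda>s. z2 b w (x, s))"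
    using sqint_slices(1)[OF s]
  proof eventually_elim
    case (elim x)
    show ?case using prim_le[OF elim, of 0 1 1] z2_out2 by simp
  qed
  show "sqint (\<lambda>x. prim (\<lambda>s. z2 b w (x, s)) 1)" by (rule sqint_bound[OF m sqint_slices(3)[OF s] le])
qed

lemma sqint_prim_z2:
  assumes s: "sqint (z2 b w)"
  shows "sqint (z2 b (\<lambda>x r. prim (\<lambda>s. z2 b w (x, s)) r))"
proof -
  obtain G where G: "G \<in> borel_measurable borel" "sqint G" "AE p in lebesgue. z2 b w p = G p" "\<And>p. p \<notin> Q2 b \<Longrightarrow> G p = 0" "integrable lebesgue G"
    using supported_borel_version[OF s z2_out] by blast
  have P: "sqint (\<lambda>p. indicator (Q2 b) p *\<^sub>R prim (\<lambda>s. G (fst p, s)) (snd p))"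
    by (rule sqint_prim_r[OF G(1,2)]) (rule G(4))
  have "AE x in lebesgue. prim (\<lambda>s. G (x, s)) = prim (\<lambda>s. z2 b w (x, s))"
    using AE_slices(1)[OF G(3)] by eventually_elim (rule prim_cong_AE[symmetric])
  from AE_fst_snd(1)[OF this]
  have ae: "AE p in lebesgue. indicator (Q2 b) p *\<^sub>R prim (\<lambda>s. G (fst p, s)) (snd p) = z2 b (\<lambda>x r. prim (\<lambda>s. z2 b w (x, s)) r) p"
    by eventually_elim (simp add: z2_def)
  show ?thesis by (rule sqint_cong_AE[OF P measurable_cong_AE_lebesgue[OF sqint_measurable[OF P] ae] ae])
qed

lemma sqint_fst_z2:
  assumes s: "sqint f" shows "sqint (z2 b (\<lambda>x r. f x))"
proof (rule sqint_bound)
  show "z2 b (\<lambda>x r. f x) \<in> borel_measurable lebesgue"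
    by (rule z2_measurable) (use fst_measurable[OF sqint_measurable[OF s]] in \<open>simp add: case_prod_unfold\<close>)
  show "integrable lebesgue (\<lambda>p :: real \<times> real. (cmod (f (fst p)))\<^sup>2 * indicator {0<..<1} (snd p))"
    by (intro product_integrable sqint_integrable s integrable_indicator_Ioo)
qed (auto simp: z2_def split: split_indicator)

lemma inner_ibp:
  assumes f: "sqint f" "\<And>x. x \<notin> {0<..<L} \<Longrightarrow> f x = 0" and g: "sqint g" "\<And>x. x \<notin> {0<..<L} \<Longrightarrow> g x = 0"
  shows "inner (cls (zext 0 L (prim f))) (cls g) + inner (cls f) (cls (zext 0 L (prim g)))
    = Re (integral\<^sup>L lebesgue f * cnj (integral\<^sup>L lebesgue g))"
proof -
  have fi: "integrable lebesgue f" and gi: "integrable lebesgue g"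
    using sqint_supported_integrable f g by blast+
  have E: "sqint (zext 0 L (prim f))" "sqint (zext 0 L (prim g))" using L2_prim[OF fi] L2_prim[OF gi] by (simp_all add: L2_iff)
  have 1: "(LINT x|lebesgue. zext 0 L (prim f) x * cnj (g x)) = (LINT x|lebesgue. prim f x * cnj (g x))"
    by (intro Bochner_Integration.integral_cong refl) (use g(2) in \<open>auto simp: zext_def split: split_indicator\<close>)
  have 2: "(LINT x|lebesgue. f x * cnj (zext 0 L (prim g) x)) = (LINT x|lebesgue. f x * prim (\<lambda>x. cnj (g x)) x)"
    by (intro Bochner_Integration.integral_cong refl) (use f(2) in \<open>auto simp: zext_def prim_cnj split: split_indicator\<close>)
  have "(LINT x|lebesgue. prim f x * cnj (g x)) + (LINT x|lebesgue. f x * prim (\<lambda>x. cnj (g x)) x)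
    = integral\<^sup>L lebesgue f * (LINT x|lebesgue. cnj (g x))"
    by (rule prim_ibp[OF fi]) (use gi in simp)
  then show ?thesis unfolding inner_cls[OF E(1) g(1)] inner_cls[OF f(1) E(2)] 1 2
    by (simp only: plus_complex.sel(1)[symmetric] Bochner_Integration.integral_cnj)
qed

lemma norm_zext_prim_le:
  assumes L: "L > 0" and f: "sqint f" "\<And>x. x \<notin> {0<..<L} \<Longrightarrow> f x = 0"
  shows "norm (cls (zext 0 L (prim f))) \<le> L * norm (cls f)"
proof -
  have fi: "integrable lebesgue f" by (rule sqint_supported_integrable[OF f])
  have E: "sqint (zext 0 L (prim f))" using L2_prim[OF fi] by (simp add: L2_iff)
  have "(norm (cls (zext 0 L (prim f))))\<^sup>2 \<le> (LINT x|lebesgue. indicator {0<..<L} x * (L * sqn f))"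
    unfolding norm_cls[OF E]
  proof (rule integral_mono_AE[OF sqint_integrable[OF E]])
    show "integrable lebesgue (\<lambda>x. indicator {0<..<L} x * (L * sqn f))"
      by (intro integrable_mult_left integrable_indicator_Ioo)
    show "AE x in lebesgue. (cmod (zext 0 L (prim f) x))\<^sup>2 \<le> indicator {0<..<L} x * (L * sqn f)"
    proof (rule AE_I2)
      fix x
      have "(cmod (prim f x))\<^sup>2 \<le> (L - 0) * sqn f" by (rule prim_le[OF f]) (use L in auto)
      then show "(cmod (zext 0 L (prim f) x))\<^sup>2 \<le> indicator {0<..<L} x * (L * sqn f)"
        by (cases "x \<in> {0<..<L}") (auto simp: zext_out)
    qed
  qed
  also have "\<dots> = (L * norm (cls f))\<^sup>2" using L by (simp add: power_mult_distrib sqn_cls[OF f(1)] power2_eq_square[of L])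
  finally show ?thesis by (rule power2_le_imp_le) (use L in simp)
qed

context wave begin

lemma Rel_st_eq:
  assumes U: "U \<in> H" and e: "st_eq U U2" and R: "Rel U V" shows "Rel U2 V"
proof -
  obtain u v y z w where Ueq: "U = (u, v, y, z, w)" by (cases U) auto
  obtain u2 v2 y2 z2' w2 where U2eq: "U2 = (u2, v2, y2, z2', w2)" by (cases U2) auto
  obtain u' v' y' z' w' where Veq: "V = (u', v', y', z', w')" by (cases V) auto
  have E: "eqon 0 L (wd 0 L u) (wd 0 L u2)" "eqon 0 L v v2" "eqon 0 L (wd 0 L y) (wd 0 L y2)" "eqon 0 L z z2'"
     "AE p in lebesgue. z2 b (Wx b w) p = z2 b (Wx b w2) p" using e by (auto simp: st_eq_def Ueq U2eq)
  obtain C C' where R: "eqon 0 L v u'" "eqon 0 L z y'"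
     "eqon 0 L (\<lambda>x. complex_of_real a * wd 0 L u x + complex_of_real (indicator {0<..<b} x) *
            (complex_of_real k1 * wd 0 L u' x + complex_of_real k2 * Tr1 (wd 0 L u') (Wx b w') 1 x))
          (\<lambda>x. C + prim (zext 0 L (\<lambda>x. v' x + cc x * y' x)) x)"
     "eqon 0 L (wd 0 L y) (\<lambda>x. C' + prim (zext 0 L (\<lambda>x. z' x - cc x * u' x)) x)"
     "AE x in lebesgue. x \<in> {0<..<b} \<longrightarrow>
        eqon 0 1 (\<lambda>r. z2 b (Wx b w) (x, r)) (\<lambda>r. Tr1 (wd 0 L u') (Wx b w') r x)"
    using R unfolding Rel_def Ueq Veq prod.case by blast
  show ?thesis unfolding Rel_def U2eq Veq prod.case
  proof (intro conjI exI)
    show "eqon 0 L v2 u'" by (rule eqon_trans[OF eqon_sym[OF E(2)] R(1)])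
    show "eqon 0 L z2' y'" by (rule eqon_trans[OF eqon_sym[OF E(4)] R(2)])
    show "eqon 0 L (\<lambda>x. complex_of_real a * wd 0 L u2 x + complex_of_real (indicator {0<..<b} x) *
            (complex_of_real k1 * wd 0 L u' x + complex_of_real k2 * Tr1 (wd 0 L u') (Wx b w') 1 x))
          (\<lambda>x. C + prim (zext 0 L (\<lambda>x. v' x + cc x * y' x)) x)"
      using E(1) R(3) by eventually_elim auto
    show "eqon 0 L (wd 0 L y2) (\<lambda>x. C' + prim (zext 0 L (\<lambda>x. z' x - cc x * u' x)) x)"
      by (rule eqon_trans[OF eqon_sym[OF E(3)] R(4)])
    show "AE x in lebesgue. x \<in> {0<..<b} \<longrightarrow>
        eqon 0 1 (\<lambda>r. z2 b (Wx b w2) (x, r)) (\<lambda>r. Tr1 (wd 0 L u') (Wx b w') r x)"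
      using R(5) AE_slices(1)[OF E(5)]
    proof eventually_elim
      case (elim x)
      show ?case
      proof
        assume "x \<in> {0<..<b}"
        with elim(1) have "eqon 0 1 (\<lambda>r. z2 b (Wx b w) (x, r)) (\<lambda>r. Tr1 (wd 0 L u') (Wx b w') r x)" by blast
        then show "eqon 0 1 (\<lambda>r. z2 b (Wx b w2) (x, r)) (\<lambda>r. Tr1 (wd 0 L u') (Wx b w') r x)"
          using elim(2) by eventually_elim simp
      qed
    qed
  qed
qed

lemma Rel_lincomb:
  assumes U: "U \<in> H" and V: "V \<in> H" and R: "Rel U V" and U2: "U2 \<in> H" and V2: "V2 \<in> H" and R2: "Rel U2 V2"
  shows "Rel (st_lin c U d U2) (st_lin c V d V2)"
proof -
  obtain u v y z w where Ueq: "U = (u, v, y, z, w)" by (cases U) auto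
  obtain u' v' y' z' w' where Veq: "V = (u', v', y', z', w')" by (cases V) auto
  obtain u2 v2 y2 zz2 w2 where U2eq: "U2 = (u2, v2, y2, zz2, w2)" by (cases U2) auto
  obtain u2' v2' y2' zz2' w2' where V2eq: "V2 = (u2', v2', y2', zz2', w2')" by (cases V2) auto
  note hU = state_facts[OF U[unfolded Ueq]] and hV = state_facts[OF V[unfolded Veq]] and hU2 = state_facts[OF U2[unfolded U2eq]] and hV2 = state_facts[OF V2[unfolded V2eq]]
  obtain C C' where R: "eqon 0 L v u'" "eqon 0 L z y'"
     "eqon 0 L (\<lambda>x. complex_of_real a * wd 0 L u x + complex_of_real (indicator {0<..<b} x) *
            (complex_of_real k1 * wd 0 L u' x + complex_of_real k2 * Tr1 (wd 0 L u') (Wx b w') 1 x))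
          (\<lambda>x. C + prim (zext 0 L (\<lambda>x. v' x + cc x * y' x)) x)"
     "eqon 0 L (wd 0 L y) (\<lambda>x. C' + prim (zext 0 L (\<lambda>x. z' x - cc x * u' x)) x)"
     "AE x in lebesgue. x \<in> {0<..<b} \<longrightarrow>
        eqon 0 1 (\<lambda>r. z2 b (Wx b w) (x, r)) (\<lambda>r. Tr1 (wd 0 L u') (Wx b w') r x)"
    using R unfolding Rel_def Ueq Veq prod.case by blast
  obtain C2 C2' where R2: "eqon 0 L v2 u2'" "eqon 0 L zz2 y2'"
     "eqon 0 L (\<lambda>x. complex_of_real a * wd 0 L u2 x + complex_of_real (indicator {0<..<b} x) *
            (complex_of_real k1 * wd 0 L u2' x + complex_of_real k2 * Tr1 (wd 0 L u2') (Wx b w2') 1 x))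
          (\<lambda>x. C2 + prim (zext 0 L (\<lambda>x. v2' x + cc x * y2' x)) x)"
     "eqon 0 L (wd 0 L y2) (\<lambda>x. C2' + prim (zext 0 L (\<lambda>x. zz2' x - cc x * u2' x)) x)"
     "AE x in lebesgue. x \<in> {0<..<b} \<longrightarrow>
        eqon 0 1 (\<lambda>r. z2 b (Wx b w2) (x, r)) (\<lambda>r. Tr1 (wd 0 L u2') (Wx b w2') r x)"
    using R2 unfolding Rel_def U2eq V2eq prod.case by blast
  have wdl: "eqon 0 L (wd 0 L (\<lambda>x. c * f x + d * g x)) (\<lambda>x. c * wd 0 L f x + d * wd 0 L g x)"
    if "H10 0 L f" "H10 0 L g" for f g by (rule H1_lincomb(2)[OF L]) (use that in \<open>auto intro: H10_H1\<close>)
  have Wl: "AE p in lebesgue. z2 b (Wx b (\<lambda>x r. c * f x r + d * g x r)) p = c * z2 b (Wx b f) p + d * z2 b (Wx b g) p"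
    if "Wmem b f" "Wmem b g" for f g
    using Wx_unique[OF b W_deriv_lincomb[OF b Wx_W_deriv[OF that(1)] Wx_W_deriv[OF that(2)], of c d]] by (simp add: z2_lincomb)
  have Tl: "AE x in lebesgue. x \<in> {0<..<L} \<longrightarrow> (\<forall>r. Tr1 (wd 0 L (\<lambda>x. c * u' x + d * u2' x)) (Wx b (\<lambda>x r. c * w' x r + d * w2' x r)) r x
      = c * Tr1 (wd 0 L u') (Wx b w') r x + d * Tr1 (wd 0 L u2') (Wx b w2') r x)"
    using wdl[OF hV(1) hV2(1)] AE_slices(1)[OF Wl[OF hV(5) hV2(5)]] sqint_slices(1)[OF hV(10)] sqint_slices(1)[OF hV2(10)]
  proof eventually_elim
    case (elim x)
    have i: "integrable lebesgue (\<lambda>s. z2 b (Wx b w') (x, s))" "integrable lebesgue (\<lambda>s. z2 b (Wx b w2') (x, s))"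
      by (rule sqint_supported_integrable[OF elim(3) z2_out2], simp)
        (rule sqint_supported_integrable[OF elim(4) z2_out2], simp)
    have "prim (\<lambda>s. z2 b (Wx b (\<lambda>x r. c * w' x r + d * w2' x r)) (x, s)) r
      = prim (\<lambda>s. c * z2 b (Wx b w') (x, s) + d * z2 b (Wx b w2') (x, s)) r" for r
      using prim_cong_AE[OF elim(2)] by simp
    also have "\<dots> r = c * prim (\<lambda>s. z2 b (Wx b w') (x, s)) r + d * prim (\<lambda>s. z2 b (Wx b w2') (x, s)) r" for r
      using i by (subst prim_add) (simp_all only: prim_cmult integrable_mult_right)
    finally show ?case using elim(1) by (simp add: Tr1_def algebra_simps)
  qed
  have pl: "prim (zext 0 L (\<lambda>x. c * f x + d * g x)) x = c * prim (zext 0 L f) x + d * prim (zext 0 L g) x"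
    if "L2 0 L f" "L2 0 L g" for f g x
    unfolding zext_add zext_cmult using L2_integrable[OF that(1)] L2_integrable[OF that(2)]
    by (subst prim_add) (simp_all only: prim_cmult integrable_mult_right)
  have l: "L2 0 L (\<lambda>x. v' x + cc x * y' x)" "L2 0 L (\<lambda>x. v2' x + cc x * y2' x)"
    "L2 0 L (\<lambda>x. z' x - cc x * u' x)" "L2 0 L (\<lambda>x. zz2' x - cc x * u2' x)"
    using hV hV2 H1_L2[OF H10_H1] by (auto intro!: L2_add L2_diff L2_cc)
  show ?thesis unfolding Rel_def st_lin_def Ueq Veq U2eq V2eq prod.case
  proof (intro conjI)
    show "eqon 0 L (\<lambda>x. c * v x + d * v2 x) (\<lambda>x. c * u' x + d * u2' x)" using R(1) R2(1) by eventually_elim auto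
    show "eqon 0 L (\<lambda>x. c * z x + d * zz2 x) (\<lambda>x. c * y' x + d * y2' x)" using R(2) R2(2) by eventually_elim auto
    have N: "(\<lambda>x. (c * v' x + d * v2' x) + cc x * (c * y' x + d * y2' x)) = (\<lambda>x. c * (v' x + cc x * y' x) + d * (v2' x + cc x * y2' x))"
      "(\<lambda>x. (c * z' x + d * zz2' x) - cc x * (c * u' x + d * u2' x)) = (\<lambda>x. c * (z' x - cc x * u' x) + d * (zz2' x - cc x * u2' x))"
      by (auto simp: fun_eq_iff algebra_simps)
    have "eqon 0 L (\<lambda>x. complex_of_real a * wd 0 L (\<lambda>x. c * u x + d * u2 x) x + complex_of_real (indicator {0<..<b} x) *
            (complex_of_real k1 * wd 0 L (\<lambda>x. c * u' x + d * u2' x) x + complex_of_real k2 *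
              Tr1 (wd 0 L (\<lambda>x. c * u' x + d * u2' x)) (Wx b (\<lambda>x r. c * w' x r + d * w2' x r)) 1 x))
          (\<lambda>x. c * (C + prim (zext 0 L (\<lambda>x. v' x + cc x * y' x)) x) + d * (C2 + prim (zext 0 L (\<lambda>x. v2' x + cc x * y2' x)) x))"
      using R(3) R2(3) wdl[OF hU(1) hU2(1)] wdl[OF hV(1) hV2(1)] Tl
    proof eventually_elim
      case (elim x)
      show ?case
      proof
        assume x: "x \<in> {0<..<L}"
        show "complex_of_real a * wd 0 L (\<lambda>x. c * u x + d * u2 x) x + complex_of_real (indicator {0<..<b} x) *
            (complex_of_real k1 * wd 0 L (\<lambda>x. c * u' x + d * u2' x) x + complex_of_real k2 *
              Tr1 (wd 0 L (\<lambda>x. c * u' x + d * u2' x)) (Wx b (\<lambda>x r. c * w' x r + d * w2' x r)) 1 x)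
          = c * (C + prim (zext 0 L (\<lambda>x. v' x + cc x * y' x)) x) + d * (C2 + prim (zext 0 L (\<lambda>x. v2' x + cc x * y2' x)) x)"
          unfolding elim(1)[rule_format, OF x, symmetric] elim(2)[rule_format, OF x, symmetric]
            elim(3)[rule_format, OF x] elim(4)[rule_format, OF x] elim(5)[rule_format, OF x]
          by (simp add: algebra_simps)
      qed
    qed
    then show "\<exists>K. eqon 0 L (\<lambda>x. complex_of_real a * wd 0 L (\<lambda>x. c * u x + d * u2 x) x + complex_of_real (indicator {0<..<b} x) *
            (complex_of_real k1 * wd 0 L (\<lambda>x. c * u' x + d * u2' x) x + complex_of_real k2 *
              Tr1 (wd 0 L (\<lambda>x. c * u' x + d * u2' x)) (Wx b (\<lambda>x r. c * w' x r + d * w2' x r)) 1 x))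
          (\<lambda>x. K + prim (zext 0 L (\<lambda>x. (c * v' x + d * v2' x) + cc x * (c * y' x + d * y2' x))) x)"
      unfolding N pl[OF l(1,2)] by (intro exI[of _ "c * C + d * C2"]) (simp add: algebra_simps)
    have "eqon 0 L (wd 0 L (\<lambda>x. c * y x + d * y2 x))
        (\<lambda>x. c * (C' + prim (zext 0 L (\<lambda>x. z' x - cc x * u' x)) x) + d * (C2' + prim (zext 0 L (\<lambda>x. zz2' x - cc x * u2' x)) x))"
      using R(4) R2(4) wdl[OF hU(3) hU2(3)] by eventually_elim auto
    then show "\<exists>K. eqon 0 L (wd 0 L (\<lambda>x. c * y x + d * y2 x))
        (\<lambda>x. K + prim (zext 0 L (\<lambda>x. (c * z' x + d * zz2' x) - cc x * (c * u' x + d * u2' x))) x)"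
      unfolding N pl[OF l(3,4)] by (intro exI[of _ "c * C' + d * C2'"]) (simp add: algebra_simps)
    show "AE x in lebesgue. x \<in> {0<..<b} \<longrightarrow>
        eqon 0 1 (\<lambda>r. z2 b (Wx b (\<lambda>x r. c * w x r + d * w2 x r)) (x, r))
          (\<lambda>r. Tr1 (wd 0 L (\<lambda>x. c * u' x + d * u2' x)) (Wx b (\<lambda>x r. c * w' x r + d * w2' x r)) r x)"
      using R(5) R2(5) Tl AE_slices(1)[OF Wl[OF hU(5) hU2(5)]]
    proof eventually_elim
      case (elim x)
      show ?case
      proof
        assume x: "x \<in> {0<..<b}"
        then have xL: "x \<in> {0<..<L}" using bL by auto
        show "eqon 0 1 (\<lambda>r. z2 b (Wx b (\<lambda>x r. c * w x r + d * w2 x r)) (x, r))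
          (\<lambda>r. Tr1 (wd 0 L (\<lambda>x. c * u' x + d * u2' x)) (Wx b (\<lambda>x r. c * w' x r + d * w2' x r)) r x)"
          using elim(1)[rule_format, OF x] elim(2)[rule_format, OF x] elim(4)
          by eventually_elim (use elim(3)[rule_format, OF xL] in auto)
      qed
    qed
  qed
qed

text \<open>Subtracting the mean over \<open>(0, L)\<close>. It selects the constant of integration
  for which a prescribed derivative belongs to a function vanishing at both ends.\<close>

lemma mean_free_shift:
  assumes h: "L2 0 L h" shows "\<exists>C. integral\<^sup>L lebesgue (zext 0 L (\<lambda>x. C + h x)) = 0"
proof -
  let ?C = "- integral\<^sup>L lebesgue (zext 0 L h) / complex_of_real L"
  have "integral\<^sup>L lebesgue (zext 0 L (\<lambda>_. ?C)) = complex_of_real L * ?C"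
    using L unfolding zext_def[abs_def] by (subst integral_scaleR_left) (simp_all add: scaleR_conv_of_real)
  also have "\<dots> = - integral\<^sup>L lebesgue (zext 0 L h)" using L by simp
  finally have i: "integral\<^sup>L lebesgue (zext 0 L (\<lambda>_. ?C)) = - integral\<^sup>L lebesgue (zext 0 L h)" .
  have "integral\<^sup>L lebesgue (zext 0 L (\<lambda>x. ?C + h x)) = 0"
    unfolding zext_add Bochner_Integration.integral_add[OF L2_integrable[OF L2_const] L2_integrable[OF h]] i by simp
  then show ?thesis by blast
qed

lemma L2_boundary_term:
  assumes V: "(u', v', y', z', e') \<in> H"
  shows "L2 0 L (\<lambda>x. complex_of_real (indicator {0<..<b} x) *
            (complex_of_real k1 * wd 0 L u' x + complex_of_real k2 * Tr1 (wd 0 L u') (Wx b e') 1 x))"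
proof -
  note h = state_facts[OF V]
  have "L2 0 L (Tr1 (wd 0 L u') (Wx b e') 1)"
    unfolding Tr1_def using h(6) L2_sqint[OF sqint_prim_at_one(1)[OF h(10)]] by (intro L2_diff L2_cmult) (simp add: L2_iff)
  then have 1: "L2 0 L (\<lambda>x. complex_of_real k1 * wd 0 L u' x + complex_of_real k2 * Tr1 (wd 0 L u') (Wx b e') 1 x)" (is "L2 0 L ?f")
    using h(6) by (intro L2_lincomb) (simp_all add: L2_iff)
  have "zext 0 L (\<lambda>x. complex_of_real (indicator {0<..<b} x) * ?f x) = zext 0 b (zext 0 L ?f)"
    using bL by (auto simp: zext_def fun_eq_iff split: split_indicator)
  then show ?thesis unfolding L2_iff using sqint_zext 1[unfolded L2_iff] by simp
qed

text \<open>Every component is explicit: the velocities are the first and third data, the delay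
  derivative is \<open>Tr1\<close>, and the first integrals are solved for \<open>wd 0 L u\<close>
  and \<open>wd 0 L y\<close> with the constants that make them mean free. No coupled problem
  remains.\<close>

lemma Rel_surj:
  assumes V: "V \<in> H" shows "\<exists>U\<in>H. Rel U V"
proof -
  obtain u' v' y' z' e' where Veq: "V = (u', v', y', z', e')" by (cases V) auto
  note h = state_facts[OF V[unfolded Veq]]
  define B where "B = (\<lambda>x. complex_of_real (indicator {0<..<b} x) *
            (complex_of_real k1 * wd 0 L u' x + complex_of_real k2 * Tr1 (wd 0 L u') (Wx b e') 1 x))"
  have B: "L2 0 L B" unfolding B_def by (rule L2_boundary_term[OF V[unfolded Veq]])
  have N: "L2 0 L (\<lambda>x. v' x + cc x * y' x)" and M: "L2 0 L (\<lambda>x. z' x - cc x * u' x)"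
    using h H1_L2[OF H10_H1] by (auto intro!: L2_add L2_diff L2_cc)
  obtain C where C: "integral\<^sup>L lebesgue (zext 0 L (\<lambda>x. C + (prim (zext 0 L (\<lambda>x. v' x + cc x * y' x)) x - B x))) = 0"
    using mean_free_shift[OF L2_diff[OF L2_prim[OF L2_integrable[OF N]] B]] by blast
  define p where "p = (\<lambda>x. (1 / complex_of_real a) * (C + (prim (zext 0 L (\<lambda>x. v' x + cc x * y' x)) x - B x)))"
  have p: "L2 0 L p" unfolding p_def by (intro L2_cmult L2_add L2_const L2_diff L2_prim L2_integrable N B)
  have p0: "integral\<^sup>L lebesgue (zext 0 L p) = 0"
    unfolding p_def zext_cmult by (subst integral_mult_right_zero) (simp add: C)
  note u = H10_wd[OF L p p0, of "prim (zext 0 L p)"]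
  obtain C' where C': "integral\<^sup>L lebesgue (zext 0 L (\<lambda>x. C' + prim (zext 0 L (\<lambda>x. z' x - cc x * u' x)) x)) = 0"
    using mean_free_shift[OF L2_prim[OF L2_integrable[OF M]]] by blast
  define r where "r = (\<lambda>x. C' + prim (zext 0 L (\<lambda>x. z' x - cc x * u' x)) x)"
  have r: "L2 0 L r" unfolding r_def by (intro L2_add L2_const L2_prim L2_integrable M)
  note y = H10_wd[OF L r C'[folded r_def], of "prim (zext 0 L r)"]
  define F where "F = z2 b (\<lambda>x r. Tr1 (wd 0 L u') (Wx b e') r x)"
  have Feq: "F = (\<lambda>p. z2 b (\<lambda>x r. zext 0 L (wd 0 L u') x) p - complex_of_real tau * z2 b (\<lambda>x r. prim (\<lambda>s. z2 b (Wx b e') (x, s)) r) p)"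
    using bL by (auto simp: F_def z2_def Tr1_def fun_eq_iff zext_def split: split_indicator)
  have F: "sqint F" unfolding Feq by (intro sqint_diff sqint_cmult sqint_fst_z2 sqint_prim_z2 h)
  have Fo: "p \<notin> Q2 b \<Longrightarrow> F p = 0" for p unfolding F_def by (rule z2_out)
  obtain e w where e: "W_deriv b e w" "AE p in lebesgue. z2 b w p = F p" using W_construct[OF b F Fo] by blast
  have We: "Wmem b e" using e(1) by (auto simp: Wmem_def)
  have WF: "AE p in lebesgue. z2 b (Wx b e) p = F p" using Wx_unique[OF b e(1)] e(2) by eventually_elim simp
  define U where "U = (prim (zext 0 L p), u', prim (zext 0 L r), y', e)"
  have "U \<in> H" unfolding U_def Hsp_def using u(1) y(1) We h H1_L2[OF H10_H1] by simp
  moreover have "Rel U V" unfolding Rel_def U_def Veq prod.case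
  proof (intro conjI exI)
    show "eqon 0 L (\<lambda>x. complex_of_real a * wd 0 L (prim (zext 0 L p)) x + complex_of_real (indicator {0<..<b} x) *
            (complex_of_real k1 * wd 0 L u' x + complex_of_real k2 * Tr1 (wd 0 L u') (Wx b e') 1 x))
          (\<lambda>x. C + prim (zext 0 L (\<lambda>x. v' x + cc x * y' x)) x)"
      using u(2) unfolding B_def[symmetric, THEN fun_cong]
      by (auto simp: p_def B_def[symmetric, THEN fun_cong] elim!: eventually_mono) (use a in \<open>simp add: B_def\<close>)
    show "eqon 0 L (wd 0 L (prim (zext 0 L r))) (\<lambda>x. C' + prim (zext 0 L (\<lambda>x. z' x - cc x * u' x)) x)"
      using y(2) by (simp add: r_def)
    show "AE x in lebesgue. x \<in> {0<..<b} \<longrightarrow>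
        eqon 0 1 (\<lambda>r. z2 b (Wx b e) (x, r)) (\<lambda>r. Tr1 (wd 0 L u') (Wx b e') r x)"
      using AE_slices(1)[OF WF]
    proof eventually_elim
      case (elim x)
      show ?case
      proof
        assume x: "x \<in> {0<..<b}"
        show "eqon 0 1 (\<lambda>r. z2 b (Wx b e) (x, r)) (\<lambda>r. Tr1 (wd 0 L u') (Wx b e') r x)"
          using elim by eventually_elim (use x in \<open>auto simp: F_def z2_def\<close>)
      qed
    qed
  qed simp_all
  ultimately show ?thesis by blast
qed

end

section \<open>Energy estimates\<close>

lemma norm_le_if_slices_le:
  fixes F :: "real \<times> real \<Rightarrow> complex"
  assumes F: "sqint F" and g: "integrable lebesgue g" and le: "AE x in lebesgue. sqn (\<lambda>r. F (x, r)) \<le> g x"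
    and c: "integral\<^sup>L lebesgue g \<le> c\<^sup>2" "0 \<le> c"
  shows "norm (cls F) \<le> c"
proof -
  have "(norm (cls F))\<^sup>2 = (LINT x|lebesgue. sqn (\<lambda>r. F (x, r)))"
    unfolding norm_cls[OF F] sqint_slices(5)[OF F] by (simp add: sqn_def)
  also have "\<dots> \<le> integral\<^sup>L lebesgue g" by (rule integral_mono_AE[OF sqint_slices(3)[OF F] g le])
  finally show ?thesis using c by (meson order_trans power2_le_imp_le)
qed

lemma sqn_unit_le:
  assumes s: "sqint f" "\<And>r. r \<notin> {0<..<1::real} \<Longrightarrow> f r = 0" and le: "\<And>r. (cmod (f r))\<^sup>2 \<le> c"
  shows "sqn f \<le> c"
proof -
  have "sqn f \<le> (LINT r|lebesgue. indicator {0<..<1::real} r * c)" unfolding sqn_def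
  proof (rule integral_mono[OF sqint_integrable[OF s(1)]])
    show "integrable lebesgue (\<lambda>r::real. indicator {0<..<1} r * c)" by (intro integrable_mult_left integrable_indicator_Ioo)
    show "(cmod (f r))\<^sup>2 \<le> indicator {0<..<1} r * c" for r
    proof (cases "r \<in> {0<..<1}")
      case True then show ?thesis using le by simp
    next
      case False then show ?thesis using s(2) by simp
    qed
  qed
  also have "\<dots> = c" by (subst integral_mult_left_zero) simp
  finally show ?thesis .
qed

lemma norm_prim_at_one:
  assumes s: "sqint (z2 b w)" shows "norm (cls (\<lambda>x. prim (\<lambda>s. z2 b w (x, s)) 1)) \<le> norm (cls (z2 b w))"
proof (rule power2_le_imp_le)
  note p = sqint_prim_at_one[OF s]
  have "(norm (cls (\<lambda>x. prim (\<lambda>s. z2 b w (x, s)) 1)))\<^sup>2 \<le> (LINT x|lebesgue. sqn (\<lambda>s. z2 b w (x, s)))"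
    unfolding norm_cls[OF p(1)] by (rule integral_mono_AE[OF sqint_integrable[OF p(1)] sqint_slices(3)[OF s] p(2)])
  then show "(norm (cls (\<lambda>x. prim (\<lambda>s. z2 b w (x, s)) 1)))\<^sup>2 \<le> (norm (cls (z2 b w)))\<^sup>2"
    unfolding sqint_slices(5)[OF s] sqn_cls[OF s] .
qed simp

lemma norm_prim_z2:
  assumes s: "sqint (z2 b w)" shows "norm (cls (z2 b (\<lambda>x r. prim (\<lambda>s. z2 b w (x, s)) r))) \<le> norm (cls (z2 b w))"
proof (rule norm_le_if_slices_le[OF sqint_prim_z2[OF s] sqint_slices(3)[OF s]])
  show "AE x in lebesgue. sqn (\<lambda>r. z2 b (\<lambda>x r. prim (\<lambda>s. z2 b w (x, s)) r) (x, r)) \<le> sqn (\<lambda>r. z2 b w (x, r))"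
    using sqint_slices(1)[OF s] sqint_slices(1)[OF sqint_prim_z2[OF s]]
  proof eventually_elim
    case (elim x)
    show ?case
    proof (rule sqn_unit_le[OF elim(2)])
      fix r
      have "(cmod (prim (\<lambda>s. z2 b w (x, s)) r))\<^sup>2 \<le> (1 - 0) * sqn (\<lambda>r. z2 b w (x, r))"
        by (rule prim_le[OF elim(1) z2_out2]) auto
      moreover have "0 \<le> sqn (\<lambda>r. z2 b w (x, r))" by (simp add: sqn_def)
      ultimately show "(cmod (z2 b (\<lambda>x r. prim (\<lambda>s. z2 b w (x, s)) r) (x, r)))\<^sup>2 \<le> sqn (\<lambda>r. z2 b w (x, r))"
        by (auto simp: z2_def split: split_indicator)
    qed (rule z2_out2)
  qed
  show "(LINT x|lebesgue. sqn (\<lambda>r. z2 b w (x, r))) \<le> (norm (cls (z2 b w)))\<^sup>2"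
    unfolding sqint_slices(5)[OF s] sqn_cls[OF s] by simp
qed simp

lemma norm_fst_z2:
  assumes s: "sqint f" shows "norm (cls (z2 b (\<lambda>x r. f x))) \<le> norm (cls f)"
proof (rule norm_le_if_slices_le[OF sqint_fst_z2[OF s] sqint_integrable[OF s]])
  show "AE x in lebesgue. sqn (\<lambda>r. z2 b (\<lambda>x r. f x) (x, r)) \<le> (cmod (f x))\<^sup>2"
    using sqint_slices(1)[OF sqint_fst_z2[OF s, of b]]
  proof eventually_elim
    case (elim x)
    show ?case by (rule sqn_unit_le[OF elim z2_out2]) (auto simp: z2_def split: split_indicator)
  qed
qed (simp_all add: norm_cls[OF s])

text \<open>The real part of the integrand is half the derivative of the squared modulus of
  \<open>prim f\<close>. Integration by parts expresses this as the integral plus its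
  conjugate.\<close>

lemma Re_prim_self:
  assumes f: "integrable lebesgue f"
  shows "Re (LINT r|lebesgue. prim f r * cnj (f r)) = (cmod (integral\<^sup>L lebesgue f))\<^sup>2 / 2"
proof -
  let ?I = "LINT r|lebesgue. prim f r * cnj (f r)"
  have "?I + (LINT r|lebesgue. f r * prim (\<lambda>r. cnj (f r)) r) = integral\<^sup>L lebesgue f * (LINT r|lebesgue. cnj (f r))"
    by (rule prim_ibp[OF f]) (use f in simp)
  moreover have "(LINT r|lebesgue. f r * prim (\<lambda>r. cnj (f r)) r) = cnj ?I"
    unfolding Bochner_Integration.integral_cnj[symmetric] prim_cnj
    by (intro Bochner_Integration.integral_cong refl) simp
  ultimately have "?I + cnj ?I = integral\<^sup>L lebesgue f * cnj (integral\<^sup>L lebesgue f)"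
    by (simp only: Bochner_Integration.integral_cnj)
  then have "Re (?I + cnj ?I) = Re (integral\<^sup>L lebesgue f * cnj (integral\<^sup>L lebesgue f))" by (rule arg_cong)
  then show ?thesis unfolding cmod_power2 by (simp add: power2_eq_square)
qed

text \<open>Here \<open>T = \<eta>\<^sub>x(x, \<cdot>)\<close> and \<open>P = v\<^sub>x(x)\<close>: the delay energy changes only through its boundary values.\<close>
lemma transport_energy:
  fixes tau :: real and P :: complex and f :: "real \<Rightarrow> complex"
  assumes tau: "tau > 0" and f: "sqint f" "\<And>r. r \<notin> {0<..<1} \<Longrightarrow> f r = 0"
  defines "T \<equiv> \<lambda>r. P - complex_of_real tau * prim f r"
  shows "tau * Re (LINT r|lebesgue. T r * cnj (f r)) = ((cmod P)\<^sup>2 - (cmod (T 1))\<^sup>2) / 2"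
proof -
  have fi: "integrable lebesgue f" by (rule sqint_supported_integrable[OF f])
  have ci: "integrable lebesgue (\<lambda>r. cnj (f r))" using fi by simp
  let ?s = "integral\<^sup>L lebesgue f"
  have s: "prim f 1 = ?s" by (rule prim_right) (simp add: f(2))
  have "(LINT r|lebesgue. T r * cnj (f r)) = (LINT r|lebesgue. P * cnj (f r) - complex_of_real tau * (prim f r * cnj (f r)))"
    by (intro Bochner_Integration.integral_cong refl) (simp add: T_def algebra_simps)
  also have "\<dots> = (LINT r|lebesgue. P * cnj (f r)) - (LINT r|lebesgue. complex_of_real tau * (prim f r * cnj (f r)))"
    using ci prim_mult_integrable[OF fi ci] by (intro Bochner_Integration.integral_diff) auto
  also have "\<dots> = P * cnj ?s - complex_of_real tau * (LINT r|lebesgue. prim f r * cnj (f r))"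
    by (simp only: integral_mult_right_zero Bochner_Integration.integral_cnj)
  finally have "Re (LINT r|lebesgue. T r * cnj (f r)) = Re (P * cnj ?s) - tau * ((cmod ?s)\<^sup>2 / 2)"
    by (simp add: Re_prim_self[OF fi])
  from this show ?thesis
    unfolding cmod_power2 by (simp only:) (simp add: T_def s power2_eq_square field_simps)
qed

text \<open>Here \<open>P\<close> is the velocity gradient and \<open>Q\<close> the delayed one.
  Young's inequality with equal weights bounds the mixed term so that
  \<open>\<bar>k2\<bar> / 2\<close> times the squared modulus of \<open>Q\<close> appears on both
  sides and cancels; what is left compares \<open>\<bar>k2\<bar>\<close> with
  \<open>k1\<close>.\<close>

lemma damping_dominates_delay:
  assumes k: "\<bar>k2\<bar> \<le> k1"
  shows "\<bar>k2\<bar> * (((cmod P)\<^sup>2 - (cmod Q)\<^sup>2) / 2) \<le> Re ((complex_of_real k1 * P + complex_of_real k2 * Q) * cnj P)"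
proof -
  have "cmod (Q * cnj P) \<le> ((cmod P)\<^sup>2 + (cmod Q)\<^sup>2) / 2"
    using sum_squares_bound[of "cmod P" "cmod Q"] by (simp add: norm_mult mult.commute[of "cmod Q"])
  then have "\<bar>Re (Q * cnj P)\<bar> \<le> ((cmod P)\<^sup>2 + (cmod Q)\<^sup>2) / 2" using abs_Re_le_cmod order_trans by blast
  then have "\<bar>k2\<bar> * \<bar>Re (Q * cnj P)\<bar> \<le> \<bar>k2\<bar> * (((cmod P)\<^sup>2 + (cmod Q)\<^sup>2) / 2)" by (intro mult_left_mono) auto
  then have "\<bar>k2 * Re (Q * cnj P)\<bar> \<le> \<bar>k2\<bar> * (((cmod P)\<^sup>2 + (cmod Q)\<^sup>2) / 2)" by (simp only: abs_mult)
  moreover have "\<bar>k2\<bar> * (cmod P)\<^sup>2 \<le> k1 * (cmod P)\<^sup>2" using k by (intro mult_right_mono) auto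
  moreover have "Re ((complex_of_real k1 * P + complex_of_real k2 * Q) * cnj P) = k1 * (cmod P)\<^sup>2 + k2 * Re (Q * cnj P)"
    unfolding cmod_power2 by (simp add: power2_eq_square algebra_simps)
  moreover have "(z - y) / 2 \<le> w + x" if "\<bar>x\<bar> \<le> (z + y) / 2" "z \<le> w" for x y z w :: real
    using abs_le_D2[OF that(1)] that(2) by (simp add: field_simps)
  ultimately show ?thesis
    by (simp only: right_diff_distrib distrib_left times_divide_eq_right)
qed

context wave begin

text \<open>The damping part of \<open>Sb\<close>, with the trace of the delay state at 1 already
  replaced by its expression in the data.\<close>

definition Bd :: "(real \<Rightarrow> complex) \<Rightarrow> (real \<Rightarrow> real \<Rightarrow> complex) \<Rightarrow> real \<Rightarrow> complex" where
  "Bd u' e' x = complex_of_real (indicator {0<..<b} x) *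
            (complex_of_real k1 * wd 0 L u' x + complex_of_real k2 * Tr1 (wd 0 L u') (Wx b e') 1 x)"

text \<open>For almost every \<open>x\<close> in the damped interval,
  \<open>transport_energy\<close> evaluates the integral over the delay variable and
  \<open>damping_dominates_delay\<close> bounds it pointwise; elsewhere both integrands vanish.
  Integration over \<open>x\<close> gives the estimate.\<close>

lemma delay_estimate:
  assumes V: "(u', v', y', z', e') \<in> H" and e: "Wmem b e"
    and R: "AE x in lebesgue. x \<in> {0<..<b} \<longrightarrow>
        eqon 0 1 (\<lambda>r. z2 b (Wx b e) (x, r)) (\<lambda>r. Tr1 (wd 0 L u') (Wx b e') r x)"
  shows "tau * \<bar>k2\<bar> * inner (cls (z2 b (Wx b e))) (cls (z2 b (Wx b e')))
    \<le> inner (cls (zext 0 L (Bd u' e'))) (cls (zext 0 L (wd 0 L u')))"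
proof -
  note h = state_facts[OF V]
  have We: "sqint (z2 b (Wx b e))" by (rule W_deriv_sqint[OF b Wx_W_deriv[OF e]])
  have B: "sqint (zext 0 L (Bd u' e'))" using L2_boundary_term[OF V] unfolding Bd_def[abs_def] L2_iff .
  define F where "F = (\<lambda>p. z2 b (Wx b e) p * cnj (z2 b (Wx b e') p))"
  have F: "integrable lebesgue F" unfolding F_def by (rule sqint_mult_integrable[OF We sqint_cnj[OF h(10)]])
  have i2: "integrable lebesgue (\<lambda>x. zext 0 L (Bd u' e') x * cnj (zext 0 L (wd 0 L u') x))"
    by (rule sqint_mult_integrable[OF B sqint_cnj[OF h(6)]])
  have "tau * \<bar>k2\<bar> * inner (cls (z2 b (Wx b e))) (cls (z2 b (Wx b e')))
      = tau * \<bar>k2\<bar> * Re (LINT x|lebesgue. LINT r|lebesgue. F (x, r))"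
    unfolding inner_cls[OF We h(10)] integral_slices(5)[OF F] by (simp add: F_def)
  also have "\<dots> = tau * \<bar>k2\<bar> * (LINT x|lebesgue. Re (LINT r|lebesgue. F (x, r)))"
    by (subst integral_Re[OF integral_slices(3)[OF F]]) (rule refl)
  also have "\<dots> = (LINT x|lebesgue. tau * \<bar>k2\<bar> * Re (LINT r|lebesgue. F (x, r)))" by simp
  also have "\<dots> \<le> (LINT x|lebesgue. Re (zext 0 L (Bd u' e') x * cnj (zext 0 L (wd 0 L u') x)))"
  proof (rule integral_mono_AE)
    show "integrable lebesgue (\<lambda>x. tau * \<bar>k2\<bar> * Re (LINT r|lebesgue. F (x, r)))"
      by (intro integrable_mult_right integrable_Re integral_slices(3)[OF F])
    show "integrable lebesgue (\<lambda>x. Re (zext 0 L (Bd u' e') x * cnj (zext 0 L (wd 0 L u') x)))"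
      by (intro integrable_Re i2)
    show "AE x in lebesgue. tau * \<bar>k2\<bar> * Re (LINT r|lebesgue. F (x, r)) \<le> Re (zext 0 L (Bd u' e') x * cnj (zext 0 L (wd 0 L u') x))"
      using R sqint_slices(1)[OF h(10)]
    proof eventually_elim
      case (elim x)
      show ?case
      proof (cases "x \<in> {0<..<b}")
        case False
        then show ?thesis by (simp add: F_def z2_out1[OF False] zext_def Bd_def)
      next
        case True
        then have xL: "x \<in> {0<..<L}" using bL by auto
        define T where "T = (\<lambda>r. wd 0 L u' x - complex_of_real tau * prim (\<lambda>s. z2 b (Wx b e') (x, s)) r)"
        have "(LINT r|lebesgue. F (x, r)) = (LINT r|lebesgue. T r * cnj (z2 b (Wx b e') (x, r)))"
        proof (rule integral_cong_AE_lebesgue)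
          show "AE r in lebesgue. F (x, r) = T r * cnj (z2 b (Wx b e') (x, r))"
            using elim(1)[rule_format, OF True]
          proof eventually_elim
            case (elim r)
            then show ?case by (cases "r \<in> {0<..<1}") (auto simp: F_def T_def Tr1_def z2_out2)
          qed
        qed
        then have "tau * Re (LINT r|lebesgue. F (x, r)) = ((cmod (wd 0 L u' x))\<^sup>2 - (cmod (T 1))\<^sup>2) / 2"
          using transport_energy[OF tau elim(2) z2_out2, of "wd 0 L u' x"] unfolding T_def by simp
        then have "tau * \<bar>k2\<bar> * Re (LINT r|lebesgue. F (x, r)) = \<bar>k2\<bar> * (((cmod (wd 0 L u' x))\<^sup>2 - (cmod (T 1))\<^sup>2) / 2)"
          by (metis mult.assoc mult.commute)
        also have "\<dots> \<le> Re ((complex_of_real k1 * wd 0 L u' x + complex_of_real k2 * T 1) * cnj (wd 0 L u' x))"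
          by (rule damping_dominates_delay) (use k12 in simp)
        also have "\<dots> = Re (zext 0 L (Bd u' e') x * cnj (zext 0 L (wd 0 L u') x))"
          unfolding zext_in[OF xL] using True by (simp add: Bd_def T_def Tr1_def)
        finally show ?thesis .
      qed
    qed
  qed
  also have "\<dots> = inner (cls (zext 0 L (Bd u' e'))) (cls (zext 0 L (wd 0 L u')))"
    unfolding inner_cls[OF B h(6)] by (rule integral_Re[OF i2])
  finally show ?thesis .
qed

lemma norm_cc_le: assumes s: "sqint f" shows "norm (cls (\<lambda>x. cc x * f x)) \<le> c0 * norm (cls f)"
proof (rule power2_le_imp_le)
  have "(norm (cls (\<lambda>x. cc x * f x)))\<^sup>2 \<le> (LINT x|lebesgue. c0\<^sup>2 * (cmod (f x))\<^sup>2)"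
    unfolding norm_cls[OF sqint_cc[OF s]]
    by (intro integral_mono sqint_integrable sqint_cc s integrable_mult_right)
      (auto simp: cc_def norm_mult power_mult_distrib split: split_indicator)
  then show "(norm (cls (\<lambda>x. cc x * f x)))\<^sup>2 \<le> (c0 * norm (cls f))\<^sup>2"
    by (simp add: power_mult_distrib norm_cls[OF s])
qed (use c0 in simp)

text \<open>The coupling coefficient is real. This symmetry is what cancels the two coupling terms,
  which enter the wave equations with opposite signs.\<close>

lemma inner_cc_commute:
  assumes f: "sqint f" and g: "sqint g"
  shows "inner (cls (\<lambda>x. cc x * f x)) (cls g) = inner (cls (\<lambda>x. cc x * g x)) (cls f)"
proof -
  have "(LINT x|lebesgue. cc x * f x * cnj (g x)) = (LINT x|lebesgue. cnj (cc x * g x * cnj (f x)))"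
    by (intro Bochner_Integration.integral_cong refl) (simp add: cc_def)
  then show ?thesis unfolding inner_cls[OF sqint_cc[OF f] g] inner_cls[OF sqint_cc[OF g] f]
    by (simp only: Bochner_Integration.integral_cnj complex_cnj)  simp
qed

lemma norm_boundary_le:
  assumes V: "(u', v', y', z', e') \<in> H"
  shows "norm (cls (zext 0 L (Bd u' e')))
    \<le> (k1 + \<bar>k2\<bar>) * norm (cls (zext 0 L (wd 0 L u'))) + \<bar>k2\<bar> * tau * norm (cls (z2 b (Wx b e')))"
proof -
  note h = state_facts[OF V]
  define P where "P = zext 0 L (wd 0 L u')"
  define Q where "Q = (\<lambda>x. prim (\<lambda>s. z2 b (Wx b e') (x, s)) 1)"
  have P: "sqint P" unfolding P_def by (rule h(6))
  have Q: "sqint Q" unfolding Q_def by (rule sqint_prim_at_one(1)[OF h(10)])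
  \<comment> \<open>Inserting \<open>Tr1\<close> at delay 1, which is \<open>P - tau * Q\<close>,
    and collecting the coefficients of \<open>P\<close> and \<open>Q\<close> in
    \<open>k1 * P + k2 * (P - tau * Q)\<close>.\<close>
  define S where "S = (\<lambda>x. complex_of_real (k1 + k2) * P x + complex_of_real (- k2 * tau) * Q x)"
  have S: "sqint S" unfolding S_def by (intro sqint_add sqint_cmult P Q)
  have B: "sqint (zext 0 L (Bd u' e'))" using L2_boundary_term[OF V] unfolding Bd_def[abs_def] L2_iff .
  have le: "norm (cls f) \<le> norm (cls S)" if "sqint f" "\<And>x. cmod (f x) \<le> cmod (S x)" for f
  proof (rule power2_le_imp_le)
    show "(norm (cls f))\<^sup>2 \<le> (norm (cls S))\<^sup>2"
      unfolding norm_cls[OF that(1)] norm_cls[OF S]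
      by (intro integral_mono sqint_integrable that S power_mono) auto
  qed simp
  have "norm (cls (zext 0 L (Bd u' e'))) \<le> norm (cls S)"
  proof (rule le[OF B])
    fix x
    have "zext 0 L (Bd u' e') x = indicator {0<..<b} x *\<^sub>R S x"
      using bL by (auto simp: Bd_def Tr1_def S_def P_def Q_def zext_def algebra_simps split: split_indicator)
    then show "cmod (zext 0 L (Bd u' e') x) \<le> cmod (S x)" by (simp split: split_indicator)
  qed
  also have "cls S = csc (complex_of_real (k1 + k2)) (cls P) + csc (complex_of_real (- k2 * tau)) (cls Q)"
    unfolding S_def csc_cls[OF P] csc_cls[OF Q] by (rule cls_add) (intro sqint_cmult P Q)+
  also have "norm \<dots> \<le> \<bar>k1 + k2\<bar> * norm (cls P) + \<bar>k2\<bar> * tau * norm (cls Q)"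
  proof -
    have r: "csc (complex_of_real r) x = r *\<^sub>R x" for r and x :: "real l2"
      by (rule cls_ex[of x]) (simp add: csc_cls cls_scaleR[symmetric] scaleR_conv_of_real)
    show ?thesis unfolding r using tau by (intro norm_triangle_le) (simp add: abs_mult)
  qed
  also have "\<dots> \<le> (k1 + \<bar>k2\<bar>) * norm (cls P) + \<bar>k2\<bar> * tau * norm (cls (z2 b (Wx b e')))"
    using norm_prim_at_one[OF h(10)] k1 tau unfolding Q_def
    by (intro add_mono mult_right_mono mult_left_mono) auto
  finally show ?thesis unfolding P_def .
qed

lemma norm_delay_le:
  assumes V: "(u', v', y', z', e') \<in> H" and e: "Wmem b e"
    and R: "AE x in lebesgue. x \<in> {0<..<b} \<longrightarrow>
        eqon 0 1 (\<lambda>r. z2 b (Wx b e) (x, r)) (\<lambda>r. Tr1 (wd 0 L u') (Wx b e') r x)"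
  shows "norm (cls (z2 b (Wx b e))) \<le> norm (cls (zext 0 L (wd 0 L u'))) + tau * norm (cls (z2 b (Wx b e')))"
proof -
  note h = state_facts[OF V]
  define P where "P = zext 0 L (wd 0 L u')"
  define Q where "Q = z2 b (\<lambda>x r. prim (\<lambda>s. z2 b (Wx b e') (x, s)) r)"
  have P: "sqint (z2 b (\<lambda>x r. P x))" unfolding P_def by (rule sqint_fst_z2[OF h(6)])
  have Q: "sqint Q" unfolding Q_def by (rule sqint_prim_z2[OF h(10)])
  have We: "sqint (z2 b (Wx b e))" by (rule W_deriv_sqint[OF b Wx_W_deriv[OF e]])
  have D: "sqint (\<lambda>p. z2 b (\<lambda>x r. P x) p - tau *\<^sub>R Q p)" by (intro sqint_diff sqint_scaleR P Q)
  have "AE p in lebesgue. z2 b (Wx b e) p = z2 b (\<lambda>x r. P x) p - tau *\<^sub>R Q p"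
  proof (rule AE_eq_from_slices[OF sqint_measurable[OF We] sqint_measurable[OF D]], rule disjI1)
    show "AE x in lebesgue. AE r in lebesgue. z2 b (Wx b e) (x, r) = z2 b (\<lambda>x r. P x) (x, r) - tau *\<^sub>R Q (x, r)"
      using R
    proof eventually_elim
      case (elim x)
      show ?case
      proof (cases "x \<in> {0<..<b}")
        case False
        show ?thesis by (simp add: Q_def z2_out1[OF False])
      next
        case True
        show ?thesis using elim[rule_format, OF True]
        proof eventually_elim
          case (elim r)
          then show ?case using True bL
            by (cases "r \<in> {0<..<1}") (auto simp: Q_def P_def z2_out2 Tr1_def z2_def scaleR_conv_of_real)
        qed
      qed
    qed
  qed
  then have "cls (z2 b (Wx b e)) = cls (z2 b (\<lambda>x r. P x)) - tau *\<^sub>R cls Q"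
    using cls_eq_iff[OF We D] by (simp add: cls_diff P Q sqint_scaleR cls_scaleR)
  then have "norm (cls (z2 b (Wx b e))) \<le> norm (cls (z2 b (\<lambda>x r. P x))) + tau * norm (cls Q)"
    using norm_triangle_ineq4[of "cls (z2 b (\<lambda>x r. P x))" "tau *\<^sub>R cls Q"] tau by simp
  also have "\<dots> \<le> norm (cls P) + tau * norm (cls (z2 b (Wx b e')))"
    unfolding Q_def P_def by (intro add_mono mult_left_mono norm_fst_z2 norm_prim_z2 h) (use tau in auto)
  finally show ?thesis unfolding P_def .
qed

end

section \<open>Dissipativity and the bound for the inverse\<close>

context wave begin

definition En :: "(real \<Rightarrow> complex) \<Rightarrow> real l2" where "En f = cls (zext 0 L (prim (zext 0 L f)))"

lemma H10_class_prim: "H10 0 L f \<Longrightarrow> cls (zext 0 L f) = En (wd 0 L f)"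
  unfolding En_def by (rule cls_zext_cong[OF H1_L2[OF H10_H1] H10_wdD(3)[OF L]])

lemma norm_En_le: "L2 0 L f \<Longrightarrow> norm (En f) \<le> L * norm (cls (zext 0 L f))"
  unfolding En_def by (rule norm_zext_prim_le[OF L]) (auto simp: L2_iff zext_out)

text \<open>Integration by parts without boundary term: the derivative of an element of
  \<open>H10\<close> has zero mean, so the product of total integrals in \<open>inner_ibp\<close>
  vanishes.\<close>

lemma inner_En:
  assumes f: "L2 0 L f" and g: "H10 0 L g"
  shows "inner (En f) (cls (zext 0 L (wd 0 L g))) = - inner (cls (zext 0 L f)) (cls (zext 0 L g))"
proof -
  have "inner (En f) (cls (zext 0 L (wd 0 L g))) + inner (cls (zext 0 L f)) (En (wd 0 L g)) = 0"
    unfolding En_def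
    by (subst inner_ibp[of _ L]) (use f H10_wdD(1,2)[OF L g] in \<open>auto simp: L2_iff zext_out\<close>)
  then show ?thesis using H10_class_prim[OF g] by simp
qed

text \<open>Derivatives of functions vanishing at both ends are orthogonal to constants. This is why
  the unknown constants of integration disappear from the energy balance and from the
  bounds.\<close>

lemma inner_const:
  assumes g: "H10 0 L g" shows "inner (cls (zext 0 L (\<lambda>_. c))) (cls (zext 0 L (wd 0 L g))) = 0"
proof -
  have s: "sqint (zext 0 L (wd 0 L g))" using H10_wdD(1)[OF L g] by (simp add: L2_iff)
  have "cls (zext 0 L (wd 0 L g)) \<in> orth (constants L)"
    unfolding orth_constants_iff[OF s] using H10_wdD(2)[OF L g] by simp
  then show ?thesis by (auto simp: orth_def constants_def inner_commute)
qed

lemma const_plus_prim: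
  assumes f: "L2 0 L f" and h: "L2 0 L h" and e: "eqon 0 L h (\<lambda>x. C + prim (zext 0 L f) x)" 
  shows "cls (zext 0 L h) = cls (zext 0 L (\<lambda>_. C)) + En f"
proof -
  have "cls (zext 0 L h) = cls (zext 0 L (\<lambda>x. C + prim (zext 0 L f) x))" by (rule cls_zext_cong[OF h e])
  also have "\<dots> = cls (zext 0 L (\<lambda>_. C)) + En f" unfolding zext_add En_def
    by (rule cls_add) (use L2_const[of 0 L C] L2_prim[OF L2_integrable[OF f], of 0 L] in \<open>simp_all add: L2_iff\<close>)
  finally show ?thesis .
qed

text \<open>Recasts the relation as equations between vectors of \<open>l2\<close>, so that
  dissipativity and the bound become computations with inner products and norms.\<close>

lemma Rel_eqs:
  assumes U: "(u, v, y, z, e) \<in> H" and V: "(u', v', y', z', e') \<in> H" and R: "Rel (u, v, y, z, e) (u', v', y', z', e')"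
  shows "cls (zext 0 L v) = cls (zext 0 L u')" "cls (zext 0 L z) = cls (zext 0 L y')"
    "\<exists>C. a *\<^sub>R cls (zext 0 L (wd 0 L u)) + cls (zext 0 L (Bd u' e'))
      = cls (zext 0 L (\<lambda>_. C)) + En (\<lambda>x. v' x + cc x * y' x)"
    "\<exists>C. cls (zext 0 L (wd 0 L y)) = cls (zext 0 L (\<lambda>_. C)) + En (\<lambda>x. z' x - cc x * u' x)"
    "AE x in lebesgue. x \<in> {0<..<b} \<longrightarrow>
        eqon 0 1 (\<lambda>r. z2 b (Wx b e) (x, r)) (\<lambda>r. Tr1 (wd 0 L u') (Wx b e') r x)"
    "cls (zext 0 L (\<lambda>x. v' x + cc x * y' x)) = cls (zext 0 L v') + cls (\<lambda>x. cc x * zext 0 L y' x)"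
    "cls (zext 0 L (\<lambda>x. z' x - cc x * u' x)) = cls (zext 0 L z') - cls (\<lambda>x. cc x * zext 0 L u' x)"
    "L2 0 L (\<lambda>x. v' x + cc x * y' x)" "L2 0 L (\<lambda>x. z' x - cc x * u' x)"
proof -
  note h = state_facts[OF U] and h' = state_facts[OF V]
  obtain C C' where R: "eqon 0 L v u'" "eqon 0 L z y'"
     "eqon 0 L (\<lambda>x. complex_of_real a * wd 0 L u x + Bd u' e' x) (\<lambda>x. C + prim (zext 0 L (\<lambda>x. v' x + cc x * y' x)) x)"
     "eqon 0 L (wd 0 L y) (\<lambda>x. C' + prim (zext 0 L (\<lambda>x. z' x - cc x * u' x)) x)"
     "AE x in lebesgue. x \<in> {0<..<b} \<longrightarrow>
        eqon 0 1 (\<lambda>r. z2 b (Wx b e) (x, r)) (\<lambda>r. Tr1 (wd 0 L u') (Wx b e') r x)"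
    using R unfolding Rel_def prod.case Bd_def by blast
  show "cls (zext 0 L v) = cls (zext 0 L u')" "cls (zext 0 L z) = cls (zext 0 L y')"
    using cls_zext_cong[OF h(2) R(1)] cls_zext_cong[OF h(4) R(2)] .
  show "cls (zext 0 L (\<lambda>x. v' x + cc x * y' x)) = cls (zext 0 L v') + cls (\<lambda>x. cc x * zext 0 L y' x)"
    unfolding zext_add zext_mult by (intro cls_add sqint_cc h')
  show "cls (zext 0 L (\<lambda>x. z' x - cc x * u' x)) = cls (zext 0 L z') - cls (\<lambda>x. cc x * zext 0 L u' x)"
    unfolding zext_diff zext_mult by (intro cls_diff sqint_cc h')
  show N: "L2 0 L (\<lambda>x. v' x + cc x * y' x)" and M: "L2 0 L (\<lambda>x. z' x - cc x * u' x)"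
    using h' H1_L2[OF H10_H1] by (auto intro!: L2_add L2_diff L2_cc)
  have u: "L2 0 L (wd 0 L u)" and y: "L2 0 L (wd 0 L y)" and B: "L2 0 L (Bd u' e')"
    using h L2_boundary_term[OF V] by (simp_all add: L2_iff Bd_def[abs_def])
  have "cls (zext 0 L (\<lambda>x. complex_of_real a * wd 0 L u x + Bd u' e' x)) = cls (\<lambda>x. a *\<^sub>R zext 0 L (wd 0 L u) x + zext 0 L (Bd u' e') x)"
    unfolding zext_add zext_cmult by (simp add: scaleR_conv_of_real)
  also have "\<dots> = a *\<^sub>R cls (zext 0 L (wd 0 L u)) + cls (zext 0 L (Bd u' e'))"
    using u B by (simp add: L2_iff cls_add cls_scaleR sqint_scaleR)
  finally show "\<exists>C. a *\<^sub>R cls (zext 0 L (wd 0 L u)) + cls (zext 0 L (Bd u' e'))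
      = cls (zext 0 L (\<lambda>_. C)) + En (\<lambda>x. v' x + cc x * y' x)"
    using const_plus_prim[OF N L2_add[OF L2_cmult[OF u] B] R(3)] by metis
  show "\<exists>C. cls (zext 0 L (wd 0 L y)) = cls (zext 0 L (\<lambda>_. C)) + En (\<lambda>x. z' x - cc x * u' x)"
    using const_plus_prim[OF M y R(4)] by metis
  show "AE x in lebesgue. x \<in> {0<..<b} \<longrightarrow>
        eqon 0 1 (\<lambda>r. z2 b (Wx b e) (x, r)) (\<lambda>r. Tr1 (wd 0 L u') (Wx b e') r x)" by (rule R(5))
qed

lemma Rel_dissipative:
  assumes U: "U \<in> H" and V: "V \<in> H" and R: "Rel U V" shows "inner (Phi U) (Phi V) \<le> 0"
proof -
  obtain u v y z e where Ueq: "U = (u, v, y, z, e)" by (cases U) auto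
  obtain u' v' y' z' e' where Veq: "V = (u', v', y', z', e')" by (cases V) auto
  note h = state_facts[OF U[unfolded Ueq]] and h' = state_facts[OF V[unfolded Veq]]
  note E = Rel_eqs[OF U[unfolded Ueq] V[unfolded Veq] R[unfolded Ueq Veq]]
  define P P' Y Y' cu cy cv cz B where "P = cls (zext 0 L (wd 0 L u))" "P' = cls (zext 0 L (wd 0 L u'))"
    "Y = cls (zext 0 L (wd 0 L y))" "Y' = cls (zext 0 L (wd 0 L y'))" "cu = cls (zext 0 L u')" "cy = cls (zext 0 L y')"
    "cv = cls (zext 0 L v')" "cz = cls (zext 0 L z')" "B = cls (zext 0 L (Bd u' e'))"
  note d = this
  define ccu ccy where "ccu = cls (\<lambda>x. cc x * zext 0 L u' x)" "ccy = cls (\<lambda>x. cc x * zext 0 L y' x)"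
  note dc = this
  define W W' where "W = cls (z2 b (Wx b e))" "W' = cls (z2 b (Wx b e'))"
  note dW = this
  \<comment> \<open>Pairing with the derivative of the velocity removes the constant of integration
    and turns the primitive into minus the force paired with the velocity; \<open>2\<close> is the
    same for the second wave.\<close>
  have 1: "a * inner P P' + inner B P' = - inner (cv + ccy) cu"
  proof -
    obtain C where "a *\<^sub>R P + B = cls (zext 0 L (\<lambda>_. C)) + En (\<lambda>x. v' x + cc x * y' x)" using E(3) unfolding d by blast
    from arg_cong[OF this, of "\<lambda>x. inner x P'"]
    show ?thesis using inner_const[OF h'(1)] inner_En[OF E(8) h'(1)] unfolding E(6) d dc by (simp add: inner_add_left)
  qed
  have 2: "inner Y Y' = - inner (cz - ccu) cy"
  proof -
    obtain C where "Y = cls (zext 0 L (\<lambda>_. C)) + En (\<lambda>x. z' x - cc x * u' x)" using E(4) unfolding d by blast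
    from arg_cong[OF this, of "\<lambda>x. inner x Y'"]
    show ?thesis using inner_const[OF h'(3)] inner_En[OF E(9) h'(3)] unfolding E(7) d dc by (simp add: inner_add_left)
  qed
  have 3: "inner ccy cu = inner ccu cy" unfolding d dc by (rule inner_cc_commute) (rule h')+
  have 4: "tau * \<bar>k2\<bar> * inner W W' \<le> inner B P'"
    unfolding d dW by (rule delay_estimate[OF V[unfolded Veq] h(5) E(5)])
  have sq: "sqrt a * sqrt a = a" "sqrt (tau * \<bar>k2\<bar>) * sqrt (tau * \<bar>k2\<bar>) = tau * \<bar>k2\<bar>"
    using a tau by (simp_all del: real_sqrt_mult)
  have "inner (Phi U) (Phi V) = a * inner P P' + inner cu cv + inner Y Y' + inner cy cz + tau * \<bar>k2\<bar> * inner W W'"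
    unfolding Phi_def Ueq Veq prod.case inner_Pair inner_scaleR_left inner_scaleR_right mult.assoc[symmetric] sq E(1,2) d dW by simp
  \<comment> \<open>The kinetic products cancel against the first terms of \<open>1\<close> and
    \<open>2\<close>, and \<open>3\<close> cancels the coupling. What remains is the delay product
    minus \<open>inner B P'\<close>, which is nonpositive by \<open>4\<close>.\<close>
  then show ?thesis using 1 2 3 4 inner_commute[of cu cv] inner_commute[of cy cz]
    unfolding inner_add_left inner_diff_left by linarith
qed

text \<open>Each component of the solution is bounded by the data through the Poincare estimate
  \<open>norm_En_le\<close>. The constants of integration need no estimate, being orthogonal to the
  derivatives they accompany. Crude addition of the five components gives the final
  constant.\<close>

lemma Rel_bound: "\<exists>K. \<forall>U\<in>H. \<forall>V\<in>H. Rel U V \<longrightarrow> norm (Phi U) \<le> K * norm (Phi V)"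
proof -
  define s where "s = sqrt (tau * \<bar>k2\<bar>)"
  have s: "s > 0" and sa: "sqrt a > 0" using a tau k2 by (simp_all add: s_def)
  \<comment> \<open>\<open>KP\<close> and \<open>KW\<close> undo the scaling of the first and last
    component of \<open>Phi\<close>.\<close>
  define KP KR KW where "KP = 1 / sqrt a" "KR = (1::real)" "KW = 1 / s"
  note dK = this
  \<comment> \<open>Read off from the first integral solved for \<open>a *\<^sub>R P\<close>: the
    primitive of the force with its coupling contributes \<open>L * (1 + c0 * L)\<close>, the
    boundary term \<open>B\<close> the remaining summands.\<close>
  define K1 where "K1 = (L * (1 + c0 * L) + (k1 + \<bar>k2\<bar>) * KP + \<bar>k2\<bar> * tau * KW) / a"
  have aK1: "a * K1 = L * (1 + c0 * L) + (k1 + \<bar>k2\<bar>) * KP + \<bar>k2\<bar> * tau * KW" using a by (simp add: K1_def)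
  define K2 where "K2 = L * KP"
  define K3 where "K3 = L * (1 + c0 * L * KP)"
  define K5 where "K5 = KP + tau * KW"
  have "norm (Phi U) \<le> (sqrt a * K1 + K2 + K3 + L + s * K5) * norm (Phi V)"
    if U: "U \<in> H" and V: "V \<in> H" and R: "Rel U V" for U V
  proof -
    obtain u v y z e where Ueq: "U = (u, v, y, z, e)" by (cases U) auto
    obtain u' v' y' z' e' where Veq: "V = (u', v', y', z', e')" by (cases V) auto
    note h = state_facts[OF U[unfolded Ueq]] and h' = state_facts[OF V[unfolded Veq]]
    note E = Rel_eqs[OF U[unfolded Ueq] V[unfolded Veq] R[unfolded Ueq Veq]]
    define P P' Y Y' cu cy cv cz B where "P = cls (zext 0 L (wd 0 L u))" "P' = cls (zext 0 L (wd 0 L u'))"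
      "Y = cls (zext 0 L (wd 0 L y))" "Y' = cls (zext 0 L (wd 0 L y'))" "cu = cls (zext 0 L u')" "cy = cls (zext 0 L y')"
      "cv = cls (zext 0 L v')" "cz = cls (zext 0 L z')" "B = cls (zext 0 L (Bd u' e'))"
    note d = this
    define W W' where "W = cls (z2 b (Wx b e))" "W' = cls (z2 b (Wx b e'))"
    note dW = this
    define n where "n = norm (Phi V)"
    have PV: "Phi V = (sqrt a *\<^sub>R P', cv, Y', cz, s *\<^sub>R W')" unfolding Phi_def Veq prod.case d dW s_def ..
    have comp: "norm p \<le> norm (p, q, r, t, w)" "norm q \<le> norm (p, q, r, t, w)" "norm r \<le> norm (p, q, r, t, w)"
      "norm t \<le> norm (p, q, r, t, w)" "norm w \<le> norm (p, q, r, t, w)" for p q r t :: "real l2" and w :: "(real \<times> real) l2"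
      by (rule norm_fst_le order_trans[OF _ norm_snd_le] order_refl)+
    have n0: "0 \<le> n" by (simp add: n_def)
    have nP: "norm P' \<le> KP * n" using comp(1)[where p = "sqrt a *\<^sub>R P'"] sa unfolding n_def PV dK by (auto simp: field_simps)
    have nv: "norm cv \<le> n" unfolding n_def PV by (rule comp)
    have nY: "norm Y' \<le> n" unfolding n_def PV by (rule comp)
    have nz: "norm cz \<le> n" unfolding n_def PV by (rule comp)
    have nW: "norm W' \<le> KW * n" using comp(5)[where w = "s *\<^sub>R W'"] s unfolding n_def PV dK by (auto simp: field_simps)
    have ncu: "norm cu \<le> L * (KP * n)"
      unfolding d H10_class_prim[OF h'(1)]
      by (rule order_trans[OF norm_En_le[OF H10_wdD(1)[OF L h'(1)]] mult_left_mono[OF nP[unfolded d]]]) (use L in simp)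
    have ncy: "norm cy \<le> L * n"
      unfolding d H10_class_prim[OF h'(3)]
      by (rule order_trans[OF norm_En_le[OF H10_wdD(1)[OF L h'(3)]] mult_left_mono[OF nY[unfolded d]]]) (use L in simp)
    have N: "norm (En (\<lambda>x. v' x + cc x * y' x)) \<le> L * (n + c0 * (L * n))"
    proof -
      have "norm (cls (zext 0 L (\<lambda>x. v' x + cc x * y' x))) \<le> norm cv + c0 * norm cy"
        unfolding E(6) d using norm_cc_le[OF h'(14)] by (intro norm_triangle_le) simp
      also have "\<dots> \<le> n + c0 * (L * n)" using nv ncy c0 by (intro add_mono mult_left_mono) auto
      finally show ?thesis using norm_En_le[OF E(8)] L by (meson mult_left_mono less_imp_le order_trans)
    qed
    have M: "norm (En (\<lambda>x. z' x - cc x * u' x)) \<le> L * (n + c0 * (L * (KP * n)))"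
    proof -
      have "norm (cls (zext 0 L (\<lambda>x. z' x - cc x * u' x))) \<le> norm cz + c0 * norm cu"
        unfolding E(7) d using norm_cc_le[OF h'(13)] by (intro order_trans[OF norm_triangle_ineq4]) simp
      also have "\<dots> \<le> n + c0 * (L * (KP * n))" using nz ncu c0 by (intro add_mono mult_left_mono) auto
      finally show ?thesis using norm_En_le[OF E(9)] L by (meson mult_left_mono less_imp_le order_trans)
    qed
    \<comment> \<open>An abstract form of dropping a constant orthogonal to \<open>p\<close>: if
      \<open>p\<close> and \<open>q\<close> have the same pairing with \<open>p\<close>, then
      \<open>p\<close> is a projection of \<open>q\<close> and no longer than it.\<close>
    have cancel: "norm p \<le> norm q" if "inner p p = inner q p" for p q :: "real l2"
    proof -
      have "norm p * norm p \<le> norm q * norm p"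
        using norm_cauchy_schwarz[of q p] that by (simp flip: power2_eq_square add: power2_norm_eq_inner)
      then show ?thesis by (metis mult_le_cancel_right norm_ge_zero norm_zero less_le order_refl)
    qed
    have nB: "norm B \<le> (k1 + \<bar>k2\<bar>) * (KP * n) + \<bar>k2\<bar> * tau * (KW * n)"
      unfolding d using norm_boundary_le[OF V[unfolded Veq]] mult_left_mono[OF nP, of "k1 + \<bar>k2\<bar>"] mult_left_mono[OF nW, of "\<bar>k2\<bar> * tau"]
        k1 tau unfolding d dW by simp
    have nPu: "norm P \<le> K1 * n"
    proof -
      obtain C where C: "a *\<^sub>R P + B = cls (zext 0 L (\<lambda>_. C)) + En (\<lambda>x. v' x + cc x * y' x)" using E(3) unfolding d by blast
      have "inner (a *\<^sub>R P + B) (a *\<^sub>R P) = inner (En (\<lambda>x. v' x + cc x * y' x)) (a *\<^sub>R P)"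
        unfolding C using inner_const[OF h(1), of C] unfolding d by (simp add: inner_add_left)
      then have "norm (a *\<^sub>R P) \<le> norm (En (\<lambda>x. v' x + cc x * y' x) - B)"
        by (intro cancel) (auto simp: inner_add_left inner_diff_left)
      also have "\<dots> \<le> L * (n + c0 * (L * n)) + ((k1 + \<bar>k2\<bar>) * (KP * n) + \<bar>k2\<bar> * tau * (KW * n))"
        using N nB by (intro order_trans[OF norm_triangle_ineq4] add_mono)
      also have "\<dots> = (a * K1) * n" unfolding aK1 by (simp add: algebra_simps)
      finally show ?thesis using a by simp
    qed
    have nYu: "norm Y \<le> K3 * n"
    proof -
      obtain C where C: "Y = cls (zext 0 L (\<lambda>_. C)) + En (\<lambda>x. z' x - cc x * u' x)" using E(4) unfolding d by blast
      have "inner Y Y = inner (En (\<lambda>x. z' x - cc x * u' x)) Y"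
        using arg_cong[OF C, of "\<lambda>x. inner x Y"] inner_const[OF h(3), of C] unfolding d by (simp add: inner_add_left)
      then have "norm Y \<le> norm (En (\<lambda>x. z' x - cc x * u' x))" by (rule cancel)
      also have "\<dots> \<le> K3 * n" using M by (simp add: K3_def algebra_simps)
      finally show ?thesis .
    qed
    have nWu: "norm W \<le> K5 * n"
    proof -
      have "norm W \<le> norm P' + tau * norm W'" unfolding d dW by (rule norm_delay_le[OF V[unfolded Veq] h(5) E(5)])
      also have "\<dots> \<le> KP * n + tau * (KW * n)" using nP nW tau by (intro add_mono mult_left_mono) auto
      finally show ?thesis by (simp add: K5_def algebra_simps)
    qed
    have PU: "Phi U = (sqrt a *\<^sub>R P, cu, Y, cy, s *\<^sub>R W)" unfolding Phi_def Ueq prod.case d dW s_def E(1,2) ..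
    have tri: "norm (p, q) \<le> norm p + norm q" for p :: "'x::real_normed_vector" and q :: "'y::real_normed_vector"
      by (rule norm_Pair_le)
    have "norm (Phi U) \<le> norm (sqrt a *\<^sub>R P) + (norm cu + (norm Y + (norm cy + norm (s *\<^sub>R W))))"
      unfolding PU by (meson tri add_left_mono order_trans)
    also have "\<dots> \<le> sqrt a * (K1 * n) + (L * (KP * n) + (K3 * n + (L * n + s * (K5 * n))))"
      using nPu ncu nYu ncy nWu s sa by (intro add_mono) auto
    finally show ?thesis by (simp add: K2_def n_def algebra_simps)
  qed
  then show ?thesis by blast
qed

end

section \<open>Generation\<close>

lemma inner_csc_ii: "inner (csc \<i> x) y = - inner x (csc \<i> y)"
proof -
  obtain f where f: "sqint f" "x = cls f" by (rule cls_ex)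
  obtain g where g: "sqint g" "y = cls g" by (rule cls_ex)
  have "(LINT x|lebesgue. \<i> * f x * cnj (g x)) = (LINT x|lebesgue. - (f x * cnj (\<i> * g x)))"
    by (intro Bochner_Integration.integral_cong refl) simp
  then show ?thesis
    unfolding f(2) g(2) csc_cls[OF f(1)] csc_cls[OF g(1)] inner_cls[OF sqint_cmult[OF f(1)] g(1)] inner_cls[OF f(1) sqint_cmult[OF g(1)]]
    by simp
qed

lemma csc_of_real: "csc (of_real r) x = r *\<^sub>R x"
  by (rule cls_ex[of x]) (simp add: csc_cls cls_scaleR[symmetric] scaleR_conv_of_real)

lemma cX_of_real: "cX (of_real r) x = r *\<^sub>R x"
  by (simp add: cX_def csc_of_real split: prod.splits)

context wave begin

lemma D_H: "U \<in> D \<Longrightarrow> U \<in> H" by (auto simp: DA_def)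

text \<open>For the backward direction let \<open>W\<close> solve the equation with datum
  \<open>V\<close>. The difference of \<open>U\<close> and \<open>W\<close> is related to the
  difference of two representatives of one vector, so \<open>Rel_bound\<close> gives
  \<open>Phi U = Phi W\<close>, and \<open>Rel\<close> is invariant under changing the solution in
  its class.\<close>

lemma Rel_iff_DA:
  assumes U: "U \<in> H" and V: "V \<in> H" shows "Rel U V \<longleftrightarrow> U \<in> D \<and> Phi (A U) = Phi V"
proof
  assume R: "Rel U V"
  show "U \<in> D \<and> Phi (A U) = Phi V"
    using Rel_DA[OF U V R] Phi_eq_iff[OF DA_Rel(1) V] by blast
next
  assume d: "U \<in> D \<and> Phi (A U) = Phi V"
  obtain V' where V': "V' \<in> H" "Rel U V'" using DA_Rel d by blast
  obtain W where W: "W \<in> H" "Rel W V" using Rel_surj[OF V] by blast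
  have W': "W \<in> D" "Phi (A W) = Phi V" using Rel_DA[OF W(1) V W(2)] Phi_eq_iff[OF DA_Rel(1) V] by blast+
  obtain K where K: "norm (Phi P) \<le> K * norm (Phi Q)" if "P \<in> H" "Q \<in> H" "Rel P Q" for P Q using Rel_bound by blast
  have dH: "A U \<in> H" "Rel U (A U)" using DA_Rel d by auto
  note l = Rel_lincomb[OF U dH W(1) V W(2), of 1 "-1"]
  note m = st_lin_H[OF U W(1), of 1 "-1"] st_lin_H[OF dH(1) V, of 1 "-1"]
  have c: "cX 1 x = x" "cX (-1) x = - x" for x
    using cX_of_real[of 1] cX_of_real[of "-1"] by simp_all
  have "Phi U = Phi W" using K[OF m(1,3) l] d unfolding m c by simp
  then show "Rel U V" using Rel_st_eq[OF W(1) _ W(2)] Phi_eq_iff[OF W(1) U] by simp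
qed

lemma represented: "\<exists>K. represented_dissipative H D A Phi cX (norm_H L a tau k2 b) st_lin (inner_H L a tau k2 b) K"
proof -
  obtain K where K: "\<And>U V. U \<in> H \<Longrightarrow> V \<in> H \<Longrightarrow> Rel U V \<Longrightarrow> norm (Phi U) \<le> K * norm (Phi V)" using Rel_bound by blast
  have "represented_dissipative H D A Phi cX (norm_H L a tau k2 b) st_lin (inner_H L a tau k2 b) K"
  proof (rule represented_dissipative.intro)
    show "subspace (Phi ` H)" "complete (Phi ` H)" unfolding Phi_image by (rule subspace_SX complete_SX)+
    show "bounded_linear (cX c)" for c by (rule bounded_linear_cX)
    show "cX (of_real r) x = r *\<^sub>R x" for r x by (rule cX_of_real)
    show "inner (cX \<i> x) y = - inner x (cX \<i> y)" for x y
      by (simp add: cX_def inner_csc_ii split: prod.splits)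
    show "norm_H L a tau k2 b U = norm (Phi U)" if "U \<in> H" for U by (rule norm_H_Phi[OF that])
    show "st_lin c U d V \<in> H" "Phi (st_lin c U d V) = cX c (Phi U) + cX d (Phi V)" if "U \<in> H" "V \<in> H" for U V c d
      by (rule st_lin_H[OF that])+
    show "inner_H L a tau k2 b U V = Complex (inner (Phi U) (Phi V)) (inner (Phi U) (cX \<i> (Phi V)))" if "U \<in> H" "V \<in> H" for U V
      by (rule inner_H_Phi[OF that])
    show "D \<subseteq> H" using D_H by blast
    show "A U \<in> H" if "U \<in> D" for U by (rule DA_Rel(1)[OF that])
    show "V \<in> D \<and> Phi (A V) = Phi (A U)" if "U \<in> D" "V \<in> H" "Phi V = Phi U" for U V
    proof -
      have "Rel V (A U)"
        using Rel_st_eq[OF D_H[OF that(1)] _ DA_Rel(2)[OF that(1)]] Phi_eq_iff[OF D_H[OF that(1)] that(2)] that(3) by simp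
      then show ?thesis using Rel_iff_DA[OF that(2) DA_Rel(1)[OF that(1)]] by simp
    qed
    show "st_lin c U d V \<in> D \<and> Phi (A (st_lin c U d V)) = cX c (Phi (A U)) + cX d (Phi (A V))" if "U \<in> D" "V \<in> D" for U V c d
    proof -
      note r = DA_Rel[OF that(1)] DA_Rel[OF that(2)] and h = D_H[OF that(1)] D_H[OF that(2)]
      have "Rel (st_lin c U d V) (st_lin c (A U) d (A V))" by (rule Rel_lincomb[OF h(1) r(1,2) h(2) r(3,4)])
      then show ?thesis using Rel_iff_DA[OF st_lin_H(1)[OF h] st_lin_H(1)[OF r(1,3)]] st_lin_H(2)[OF r(1,3)] by simp
    qed
    show "inner (Phi (A U)) (Phi U) \<le> 0" if "U \<in> D" for U
      using Rel_dissipative[OF D_H[OF that] DA_Rel[OF that]] by (simp add: inner_commute)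
    show "\<exists>U\<in>D. Phi (A U) = Phi V" if "V \<in> H" for V
      using Rel_surj[OF that] Rel_iff_DA[OF _ that] by blast
    show "norm (Phi U) \<le> K * norm (Phi (A U))" if "U \<in> D" for U
      by (rule K[OF D_H[OF that] DA_Rel[OF that]])
  qed
  then show ?thesis by blast
qed

end

theorem theorem2p4:
  fixes L tau a k1 k2 al b ga c0 :: real
  assumes "L > 0" and "tau > 0" and "a > 0" and "k1 > 0" and "k2 \<noteq> 0" and "\<bar>k2\<bar> < k1"
    and "0 < al" and "al < b" and "b < ga" and "ga < L" and "c0 > 0"
  shows "\<exists>T. C0_contraction_semigroup (Hsp L b) (norm_H L a tau k2 b) st_lin T \<and>
     is_generator (Hsp L b) (norm_H L a tau k2 b) st_lin T (DA L a k1 k2 b) (Aop L a tau k1 k2 b al ga c0) \<and>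
     (\<forall>U0\<in>Hsp L b.
        weak_solution (Hsp L b) (norm_H L a tau k2 b) st_lin (inner_H L a tau k2 b)
          (DA L a k1 k2 b) (Aop L a tau k1 k2 b al ga c0) U0 (\<lambda>t. T t U0) \<and>
        (\<forall>U. weak_solution (Hsp L b) (norm_H L a tau k2 b) st_lin (inner_H L a tau k2 b)
               (DA L a k1 k2 b) (Aop L a tau k1 k2 b al ga c0) U0 U \<longrightarrow>
             (\<forall>t\<ge>0. norm_H L a tau k2 b (st_lin 1 (U t) (-1) (T t U0)) = 0))) \<and>
     (\<forall>U0\<in>DA L a k1 k2 b.
        strong_solution (Hsp L b) (norm_H L a tau k2 b) st_lin
          (DA L a k1 k2 b) (Aop L a tau k1 k2 b al ga c0) U0 (\<lambda>t. T t U0) \<and>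
        (\<forall>U. strong_solution (Hsp L b) (norm_H L a tau k2 b) st_lin
               (DA L a k1 k2 b) (Aop L a tau k1 k2 b al ga c0) U0 U \<longrightarrow>
             (\<forall>t\<ge>0. norm_H L a tau k2 b (st_lin 1 (U t) (-1) (T t U0)) = 0)))"
proof -
  interpret wave L tau a k1 k2 al b ga c0 by unfold_locales (use assms in auto)
  obtain K where "represented_dissipative H D A Phi cX (norm_H L a tau k2 b) st_lin (inner_H L a tau k2 b) K"
    using represented by blast
  then interpret R: represented_dissipative H D A Phi cX "norm_H L a tau k2 b" st_lin "inner_H L a tau k2 b" K .
  show ?thesis
  proof (intro exI[of _ R.sg] conjI ballI allI impI)
    show "C0_contraction_semigroup H (norm_H L a tau k2 b) st_lin R.sg" by (rule R.sg_contraction_semigroup)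
    show "is_generator H (norm_H L a tau k2 b) st_lin R.sg D A" by (rule R.sg_generator)
  next
    fix U0 assume U0: "U0 \<in> H"
    show "weak_solution H (norm_H L a tau k2 b) st_lin (inner_H L a tau k2 b) D A U0 (\<lambda>t. R.sg t U0)"
      by (rule R.sg_weak_solution[OF U0])
    fix U t assume "weak_solution H (norm_H L a tau k2 b) st_lin (inner_H L a tau k2 b) D A U0 U" "0 \<le> (t::real)"
    then show "norm_H L a tau k2 b (st_lin 1 (U t) (-1) (R.sg t U0)) = 0" by (rule R.weak_solution_unique[OF U0])
  next
    fix U0 assume U0: "U0 \<in> D"
    show "strong_solution H (norm_H L a tau k2 b) st_lin D A U0 (\<lambda>t. R.sg t U0)"
      by (rule R.sg_strong_solution[OF U0])
    fix U t assume "strong_solution H (norm_H L a tau k2 b) st_lin D A U0 U" "0 \<le> (t::real)"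
    then show "norm_H L a tau k2 b (st_lin 1 (U t) (-1) (R.sg t U0)) = 0" by (rule R.strong_solution_unique[OF D_H[OF U0]])
  qed
qed

end
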